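(* Let $p$ be a prime and let $\mathcal{F}$ be a saturated fusion system on a finite $p$-group $S$. Let $\mathcal{H}$ be a saturated fusion subsystem of $\mathcal{F}$ on $S$, and let $\mathcal{K}$ be a saturated fusion subsystem of $\mathcal{F}$ on a subgroup $T\le S$. Assume that $\mathcal{K}$ is weakly normal in $\mathcal{F}$ and that ${}_S\mathcal{F}_T=\mathcal{H}\mathcal{K}$. If $M$ is a contravariant $p$-local, $p$-defined Mackey functor, then the maps \[ M(\mathcal{H}) \xrightarrow{tr_{\mathcal{H}}^{\mathcal{F}}} M(\mathcal{F}) \xrightarrow{res_{\mathcal{K}}^{\mathcal{F}}} M(\mathcal{K}) \] and \[ M(\mathcal{H}) \xrightarrow{res_T^{\mathcal{H}}} M(T) \xrightarrow{tr_T^{\mathcal{K}}} M(\mathcal{K}) \] agree.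
   Context: Fusion systems and saturation are in the standard sense of Broto--Levi--Oliver. A fusion subsystem of $\mathcal{F}$ on a subgroup $R\le S$ is a fusion system on $R$ all of whose morphisms are morphisms of $\mathcal{F}$. Composition product. Let $\mathcal{H},\mathcal{K}$ be fusion subsystems of $\mathcal{F}$ on subgroups $R,T\le S$. Write ${}_R\mathcal{F}_T=\mathcal{H}\mathcal{K}$ if $S=RT$ and every morphism $\varphi\colon P\to Q$ in $\mathcal{F}$ with $P\le T$ and $Q\le R$ can be written as $\varphi=\eta\circ\kappa$ with $\kappa$ in $\mathcal{K}$ and $\eta$ in $\mathcal{H}$. Here $R=S$. Weak normality. $\mathcal{K}$ (saturated, on $T$) is weakly normal in $\mathcal{F}$ if $T$ is strongly $\mathcal{F}$-closed (i.e. $\varphi(P)\le T$ for all $P\le T$ and $\varphi\in\mathrm{Hom}_{\mathcal{F}}(P,S)$) and, whenever $\varphi\in\mathrm{Hom}_{\mathcal{F}}(P,S)$ and $\psi\in\mathrm{Hom}_{\mathcal{K}}(Q,R)$ with $Q,R\le P$, we have $\varphi\psi\varphi^{-1}\in\mathrm{Hom}_{\mathcal{K}}(\varphi(Q),\varphi(R))$. Burnside modules. For finite groups $G,H$, a $(G,H)$-biset is a set with commuting left $H$-action and right $G$-action. $A(G,H)$ is the Grothendieck group (under disjoint union) of isomorphism classes of finite $(G,H)$-bisets whose left $H$-action is free; $A(G,H)_{(p)}$ is its $p$-localization. For $K\le G$ and a homomorphism $\varphi\colon K\to H$, $[K,\varphi]_G^H$ (or $[K,\varphi]$) is the class of $H\times_{K,\varphi}G=(H\times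 G)/\sim$, where $(h,kg)\sim(h\varphi(k),g)$ for $k\in K$. These classes, over conjugacy classes of pairs $(K,\varphi)$ (conjugacy in both $G$ and $H$), form a basis of $A(G,H)$. The bilinear composition $A(H,K)\times A(G,H)\to A(G,K)$ is given on bisets by $X\circ Y=X\times_H Y$. The map $\mathrm{incl}$ denotes the relevant inclusion of subgroups. Characteristic idempotents. Let $\mathcal{F}$ be a fusion system on $S$. An element $X\in A(S,S)_{(p)}$ is $\mathcal{F}$-generated if it is a linear combination of basis elements $[P,\varphi]$ with $\varphi$ in $\mathcal{F}$. For a finite group $H$, $X\in A(S,H)_{(p)}$ is right $\mathcal{F}$-stable if $X\circ[P,\varphi]_P^S=X\circ[P,\mathrm{incl}]_P^S$ for all $P\le S$, $\varphi\in\mathrm{Hom}_{\mathcal{F}}(P,S)$; $X\in A(H,S)_{(p)}$ is left $\mathcal{F}$-stable if $[\varphi(P),\varphi^{-1}]_S^P\circ X=[P,\mathrm{id}]_S^P\circ X$ for all such $P,\varphi$. The augmentation $\epsilon\colon A(S,S)_{(p)}\to\mathbb{Z}_{(p)}$ is the linear map with $\epsilon([P,\varphi]_S^S)=|S/P|$. For $\mathcal{F}$ saturated, a characteristic idempotent for $\mathcal{F}$ is an idempotent of the ring $A(S,S)_{(p)}$ that is $\mathcal{F}$-generated, left and right $\mathcal{F}$-stable, and of augmentation prime to $p$. It is known that every saturated fusion system $\mathcal{F}$ has exactly one characteristic idempotent; it is denoted $\omega_{\mathcal{F}}$. Mackey functors. The $p$-local Burnside category on $p$-groups has as objects the finite $p$-groups,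 morphism modules $A(G,H)_{(p)}$ from $G$ to $H$, and composition $\circ$. A contravariant $p$-local, $p$-defined Mackey functor is a contravariant $\mathbb{Z}_{(p)}$-linear functor $M$ from this category to $\mathbb{Z}_{(p)}$-modules. For $T\le S$ finite $p$-groups, $res_T^S=M([T,\mathrm{incl}]_T^S)\colon M(S)\to M(T)$ and $tr_T^S=M([T,\mathrm{id}]_S^T)\colon M(T)\to M(S)$. For a saturated fusion system $\mathcal{F}$ on $S$, an element $x\in M(S)$ is $\mathcal{F}$-stable if $M([P,\varphi]_P^S)(x)=M([P,\mathrm{incl}]_P^S)(x)$ for all $P\le S$ and $\varphi\in\mathrm{Hom}_{\mathcal{F}}(P,S)$; $M(\mathcal{F})\subseteq M(S)$ is the submodule of $\mathcal{F}$-stable elements. It is known that $x\in M(S)$ is $\mathcal{F}$-stable if and only if $M(\omega_{\mathcal{F}})(x)=x$. Let $res_S^{\mathcal{F}}\colon M(\mathcal{F})\to M(S)$ be the inclusion, and let $tr_S^{\mathcal{F}}\colon M(S)\to M(\mathcal{F})$ be the map $M(\omega_{\mathcal{F}})$ with codomain restricted to its image $M(\mathcal{F})$. For a saturated fusion subsystem $\mathcal{K}$ of $\mathcal{F}$ on $T\le S$, define $tr_{\mathcal{K}}^{\mathcal{F}}=tr_S^{\mathcal{F}}\circ tr_T^S\circ res_T^{\mathcal{K}}\colon M(\mathcal{K})\to M(\mathcal{F})$ and $res_{\mathcal{K}}^{\mathcal{F}}=tr_T^{\mathcal{K}}\circ res_T^S\circ res_S^{\mathcal{F}}\colon M(\mathcal{F})\to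 M(\mathcal{K})$. For $\mathcal{H}$ on $S$ and $T\le S$, $res_T^{\mathcal{H}}=res_T^S\circ res_S^{\mathcal{H}}\colon M(\mathcal{H})\to M(T)$. *)

theory Defs
  imports Complex_Main "HOL-Algebra.Group_Action" "HOL-Algebra.Module" "HOL-Library.Poly_Mapping"
    "HOL-Computational_Algebra.Primes"
begin

section \<open>Fusion systems\<close>

abbreviation subgrp :: "'a monoid \<Rightarrow> 'a set \<Rightarrow> 'a monoid" where
  "subgrp G P \<equiv> G\<lparr>carrier := P\<rparr>"

definition finite_p_group :: "nat \<Rightarrow> 'a monoid \<Rightarrow> bool" where
  "finite_p_group p G \<longleftrightarrow> group G \<and> finite (carrier G) \<and> (\<exists>n. order G = p ^ n)"

text \<open>A morphism out of \<open>P\<close> is a function that is extensional on \<open>P\<close>, so that equality of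
  morphisms with given source and target is equality of functions, and composition is
  \<^const>\<open>compose\<close>.\<close>

definition inj_homs :: "'a monoid \<Rightarrow> 'a set \<Rightarrow> 'a set \<Rightarrow> ('a \<Rightarrow> 'a) set" where
  "inj_homs S P Q = {\<phi> \<in> hom (subgrp S P) (subgrp S Q). inj_on \<phi> P \<and> \<phi> \<in> extensional P}"

definition conj_homs :: "'a monoid \<Rightarrow> 'a set \<Rightarrow> 'a set \<Rightarrow> ('a \<Rightarrow> 'a) set" where
  "conj_homs S P Q =
     {(\<lambda>x\<in>P. g \<otimes>\<^bsub>S\<^esub> x \<otimes>\<^bsub>S\<^esub> inv\<^bsub>S\<^esub> g) | g.
        g \<in> carrier S \<and> (\<forall>x\<in>P. g \<otimes>\<^bsub>S\<^esub> x \<otimes>\<^bsub>S\<^esub> inv\<^bsub>S\<^esub> g \<in> Q)}"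

text \<open>\<open>F P Q\<close> is the set of morphisms from \<open>P\<close> to \<open>Q\<close>. It is empty unless \<open>P\<close> and \<open>Q\<close> are
  subgroups, so that the objects are the subgroups of \<open>S\<close>; the identities belong to
  \<^const>\<open>conj_homs\<close>.\<close>

type_synonym 'a fusion = "'a set \<Rightarrow> 'a set \<Rightarrow> ('a \<Rightarrow> 'a) set"

definition fusion_system :: "nat \<Rightarrow> 'a monoid \<Rightarrow> 'a fusion \<Rightarrow> bool" where
  "fusion_system p S F \<longleftrightarrow>
     finite_p_group p S \<and>
     (\<forall>P Q \<phi>. \<phi> \<in> F P Q \<longrightarrow> subgroup P S \<and> subgroup Q S) \<and>
     (\<forall>P Q. subgroup P S \<longrightarrow> subgroup Q S \<longrightarrow>
        conj_homs S P Q \<subseteq> F P Q \<and> F P Q \<subseteq> inj_homs S P Q) \<and>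
     (\<forall>P Q R \<phi> \<psi>. \<phi> \<in> F P Q \<longrightarrow> \<psi> \<in> F Q R \<longrightarrow> compose P \<psi> \<phi> \<in> F P R) \<and>
     (\<forall>P Q \<phi>. \<phi> \<in> F P Q \<longrightarrow>
        \<phi> \<in> F P (\<phi> ` P) \<and> (\<lambda>y\<in>\<phi> ` P. inv_into P \<phi> y) \<in> F (\<phi> ` P) P)"

definition centralizer :: "'a monoid \<Rightarrow> 'a set \<Rightarrow> 'a set" where
  "centralizer G P = {g \<in> carrier G. \<forall>x\<in>P. g \<otimes>\<^bsub>G\<^esub> x = x \<otimes>\<^bsub>G\<^esub> g}"

definition fully_centralized :: "'a monoid \<Rightarrow> 'a fusion \<Rightarrow> 'a set \<Rightarrow> bool" where
  "fully_centralized S F P \<longleftrightarrow>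
     (\<forall>\<phi>\<in>F P (carrier S). card (centralizer S (\<phi> ` P)) \<le> card (centralizer S P))"

definition fully_normalized :: "'a monoid \<Rightarrow> 'a fusion \<Rightarrow> 'a set \<Rightarrow> bool" where
  "fully_normalized S F P \<longleftrightarrow>
     (\<forall>\<phi>\<in>F P (carrier S). card (normalizer S (\<phi> ` P)) \<le> card (normalizer S P))"

definition aut_group :: "'a fusion \<Rightarrow> 'a set \<Rightarrow> ('a \<Rightarrow> 'a) monoid" where
  "aut_group F P = \<lparr>carrier = F P P, monoid.mult = compose P, one = (\<lambda>x\<in>P. x)\<rparr>"

definition sylow_subgroup :: "nat \<Rightarrow> 'b set \<Rightarrow> 'b monoid \<Rightarrow> bool" where
  "sylow_subgroup p H G \<longleftrightarrow> subgroup H G \<and> card H = p ^ multiplicity p (order G)"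

definition extender :: "'a monoid \<Rightarrow> 'a set \<Rightarrow> ('a \<Rightarrow> 'a) \<Rightarrow> 'a set" where
  "extender S P \<phi> = {g \<in> normalizer S P.
     (\<lambda>y\<in>\<phi> ` P. \<phi> (g \<otimes>\<^bsub>S\<^esub> inv_into P \<phi> y \<otimes>\<^bsub>S\<^esub> inv\<^bsub>S\<^esub> g)) \<in> conj_homs S (\<phi> ` P) (\<phi> ` P)}"

definition saturated :: "nat \<Rightarrow> 'a monoid \<Rightarrow> 'a fusion \<Rightarrow> bool" where
  "saturated p S F \<longleftrightarrow>
     fusion_system p S F \<and>
     (\<forall>P. subgroup P S \<longrightarrow> fully_normalized S F P \<longrightarrow>
        fully_centralized S F P \<and> sylow_subgroup p (conj_homs S P P) (aut_group F P)) \<and>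
     (\<forall>P. \<forall>\<phi>\<in>F P (carrier S). fully_centralized S F (\<phi> ` P) \<longrightarrow>
        (\<exists>\<psi>\<in>F (extender S P \<phi>) (carrier S). restrict \<psi> P = \<phi>))"

definition fusion_subsystem ::
    "nat \<Rightarrow> 'a monoid \<Rightarrow> 'a fusion \<Rightarrow> 'a set \<Rightarrow> 'a fusion \<Rightarrow> bool" where
  "fusion_subsystem p S F R H \<longleftrightarrow>
     subgroup R S \<and> fusion_system p (subgrp S R) H \<and> (\<forall>P Q. H P Q \<subseteq> F P Q)"

definition composition_product ::
    "'a monoid \<Rightarrow> 'a fusion \<Rightarrow> 'a set \<Rightarrow> 'a fusion \<Rightarrow> 'a set \<Rightarrow> 'a fusion \<Rightarrow> bool" where
  "composition_product S F R H T K \<longleftrightarrow>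
     carrier S = R <#>\<^bsub>S\<^esub> T \<and>
     (\<forall>P Q. P \<subseteq> T \<longrightarrow> Q \<subseteq> R \<longrightarrow>
        (\<forall>\<phi>\<in>F P Q. \<exists>U. \<exists>\<kappa>\<in>K P U. \<exists>\<eta>\<in>H U Q. \<phi> = compose P \<eta> \<kappa>))"

definition strongly_closed :: "'a monoid \<Rightarrow> 'a fusion \<Rightarrow> 'a set \<Rightarrow> bool" where
  "strongly_closed S F T \<longleftrightarrow> (\<forall>P. P \<subseteq> T \<longrightarrow> (\<forall>\<phi>\<in>F P (carrier S). \<phi> ` P \<subseteq> T))"

definition weakly_normal :: "nat \<Rightarrow> 'a monoid \<Rightarrow> 'a fusion \<Rightarrow> 'a set \<Rightarrow> 'a fusion \<Rightarrow> bool" where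
  "weakly_normal p S F T K \<longleftrightarrow>
     saturated p (subgrp S T) K \<and> fusion_subsystem p S F T K \<and> strongly_closed S F T \<and>
     (\<forall>P Q R. \<forall>\<phi>\<in>F P (carrier S). \<forall>\<psi>\<in>K Q R. Q \<subseteq> P \<longrightarrow> R \<subseteq> P \<longrightarrow>
        (\<lambda>y\<in>\<phi> ` Q. \<phi> (\<psi> (inv_into Q \<phi> y))) \<in> K (\<phi> ` Q) (\<phi> ` R))"


section \<open>Bisets\<close>

text \<open>A \<open>(G, H)\<close>-biset has its left action by \<open>H\<close> and its right action by \<open>G\<close>.\<close>

record ('a, 'x) biset =
  points :: "'x set"
  lact :: "'a \<Rightarrow> 'x \<Rightarrow> 'x"
  ract :: "'x \<Rightarrow> 'a \<Rightarrow> 'x"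

definition is_biset :: "'a monoid \<Rightarrow> 'a monoid \<Rightarrow> ('a, 'x) biset \<Rightarrow> bool" where
  "is_biset G H X \<longleftrightarrow>
     (\<forall>x\<in>points X.
        (\<forall>h\<in>carrier H. lact X h x \<in> points X) \<and>
        (\<forall>g\<in>carrier G. ract X x g \<in> points X) \<and>
        lact X \<one>\<^bsub>H\<^esub> x = x \<and>
        ract X x \<one>\<^bsub>G\<^esub> = x \<and>
        (\<forall>h\<in>carrier H. \<forall>h'\<in>carrier H. lact X (h \<otimes>\<^bsub>H\<^esub> h') x = lact X h (lact X h' x)) \<and>
        (\<forall>g\<in>carrier G. \<forall>g'\<in>carrier G. ract X x (g \<otimes>\<^bsub>G\<^esub> g') = ract X (ract X x g) g') \<and>
        (\<forall>h\<in>carrier H. \<forall>g\<in>carrier G. ract X (lact X h x) g = lact X h (ract X x g)))"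

definition finite_left_free_biset :: "'a monoid \<Rightarrow> 'a monoid \<Rightarrow> ('a, 'x) biset \<Rightarrow> bool" where
  "finite_left_free_biset G H X \<longleftrightarrow>
     is_biset G H X \<and> finite (points X) \<and>
     (\<forall>x\<in>points X. \<forall>h\<in>carrier H. lact X h x = x \<longrightarrow> h = \<one>\<^bsub>H\<^esub>)"

definition biset_iso ::
    "'a monoid \<Rightarrow> 'a monoid \<Rightarrow> ('a, 'x) biset \<Rightarrow> ('a, 'y) biset \<Rightarrow> bool" where
  "biset_iso G H X Y \<longleftrightarrow>
     (\<exists>f. bij_betw f (points X) (points Y) \<and>
        (\<forall>x\<in>points X. (\<forall>h\<in>carrier H. f (lact X h x) = lact Y h (f x)) \<and>
                      (\<forall>g\<in>carrier G. f (ract X x g) = ract Y (f x) g)))"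

definition biset_sum :: "('a, 'x) biset \<Rightarrow> ('a, 'y) biset \<Rightarrow> ('a, 'x + 'y) biset" where
  "biset_sum X Y =
     \<lparr>points = points X <+> points Y,
      lact = (\<lambda>h. map_sum (lact X h) (lact Y h)),
      ract = (\<lambda>z g. map_sum (\<lambda>x. ract X x g) (\<lambda>y. ract Y y g) z)\<rparr>"

text \<open>\<open>X \<times>\<^sub>H Y\<close> for a biset \<open>X\<close> with right action of \<open>H\<close> and a biset \<open>Y\<close> with left action of \<open>H\<close>.
  The relation identifying \<open>(x h, y)\<close> with \<open>(x, h y)\<close> is already an equivalence relation,
  and both actions pass to the classes.\<close>

definition biset_comp ::
    "'a monoid \<Rightarrow> ('a, 'x) biset \<Rightarrow> ('a, 'y) biset \<Rightarrow> ('a, ('x \<times> 'y) set) biset" where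
  "biset_comp H X Y =
     \<lparr>points = (points X \<times> points Y) //
        {((ract X x h, y), (x, lact Y h y)) | x h y.
            x \<in> points X \<and> h \<in> carrier H \<and> y \<in> points Y},
      lact = (\<lambda>k C. (\<lambda>(x, y). (lact X k x, y)) ` C),
      ract = (\<lambda>C g. (\<lambda>(x, y). (x, ract Y y g)) ` C)\<rparr>"

text \<open>\<open>H \<times>\<^bsub>(P,\<phi>)\<^esub> G\<close>: here too the displayed relation is already an equivalence relation.\<close>

definition std_biset ::
    "'a monoid \<Rightarrow> 'a monoid \<Rightarrow> 'a set \<Rightarrow> ('a \<Rightarrow> 'a) \<Rightarrow> ('a, ('a \<times> 'a) set) biset" where
  "std_biset G H P \<phi> =
     \<lparr>points = (carrier H \<times> carrier G) //
        {((h, k \<otimes>\<^bsub>G\<^esub> g), (h \<otimes>\<^bsub>H\<^esub> \<phi> k, g)) | h k g.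
            h \<in> carrier H \<and> k \<in> P \<and> g \<in> carrier G},
      lact = (\<lambda>x C. (\<lambda>(h, g). (x \<otimes>\<^bsub>H\<^esub> h, g)) ` C),
      ract = (\<lambda>C y. (\<lambda>(h, g). (h, g \<otimes>\<^bsub>G\<^esub> y)) ` C)\<rparr>"


section \<open>Burnside modules\<close>

text \<open>Every finite biset is isomorphic to one whose points are natural numbers; an isomorphism
  class is represented by the set of its members of that kind. This gives all classes a common
  type, while \<open>X\<close> may have points of any type.\<close>

type_synonym 'a biset_class = "('a, nat) biset set"

definition iso_class :: "'a monoid \<Rightarrow> 'a monoid \<Rightarrow> ('a, 'x) biset \<Rightarrow> 'a biset_class" where
  "iso_class G H X = {Y. finite_left_free_biset G H Y \<and> biset_iso G H X Y}"

definition iso_classes :: "'a monoid \<Rightarrow> 'a monoid \<Rightarrow> 'a biset_class set" where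
  "iso_classes G H =
     {iso_class G H X | X :: ('a, nat) biset. finite_left_free_biset G H X}"

text \<open>\<open>\<int>\<^bsub>(p)\<^esub>\<close>, as a module over itself.\<close>

definition Zloc :: "nat \<Rightarrow> (rat, rat) module" where
  "Zloc p = \<lparr>carrier = {r. coprime (snd (quotient_of r)) (int p)},
             monoid.mult = (*), one = 1, zero = 0, add = (+), smult = (*)\<rparr>"

definition prime_to :: "nat \<Rightarrow> rat \<Rightarrow> bool" where
  "prime_to p r \<longleftrightarrow> coprime (fst (quotient_of r)) (int p)"

definition scale :: "rat \<Rightarrow> ('c \<Rightarrow>\<^sub>0 rat) \<Rightarrow> ('c \<Rightarrow>\<^sub>0 rat)" where
  "scale r f = Poly_Mapping.map ((*) r) f"

text \<open>The \<open>p\<close>-localization of the Grothendieck group is the \<open>\<int>\<^bsub>(p)\<^esub>\<close>-module generated by the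
  isomorphism classes \<open>[X]\<close> subject to the relations \<open>[X \<squnion> Y] = [X] + [Y]\<close>. Its elements are the
  cosets of the submodule \<open>burnside_rel\<close> in the free module \<open>burnside_free\<close>.\<close>

definition burnside_free :: "nat \<Rightarrow> 'a monoid \<Rightarrow> 'a monoid \<Rightarrow> ('a biset_class \<Rightarrow>\<^sub>0 rat) set" where
  "burnside_free p G H =
     {f. Poly_Mapping.keys f \<subseteq> iso_classes G H \<and>
         (\<forall>c. Poly_Mapping.lookup f c \<in> carrier (Zloc p))}"

inductive_set burnside_rel ::
    "nat \<Rightarrow> 'a monoid \<Rightarrow> 'a monoid \<Rightarrow> ('a biset_class \<Rightarrow>\<^sub>0 rat) set"
  for p :: nat and G H :: "'a monoid" where
  zero: "0 \<in> burnside_rel p G H"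
| step: "\<lbrakk>f \<in> burnside_rel p G H; r \<in> carrier (Zloc p);
          finite_left_free_biset G H (X :: ('a, nat) biset);
          finite_left_free_biset G H (Y :: ('a, nat) biset)\<rbrakk>
    \<Longrightarrow> f + scale r (Poly_Mapping.single (iso_class G H (biset_sum X Y)) 1
                     - Poly_Mapping.single (iso_class G H X) 1
                     - Poly_Mapping.single (iso_class G H Y) 1) \<in> burnside_rel p G H"

type_synonym 'a burnside = "('a biset_class \<Rightarrow>\<^sub>0 rat) set"

definition burnside_coset ::
    "nat \<Rightarrow> 'a monoid \<Rightarrow> 'a monoid \<Rightarrow> ('a biset_class \<Rightarrow>\<^sub>0 rat) \<Rightarrow> 'a burnside" where
  "burnside_coset p G H f = {g \<in> burnside_free p G H. g - f \<in> burnside_rel p G H}"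

definition burnside_rep :: "'a burnside \<Rightarrow> ('a biset_class \<Rightarrow>\<^sub>0 rat)" where
  "burnside_rep a = (SOME f. f \<in> a)"

text \<open>\<open>A(G, H)\<^bsub>(p)\<^esub>\<close>. The multiplicative fields of the record are not used, since composition is
  not an operation on a single \<open>A(G, H)\<^bsub>(p)\<^esub>\<close> in general.\<close>

definition burnside :: "nat \<Rightarrow> 'a monoid \<Rightarrow> 'a monoid \<Rightarrow> (rat, 'a burnside) module" where
  "burnside p G H =
     \<lparr>carrier = burnside_coset p G H ` burnside_free p G H,
      monoid.mult = undefined, one = undefined,
      zero = burnside_coset p G H 0,
      add = (\<lambda>a b. burnside_coset p G H (burnside_rep a + burnside_rep b)),
      smult = (\<lambda>r a. burnside_coset p G H (scale r (burnside_rep a)))\<rparr>"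

definition burnside_basis ::
    "nat \<Rightarrow> 'a monoid \<Rightarrow> 'a monoid \<Rightarrow> 'a set \<Rightarrow> ('a \<Rightarrow> 'a) \<Rightarrow> 'a burnside" where
  "burnside_basis p G H P \<phi> =
     burnside_coset p G H (Poly_Mapping.single (iso_class G H (std_biset G H P \<phi>)) 1)"

definition class_comp ::
    "'a monoid \<Rightarrow> 'a monoid \<Rightarrow> 'a monoid \<Rightarrow> 'a biset_class \<Rightarrow> 'a biset_class \<Rightarrow> 'a biset_class" where
  "class_comp G H K c d = (\<Union>X\<in>c. \<Union>Y\<in>d. iso_class G K (biset_comp H X Y))"

text \<open>\<open>burnside_comp p G H K a b\<close> is \<open>a \<circ> b \<in> A(G, K)\<^bsub>(p)\<^esub>\<close> for \<open>a \<in> A(H, K)\<^bsub>(p)\<^esub>\<close> and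
  \<open>b \<in> A(G, H)\<^bsub>(p)\<^esub>\<close>.\<close>

definition burnside_comp ::
    "nat \<Rightarrow> 'a monoid \<Rightarrow> 'a monoid \<Rightarrow> 'a monoid \<Rightarrow> 'a burnside \<Rightarrow> 'a burnside \<Rightarrow> 'a burnside" where
  "burnside_comp p G H K a b =
     (let f = burnside_rep a; g = burnside_rep b in
      burnside_coset p G K
        (\<Sum>c\<in>Poly_Mapping.keys f. \<Sum>d\<in>Poly_Mapping.keys g.
           Poly_Mapping.single (class_comp G H K c d)
             (Poly_Mapping.lookup f c * Poly_Mapping.lookup g d)))"

definition linear_map ::
    "('r, 'm) ring_scheme \<Rightarrow> ('r, 'b, 'n) module_scheme \<Rightarrow> ('r, 'c, 'k) module_scheme
       \<Rightarrow> ('b \<Rightarrow> 'c) \<Rightarrow> bool" where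
  "linear_map R M N f \<longleftrightarrow>
     f \<in> carrier M \<rightarrow> carrier N \<and>
     (\<forall>x\<in>carrier M. \<forall>y\<in>carrier M. f (x \<oplus>\<^bsub>M\<^esub> y) = f x \<oplus>\<^bsub>N\<^esub> f y) \<and>
     (\<forall>r\<in>carrier R. \<forall>x\<in>carrier M. f (r \<odot>\<^bsub>M\<^esub> x) = r \<odot>\<^bsub>N\<^esub> f x)"


section \<open>Characteristic idempotents\<close>

definition F_generated :: "nat \<Rightarrow> 'a monoid \<Rightarrow> 'a fusion \<Rightarrow> 'a burnside \<Rightarrow> bool" where
  "F_generated p S F X \<longleftrightarrow>
     (\<exists>c. range c \<subseteq> carrier (Zloc p) \<and>
        X = (\<Oplus>\<^bsub>burnside p S S\<^esub>b\<in>{(P, \<phi>). \<phi> \<in> F P (carrier S)}.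
               c b \<odot>\<^bsub>burnside p S S\<^esub> burnside_basis p S S (fst b) (snd b)))"

definition right_stable ::
    "nat \<Rightarrow> 'a monoid \<Rightarrow> 'a fusion \<Rightarrow> 'a monoid \<Rightarrow> 'a burnside \<Rightarrow> bool" where
  "right_stable p S F H X \<longleftrightarrow>
     (\<forall>P. \<forall>\<phi>\<in>F P (carrier S).
        burnside_comp p (subgrp S P) S H X (burnside_basis p (subgrp S P) S P \<phi>) =
        burnside_comp p (subgrp S P) S H X (burnside_basis p (subgrp S P) S P (\<lambda>x. x)))"

definition left_stable ::
    "nat \<Rightarrow> 'a monoid \<Rightarrow> 'a fusion \<Rightarrow> 'a monoid \<Rightarrow> 'a burnside \<Rightarrow> bool" where
  "left_stable p S F H X \<longleftrightarrow>
     (\<forall>P. \<forall>\<phi>\<in>F P (carrier S).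
        burnside_comp p H S (subgrp S P)
          (burnside_basis p S (subgrp S P) (\<phi> ` P) (inv_into P \<phi>)) X =
        burnside_comp p H S (subgrp S P)
          (burnside_basis p S (subgrp S P) P (\<lambda>x. x)) X)"

definition augmentation :: "nat \<Rightarrow> 'a monoid \<Rightarrow> 'a burnside \<Rightarrow> rat" where
  "augmentation p S = (THE e.
     e \<in> extensional (carrier (burnside p S S)) \<and>
     linear_map (Zloc p) (burnside p S S) (Zloc p) e \<and>
     (\<forall>P. subgroup P S \<longrightarrow> (\<forall>\<phi>\<in>hom (subgrp S P) S.
        e (burnside_basis p S S P \<phi>) = of_nat (card (rcosets\<^bsub>S\<^esub> P)))))"

definition characteristic_idempotent ::
    "nat \<Rightarrow> 'a monoid \<Rightarrow> 'a fusion \<Rightarrow> 'a burnside \<Rightarrow> bool" where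
  "characteristic_idempotent p S F \<omega> \<longleftrightarrow>
     \<omega> \<in> carrier (burnside p S S) \<and>
     burnside_comp p S S S \<omega> \<omega> = \<omega> \<and>
     F_generated p S F \<omega> \<and> left_stable p S F S \<omega> \<and> right_stable p S F S \<omega> \<and>
     prime_to p (augmentation p S \<omega>)"


section \<open>Mackey functors\<close>

text \<open>A contravariant functor is given by modules \<open>Mob G\<close> and maps
  \<open>Mmor G H X : Mob H \<rightarrow> Mob G\<close> for \<open>X \<in> A(G, H)\<^bsub>(p)\<^esub>\<close>. The objects are the finite \<open>p\<close>-groups
  with elements in \<open>'a\<close>; if \<open>'a\<close> is infinite these are all finite \<open>p\<close>-groups up to isomorphism.\<close>

type_synonym ('a, 'm) mackey_ob = "'a monoid \<Rightarrow> (rat, 'm) module"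
type_synonym ('a, 'm) mackey_mor = "'a monoid \<Rightarrow> 'a monoid \<Rightarrow> 'a burnside \<Rightarrow> 'm \<Rightarrow> 'm"

definition mackey_functor :: "nat \<Rightarrow> ('a, 'm) mackey_ob \<Rightarrow> ('a, 'm) mackey_mor \<Rightarrow> bool" where
  "mackey_functor p Mob Mmor \<longleftrightarrow>
     (\<forall>G. finite_p_group p G \<longrightarrow>
        module (Zloc p) (Mob G) \<and>
        (\<forall>x\<in>carrier (Mob G). Mmor G G (burnside_basis p G G (carrier G) (\<lambda>x. x)) x = x)) \<and>
     (\<forall>G H. finite_p_group p G \<longrightarrow> finite_p_group p H \<longrightarrow>
        (\<forall>X\<in>carrier (burnside p G H). linear_map (Zloc p) (Mob H) (Mob G) (Mmor G H X)) \<and>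
        (\<forall>X\<in>carrier (burnside p G H). \<forall>x\<in>carrier (Mob H).
           (\<forall>Y\<in>carrier (burnside p G H).
              Mmor G H (X \<oplus>\<^bsub>burnside p G H\<^esub> Y) x = Mmor G H X x \<oplus>\<^bsub>Mob G\<^esub> Mmor G H Y x) \<and>
           (\<forall>r\<in>carrier (Zloc p).
              Mmor G H (r \<odot>\<^bsub>burnside p G H\<^esub> X) x = r \<odot>\<^bsub>Mob G\<^esub> Mmor G H X x))) \<and>
     (\<forall>G H K. finite_p_group p G \<longrightarrow> finite_p_group p H \<longrightarrow> finite_p_group p K \<longrightarrow>
        (\<forall>Y\<in>carrier (burnside p H K). \<forall>X\<in>carrier (burnside p G H). \<forall>x\<in>carrier (Mob K).
           Mmor G K (burnside_comp p G H K Y X) x = Mmor G H X (Mmor H K Y x)))"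

definition res_sub :: "nat \<Rightarrow> ('a, 'm) mackey_mor \<Rightarrow> 'a monoid \<Rightarrow> 'a set \<Rightarrow> 'm \<Rightarrow> 'm" where
  "res_sub p Mmor S T =
     Mmor (subgrp S T) S (burnside_basis p (subgrp S T) S T (\<lambda>x. x))"

definition tr_sub :: "nat \<Rightarrow> ('a, 'm) mackey_mor \<Rightarrow> 'a monoid \<Rightarrow> 'a set \<Rightarrow> 'm \<Rightarrow> 'm" where
  "tr_sub p Mmor S T =
     Mmor S (subgrp S T) (burnside_basis p S (subgrp S T) T (\<lambda>x. x))"

definition stable_elements ::
    "nat \<Rightarrow> ('a, 'm) mackey_ob \<Rightarrow> ('a, 'm) mackey_mor \<Rightarrow> 'a monoid \<Rightarrow> 'a fusion \<Rightarrow> 'm set" where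
  "stable_elements p Mob Mmor S F =
     {x \<in> carrier (Mob S). \<forall>P. \<forall>\<phi>\<in>F P (carrier S).
        Mmor (subgrp S P) S (burnside_basis p (subgrp S P) S P \<phi>) x =
        Mmor (subgrp S P) S (burnside_basis p (subgrp S P) S P (\<lambda>x. x)) x}"

text \<open>The transfer \<open>M(S) \<rightarrow> M(\<F>)\<close> takes the characteristic idempotent \<open>\<omega>\<close> of \<open>\<F>\<close> as a parameter;
  a saturated fusion system has exactly one.
  The inclusions \<open>M(\<F>) \<rightarrow> M(S)\<close> of stable elements are not written.\<close>

definition tr_fus :: "('a, 'm) mackey_mor \<Rightarrow> 'a monoid \<Rightarrow> 'a burnside \<Rightarrow> 'm \<Rightarrow> 'm" where
  "tr_fus Mmor S \<omega> = Mmor S S \<omega>"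

text \<open>In the next two definitions \<open>\<F>\<close> is a fusion system on \<open>S\<close> and the subsystem \<open>\<K>\<close> is one
  on \<open>T\<close>.\<close>

definition tr_subsys ::
    "nat \<Rightarrow> ('a, 'm) mackey_mor \<Rightarrow> 'a monoid \<Rightarrow> 'a burnside \<Rightarrow> 'a set \<Rightarrow> 'm \<Rightarrow> 'm" where
  "tr_subsys p Mmor S \<omega>F T = tr_fus Mmor S \<omega>F \<circ> tr_sub p Mmor S T"

definition res_subsys ::
    "nat \<Rightarrow> ('a, 'm) mackey_mor \<Rightarrow> 'a monoid \<Rightarrow> 'a set \<Rightarrow> 'a burnside \<Rightarrow> 'm \<Rightarrow> 'm" where
  "res_subsys p Mmor S T \<omega>K = tr_fus Mmor (subgrp S T) \<omega>K \<circ> res_sub p Mmor S T"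

end

theory Submission
  imports Defs "HOL-Number_Theory.Cong"
begin

text \<open>The two maps are the values of \<open>M\<close> at \<open>\<omega>F \<circ> incl \<circ> \<omega>K\<close> and \<open>incl \<circ> \<omega>K\<close> in \<open>A(T, S)\<close>, restricted to
  \<open>H\<close>-stable elements. On those, \<open>M\<close> does not distinguish \<open>[Q, \<eta>\<psi>]\<close> from \<open>[Q, \<psi>]\<close> for \<open>\<eta>\<close> in \<open>H\<close>, and an element of
  \<open>A(T, S)\<close> is a combination of such differences as soon as its marks, summed at each \<open>(P, \<phi>)\<close> over all
  \<open>(P, \<eta>\<phi>)\<close> with \<open>\<eta>\<close> in \<open>H\<close>, vanish. So only marks have to be compared.

  Stability makes the mark of a characteristic idempotent \<open>\<omega>F\<close> at \<open>(P, \<phi>)\<close> independent of \<open>\<phi> \<in> F(P, S)\<close>,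
  and idempotency together with the augmentation forces its value to be \<open>|S| / |F(P, S)|\<close>. The
  comparison of the averaged marks then becomes
  \<open>|F(P, S)| |(H \<inter> K)(P, T)| = |H(P, S)| |K(P, T)|\<close> for \<open>P \<le> T\<close>. Weak normality enters through a Frattini
  argument: every \<open>F\<close>-morphism from \<open>P\<close> to \<open>T\<close> is a \<open>K\<close>-morphism followed by an \<open>F\<close>-automorphism of \<open>T\<close>, which the
  product decomposition allows to be taken in \<open>H\<close>. Such automorphisms normalise \<open>K\<close>, so the identity
  follows as the product formula \<open>|HK| |H \<inter> K| = |H| |K|\<close> does for groups.\<close>

section \<open>Actions of p-groups\<close>

text \<open>The values of \<open>M\<close> may have torsion, so the comparison cannot be made after
  tensoring with the rationals: the difference of the two elements of A(T, S), which are in general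
  distinct, has to be written with coefficients prime to \<open>p\<close> in the denominator.
  Detection therefore merges coefficients of basis elements and never inverts a table of marks. The
  product hypothesis alone gives an \<open>H\<close>-factor defined on some intermediate subgroup.
  Conjugating by such a partial morphism is controlled by weak normality only for
  \<open>K\<close>-morphisms inside its domain; a factor defined on all of \<open>T\<close> acts on
  every K(P, T). Obtaining it is the purpose of the Frattini argument. In the product formula, two
  factorisations of one morphism through \<open>H\<close> and \<open>K\<close> differ by a morphism
  of both. The counts close up because |K(P, T)| does not change along
  \<open>F\<close>-isomorphisms, nor |(H \<inter> K)(P, T)| along \<open>H\<close>-isomorphisms. The
  factor |S| in the mark of an idempotent is the size of the classes that form a balanced product
  over \<open>S\<close>.\<close>

lemma group_actionI:
  assumes "group G"
    and "\<And>g x. g \<in> carrier G \<Longrightarrow> x \<in> E \<Longrightarrow> act g x \<in> E"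
    and "\<And>x. x \<in> E \<Longrightarrow> act \<one>\<^bsub>G\<^esub> x = x"
    and "\<And>g h x. g \<in> carrier G \<Longrightarrow> h \<in> carrier G \<Longrightarrow> x \<in> E \<Longrightarrow>
           act (g \<otimes>\<^bsub>G\<^esub> h) x = act g (act h x)"
  shows "group_action G E (\<lambda>g. \<lambda>x\<in>E. act g x)"
proof -
  interpret group G by fact
  have inv: "act (inv\<^bsub>G\<^esub> g) (act g x) = x" "act g (act (inv\<^bsub>G\<^esub> g) x) = x"
    if "g \<in> carrier G" "x \<in> E" for g x
    using that assms(3) assms(4)[of "inv\<^bsub>G\<^esub> g" g x] assms(4)[of g "inv\<^bsub>G\<^esub> g" x] by simp_all
  have "bij_betw (act g) E E" if "g \<in> carrier G" for g
    by (rule bij_betw_byWitness[where f' = "act (inv\<^bsub>G\<^esub> g)"]) (use that inv assms(2) in auto)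
  \<comment> \<open>\<open>Bij E\<close> consists of extensional functions, hence the restriction of
    each \<open>act g\<close> to \<open>E\<close>.\<close>
  hence bij: "(\<lambda>x\<in>E. act g x) \<in> Bij E" if "g \<in> carrier G" for g
    using that by (simp add: Bij_def cong: bij_betw_cong)
  have "(\<lambda>g. \<lambda>x\<in>E. act g x) \<in> hom G (BijGroup E)"
    using bij assms(2,4)
    by (intro homI) (auto simp: BijGroup_def compose_def restrict_def fun_eq_iff)
  thus ?thesis
    unfolding group_action_def group_hom_def group_hom_axioms_def
    using group_BijGroup assms(1) by auto
qed

lemma prime_power_divisor:
  assumes "prime (p::nat)" "m dvd p ^ n" "m \<noteq> 1"
  shows "p dvd m"
  using assms divides_primepow_nat[of p m n] by (metis dvd_power gr0I power_0)

text \<open>The size of an orbit divides p^n, so it is 1 or a multiple of \<open>p\<close>; the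
  orbits of size 1 are the fixed points.\<close>

lemma fixed_points_cong:
  assumes G: "group G" and p: "prime (p::nat)" and ord: "order G = p ^ n" and fin: "finite E"
    and closed: "\<And>g x. g \<in> carrier G \<Longrightarrow> x \<in> E \<Longrightarrow> act g x \<in> E"
    and one: "\<And>x. x \<in> E \<Longrightarrow> act \<one>\<^bsub>G\<^esub> x = x"
    and mult: "\<And>g h x. g \<in> carrier G \<Longrightarrow> h \<in> carrier G \<Longrightarrow> x \<in> E \<Longrightarrow>
           act (g \<otimes>\<^bsub>G\<^esub> h) x = act g (act h x)"
  shows "[card E = card {x\<in>E. \<forall>g\<in>carrier G. act g x = x}] (mod p)"
proof -
  define \<phi> where "\<phi> = (\<lambda>g. \<lambda>x\<in>E. act g x)"
  interpret A: group_action G E \<phi>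
    unfolding \<phi>_def by (rule group_actionI) fact+
  interpret group G by fact
  let ?F = "{x\<in>E. \<forall>g\<in>carrier G. act g x = x}"
  have orb: "orbit G \<phi> x = {act g x | g. g \<in> carrier G}" if "x \<in> E" for x
    using that by (auto simp: orbit_def \<phi>_def)
  have part: "partition E (orbits G E \<phi>)" by (rule A.orbit_partition)
  have sub: "x \<in> E" if "O' \<in> orbits G E \<phi>" "x \<in> O'" for O' x
    using part that unfolding partition_def by blast
  have U: "\<Union> (orbits G E \<phi>) = E"
    using part by (auto simp: partition_def)
  have fin': "finite (orbits G E \<phi>)"
    using fin by (simp add: U finite_UnionD)
  have disj: "O1 = O2" if "O1 \<in> orbits G E \<phi>" "O2 \<in> orbits G E \<phi>" "O1 \<inter> O2 \<noteq> {}" for O1 O2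
    using part that sub unfolding partition_def by blast
  let ?O1 = "{X \<in> orbits G E \<phi>. card X = 1}"
  have cE: "card E = (\<Sum>X\<in>orbits G E \<phi>. card X)"
  proof -
    have "pairwise disjnt (orbits G E \<phi>)"
      using disj by (fastforce simp: pairwise_def disjnt_def)
    moreover have "finite X" if "X \<in> orbits G E \<phi>" for X
      using sub[OF that] fin by (meson finite_subset subsetI)
    ultimately show ?thesis
      by (subst U[symmetric]) (rule card_Union_disjoint)
  qed
  have dvd: "p dvd card X" if "X \<in> orbits G E \<phi>" "card X \<noteq> 1" for X
  proof -
    obtain x where "x \<in> E" "X = orbit G \<phi> x" using \<open>X \<in> orbits G E \<phi>\<close> by (auto simp: orbits_def)
    hence "card X dvd p ^ n"
      using A.orbit_stabilizer_theorem ord by (metis dvd_triv_left)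
    thus ?thesis using prime_power_divisor p that by blast
  qed
  have "[card E = (\<Sum>X\<in>orbits G E \<phi>. if card X = 1 then 1 else 0)] (mod p)"
    unfolding cE by (rule cong_sum) (use dvd in \<open>auto simp: cong_0_iff\<close>)
  also have "(\<Sum>X\<in>orbits G E \<phi>. if card X = 1 then 1 else 0) = card ?O1"
    using fin' by (simp add: sum.If_cases Int_def)
  also have "card ?O1 = card ?F"
  proof -
    have "bij_betw (\<lambda>x. {x}) ?F ?O1"
      unfolding bij_betw_def
    proof
      show "(\<lambda>x. {x}) ` ?F = ?O1"
      proof safe
        fix x assume "x \<in> E" "\<forall>g\<in>carrier G. act g x = x"
        hence "orbit G \<phi> x = {x}" using A.orbit_refl[of x] by (auto simp: orb)
        thus "{x} \<in> orbits G E \<phi>" using \<open>x \<in> E\<close> unfolding orbits_def by blast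
      next
        fix X assume "X \<in> orbits G E \<phi>" "card X = 1"
        then obtain x where x: "x \<in> E" "X = orbit G \<phi> x" by (auto simp: orbits_def)
        have "X = {x}" using \<open>card X = 1\<close> A.orbit_refl[OF x(1)] x(2)
          by (metis card_1_singletonE singletonD)
        moreover from this have "\<forall>g\<in>carrier G. act g x = x" using x orb by auto
        ultimately show "X \<in> (\<lambda>x. {x}) ` ?F" using x(1) by auto
      qed simp
    qed auto
    thus ?thesis by (simp add: bij_betw_same_card)
  qed
  finally show ?thesis .
qed

section \<open>Conjugation, fixed cosets, Sylow conjugacy and growth of normalizers\<close>

context group
begin

lemma inv_mult_cancel:
  "g \<in> carrier G \<Longrightarrow> x \<in> carrier G \<Longrightarrow> inv g \<otimes> (g \<otimes> x) = x"
  "g \<in> carrier G \<Longrightarrow> x \<in> carrier G \<Longrightarrow> g \<otimes> (inv g \<otimes> x) = x"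
  by (simp_all flip: m_assoc)

lemma conj_mult:
  "g \<in> carrier G \<Longrightarrow> x \<in> carrier G \<Longrightarrow> y \<in> carrier G \<Longrightarrow>
    g \<otimes> (x \<otimes> y) \<otimes> inv g = (g \<otimes> x \<otimes> inv g) \<otimes> (g \<otimes> y \<otimes> inv g)"
  by (simp add: m_assoc inv_mult_cancel)

lemma conj_conj:
  "g \<in> carrier G \<Longrightarrow> h \<in> carrier G \<Longrightarrow> x \<in> carrier G \<Longrightarrow>
    g \<otimes> (h \<otimes> x \<otimes> inv h) \<otimes> inv g = (g \<otimes> h) \<otimes> x \<otimes> inv (g \<otimes> h)"
  by (simp add: m_assoc inv_mult_group)

lemma conj_inv_cancel:
  "g \<in> carrier G \<Longrightarrow> x \<in> carrier G \<Longrightarrow> inv g \<otimes> (g \<otimes> x \<otimes> inv g) \<otimes> g = x"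
  "g \<in> carrier G \<Longrightarrow> x \<in> carrier G \<Longrightarrow> g \<otimes> (inv g \<otimes> x \<otimes> g) \<otimes> inv g = x"
  by (simp_all add: m_assoc inv_mult_cancel)

lemma rcos_fixed_iff:
  assumes "g \<in> carrier G" "x \<in> carrier G" "subgroup H G"
  shows "H #> (x \<otimes> g) = H #> x \<longleftrightarrow> x \<otimes> g \<otimes> inv x \<in> H"
proof -
  interpret H: subgroup H G by fact
  have "H #> (x \<otimes> g) = H #> x \<longleftrightarrow> x \<otimes> g \<in> H #> x"
    using assms by (metis repr_independence rcos_self m_closed)
  also have "\<dots> \<longleftrightarrow> x \<otimes> g \<otimes> inv x \<in> H"
  proof
    assume "x \<otimes> g \<in> H #> x"
    then obtain h where h: "h \<in> H" "x \<otimes> g = h \<otimes> x" by (auto simp: r_coset_def)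
    thus "x \<otimes> g \<otimes> inv x \<in> H" using assms H.mem_carrier by (simp add: m_assoc)
  next
    assume "x \<otimes> g \<otimes> inv x \<in> H"
    moreover have "x \<otimes> g = (x \<otimes> g \<otimes> inv x) \<otimes> x" using assms by (simp add: m_assoc)
    ultimately show "x \<otimes> g \<in> H #> x" unfolding r_coset_def by blast
  qed
  finally show ?thesis .
qed

end

text \<open>\<open>N\<close> acts on the right cosets of \<open>H\<close> through \<theta>, and the
  coset of \<open>x\<close> is fixed exactly when \<open>x\<close> conjugates the image of
  \<open>N\<close> into \<open>H\<close>. Sylow conjugacy and the growth of normalizers are both
  read off from this congruence.\<close>

lemma rcos_fixed_cong:
  fixes G :: "'a monoid" (structure)
  assumes "group G" and p: "prime (p::nat)" and fin: "finite (carrier G)"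
    and N: "group N" "order N = p ^ n" and \<theta>: "\<theta> \<in> hom N G" and H: "subgroup H G"
  shows "[card (rcosets H) =
          card ((\<lambda>x. H #> x) ` {x \<in> carrier G. \<forall>q\<in>carrier N. x \<otimes> \<theta> q \<otimes> inv x \<in> H})] (mod p)"
proof -
  interpret group G by fact
  interpret \<theta>: group_hom N G \<theta> using assms by (simp add: group_hom_def group_hom_axioms_def)
  have HG: "H \<subseteq> carrier G" using H by (rule subgroup.subset)
  have act: "(H #> x) #> q = H #> (x \<otimes> q)" if "x \<in> carrier G" "q \<in> carrier G" for x q
    using that HG by (simp add: coset_mult_assoc)
  have "[card (rcosets H) =
      card {X\<in>rcosets H. \<forall>g\<in>carrier N. X #> inv (\<theta> g) = X}] (mod p)"
  proof (rule fixed_points_cong[OF N(1) p N(2)])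
    show "finite (rcosets H)" using fin by (simp add: RCOSETS_def)
  next
    fix g X assume "g \<in> carrier N" "X \<in> rcosets H"
    thus "X #> inv (\<theta> g) \<in> rcosets H" by (fastforce simp: RCOSETS_def act)
  next
    fix X assume "X \<in> rcosets H"
    thus "X #> inv (\<theta> \<one>\<^bsub>N\<^esub>) = X" by (auto simp: RCOSETS_def act)
  next
    fix g h X assume "g \<in> carrier N" "h \<in> carrier N" "X \<in> rcosets H"
    thus "X #> inv (\<theta> (g \<otimes>\<^bsub>N\<^esub> h)) = X #> inv (\<theta> h) #> inv (\<theta> g)"
      by (auto simp: RCOSETS_def act m_assoc inv_mult_group)
  qed
  also have "{X\<in>rcosets H. \<forall>g\<in>carrier N. X #> inv (\<theta> g) = X} =
      (\<lambda>x. H #> x) ` {x \<in> carrier G. \<forall>q\<in>carrier N. x \<otimes> \<theta> q \<otimes> inv x \<in> H}" (is "?A = ?B")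
  proof -
    \<comment> \<open>The inverse turns right translation of cosets into a left action; it drops out
      of the fixed-point condition because the condition runs over all of \<open>N\<close>.\<close>
    have iff: "(\<forall>g\<in>carrier N. H #> x #> inv (\<theta> g) = H #> x) \<longleftrightarrow> (\<forall>q\<in>carrier N. x \<otimes> \<theta> q \<otimes> inv x \<in> H)"
      if x: "x \<in> carrier G" for x
    proof -
      have i: "H #> x #> inv (\<theta> g) = H #> x \<longleftrightarrow> x \<otimes> \<theta> (inv\<^bsub>N\<^esub> g) \<otimes> inv x \<in> H" if "g \<in> carrier N" for g
        using that x H by (simp add: act rcos_fixed_iff)
      show ?thesis
      proof (intro iffI ballI)
        fix q assume "\<forall>g\<in>carrier N. H #> x #> inv (\<theta> g) = H #> x" and q: "q \<in> carrier N"
        hence "x \<otimes> \<theta> (inv\<^bsub>N\<^esub> (inv\<^bsub>N\<^esub> q)) \<otimes> inv x \<in> H" using i[of "inv\<^bsub>N\<^esub> q"] by blast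
        thus "x \<otimes> \<theta> q \<otimes> inv x \<in> H" using q by simp
      next
        fix g assume a: "\<forall>q\<in>carrier N. x \<otimes> \<theta> q \<otimes> inv x \<in> H" and g: "g \<in> carrier N"
        show "H #> x #> inv (\<theta> g) = H #> x" using i[OF g] a \<theta>.G.inv_closed[OF g] by blast
      qed
    qed
    thus ?thesis by (auto simp: RCOSETS_def)
  qed
  finally show ?thesis .
qed

text \<open>The index of a Sylow subgroup is prime to \<open>p\<close>, so the image of a
  \<open>p\<close>-group fixes some coset, and a representative of that coset conjugates the image
  into \<open>H\<close>.\<close>

lemma sylow_conj:
  fixes G :: "'a monoid" (structure)
  assumes "group G" and p: "prime (p::nat)" and fin: "finite (carrier G)"
    and N: "group N" "order N = p ^ n" and \<theta>: "\<theta> \<in> hom N G" and H: "sylow_subgroup p H G"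
  obtains g where "g \<in> carrier G" "\<And>q. q \<in> carrier N \<Longrightarrow> g \<otimes> \<theta> q \<otimes> inv g \<in> H"
proof -
  interpret group G by fact
  have H': "subgroup H G" "card H = p ^ multiplicity p (order G)"
    using H by (auto simp: sylow_subgroup_def)
  have eq: "card (rcosets H) * p ^ multiplicity p (order G) = order G"
    using lagrange[OF H'(1)] H'(2) by simp
  have o: "order G \<noteq> 0" using fin by (auto simp: order_def)
  have "\<not> p dvd card (rcosets H)"
  proof
    assume "p dvd card (rcosets H)"
    hence "p * p ^ multiplicity p (order G) dvd card (rcosets H) * p ^ multiplicity p (order G)"
      by (rule mult_dvd_mono) (rule dvd_refl)
    with eq have "p * p ^ multiplicity p (order G) dvd order G" by argo
    hence "p ^ Suc (multiplicity p (order G)) dvd order G" by (subst power_Suc)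
    moreover have "\<not> is_unit p" using p by (auto simp: prime_nat_iff)
    ultimately have "Suc (multiplicity p (order G)) \<le> multiplicity p (order G)"
      using o by (intro multiplicity_geI) auto
    thus False by simp
  qed
  hence ndvd: "\<not> p dvd card ((\<lambda>x. H #> x) ` {x \<in> carrier G. \<forall>q\<in>carrier N. x \<otimes> \<theta> q \<otimes> inv x \<in> H})"
    using cong_dvd_iff[OF rcos_fixed_cong[OF assms(1) p fin N \<theta> H'(1)]] by simp
  have "{x \<in> carrier G. \<forall>q\<in>carrier N. x \<otimes> \<theta> q \<otimes> inv x \<in> H} \<noteq> {}"
  proof
    assume e: "{x \<in> carrier G. \<forall>q\<in>carrier N. x \<otimes> \<theta> q \<otimes> inv x \<in> H} = {}"
    show False using ndvd unfolding e by simp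
  qed
  thus ?thesis using that by blast
qed

text \<open>\<open>P\<close> acts on its own cosets. Their number is a proper power of
  \<open>p\<close>, so the number of fixed ones is divisible by \<open>p\<close>, and the fixed
  cosets are those of elements that normalise \<open>P\<close>.\<close>

lemma normalizer_grows:
  fixes G :: "'a monoid" (structure)
  assumes "group G" and p: "prime (p::nat)" and ord: "order G = p ^ n"
    and P: "subgroup P G" "P \<noteq> carrier G"
  obtains g where "g \<in> carrier G" "g \<notin> P" "\<And>x. x \<in> P \<Longrightarrow> g \<otimes> x \<otimes> inv g \<in> P"
proof -
  interpret group G by fact
  interpret P: subgroup P G by fact
  have "p > 0" using p by (rule prime_gt_0_nat)
  hence "card (carrier G) > 0" using ord by (simp add: order_def)
  hence fin: "finite (carrier G)" by (simp add: card_gt_0_iff)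
  let ?F = "(\<lambda>x. P #> x) ` {x \<in> carrier G. \<forall>q\<in>P. x \<otimes> q \<otimes> inv x \<in> P}"
  have eq: "card (rcosets P) * card P = p ^ n" using lagrange[OF P(1)] ord by simp
  have "card P dvd p ^ n" unfolding eq[symmetric] by simp
  then obtain m where "card P = p ^ m" using divides_primepow_nat[OF p] by blast
  hence m: "order (G\<lparr>carrier := P\<rparr>) = p ^ m" by (simp add: order_def)
  have gP: "group (G\<lparr>carrier := P\<rparr>)" by (rule P.subgroup_is_group[OF is_group])
  have id: "(\<lambda>x. x) \<in> hom (G\<lparr>carrier := P\<rparr>) G" by (auto simp: hom_def)
  have "card (rcosets P) \<noteq> 1"
  proof
    assume "card (rcosets P) = 1"
    hence "card P = card (carrier G)" using eq ord by (simp add: order_def)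
    thus False using P fin card_subset_eq P.subset by blast
  qed
  moreover have "card (rcosets P) dvd p ^ n" unfolding eq[symmetric] by simp
  ultimately have "p dvd card (rcosets P)" using prime_power_divisor[OF p] by blast
  hence "p dvd card ?F"
    using cong_dvd_iff[OF rcos_fixed_cong[OF assms(1) p fin gP m id P(1)]] by simp
  \<comment> \<open>The trivial coset is fixed, so the number of fixed cosets is positive and a
    multiple of \<open>p\<close>; hence there is a second one.\<close>
  have one: "P #> \<one> \<in> ?F" using P.mem_carrier by auto
  have "card ?F \<noteq> 0" using one fin by auto
  hence "p \<le> card ?F" using \<open>p dvd card ?F\<close> by (intro dvd_imp_le) linarith+
  hence "card ?F > 1" using prime_gt_1_nat[OF p] by linarith
  hence "\<not> ?F \<subseteq> {P #> \<one>}" using card_mono[of "{P #> \<one>}" ?F] by auto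
  then obtain x where x: "x \<in> carrier G" "\<forall>q\<in>P. x \<otimes> q \<otimes> inv x \<in> P" "P #> x \<noteq> P #> \<one>"
    by blast
  have "x \<notin> P" using x(1,3) P(1) by (metis P.rcos_const P.subset coset_mult_one is_group)
  thus ?thesis using that x by blast
qed

section \<open>Bisets and their marks\<close>

locale fin_group = group G for G :: "'a monoid" (structure) +
  assumes fin: "finite (carrier G)"

locale lf_biset = G: fin_group G + H: fin_group H for G H :: "'a monoid" +
  fixes X :: "('a, 'x) biset"
  assumes flfb: "finite_left_free_biset G H X"
begin

lemma fin_points: "finite (points X)"
  using flfb by (simp add: finite_left_free_biset_def)

lemma
  shows lact_closed: "x \<in> points X \<Longrightarrow> h \<in> carrier H \<Longrightarrow> lact X h x \<in> points X"
    and ract_closed: "x \<in> points X \<Longrightarrow> g \<in> carrier G \<Longrightarrow> ract X x g \<in> points X"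
    and lact_one: "x \<in> points X \<Longrightarrow> lact X \<one>\<^bsub>H\<^esub> x = x"
    and ract_one: "x \<in> points X \<Longrightarrow> ract X x \<one>\<^bsub>G\<^esub> = x"
    and lact_mult: "x \<in> points X \<Longrightarrow> h \<in> carrier H \<Longrightarrow> h' \<in> carrier H \<Longrightarrow>
          lact X (h \<otimes>\<^bsub>H\<^esub> h') x = lact X h (lact X h' x)"
    and ract_mult: "x \<in> points X \<Longrightarrow> g \<in> carrier G \<Longrightarrow> g' \<in> carrier G \<Longrightarrow>
          ract X x (g \<otimes>\<^bsub>G\<^esub> g') = ract X (ract X x g) g'"
    and ract_lact: "x \<in> points X \<Longrightarrow> h \<in> carrier H \<Longrightarrow> g \<in> carrier G \<Longrightarrow>
          ract X (lact X h x) g = lact X h (ract X x g)"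
    and free: "x \<in> points X \<Longrightarrow> h \<in> carrier H \<Longrightarrow> lact X h x = x \<Longrightarrow> h = \<one>\<^bsub>H\<^esub>"
  using flfb unfolding finite_left_free_biset_def is_biset_def by blast+

lemma lact_inv:
  assumes "x \<in> points X" "h \<in> carrier H"
  shows "lact X (inv\<^bsub>H\<^esub> h) (lact X h x) = x" "lact X h (lact X (inv\<^bsub>H\<^esub> h) x) = x"
  using assms lact_mult[of x "inv\<^bsub>H\<^esub> h" h] lact_mult[of x h "inv\<^bsub>H\<^esub> h"]
  by (simp_all add: lact_one)

lemma ract_inv:
  assumes "x \<in> points X" "g \<in> carrier G"
  shows "ract X (ract X x g) (inv\<^bsub>G\<^esub> g) = x" "ract X (ract X x (inv\<^bsub>G\<^esub> g)) g = x"
  using assms ract_mult[of x "inv\<^bsub>G\<^esub> g" g] ract_mult[of x g "inv\<^bsub>G\<^esub> g"]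
  by (simp_all add: ract_one)

lemma lact_cancel:
  assumes "x \<in> points X" "h \<in> carrier H" "h' \<in> carrier H" "lact X h x = lact X h' x"
  shows "h = h'"
proof -
  have "lact X (inv\<^bsub>H\<^esub> h' \<otimes>\<^bsub>H\<^esub> h) x = x"
    using assms by (simp add: lact_mult lact_inv)
  hence "inv\<^bsub>H\<^esub> h' \<otimes>\<^bsub>H\<^esub> h = \<one>\<^bsub>H\<^esub>" using assms free by simp
  thus ?thesis using assms by (metis H.inv_equality H.inv_inv H.inv_closed)
qed

end

lemma lf_bisetI:
  assumes "fin_group G" "fin_group H" "finite_left_free_biset G H X"
  shows "lf_biset G H X"
  using assms by (simp add: lf_biset_def lf_biset_axioms_def)

text \<open>\<open>mark I a b X\<close> counts the points fixed by the twisted diagonal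
  \<open>{(b k, a k) | k \<in> I}\<close>; for \<open>I = P\<close>, \<open>a\<close> the inclusion and \<open>b = \<phi>\<close> this is the usual mark
  \<open>\<Phi>\<^bsub>P,\<phi>\<^esub>(X)\<close>.\<close>

definition mark :: "'k set \<Rightarrow> ('k \<Rightarrow> 'a) \<Rightarrow> ('k \<Rightarrow> 'a) \<Rightarrow> ('a, 'x) biset \<Rightarrow> nat" where
  "mark I a b X = card {x \<in> points X. \<forall>k\<in>I. lact X (b k) x = ract X x (a k)}"

lemma mark_cong:
  "(\<And>k. k \<in> I \<Longrightarrow> a k = a' k) \<Longrightarrow> (\<And>k. k \<in> I \<Longrightarrow> b k = b' k) \<Longrightarrow> mark I a b X = mark I a' b' X"
  by (simp add: mark_def cong: conj_cong)

context lf_biset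
begin

text \<open>Left translation by \<open>h\<close> carries the points fixed by one twisted diagonal to
  those fixed by its conjugate.\<close>

lemma mark_left_conj:
  assumes "b \<in> I \<rightarrow> carrier H" "a \<in> I \<rightarrow> carrier G" "h \<in> carrier H"
  shows "mark I a (\<lambda>k. h \<otimes>\<^bsub>H\<^esub> b k \<otimes>\<^bsub>H\<^esub> inv\<^bsub>H\<^esub> h) X = mark I a b X"
proof -
  have "bij_betw (lact X h) {x \<in> points X. \<forall>k\<in>I. lact X (b k) x = ract X x (a k)}
      {x \<in> points X. \<forall>k\<in>I. lact X (h \<otimes>\<^bsub>H\<^esub> b k \<otimes>\<^bsub>H\<^esub> inv\<^bsub>H\<^esub> h) x = ract X x (a k)}"
  proof (rule bij_betw_byWitness[where f' = "lact X (inv\<^bsub>H\<^esub> h)"], goal_cases)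
    case 3 thus ?case using assms
      by (auto simp: lact_closed lact_mult lact_inv ract_lact Pi_iff)
  next
    case 4 show ?case
    proof (intro subsetI)
      fix y assume "y \<in> lact X (inv\<^bsub>H\<^esub> h) ` {x \<in> points X. \<forall>k\<in>I.
        lact X (h \<otimes>\<^bsub>H\<^esub> b k \<otimes>\<^bsub>H\<^esub> inv\<^bsub>H\<^esub> h) x = ract X x (a k)}"
      then obtain x where x: "x \<in> points X" "y = lact X (inv\<^bsub>H\<^esub> h) x"
        "\<And>k. k \<in> I \<Longrightarrow> lact X (h \<otimes>\<^bsub>H\<^esub> b k \<otimes>\<^bsub>H\<^esub> inv\<^bsub>H\<^esub> h) x = ract X x (a k)" by blast
      have "lact X (b k) y = ract X y (a k)" if "k \<in> I" for k
      proof -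
        have k: "b k \<in> carrier H" "a k \<in> carrier G" using that assms by auto
        have "lact X (b k) y =
            lact X (inv\<^bsub>H\<^esub> h) (lact X (h \<otimes>\<^bsub>H\<^esub> b k \<otimes>\<^bsub>H\<^esub> inv\<^bsub>H\<^esub> h) x)"
          using x(1,2) k assms(3) by (simp add: lact_closed lact_mult lact_inv)
        thus ?thesis using x k that assms(3) by (simp add: ract_lact)
      qed
      thus "y \<in> {x \<in> points X. \<forall>k\<in>I. lact X (b k) x = ract X x (a k)}"
        using x assms by (simp add: lact_closed)
    qed
  qed (use assms in \<open>auto simp: lact_inv\<close>)
  thus ?thesis unfolding mark_def by (simp add: bij_betw_same_card)
qed

text \<open>Right translation by \<open>g\<close> gives the bijection, from the points for the
  conjugated \<open>a\<close> to those for \<open>a\<close>.\<close>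

lemma mark_right_conj:
  assumes "b \<in> I \<rightarrow> carrier H" "a \<in> I \<rightarrow> carrier G" "g \<in> carrier G"
  shows "mark I (\<lambda>k. g \<otimes>\<^bsub>G\<^esub> a k \<otimes>\<^bsub>G\<^esub> inv\<^bsub>G\<^esub> g) b X = mark I a b X"
proof -
  have "bij_betw (\<lambda>x. ract X x g)
      {x \<in> points X. \<forall>k\<in>I. lact X (b k) x = ract X x (g \<otimes>\<^bsub>G\<^esub> a k \<otimes>\<^bsub>G\<^esub> inv\<^bsub>G\<^esub> g)}
      {x \<in> points X. \<forall>k\<in>I. lact X (b k) x = ract X x (a k)}"
  proof (rule bij_betw_byWitness[where f' = "\<lambda>x. ract X x (inv\<^bsub>G\<^esub> g)"], goal_cases)
    case 3 show ?case
    proof (intro subsetI)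
      fix y assume "y \<in> (\<lambda>x. ract X x g) ` {x \<in> points X. \<forall>k\<in>I.
        lact X (b k) x = ract X x (g \<otimes>\<^bsub>G\<^esub> a k \<otimes>\<^bsub>G\<^esub> inv\<^bsub>G\<^esub> g)}"
      then obtain x where x: "x \<in> points X" "y = ract X x g"
        "\<And>k. k \<in> I \<Longrightarrow> lact X (b k) x = ract X x (g \<otimes>\<^bsub>G\<^esub> a k \<otimes>\<^bsub>G\<^esub> inv\<^bsub>G\<^esub> g)" by blast
      have "lact X (b k) y = ract X y (a k)" if "k \<in> I" for k
      proof -
        have k: "b k \<in> carrier H" "a k \<in> carrier G" using that assms by auto
        have "lact X (b k) y = ract X (ract X x (g \<otimes>\<^bsub>G\<^esub> a k \<otimes>\<^bsub>G\<^esub> inv\<^bsub>G\<^esub> g)) g"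
          using x k assms(3) that by (simp flip: ract_lact)
        also have "\<dots> = ract X y (a k)"
          using x(1,2) k assms(3) by (simp add: ract_closed ract_mult ract_inv)
        finally show ?thesis .
      qed
      thus "y \<in> {x \<in> points X. \<forall>k\<in>I. lact X (b k) x = ract X x (a k)}"
        using x assms by (simp add: ract_closed)
    qed
  next
    case 4 thus ?case using assms
      by (auto simp: ract_closed ract_mult ract_inv Pi_iff simp flip: ract_lact)
  qed (use assms in \<open>auto simp: ract_inv\<close>)
  thus ?thesis unfolding mark_def by (simp add: bij_betw_same_card)
qed

end

subsection \<open>Isomorphism and disjoint union\<close>

lemma biset_iso_sym:
  assumes "biset_iso G H X Y" "is_biset G H X"
  shows "biset_iso G H Y X"
proof -
  obtain f where f: "bij_betw f (points X) (points Y)"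
    "\<And>x h. x \<in> points X \<Longrightarrow> h \<in> carrier H \<Longrightarrow> f (lact X h x) = lact Y h (f x)"
    "\<And>x g. x \<in> points X \<Longrightarrow> g \<in> carrier G \<Longrightarrow> f (ract X x g) = ract Y (f x) g"
    using assms(1) unfolding biset_iso_def by blast
  let ?g = "inv_into (points X) f"
  have g: "?g y \<in> points X" "f (?g y) = y" if "y \<in> points Y" for y
    using that f(1) by (auto simp: bij_betw_def inv_into_into f_inv_into_f)
  have gf: "?g (f x) = x" if "x \<in> points X" for x
    using that f(1) by (auto simp: bij_betw_def)
  have "?g (lact Y h y) = lact X h (?g y)" if "y \<in> points Y" "h \<in> carrier H" for y h
    using that g[OF that(1)] f(2)[of "?g y" h] gf[of "lact X h (?g y)"] assms(2)
    by (simp add: is_biset_def)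
  moreover have "?g (ract Y y k) = ract X (?g y) k" if "y \<in> points Y" "k \<in> carrier G" for y k
    using that g[OF that(1)] f(3)[of "?g y" k] gf[of "ract X (?g y) k"] assms(2)
    by (simp add: is_biset_def)
  ultimately show ?thesis
    unfolding biset_iso_def using bij_betw_inv_into[OF f(1)] by blast
qed

lemma biset_iso_trans:
  assumes "biset_iso G H X Y" "biset_iso G H Y Z"
  shows "biset_iso G H X Z"
proof -
  obtain f where f: "bij_betw f (points X) (points Y)"
    "\<And>x h. x \<in> points X \<Longrightarrow> h \<in> carrier H \<Longrightarrow> f (lact X h x) = lact Y h (f x)"
    "\<And>x g. x \<in> points X \<Longrightarrow> g \<in> carrier G \<Longrightarrow> f (ract X x g) = ract Y (f x) g"
    using assms(1) unfolding biset_iso_def by blast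
  obtain f' where f': "bij_betw f' (points Y) (points Z)"
    "\<And>x h. x \<in> points Y \<Longrightarrow> h \<in> carrier H \<Longrightarrow> f' (lact Y h x) = lact Z h (f' x)"
    "\<And>x g. x \<in> points Y \<Longrightarrow> g \<in> carrier G \<Longrightarrow> f' (ract Y x g) = ract Z (f' x) g"
    using assms(2) unfolding biset_iso_def by blast
  have "f x \<in> points Y" if "x \<in> points X" for x using that f(1) by (auto simp: bij_betw_def)
  thus ?thesis
    unfolding biset_iso_def using bij_betw_trans[OF f(1) f'(1)] f f'
    by (intro exI[of _ "f' \<circ> f"]) simp
qed

text \<open>Transport of structure along an injection. It moves any finite biset to one with points
  in \<open>nat\<close>, the point type of the members of a \<open>biset_class\<close>.\<close>

lemma biset_transport:
  assumes "finite_left_free_biset G H X" "inj_on f (points X)" "finite (points X)"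
  defines "Y \<equiv> \<lparr>points = f ` points X, lact = (\<lambda>h y. f (lact X h (inv_into (points X) f y))),
      ract = (\<lambda>y g. f (ract X (inv_into (points X) f y) g))\<rparr>"
  shows "finite_left_free_biset G H Y" "biset_iso G H X Y"
proof -
  have B: "is_biset G H X" "\<forall>x\<in>points X. \<forall>h\<in>carrier H. lact X h x = x \<longrightarrow> h = \<one>\<^bsub>H\<^esub>"
    using assms(1) by (auto simp: finite_left_free_biset_def)
  have [simp]: "inv_into (points X) f (f x) = x" if "x \<in> points X" for x
    using that assms(2) by simp
  have [simp]: "f x = f y \<longleftrightarrow> x = y" if "x \<in> points X" "y \<in> points X" for x y
    using that assms(2) by (auto dest: inj_onD)
  have "is_biset G H Y" using B(1) unfolding is_biset_def Y_def by auto
  moreover have "\<forall>y\<in>points Y. \<forall>h\<in>carrier H. lact Y h y = y \<longrightarrow> h = \<one>\<^bsub>H\<^esub>"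
    using B unfolding is_biset_def Y_def by auto
  ultimately show "finite_left_free_biset G H Y"
    using assms(3) by (simp add: finite_left_free_biset_def Y_def)
  show "biset_iso G H X Y"
    unfolding biset_iso_def using assms(2) B
    by (intro exI[of _ f]) (auto simp: Y_def bij_betw_def)
qed

lemma ex_nat_biset:
  assumes "finite_left_free_biset G H X"
  obtains Y :: "('a, nat) biset" where "finite_left_free_biset G H Y" "biset_iso G H X Y"
proof -
  have fin: "finite (points X)" using assms by (simp add: finite_left_free_biset_def)
  then obtain f :: "_ \<Rightarrow> nat" where "inj_on f (points X)" using finite_imp_inj_to_nat_seg by blast
  thus ?thesis using biset_transport[OF assms _ fin] that by blast
qed

lemma mark_iso:
  assumes "biset_iso G H X Y" "a \<in> I \<rightarrow> carrier G" "b \<in> I \<rightarrow> carrier H" "is_biset G H X"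
  shows "mark I a b X = mark I a b Y"
proof -
  obtain f where f: "bij_betw f (points X) (points Y)"
    "\<And>x h. x \<in> points X \<Longrightarrow> h \<in> carrier H \<Longrightarrow> f (lact X h x) = lact Y h (f x)"
    "\<And>x g. x \<in> points X \<Longrightarrow> g \<in> carrier G \<Longrightarrow> f (ract X x g) = ract Y (f x) g"
    using assms(1) unfolding biset_iso_def by blast
  have inj: "f x = f y \<longleftrightarrow> x = y" if "x \<in> points X" "y \<in> points X" for x y
    using f(1) that by (auto simp: bij_betw_def inj_on_def)
  have iff: "lact X (b k) x = ract X x (a k) \<longleftrightarrow> lact Y (b k) (f x) = ract Y (f x) (a k)"
    if "k \<in> I" "x \<in> points X" for k x
  proof -
    have k: "a k \<in> carrier G" "b k \<in> carrier H" using that assms by auto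
    hence "lact X (b k) x \<in> points X" "ract X x (a k) \<in> points X"
      using assms(4) that by (auto simp: is_biset_def)
    thus ?thesis using inj f(2)[OF that(2) k(2)] f(3)[OF that(2) k(1)] by metis
  qed
  have "bij_betw f {x \<in> points X. \<forall>k\<in>I. lact X (b k) x = ract X x (a k)}
      {x \<in> points Y. \<forall>k\<in>I. lact Y (b k) x = ract Y x (a k)}"
    unfolding bij_betw_def
  proof
    show "inj_on f {x \<in> points X. \<forall>k\<in>I. lact X (b k) x = ract X x (a k)}"
      using inj by (auto simp: inj_on_def)
    have "points Y = f ` points X" using f(1) by (simp add: bij_betw_def)
    thus "f ` {x \<in> points X. \<forall>k\<in>I. lact X (b k) x = ract X x (a k)} =
        {x \<in> points Y. \<forall>k\<in>I. lact Y (b k) x = ract Y x (a k)}"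
      using iff by auto
  qed
  thus ?thesis unfolding mark_def by (rule bij_betw_same_card)
qed

lemma biset_sum_flfb:
  assumes "finite_left_free_biset G H X" "finite_left_free_biset G H Y"
  shows "finite_left_free_biset G H (biset_sum X Y)"
  using assms unfolding finite_left_free_biset_def is_biset_def biset_sum_def by auto

lemma mark_sum:
  assumes "finite (points X)" "finite (points Y)"
  shows "mark I a b (biset_sum X Y) = mark I a b X + mark I a b Y"
proof -
  have "{z \<in> points (biset_sum X Y). \<forall>k\<in>I. lact (biset_sum X Y) (b k) z = ract (biset_sum X Y) z (a k)}
    = {x \<in> points X. \<forall>k\<in>I. lact X (b k) x = ract X x (a k)} <+>
      {y \<in> points Y. \<forall>k\<in>I. lact Y (b k) y = ract Y y (a k)}"
    by (auto simp: biset_sum_def)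
  thus ?thesis using assms by (simp add: mark_def card_Plus)
qed

lemma biset_sum_iso:
  assumes "A \<inter> B = {}" "A \<union> B = points X"
  shows "biset_iso G H (biset_sum (X\<lparr>points := A\<rparr>) (X\<lparr>points := B\<rparr>)) X"
proof -
  have "case_sum id id ` (A <+> B) = points X"
    unfolding Plus_def using assms(2) by (simp add: image_Un image_image)
  moreover have "inj_on (case_sum id id) (A <+> B)"
    using assms(1) by (auto simp: inj_on_def)
  ultimately show ?thesis
    unfolding biset_iso_def
    by (intro exI[of _ "case_sum id id"]) (auto simp: biset_sum_def bij_betw_def)
qed

subsection \<open>Quotients by free actions\<close>

text \<open>Marks of a quotient biset are counted upstairs, on pairs, where the fixing condition is
  an explicit equation. All classes having the same size \<open>n\<close>, the count upstairs is
  \<open>n\<close> times the mark.\<close>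

lemma quotient_count:
  assumes e: "equiv A r" and fin: "finite A" and n: "\<And>x. x \<in> A \<Longrightarrow> card (r `` {x}) = n"
    and Q: "\<And>x. x \<in> A \<Longrightarrow> Q x \<longleftrightarrow> Q' (r `` {x})"
  shows "card {x \<in> A. Q x} = n * card {C \<in> A // r. Q' C}"
proof -
  have eq: "{x \<in> A. Q x} = \<Union> {C \<in> A // r. Q' C}"
  proof (rule Set.set_eqI)
    fix x
    have "x \<in> \<Union> {C \<in> A // r. Q' C} \<longleftrightarrow> x \<in> A \<and> Q' (r `` {x})"
    proof
      assume "x \<in> \<Union> {C \<in> A // r. Q' C}"
      then obtain y where y: "y \<in> A" "Q' (r `` {y})" "(y, x) \<in> r" unfolding quotient_def by blast
      moreover have "x \<in> A" using e y(3) by (auto simp: equiv_def)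
      ultimately show "x \<in> A \<and> Q' (r `` {x})" using equiv_class_eq[OF e y(3)] by simp
    next
      assume x: "x \<in> A \<and> Q' (r `` {x})"
      have "x \<in> r `` {x}" using equiv_class_self[OF e] x by simp
      moreover have "r `` {x} \<in> A // r" using x by (simp add: quotientI)
      ultimately show "x \<in> \<Union> {C \<in> A // r. Q' C}" using x by blast
    qed
    thus "x \<in> {x \<in> A. Q x} \<longleftrightarrow> x \<in> \<Union> {C \<in> A // r. Q' C}" using Q by auto
  qed
  have "card {x \<in> A. Q x} = (\<Sum>C\<in>{C \<in> A // r. Q' C}. card C)"
    unfolding eq
  proof (rule card_Union_disjoint)
    show "pairwise disjnt {C \<in> A // r. Q' C}"
      using quotient_disj[OF e] by (fastforce simp: pairwise_def disjnt_def)
    show "finite C" if "C \<in> {C \<in> A // r. Q' C}" for C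
      using that e by (intro finite_equiv_class[OF fin, of r]) (simp_all add: equiv_def)
  qed
  also have "\<dots> = (\<Sum>C\<in>{C \<in> A // r. Q' C}. n)"
    by (rule sum.cong) (auto simp: quotient_def n)
  finally show ?thesis by simp
qed

text \<open>Balanced products and the transitive bisets are both orbit sets of free actions.
  Freeness makes every orbit a copy of \<open>L\<close>, which supplies the constant class size that
  \<open>quotient_count\<close> asks for.\<close>

lemma free_action_equiv:
  assumes "group L"
    and closed: "\<And>k z. k \<in> carrier L \<Longrightarrow> z \<in> E \<Longrightarrow> act k z \<in> E"
    and one: "\<And>z. z \<in> E \<Longrightarrow> act \<one>\<^bsub>L\<^esub> z = z"
    and mult: "\<And>k l z. k \<in> carrier L \<Longrightarrow> l \<in> carrier L \<Longrightarrow> z \<in> E \<Longrightarrow>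
           act (k \<otimes>\<^bsub>L\<^esub> l) z = act k (act l z)"
    and free: "\<And>k z. k \<in> carrier L \<Longrightarrow> z \<in> E \<Longrightarrow> act k z = z \<Longrightarrow> k = \<one>\<^bsub>L\<^esub>"
    and r: "r = {(z, act k z) | z k. z \<in> E \<and> k \<in> carrier L}"
  shows "equiv E r" "\<And>z. z \<in> E \<Longrightarrow> r `` {z} = (\<lambda>k. act k z) ` carrier L"
    "\<And>z. z \<in> E \<Longrightarrow> card (r `` {z}) = card (carrier L)"
proof -
  interpret group L by fact
  have inv: "act (inv\<^bsub>L\<^esub> k) (act k z) = z" if "k \<in> carrier L" "z \<in> E" for k z
    using that mult[of "inv\<^bsub>L\<^esub> k" k z] one by simp
  show "equiv E r"
  proof (rule equivI)
    show "r \<subseteq> E \<times> E" using closed r by auto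
    show "refl_on E r"
      by (rule refl_onI) (use one r one_closed in \<open>force\<close>)
    show "sym r"
    proof (rule symI)
      fix y z assume "(y, z) \<in> r"
      then obtain k where "k \<in> carrier L" "y \<in> E" "z = act k y" using r by auto
      thus "(z, y) \<in> r" using inv closed r inv_closed by (auto intro!: exI[of _ "inv\<^bsub>L\<^esub> k"])
    qed
    show "trans r"
    proof (rule transI)
      fix x y z assume "(x, y) \<in> r" "(y, z) \<in> r"
      then obtain k l where "x \<in> E" "k \<in> carrier L" "l \<in> carrier L" "y = act k x" "z = act l y"
        using r by auto
      thus "(x, z) \<in> r" using mult r by (auto intro!: exI[of _ "l \<otimes>\<^bsub>L\<^esub> k"])
    qed
  qed
  show cls: "r `` {z} = (\<lambda>k. act k z) ` carrier L" if "z \<in> E" for z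
    using that r by auto
  have "inj_on (\<lambda>k. act k z) (carrier L)" if "z \<in> E" for z
  proof (rule inj_onI)
    fix k l assume kl: "k \<in> carrier L" "l \<in> carrier L" "act k z = act l z"
    hence "act (inv\<^bsub>L\<^esub> l \<otimes>\<^bsub>L\<^esub> k) z = z" using that mult inv by simp
    hence "inv\<^bsub>L\<^esub> l \<otimes>\<^bsub>L\<^esub> k = \<one>\<^bsub>L\<^esub>" using free that kl by simp
    thus "k = l" using kl by (metis inv_equality inv_inv inv_closed)
  qed
  thus "card (r `` {z}) = card (carrier L)" if "z \<in> E" for z
    using that by (simp add: cls card_image)
qed

subsection \<open>Composition\<close>

locale biset_pair = X: lf_biset H K X + Y: lf_biset G H Y
  for G H K :: "'a monoid" and X :: "('a, 'x) biset" and Y :: "('a, 'y) biset"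
begin

definition rel where
  "rel = {((ract X x h, y), (x, lact Y h y)) | x h y.
            x \<in> points X \<and> h \<in> carrier H \<and> y \<in> points Y}"

definition cls where "cls x y = rel `` {(x, y)}"

text \<open>The balancing relation is the orbit relation of \<open>H\<close> acting by (x, y) -> (x
  h^-1, h y), the form in which \<open>free_action_equiv\<close> applies.\<close>

lemma rel_eq:
  "rel = {(z, (ract X (fst z) (inv\<^bsub>H\<^esub> h), lact Y h (snd z))) | z h.
     z \<in> points X \<times> points Y \<and> h \<in> carrier H}" (is "_ = ?R")
proof
  show "rel \<subseteq> ?R"
  proof
    fix w assume "w \<in> rel"
    then obtain x h y where w: "w = ((ract X x h, y), (x, lact Y h y))"
      "x \<in> points X" "h \<in> carrier H" "y \<in> points Y" by (auto simp: rel_def)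
    thus "w \<in> ?R" using X.ract_closed X.ract_inv
      by (auto intro!: exI[of _ "ract X x h"] exI[of _ h])
  qed
  show "?R \<subseteq> rel"
  proof
    fix w assume "w \<in> ?R"
    then obtain x h y where w: "w = ((x, y), (ract X x (inv\<^bsub>H\<^esub> h), lact Y h y))"
      "x \<in> points X" "h \<in> carrier H" "y \<in> points Y" by auto
    thus "w \<in> rel" unfolding rel_def using X.ract_closed[of x "inv\<^bsub>H\<^esub> h"] X.ract_inv
      by (auto intro!: exI[of _ "ract X x (inv\<^bsub>H\<^esub> h)"] exI[of _ h])
  qed
qed

lemma
  shows equiv_rel: "equiv (points X \<times> points Y) rel"
    and cls_eq: "x \<in> points X \<Longrightarrow> y \<in> points Y \<Longrightarrow>
          cls x y = (\<lambda>h. (ract X x (inv\<^bsub>H\<^esub> h), lact Y h y)) ` carrier H"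
    and card_cls: "x \<in> points X \<Longrightarrow> y \<in> points Y \<Longrightarrow> card (cls x y) = card (carrier H)"
proof -
  define act where "act = (\<lambda>h z. (ract X (fst z) (inv\<^bsub>H\<^esub> h), lact Y h (snd z)))"
  have 1: "group H" by (rule X.G.group_axioms)
  have 2: "act k z \<in> points X \<times> points Y" if "k \<in> carrier H" "z \<in> points X \<times> points Y" for k z
    using that by (auto simp: act_def X.ract_closed Y.lact_closed)
  have 3: "act \<one>\<^bsub>H\<^esub> z = z" if "z \<in> points X \<times> points Y" for z
    using that by (auto simp: act_def X.ract_one Y.lact_one)
  have 4: "act (k \<otimes>\<^bsub>H\<^esub> l) z = act k (act l z)"
    if "k \<in> carrier H" "l \<in> carrier H" "z \<in> points X \<times> points Y" for k l z
    using that by (auto simp: act_def X.ract_mult Y.lact_mult X.G.inv_mult_group)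
  \<comment> \<open>The action on pairs is free already in the second coordinate, where it is the
    left action on \<open>Y\<close>.\<close>
  have 5: "k = \<one>\<^bsub>H\<^esub>" if "k \<in> carrier H" "z \<in> points X \<times> points Y" "act k z = z" for k z
    using that Y.free by (auto simp: act_def prod_eq_iff)
  have 6: "rel = {(z, act k z) | z k. z \<in> points X \<times> points Y \<and> k \<in> carrier H}"
    unfolding act_def by (rule rel_eq)
  note * = free_action_equiv[where act = act, OF 1 2 3 4 5 6]
  show "equiv (points X \<times> points Y) rel" by (rule *(1))
  show "cls x y = (\<lambda>h. (ract X x (inv\<^bsub>H\<^esub> h), lact Y h y)) ` carrier H"
    if "x \<in> points X" "y \<in> points Y"
    using *(2)[where z = "(x, y)"] that by (simp add: act_def cls_def)
  show "card (cls x y) = card (carrier H)" if "x \<in> points X" "y \<in> points Y"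
    using *(3)[where z = "(x, y)"] that by (simp add: cls_def)
qed

lemma cls_eq_iff:
  assumes "x \<in> points X" "y \<in> points Y" "x' \<in> points X" "y' \<in> points Y"
  shows "cls x y = cls x' y' \<longleftrightarrow> (\<exists>h\<in>carrier H. x = ract X x' h \<and> y' = lact Y h y)"
proof -
  have "cls x y = cls x' y' \<longleftrightarrow> ((x, y), (x', y')) \<in> rel"
    unfolding cls_def using eq_equiv_class_iff[OF equiv_rel] assms by simp
  thus ?thesis using assms by (auto simp: rel_def)
qed

lemma points_comp: "points (biset_comp H X Y) = {cls x y | x y. x \<in> points X \<and> y \<in> points Y}"
  unfolding biset_comp_def rel_def[symmetric] cls_def by (auto simp: quotient_def)

lemma cls_in_points: "x \<in> points X \<Longrightarrow> y \<in> points Y \<Longrightarrow> cls x y \<in> points (biset_comp H X Y)"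
  unfolding points_comp by blast

lemma lact_comp:
  assumes "x \<in> points X" "y \<in> points Y" "k \<in> carrier K"
  shows "lact (biset_comp H X Y) k (cls x y) = cls (lact X k x) y"
  using assms by (simp add: biset_comp_def cls_eq X.lact_closed image_image X.ract_lact)

lemma ract_comp:
  assumes "x \<in> points X" "y \<in> points Y" "g \<in> carrier G"
  shows "ract (biset_comp H X Y) (cls x y) g = cls x (ract Y y g)"
  using assms by (simp add: biset_comp_def cls_eq Y.ract_closed image_image Y.ract_lact)

text \<open>If \<open>k\<close> fixes the class of (x, y), then k x = x h and h y = y for some
  \<open>h\<close>; freeness of \<open>Y\<close> gives h = 1, and then freeness of \<open>X\<close>
  gives k = 1.\<close>

lemma biset_comp_flfb: "finite_left_free_biset G K (biset_comp H X Y)"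
  unfolding finite_left_free_biset_def
proof (intro conjI ballI impI)
  show "is_biset G K (biset_comp H X Y)"
    unfolding is_biset_def
  proof (rule ballI, goal_cases)
    case (1 z)
    then obtain x y where xy: "x \<in> points X" "y \<in> points Y" and z: "z = cls x y"
      by (auto simp: points_comp)
    show ?case unfolding z using xy
      by (intro conjI ballI) (simp_all add: cls_in_points lact_comp ract_comp X.lact_closed Y.ract_closed
        X.lact_one Y.ract_one X.lact_mult Y.ract_mult)
  qed
  have "points (biset_comp H X Y) = (\<lambda>(x, y). cls x y) ` (points X \<times> points Y)"
    by (auto simp: points_comp)
  thus "finite (points (biset_comp H X Y))" using X.fin_points Y.fin_points by simp
next
  fix z k assume "z \<in> points (biset_comp H X Y)" and k: "k \<in> carrier K"
    and fx: "lact (biset_comp H X Y) k z = z"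
  then obtain x y where xy: "x \<in> points X" "y \<in> points Y" "z = cls x y" by (auto simp: points_comp)
  hence "cls (lact X k x) y = cls x y" using fx k by (simp add: lact_comp)
  then obtain h where h: "h \<in> carrier H" "lact X k x = ract X x h" "lact Y h y = y"
    using xy k by (auto simp: cls_eq_iff X.lact_closed)
  hence "h = \<one>\<^bsub>H\<^esub>" using Y.free xy by blast
  thus "k = \<one>\<^bsub>K\<^esub>" using X.free xy k h by (simp add: X.ract_one)
qed

text \<open>The class of (x, y) is fixed at \<open>k\<close> exactly when some \<open>h\<close>
  satisfies b(k) x = x h and h y = y a(k). Left freeness of \<open>Y\<close> makes this
  \<open>h\<close> unique, so the fixed pairs split according to the function k -> h, called
  \<theta>. It ranges over all functions from \<open>I\<close> to \<open>H\<close>; no homomorphism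
  condition is imposed.\<close>

lemma mark_comp:
  assumes fI: "finite I" and a: "a \<in> I \<rightarrow> carrier G" and b: "b \<in> I \<rightarrow> carrier K"
  shows "card (carrier H) * mark I a b (biset_comp H X Y) =
    (\<Sum>\<theta>\<in>I \<rightarrow>\<^sub>E carrier H. mark I \<theta> b X * mark I a \<theta> Y)"
proof -
  let ?E = "points X \<times> points Y"
  let ?Q = "\<lambda>z. \<forall>k\<in>I. cls (lact X (b k) (fst z)) (snd z) = cls (fst z) (ract Y (snd z) (a k))"
  let ?Q' = "\<lambda>C. \<forall>k\<in>I. lact (biset_comp H X Y) (b k) C = ract (biset_comp H X Y) C (a k)"
  let ?A = "\<lambda>\<theta>. {x \<in> points X. \<forall>k\<in>I. lact X (b k) x = ract X x (\<theta> k)}"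
  let ?B = "\<lambda>\<theta>. {y \<in> points Y. \<forall>k\<in>I. lact Y (\<theta> k) y = ract Y y (a k)}"
  have "card {z \<in> ?E. ?Q z} = card (carrier H) * card {C \<in> ?E // rel. ?Q' C}"
  proof (rule quotient_count[OF equiv_rel])
    show "finite ?E" using X.fin_points Y.fin_points by simp
    show "card (rel `` {z}) = card (carrier H)" if "z \<in> ?E" for z
      using that card_cls by (auto simp: cls_def)
    fix z assume z: "z \<in> ?E"
    hence "rel `` {z} = cls (fst z) (snd z)" by (simp add: cls_def)
    moreover have "fst z \<in> points X" "snd z \<in> points Y" using z by auto
    moreover have "a k \<in> carrier G" "b k \<in> carrier K" if "k \<in> I" for k using that a b by auto
    ultimately show "?Q z \<longleftrightarrow> ?Q' (rel `` {z})" by (simp add: lact_comp ract_comp)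
  qed
  hence "card (carrier H) * mark I a b (biset_comp H X Y) = card {z \<in> ?E. ?Q z}"
    by (simp add: mark_def) (simp add: biset_comp_def rel_def)
  also have "{z \<in> ?E. ?Q z} = (\<Union>\<theta>\<in>I \<rightarrow>\<^sub>E carrier H. ?A \<theta> \<times> ?B \<theta>)"
  proof (intro equalityI subsetI)
    fix z assume "z \<in> {z \<in> ?E. ?Q z}"
    then obtain x y where z: "z = (x, y)" "x \<in> points X" "y \<in> points Y"
      "\<forall>k\<in>I. cls (lact X (b k) x) y = cls x (ract Y y (a k))" by auto
    have "\<exists>h\<in>carrier H. lact X (b k) x = ract X x h \<and> lact Y h y = ract Y y (a k)" if "k \<in> I" for k
    proof -
      have "a k \<in> carrier G" "b k \<in> carrier K" using that a b by auto
      hence "lact X (b k) x \<in> points X" "ract Y y (a k) \<in> points Y"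
        using z by (auto simp: X.lact_closed Y.ract_closed)
      thus ?thesis using z that cls_eq_iff[of "lact X (b k) x" y x "ract Y y (a k)"] by auto
    qed
    then obtain \<theta> where \<theta>: "\<And>k. k \<in> I \<Longrightarrow> \<theta> k \<in> carrier H \<and> lact X (b k) x = ract X x (\<theta> k) \<and>
       lact Y (\<theta> k) y = ract Y y (a k)" by metis
    hence "restrict \<theta> I \<in> I \<rightarrow>\<^sub>E carrier H" "z \<in> ?A (restrict \<theta> I) \<times> ?B (restrict \<theta> I)"
      using z by auto
    thus "z \<in> (\<Union>\<theta>\<in>I \<rightarrow>\<^sub>E carrier H. ?A \<theta> \<times> ?B \<theta>)" by blast
  next
    fix z assume "z \<in> (\<Union>\<theta>\<in>I \<rightarrow>\<^sub>E carrier H. ?A \<theta> \<times> ?B \<theta>)"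
    then obtain \<theta> x y where z: "z = (x, y)" "x \<in> points X" "y \<in> points Y" "\<theta> \<in> I \<rightarrow>\<^sub>E carrier H"
      "\<forall>k\<in>I. lact X (b k) x = ract X x (\<theta> k)" "\<forall>k\<in>I. lact Y (\<theta> k) y = ract Y y (a k)" by auto
    have "cls (lact X (b k) x) y = cls x (ract Y y (a k))" if "k \<in> I" for k
    proof -
      have "a k \<in> carrier G" "b k \<in> carrier K" "\<theta> k \<in> carrier H" using that a b z by auto
      moreover from this have "lact X (b k) x \<in> points X" "ract Y y (a k) \<in> points Y"
        using z by (auto simp: X.lact_closed Y.ract_closed)
      ultimately show ?thesis using z that
        by (subst cls_eq_iff) (auto intro!: bexI[of _ "\<theta> k"])
    qed
    thus "z \<in> {z \<in> ?E. ?Q z}" using z by simp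
  qed
  also have "card \<dots> = (\<Sum>\<theta>\<in>I \<rightarrow>\<^sub>E carrier H. card (?A \<theta> \<times> ?B \<theta>))"
  proof (rule card_UN_disjoint)
    show "finite (I \<rightarrow>\<^sub>E carrier H)" using fI X.G.fin by (simp add: finite_PiE)
    show "\<forall>\<theta>\<in>I \<rightarrow>\<^sub>E carrier H. finite (?A \<theta> \<times> ?B \<theta>)" using X.fin_points Y.fin_points by simp
    show "\<forall>\<theta>\<in>I \<rightarrow>\<^sub>E carrier H. \<forall>\<theta>'\<in>I \<rightarrow>\<^sub>E carrier H.
        \<theta> \<noteq> \<theta>' \<longrightarrow> (?A \<theta> \<times> ?B \<theta>) \<inter> (?A \<theta>' \<times> ?B \<theta>') = {}"
    proof (intro ballI impI)
      fix \<theta> \<theta>' assume t: "\<theta> \<in> I \<rightarrow>\<^sub>E carrier H" "\<theta>' \<in> I \<rightarrow>\<^sub>E carrier H" "\<theta> \<noteq> \<theta>'"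
      have "\<theta> = \<theta>'" if "y \<in> ?B \<theta>" "y \<in> ?B \<theta>'" for y
      proof (rule PiE_ext[OF t(1,2)])
        fix k assume k: "k \<in> I"
        show "\<theta> k = \<theta>' k"
          by (rule Y.lact_cancel[of y]) (use that k t in \<open>auto simp: PiE_mem\<close>)
      qed
      thus "(?A \<theta> \<times> ?B \<theta>) \<inter> (?A \<theta>' \<times> ?B \<theta>') = {}" using t(3) by blast
    qed
  qed
  finally show ?thesis by (simp add: card_cartesian_product mark_def)
qed

end

lemma biset_comp_iso:
  assumes "biset_pair G H K X Y" "biset_pair G H K X' Y'"
    "biset_iso H K X X'" "biset_iso G H Y Y'"
  shows "biset_iso G K (biset_comp H X Y) (biset_comp H X' Y')"
proof -
  interpret P: biset_pair G H K X Y by fact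
  interpret P': biset_pair G H K X' Y' by fact
  obtain f where f: "bij_betw f (points X) (points X')"
    "\<And>x h. x \<in> points X \<Longrightarrow> h \<in> carrier K \<Longrightarrow> f (lact X h x) = lact X' h (f x)"
    "\<And>x g. x \<in> points X \<Longrightarrow> g \<in> carrier H \<Longrightarrow> f (ract X x g) = ract X' (f x) g"
    using assms(3) unfolding biset_iso_def by blast
  obtain g where g: "bij_betw g (points Y) (points Y')"
    "\<And>x h. x \<in> points Y \<Longrightarrow> h \<in> carrier H \<Longrightarrow> g (lact Y h x) = lact Y' h (g x)"
    "\<And>x k. x \<in> points Y \<Longrightarrow> k \<in> carrier G \<Longrightarrow> g (ract Y x k) = ract Y' (g x) k"
    using assms(4) unfolding biset_iso_def by blast
  have fX: "f x \<in> points X'" if "x \<in> points X" for x using that f(1) by (auto simp: bij_betw_def)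
  have gY: "g y \<in> points Y'" if "y \<in> points Y" for y using that g(1) by (auto simp: bij_betw_def)
  \<comment> \<open>Applying both isomorphisms to every member of a class avoids a choice of
    representatives.\<close>
  define F where "F = (\<lambda>C. (\<lambda>(x, y). (f x, g y)) ` C)"
  have F: "F (P.cls x y) = P'.cls (f x) (g y)" if "x \<in> points X" "y \<in> points Y" for x y
    using that fX gY by (simp add: F_def P.cls_eq P'.cls_eq image_image f g)
  have fi: "f x = f x' \<longleftrightarrow> x = x'" if "x \<in> points X" "x' \<in> points X" for x x'
    using that f(1) by (auto simp: bij_betw_def dest: inj_onD)
  have gi: "g x = g x' \<longleftrightarrow> x = x'" if "x \<in> points Y" "x' \<in> points Y" for x x'
    using that g(1) by (auto simp: bij_betw_def dest: inj_onD)
  have "bij_betw F (points (biset_comp H X Y)) (points (biset_comp H X' Y'))"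
    unfolding bij_betw_def
  proof
    show "inj_on F (points (biset_comp H X Y))"
    proof (rule inj_onI)
      fix C D assume "C \<in> points (biset_comp H X Y)" "D \<in> points (biset_comp H X Y)" and FF: "F C = F D"
      then obtain x y x' y' where xy: "x \<in> points X" "y \<in> points Y" "x' \<in> points X" "y' \<in> points Y"
        "C = P.cls x y" "D = P.cls x' y'" by (auto simp: P.points_comp)
      then obtain h where h: "h \<in> carrier H" "f x = ract X' (f x') h" "g y' = lact Y' h (g y)"
        using FF by (auto simp: F fX gY P'.cls_eq_iff)
      hence "f x = f (ract X x' h)" "g y' = g (lact Y h y)" using xy by (simp_all add: f g)
      hence "x = ract X x' h" "y' = lact Y h y"
        using xy h fi gi by (simp_all add: P.X.ract_closed P.Y.lact_closed)
      thus "C = D" using xy h by (auto simp: P.cls_eq_iff)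
    qed
    show "F ` points (biset_comp H X Y) = points (biset_comp H X' Y')"
    proof (intro equalityI subsetI)
      fix C assume "C \<in> F ` points (biset_comp H X Y)"
      then obtain x y where "x \<in> points X" "y \<in> points Y" "C = P'.cls (f x) (g y)"
        using F by (auto simp: P.points_comp)
      thus "C \<in> points (biset_comp H X' Y')"
        using fX gY unfolding P'.points_comp by blast
    next
      fix C assume "C \<in> points (biset_comp H X' Y')"
      then obtain x' y' where "C = P'.cls x' y'" "x' \<in> points X'" "y' \<in> points Y'"
        by (auto simp: P'.points_comp)
      moreover from this obtain x y where "x \<in> points X" "y \<in> points Y" "x' = f x" "y' = g y"
        using f(1) g(1) unfolding bij_betw_def by blast
      ultimately have "C = F (P.cls x y)" "P.cls x y \<in> points (biset_comp H X Y)"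
        by (simp_all add: F P.cls_in_points)
      thus "C \<in> F ` points (biset_comp H X Y)" by (rule image_eqI)
    qed
  qed
  moreover have "F (lact (biset_comp H X Y) k C) = lact (biset_comp H X' Y') k (F C)"
    if "C \<in> points (biset_comp H X Y)" "k \<in> carrier K" for C k
    using that by (auto simp: P.points_comp P.lact_comp P'.lact_comp F fX gY P.X.lact_closed f)
  moreover have "F (ract (biset_comp H X Y) C k) = ract (biset_comp H X' Y') (F C) k"
    if "C \<in> points (biset_comp H X Y)" "k \<in> carrier G" for C k
    using that by (auto simp: P.points_comp P.ract_comp P'.ract_comp F fX gY P.Y.ract_closed g)
  ultimately show ?thesis unfolding biset_iso_def by blast
qed

subsection \<open>Transitive bisets\<close>

locale std_pair = G: fin_group G + H: fin_group H + P: subgroup P G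
  for G H :: "'a monoid" and P :: "'a set" +
  fixes \<phi> :: "'a \<Rightarrow> 'a"
  assumes hom: "\<phi> \<in> hom (subgrp G P) H"
begin

lemma hom_closed: "k \<in> P \<Longrightarrow> \<phi> k \<in> carrier H"
  using hom by (auto simp: hom_def)

lemma hom_mult: "k \<in> P \<Longrightarrow> l \<in> P \<Longrightarrow> \<phi> (k \<otimes>\<^bsub>G\<^esub> l) = \<phi> k \<otimes>\<^bsub>H\<^esub> \<phi> l"
  using hom by (auto simp: hom_def)

sublocale hom: group_hom "subgrp G P" H \<phi>
  using hom P.subgroup_is_group[OF G.group_axioms] H.group_axioms
  by (simp add: group_hom_def group_hom_axioms_def)

lemma hom_one: "\<phi> \<one>\<^bsub>G\<^esub> = \<one>\<^bsub>H\<^esub>"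
  using hom.hom_one by simp

lemma hom_inv: "k \<in> P \<Longrightarrow> \<phi> (inv\<^bsub>G\<^esub> k) = inv\<^bsub>H\<^esub> (\<phi> k)"
  using hom.hom_inv[of k] G.m_inv_consistent[OF P.subgroup_axioms] by simp

definition rel where
  "rel = {((h, k \<otimes>\<^bsub>G\<^esub> g), (h \<otimes>\<^bsub>H\<^esub> \<phi> k, g)) | h k g. h \<in> carrier H \<and> k \<in> P \<and> g \<in> carrier G}"

definition cls where "cls h g = rel `` {(h, g)}"

text \<open>Again an orbit relation: \<open>P\<close> acts on pairs by (h, g) -> (h \<phi>(k^-1), k
  g).\<close>

lemma rel_eq:
  "rel = {(z, (fst z \<otimes>\<^bsub>H\<^esub> \<phi> (inv\<^bsub>G\<^esub> k), k \<otimes>\<^bsub>G\<^esub> snd z)) | z k.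
     z \<in> carrier H \<times> carrier G \<and> k \<in> carrier (subgrp G P)}" (is "_ = ?R")
proof
  show "rel \<subseteq> ?R"
  proof
    fix w assume "w \<in> rel"
    then obtain h k g where w: "w = ((h, k \<otimes>\<^bsub>G\<^esub> g), (h \<otimes>\<^bsub>H\<^esub> \<phi> k, g))"
      "h \<in> carrier H" "k \<in> P" "g \<in> carrier G" by (auto simp: rel_def)
    thus "w \<in> ?R" 
      by (auto intro!: exI[of _ "k \<otimes>\<^bsub>G\<^esub> g"] exI[of _ "inv\<^bsub>G\<^esub> k"] simp: G.inv_mult_cancel)
  qed
  show "?R \<subseteq> rel"
  proof
    fix w assume "w \<in> ?R"
    then obtain h k g where w: "w = ((h, g), (h \<otimes>\<^bsub>H\<^esub> \<phi> (inv\<^bsub>G\<^esub> k), k \<otimes>\<^bsub>G\<^esub> g))"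
      "h \<in> carrier H" "k \<in> P" "g \<in> carrier G" by auto
    thus "w \<in> rel" unfolding rel_def
      by (auto intro!: exI[of _ "k \<otimes>\<^bsub>G\<^esub> g"] exI[of _ "inv\<^bsub>G\<^esub> k"] simp: G.inv_mult_cancel)
  qed
qed

lemma
  shows equiv_rel: "equiv (carrier H \<times> carrier G) rel"
    and cls_eq: "h \<in> carrier H \<Longrightarrow> g \<in> carrier G \<Longrightarrow>
          cls h g = (\<lambda>k. (h \<otimes>\<^bsub>H\<^esub> \<phi> (inv\<^bsub>G\<^esub> k), k \<otimes>\<^bsub>G\<^esub> g)) ` P"
    and card_cls: "h \<in> carrier H \<Longrightarrow> g \<in> carrier G \<Longrightarrow> card (cls h g) = card P"
proof -
  define act where "act = (\<lambda>k z. (fst z \<otimes>\<^bsub>H\<^esub> \<phi> (inv\<^bsub>G\<^esub> k), k \<otimes>\<^bsub>G\<^esub> snd z))"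
  let ?E = "carrier H \<times> carrier G"
  have 1: "group (subgrp G P)" by (rule P.subgroup_is_group[OF G.group_axioms])
  have 2: "act k z \<in> ?E" if "k \<in> carrier (subgrp G P)" "z \<in> ?E" for k z
    using that by (auto simp: act_def hom_closed)
  have 3: "act \<one>\<^bsub>subgrp G P\<^esub> z = z" if "z \<in> ?E" for z
    using that by (auto simp: act_def hom_one)
  have 4: "act (k \<otimes>\<^bsub>subgrp G P\<^esub> l) z = act k (act l z)"
    if "k \<in> carrier (subgrp G P)" "l \<in> carrier (subgrp G P)" "z \<in> ?E" for k l z
    using that by (auto simp: act_def G.m_assoc H.m_assoc G.inv_mult_group hom_mult hom_closed)
  \<comment> \<open>Freeness comes from left multiplication on the second coordinate; \<phi> may
    have a kernel.\<close>
  have 5: "k = \<one>\<^bsub>subgrp G P\<^esub>" if "k \<in> carrier (subgrp G P)" "z \<in> ?E" "act k z = z" for k z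
    using that by (auto simp: act_def prod_eq_iff)
  have 6: "rel = {(z, act k z) | z k. z \<in> ?E \<and> k \<in> carrier (subgrp G P)}"
    unfolding act_def by (rule rel_eq)
  note * = free_action_equiv[where act = act, OF 1 2 3 4 5 6]
  show "equiv ?E rel" by (rule *(1))
  show "cls h g = (\<lambda>k. (h \<otimes>\<^bsub>H\<^esub> \<phi> (inv\<^bsub>G\<^esub> k), k \<otimes>\<^bsub>G\<^esub> g)) ` P"
    if "h \<in> carrier H" "g \<in> carrier G"
    using *(2)[where z = "(h, g)"] that by (simp add: act_def cls_def)
  show "card (cls h g) = card P" if "h \<in> carrier H" "g \<in> carrier G"
    using *(3)[where z = "(h, g)"] that by (simp add: cls_def)
qed

lemma cls_eq_iff:
  assumes "h \<in> carrier H" "g \<in> carrier G" "h' \<in> carrier H" "g' \<in> carrier G"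
  shows "cls h g = cls h' g' \<longleftrightarrow> (\<exists>k\<in>P. h' = h \<otimes>\<^bsub>H\<^esub> \<phi> k \<and> g = k \<otimes>\<^bsub>G\<^esub> g')"
proof -
  have "cls h g = cls h' g' \<longleftrightarrow> ((h, g), (h', g')) \<in> rel"
    unfolding cls_def using eq_equiv_class_iff[OF equiv_rel] assms by simp
  thus ?thesis using assms by (auto simp: rel_def)
qed

lemma points_std: "points (std_biset G H P \<phi>) = {cls h g | h g. h \<in> carrier H \<and> g \<in> carrier G}"
  unfolding std_biset_def rel_def[symmetric] cls_def by (auto simp: quotient_def)

lemma cls_in_points: "h \<in> carrier H \<Longrightarrow> g \<in> carrier G \<Longrightarrow> cls h g \<in> points (std_biset G H P \<phi>)"
  unfolding points_std by blast

lemma lact_std: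
  assumes "h \<in> carrier H" "g \<in> carrier G" "x \<in> carrier H"
  shows "lact (std_biset G H P \<phi>) x (cls h g) = cls (x \<otimes>\<^bsub>H\<^esub> h) g"
  using assms by (simp add: std_biset_def cls_eq image_image hom_closed H.m_assoc cong: image_cong)

lemma ract_std:
  assumes "h \<in> carrier H" "g \<in> carrier G" "y \<in> carrier G"
  shows "ract (std_biset G H P \<phi>) (cls h g) y = cls h (g \<otimes>\<^bsub>G\<^esub> y)"
  using assms by (simp add: std_biset_def cls_eq image_image G.m_assoc cong: image_cong)

lemma std_flfb: "finite_left_free_biset G H (std_biset G H P \<phi>)"
  unfolding finite_left_free_biset_def
proof (intro conjI ballI impI)
  show "is_biset G H (std_biset G H P \<phi>)"
    unfolding is_biset_def
  proof (rule ballI, goal_cases)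
    case (1 z)
    then obtain h g where hg: "h \<in> carrier H" "g \<in> carrier G" and z: "z = cls h g"
      by (auto simp: points_std)
    show ?case unfolding z using hg
      by (intro conjI ballI) (simp_all add: cls_in_points lact_std ract_std H.m_assoc G.m_assoc)
  qed
  have "points (std_biset G H P \<phi>) = (\<lambda>(x, y). cls x y) ` (carrier H \<times> carrier G)"
    by (auto simp: points_std)
  thus "finite (points (std_biset G H P \<phi>))" using G.fin H.fin by simp
next
  fix z x assume "z \<in> points (std_biset G H P \<phi>)" and x: "x \<in> carrier H"
    and fx: "lact (std_biset G H P \<phi>) x z = z"
  then obtain h g where hg: "h \<in> carrier H" "g \<in> carrier G" "z = cls h g" by (auto simp: points_std)
  hence "cls (x \<otimes>\<^bsub>H\<^esub> h) g = cls h g" using fx x by (simp add: lact_std)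
  then obtain k where k: "k \<in> P" "h = x \<otimes>\<^bsub>H\<^esub> h \<otimes>\<^bsub>H\<^esub> \<phi> k" "g = k \<otimes>\<^bsub>G\<^esub> g"
    using hg x by (auto simp: cls_eq_iff)
  hence "k = \<one>\<^bsub>G\<^esub>" using hg G.r_cancel_one'[of g k] P.mem_carrier by simp
  hence "h = x \<otimes>\<^bsub>H\<^esub> h" using k hg x by (simp add: hom_one)
  thus "x = \<one>\<^bsub>H\<^esub>" using hg x H.r_cancel_one'[of h x] by simp
qed

text \<open>The class of (h, g) is fixed at \<open>k\<close> exactly when (b(k) h, g) and (h, g
  a(k)) are related by an element of \<open>P\<close>, and that element can only be g a(k) g^-1.
  Each class has |P| representatives, hence the factor on the left.\<close>

lemma mark_std:
  assumes a: "a \<in> I \<rightarrow> carrier G" and b: "b \<in> I \<rightarrow> carrier H"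
  shows "card P * mark I a b (std_biset G H P \<phi>) =
    card {(h, g). h \<in> carrier H \<and> g \<in> carrier G \<and> (\<forall>k\<in>I. g \<otimes>\<^bsub>G\<^esub> a k \<otimes>\<^bsub>G\<^esub> inv\<^bsub>G\<^esub> g \<in> P \<and>
       b k = h \<otimes>\<^bsub>H\<^esub> \<phi> (g \<otimes>\<^bsub>G\<^esub> a k \<otimes>\<^bsub>G\<^esub> inv\<^bsub>G\<^esub> g) \<otimes>\<^bsub>H\<^esub> inv\<^bsub>H\<^esub> h)}"
proof -
  let ?E = "carrier H \<times> carrier G"
  let ?X = "std_biset G H P \<phi>"
  let ?Q = "\<lambda>z. \<forall>k\<in>I. cls (b k \<otimes>\<^bsub>H\<^esub> fst z) (snd z) = cls (fst z) (snd z \<otimes>\<^bsub>G\<^esub> a k)"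
  let ?Q' = "\<lambda>C. \<forall>k\<in>I. lact ?X (b k) C = ract ?X C (a k)"
  have "card {z \<in> ?E. ?Q z} = card P * card {C \<in> ?E // rel. ?Q' C}"
  proof (rule quotient_count[OF equiv_rel])
    show "finite ?E" using G.fin H.fin by simp
    show "card (rel `` {z}) = card P" if "z \<in> ?E" for z
      using that card_cls by (auto simp: cls_def)
    fix z assume z: "z \<in> ?E"
    hence "rel `` {z} = cls (fst z) (snd z)" by (simp add: cls_def)
    moreover have "fst z \<in> carrier H" "snd z \<in> carrier G" using z by auto
    moreover have "a k \<in> carrier G" "b k \<in> carrier H" if "k \<in> I" for k using that a b by auto
    ultimately show "?Q z \<longleftrightarrow> ?Q' (rel `` {z})" by (simp add: lact_std ract_std)
  qed
  hence "card P * mark I a b ?X = card {z \<in> ?E. ?Q z}"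
    by (simp add: mark_def) (simp add: std_biset_def rel_def)
  also have "{z \<in> ?E. ?Q z} = {(h, g). h \<in> carrier H \<and> g \<in> carrier G \<and>
      (\<forall>k\<in>I. g \<otimes>\<^bsub>G\<^esub> a k \<otimes>\<^bsub>G\<^esub> inv\<^bsub>G\<^esub> g \<in> P \<and>
       b k = h \<otimes>\<^bsub>H\<^esub> \<phi> (g \<otimes>\<^bsub>G\<^esub> a k \<otimes>\<^bsub>G\<^esub> inv\<^bsub>G\<^esub> g) \<otimes>\<^bsub>H\<^esub> inv\<^bsub>H\<^esub> h)}"
  proof -
    have "cls (b k \<otimes>\<^bsub>H\<^esub> h) g = cls h (g \<otimes>\<^bsub>G\<^esub> a k) \<longleftrightarrow> g \<otimes>\<^bsub>G\<^esub> a k \<otimes>\<^bsub>G\<^esub> inv\<^bsub>G\<^esub> g \<in> P \<and>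
       b k = h \<otimes>\<^bsub>H\<^esub> \<phi> (g \<otimes>\<^bsub>G\<^esub> a k \<otimes>\<^bsub>G\<^esub> inv\<^bsub>G\<^esub> g) \<otimes>\<^bsub>H\<^esub> inv\<^bsub>H\<^esub> h"
      if hg: "h \<in> carrier H" "g \<in> carrier G" and "k \<in> I" for h g k
    proof -
      have ab: "a k \<in> carrier G" "b k \<in> carrier H" using a b \<open>k \<in> I\<close> by auto
      have "cls (b k \<otimes>\<^bsub>H\<^esub> h) g = cls h (g \<otimes>\<^bsub>G\<^esub> a k) \<longleftrightarrow> cls h (g \<otimes>\<^bsub>G\<^esub> a k) = cls (b k \<otimes>\<^bsub>H\<^esub> h) g"
        by auto
      also have "\<dots> \<longleftrightarrow> (\<exists>l\<in>P. b k \<otimes>\<^bsub>H\<^esub> h = h \<otimes>\<^bsub>H\<^esub> \<phi> l \<and> g \<otimes>\<^bsub>G\<^esub> a k = l \<otimes>\<^bsub>G\<^esub> g)"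
        using hg ab by (simp add: cls_eq_iff)
      also have "\<dots> \<longleftrightarrow> (\<exists>l\<in>P. b k = h \<otimes>\<^bsub>H\<^esub> \<phi> l \<otimes>\<^bsub>H\<^esub> inv\<^bsub>H\<^esub> h \<and> g \<otimes>\<^bsub>G\<^esub> a k \<otimes>\<^bsub>G\<^esub> inv\<^bsub>G\<^esub> g = l)"
        by (rule bex_cong[OF refl])
          (use hg ab hom_closed in \<open>metis G.inv_solve_right' H.inv_solve_right G.m_closed H.m_closed P.mem_carrier\<close>)
      finally show ?thesis by auto
    qed
    hence "?Q (h, g) \<longleftrightarrow> (\<forall>k\<in>I. g \<otimes>\<^bsub>G\<^esub> a k \<otimes>\<^bsub>G\<^esub> inv\<^bsub>G\<^esub> g \<in> P \<and>
       b k = h \<otimes>\<^bsub>H\<^esub> \<phi> (g \<otimes>\<^bsub>G\<^esub> a k \<otimes>\<^bsub>G\<^esub> inv\<^bsub>G\<^esub> g) \<otimes>\<^bsub>H\<^esub> inv\<^bsub>H\<^esub> h)"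
      if "h \<in> carrier H" "g \<in> carrier G" for h g
      using that by (simp cong: ball_cong)
    thus ?thesis by (intro Collect_cong) (simp add: case_prod_beta mem_Times_iff prod_eq_iff conj_assoc cong: conj_cong)
  qed
  finally show ?thesis .
qed

end

text \<open>Orbit-stabiliser theorem for bisets: \<open>stab\<close> says that the stabiliser of
  \<open>x0\<close> is the graph of \<phi>, and [h, g] -> h x0 g is then well defined and
  injective.\<close>

lemma (in lf_biset) transitive_iso_std:
  assumes P: "subgroup P G" and \<phi>: "\<phi> \<in> hom (subgrp G P) H" and x0: "x0 \<in> points X"
    and trans: "\<And>x. x \<in> points X \<Longrightarrow> \<exists>h\<in>carrier H. \<exists>g\<in>carrier G. x = lact X h (ract X x0 g)"
    and stab: "\<And>h g. h \<in> carrier H \<Longrightarrow> g \<in> carrier G \<Longrightarrow>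
       lact X h x0 = ract X x0 g \<longleftrightarrow> g \<in> P \<and> h = \<phi> g"
  shows "biset_iso G H (std_biset G H P \<phi>) X"
proof -
  interpret std_pair G H P \<phi>
    using P \<phi> G.fin_group_axioms H.fin_group_axioms by (simp add: std_pair_def std_pair_axioms_def)
  \<comment> \<open>The representative is chosen arbitrarily; the value is shown next to be the same
    for every pair (h, g) naming the class.\<close>
  define f where "f = (\<lambda>C. (\<lambda>(h, g). lact X h (ract X x0 g)) (SOME z. z \<in> C))"
  have st: "lact X (\<phi> k) x0 = ract X x0 k" if "k \<in> P" for k
    using stab that hom_closed by simp
  have f: "f (cls h g) = lact X h (ract X x0 g)" if hg: "h \<in> carrier H" "g \<in> carrier G" for h g
  proof -
    have "(h \<otimes>\<^bsub>H\<^esub> \<phi> (inv\<^bsub>G\<^esub> \<one>\<^bsub>G\<^esub>), \<one>\<^bsub>G\<^esub> \<otimes>\<^bsub>G\<^esub> g) \<in> cls h g"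
      unfolding cls_eq[OF hg] using P.one_closed by (rule imageI)
    hence "(SOME z. z \<in> cls h g) \<in> cls h g" by (rule someI)
    then obtain k where k: "k \<in> P" "(SOME z. z \<in> cls h g) = (h \<otimes>\<^bsub>H\<^esub> \<phi> (inv\<^bsub>G\<^esub> k), k \<otimes>\<^bsub>G\<^esub> g)"
      using hg by (auto simp: cls_eq)
    hence "f (cls h g) = lact X h (lact X (\<phi> (inv\<^bsub>G\<^esub> k)) (ract X (ract X x0 k) g))"
      using hg x0 by (simp add: f_def lact_mult ract_mult ract_closed hom_closed)
    also have "\<dots> = lact X h (ract X (lact X (\<phi> (inv\<^bsub>G\<^esub> k)) (lact X (\<phi> k) x0)) g)"
      using hg x0 k by (simp add: ract_lact st lact_closed ract_closed hom_closed)
    also have "\<dots> = lact X h (ract X x0 g)"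
      using k x0 by (simp add: hom_inv lact_inv hom_closed)
    finally show ?thesis .
  qed
  have "bij_betw f (points (std_biset G H P \<phi>)) (points X)"
    unfolding bij_betw_def
  proof
    show "f ` points (std_biset G H P \<phi>) = points X"
    proof (intro equalityI subsetI)
      fix x assume "x \<in> points X"
      then obtain h g where "h \<in> carrier H" "g \<in> carrier G" "x = lact X h (ract X x0 g)"
        using trans by blast
      hence "x = f (cls h g)" "cls h g \<in> points (std_biset G H P \<phi>)"
        by (simp_all add: f cls_in_points)
      thus "x \<in> f ` points (std_biset G H P \<phi>)" by (rule image_eqI)
    qed (use f x0 in \<open>auto simp: points_std lact_closed ract_closed\<close>)
    show "inj_on f (points (std_biset G H P \<phi>))"
    proof (rule inj_onI)
      fix C D assume "C \<in> points (std_biset G H P \<phi>)" "D \<in> points (std_biset G H P \<phi>)" "f C = f D"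
      then obtain h g h' g' where hg: "h \<in> carrier H" "g \<in> carrier G" "h' \<in> carrier H" "g' \<in> carrier G"
        "C = cls h g" "D = cls h' g'" and eq: "lact X h (ract X x0 g) = lact X h' (ract X x0 g')"
        by (auto simp: points_std f)
      have "lact X (inv\<^bsub>H\<^esub> h \<otimes>\<^bsub>H\<^esub> h') x0 =
          lact X (inv\<^bsub>H\<^esub> h) (lact X h' (ract X (ract X x0 g') (inv\<^bsub>G\<^esub> g')))"
        using hg x0 by (simp add: lact_mult ract_inv)
      also have "\<dots> = ract X (lact X (inv\<^bsub>H\<^esub> h) (lact X h' (ract X x0 g'))) (inv\<^bsub>G\<^esub> g')"
        using hg x0 by (simp add: ract_lact ract_closed lact_closed)
      also have "\<dots> = ract X x0 (g \<otimes>\<^bsub>G\<^esub> inv\<^bsub>G\<^esub> g')"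
        using hg x0 by (simp add: eq[symmetric] lact_inv ract_closed ract_mult)
      finally have "g \<otimes>\<^bsub>G\<^esub> inv\<^bsub>G\<^esub> g' \<in> P" "inv\<^bsub>H\<^esub> h \<otimes>\<^bsub>H\<^esub> h' = \<phi> (g \<otimes>\<^bsub>G\<^esub> inv\<^bsub>G\<^esub> g')"
        using hg by (simp_all add: stab)
      moreover have "g = g \<otimes>\<^bsub>G\<^esub> inv\<^bsub>G\<^esub> g' \<otimes>\<^bsub>G\<^esub> g'" "h' = h \<otimes>\<^bsub>H\<^esub> (inv\<^bsub>H\<^esub> h \<otimes>\<^bsub>H\<^esub> h')"
        using hg by (simp_all add: G.m_assoc H.inv_mult_cancel)
      ultimately show "C = D" using hg by (auto simp: cls_eq_iff)
    qed
  qed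
  thus ?thesis
    unfolding biset_iso_def using f x0
    by (intro exI[of _ f]) (auto simp: points_std lact_std ract_std lact_mult ract_mult
        ract_closed lact_closed ract_lact)
qed

section \<open>Burnside modules\<close>

text \<open>Frees the ring from normal forms of fractions: the reduced denominator divides any other
  denominator, so it is prime to \<open>p\<close> as soon as one denominator is.\<close>

lemma Zloc_iff:
  "r \<in> carrier (Zloc p) \<longleftrightarrow> (\<exists>a b. b \<noteq> 0 \<and> coprime b (int p) \<and> r = of_int a / of_int b)"
proof
  assume r: "r \<in> carrier (Zloc p)"
  obtain a b where ab: "quotient_of r = (a, b)" by (cases "quotient_of r")
  have "b > 0" using ab by (rule quotient_of_denom_pos)
  thus "\<exists>a b. b \<noteq> 0 \<and> coprime b (int p) \<and> r = of_int a / of_int b"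
    using r ab quotient_of_div[OF ab] by (intro exI[of _ a] exI[of _ b]) (auto simp: Zloc_def)
next
  assume "\<exists>a b. b \<noteq> 0 \<and> coprime b (int p) \<and> r = of_int a / of_int b"
  then obtain a b where ab: "b \<noteq> 0" "coprime b (int p)" "r = of_int a / of_int b" by blast
  obtain n d where nd: "quotient_of r = (n, d)" by (cases "quotient_of r")
  have d: "d > 0" using nd by (rule quotient_of_denom_pos)
  have cop: "coprime n d" using nd by (rule quotient_of_coprime)
  have "of_int a / of_int b = (of_int n / of_int d :: rat)" using quotient_of_div[OF nd] ab(3) by simp
  hence "(of_int (a * d) :: rat) = of_int (n * b)" using ab(1) d by (simp add: field_simps)
  hence "a * d = n * b" by (simp only: of_int_eq_iff)
  hence "d dvd n * b" by (metis dvd_triv_right)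
  hence "d dvd b" using cop by (simp add: coprime_commute coprime_dvd_mult_right_iff)
  hence "coprime d (int p)" using ab(2) by (rule coprime_divisors[OF _ dvd_refl])
  thus "r \<in> carrier (Zloc p)" by (simp add: Zloc_def nd)
qed

lemma Zloc_of_int: "of_int n \<in> carrier (Zloc p)"
  unfolding Zloc_iff by (intro exI[of _ n] exI[of _ 1]) simp

lemma Zloc_0: "0 \<in> carrier (Zloc p)" and Zloc_1: "1 \<in> carrier (Zloc p)"
  and Zloc_m1: "- 1 \<in> carrier (Zloc p)" and Zloc_of_nat: "of_nat m \<in> carrier (Zloc p)"
  using Zloc_of_int[of 0 p] Zloc_of_int[of 1 p] Zloc_of_int[of "- 1" p] Zloc_of_int[of "int m" p] by simp_all

lemma Zloc_add:
  assumes "r \<in> carrier (Zloc p)" "s \<in> carrier (Zloc p)"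
  shows "r + s \<in> carrier (Zloc p)"
proof -
  obtain a b where ab: "b \<noteq> 0" "coprime b (int p)" "r = of_int a / of_int b"
    using assms(1) unfolding Zloc_iff by blast
  obtain c d where cd: "d \<noteq> 0" "coprime d (int p)" "s = of_int c / of_int d"
    using assms(2) unfolding Zloc_iff by blast
  have "r + s = of_int (a * d + c * b) / of_int (b * d)" using ab cd by (simp add: field_simps)
  moreover have "coprime (b * d) (int p)" "b * d \<noteq> 0" using ab cd by auto
  ultimately show ?thesis unfolding Zloc_iff by blast
qed

lemma Zloc_mult:
  assumes "r \<in> carrier (Zloc p)" "s \<in> carrier (Zloc p)"
  shows "r * s \<in> carrier (Zloc p)"
proof -
  obtain a b where ab: "b \<noteq> 0" "coprime b (int p)" "r = of_int a / of_int b"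
    using assms(1) unfolding Zloc_iff by blast
  obtain c d where cd: "d \<noteq> 0" "coprime d (int p)" "s = of_int c / of_int d"
    using assms(2) unfolding Zloc_iff by blast
  have "r * s = of_int (a * c) / of_int (b * d)" using ab cd by simp
  moreover have "coprime (b * d) (int p)" "b * d \<noteq> 0" using ab cd by auto
  ultimately show ?thesis unfolding Zloc_iff by blast
qed

lemma Zloc_sum: "(\<And>i. i \<in> A \<Longrightarrow> f i \<in> carrier (Zloc p)) \<Longrightarrow> sum f A \<in> carrier (Zloc p)"
  by (induction A rule: infinite_finite_induct) (auto simp: Zloc_0 Zloc_add)

text \<open>The denominator of \<open>z\<close> is prime to \<open>p\<close>, so the factor
  \<open>p\<close> survives in the reduced numerator. This is what contradicts an augmentation prime
  to \<open>p\<close>.\<close>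

lemma not_prime_to_multiple:
  assumes "prime p" "z \<in> carrier (Zloc p)"
  shows "\<not> prime_to p (of_nat p * z)"
proof -
  obtain a b where ab: "b \<noteq> 0" "coprime b (int p)" "z = of_int a / of_int b"
    using assms(2) unfolding Zloc_iff by blast
  obtain n d where nd: "quotient_of (of_nat p * z) = (n, d)" by (cases "quotient_of (of_nat p * z)")
  have d: "d > 0" using nd by (rule quotient_of_denom_pos)
  have "of_nat p * (of_int a / of_int b) = (of_int n / of_int d :: rat)"
    using quotient_of_div[OF nd] ab(3) by simp
  hence "(of_int (int p * a * d) :: rat) = of_int (n * b)" using ab(1) d by (simp add: field_simps)
  hence "int p * a * d = n * b" by (simp only: of_int_eq_iff)
  hence "int p dvd n * b" by (metis dvd_triv_left mult.assoc)
  hence "int p dvd n" using ab(2) by (simp add: coprime_commute coprime_dvd_mult_left_iff)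
  moreover have "\<not> is_unit (int p)" using assms(1) by (auto simp: prime_nat_iff)
  ultimately have "\<not> coprime n (int p)" by (meson coprime_common_divisor dvd_refl)
  thus ?thesis by (simp add: prime_to_def nd)
qed

subsection \<open>Isomorphism classes\<close>

lemma flfb_is_biset: "finite_left_free_biset G H X \<Longrightarrow> is_biset G H X"
  by (simp add: finite_left_free_biset_def)

lemma iso_class_eq:
  assumes "biset_iso G H X Y" "finite_left_free_biset G H X"
  shows "iso_class G H X = iso_class G H Y"
  using assms biset_iso_sym[OF assms(1) flfb_is_biset[OF assms(2)]]
  by (auto simp: iso_class_def intro: biset_iso_trans)

lemma iso_class_memD:
  assumes "Z \<in> iso_class G H X" "finite_left_free_biset G H X"
  shows "finite_left_free_biset G H Z" "biset_iso G H X Z"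
  using assms by (auto simp: iso_class_def)

lemma iso_class_nonempty:
  assumes "finite_left_free_biset G H X"
  shows "\<exists>Z. Z \<in> iso_class G H X"
  using ex_nat_biset[OF assms] by (fastforce simp: iso_class_def)

lemma iso_class_in:
  assumes "finite_left_free_biset G H X"
  shows "iso_class G H X \<in> iso_classes G H"
proof -
  obtain Y :: "('a, nat) biset" where "finite_left_free_biset G H Y" "biset_iso G H X Y"
    using ex_nat_biset[OF assms] .
  thus ?thesis using iso_class_eq assms unfolding iso_classes_def by blast
qed

lemma biset_sum_cong:
  assumes "biset_iso G H X X'" "biset_iso G H Y Y'"
  shows "biset_iso G H (biset_sum X Y) (biset_sum X' Y')"
proof -
  obtain f where f: "bij_betw f (points X) (points X')"
    "\<And>x h. x \<in> points X \<Longrightarrow> h \<in> carrier H \<Longrightarrow> f (lact X h x) = lact X' h (f x)"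
    "\<And>x g. x \<in> points X \<Longrightarrow> g \<in> carrier G \<Longrightarrow> f (ract X x g) = ract X' (f x) g"
    using assms(1) unfolding biset_iso_def by blast
  obtain g where g: "bij_betw g (points Y) (points Y')"
    "\<And>x h. x \<in> points Y \<Longrightarrow> h \<in> carrier H \<Longrightarrow> g (lact Y h x) = lact Y' h (g x)"
    "\<And>x k. x \<in> points Y \<Longrightarrow> k \<in> carrier G \<Longrightarrow> g (ract Y x k) = ract Y' (g x) k"
    using assms(2) unfolding biset_iso_def by blast
  have fX: "points X' = f ` points X" "points Y' = g ` points Y"
    using f(1) g(1) by (simp_all add: bij_betw_def)
  have "inj_on f (points X)" "inj_on g (points Y)"
    using f(1) g(1) by (simp_all add: bij_betw_def)
  hence "inj_on (map_sum f g) (points X <+> points Y)"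
    by (intro inj_onI) (auto elim!: PlusE dest: inj_onD)
  moreover have "map_sum f g ` (points X <+> points Y) = points X' <+> points Y'"
    unfolding Plus_def fX by (simp add: image_Un image_image)
  ultimately have "bij_betw (map_sum f g) (points X <+> points Y) (points X' <+> points Y')"
    by (simp add: bij_betw_def)
  thus ?thesis
    unfolding biset_iso_def by (intro exI[of _ "map_sum f g"]) (auto simp: biset_sum_def f g)
qed

text \<open>Isomorphic bisets have equal marks, so any member may stand for the class.\<close>

definition cmark :: "'k set \<Rightarrow> ('k \<Rightarrow> 'a) \<Rightarrow> ('k \<Rightarrow> 'a) \<Rightarrow> 'a biset_class \<Rightarrow> nat" where
  "cmark I a b c = mark I a b (SOME X. X \<in> c)"

lemma cmark_iso_class:
  assumes "finite_left_free_biset G H X" "a \<in> I \<rightarrow> carrier G" "b \<in> I \<rightarrow> carrier H"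
  shows "cmark I a b (iso_class G H X) = mark I a b X"
proof -
  have "(SOME Z. Z \<in> iso_class G H X) \<in> iso_class G H X"
    using iso_class_nonempty[OF assms(1)] by (rule someI_ex)
  hence "biset_iso G H X (SOME Z. Z \<in> iso_class G H X)" using assms(1) by (rule iso_class_memD)
  thus ?thesis unfolding cmark_def
    using mark_iso[OF _ assms(2,3)] flfb_is_biset[OF assms(1)] by metis
qed

text \<open>Composition respects isomorphism, so all classes in the union that defines
  \<open>class_comp\<close> coincide. Nonemptiness of both classes is needed for the union to be
  that common class.\<close>

lemma class_comp_eq:
  assumes G: "fin_group G" "fin_group H" "fin_group K"
    and X: "finite_left_free_biset H K X" and Y: "finite_left_free_biset G H Y"
  shows "class_comp G H K (iso_class H K X) (iso_class G H Y) = iso_class G K (biset_comp H X Y)"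
proof -
  have pair: "biset_pair G H K X' Y'"
    if "finite_left_free_biset H K X'" "finite_left_free_biset G H Y'"
    for X' :: "('a, 'u) biset" and Y' :: "('a, 'v) biset"
    using that G by (simp add: biset_pair_def lf_bisetI)
  have "iso_class G K (biset_comp H X' Y') = iso_class G K (biset_comp H X Y)"
    if "X' \<in> iso_class H K X" "Y' \<in> iso_class G H Y" for X' Y'
  proof -
    have *: "finite_left_free_biset H K X'" "biset_iso H K X X'"
      "finite_left_free_biset G H Y'" "biset_iso G H Y Y'"
      using iso_class_memD that X Y by blast+
    have "biset_iso G K (biset_comp H X Y) (biset_comp H X' Y')"
      by (rule biset_comp_iso[OF pair[OF X Y] pair[OF *(1,3)] *(2,4)])
    thus ?thesis using iso_class_eq biset_pair.biset_comp_flfb[OF pair[OF X Y]] by metis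
  qed
  moreover obtain X0 where "X0 \<in> iso_class H K X" using iso_class_nonempty[OF X] by blast
  moreover obtain Y0 where "Y0 \<in> iso_class G H Y" using iso_class_nonempty[OF Y] by blast
  ultimately show ?thesis unfolding class_comp_def by blast
qed

subsection \<open>Formal combinations\<close>

abbreviation cls1 :: "'c \<Rightarrow> ('c \<Rightarrow>\<^sub>0 rat)" where
  "cls1 c \<equiv> Poly_Mapping.single c 1"

lemma lookup_scale: "Poly_Mapping.lookup (scale r f) c = r * Poly_Mapping.lookup f c"
  unfolding scale_def by (simp add: Poly_Mapping.map.rep_eq when_def)

lemma scale_simps [simp]:
  "scale r (f + g) = scale r f + scale r g" "scale r (f - g) = scale r f - scale r g"
  "scale r (scale s f) = scale (r * s) f" "scale 1 f = f" "scale 0 f = 0" "scale r 0 = 0"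
  "scale (- 1) f = - f"
  by (auto intro!: poly_mapping_eqI simp: lookup_scale lookup_add lookup_minus algebra_simps)

lemma scale_add_left: "scale (r + s) f = scale r f + scale s f"
  by (auto intro!: poly_mapping_eqI simp: lookup_scale lookup_add algebra_simps)

lemma scale_cls1: "scale r (cls1 c) = Poly_Mapping.single c r"
  by (auto intro!: poly_mapping_eqI simp: lookup_scale lookup_single when_def)

lemma scale_sum: "scale r (sum f A) = (\<Sum>i\<in>A. scale r (f i))"
  by (induction A rule: infinite_finite_induct) auto

lemma poly_mapping_expand:
  "f = (\<Sum>c\<in>Poly_Mapping.keys f. scale (Poly_Mapping.lookup f c) (cls1 c))"
  by (rule poly_mapping_eqI)
     (auto simp: lookup_sum lookup_scale lookup_single when_def in_keys_iff if_distrib cong: if_cong)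

definition fmark :: "'k set \<Rightarrow> ('k \<Rightarrow> 'a) \<Rightarrow> ('k \<Rightarrow> 'a) \<Rightarrow> ('a biset_class \<Rightarrow>\<^sub>0 rat) \<Rightarrow> rat" where
  "fmark I a b f = (\<Sum>c\<in>Poly_Mapping.keys f. Poly_Mapping.lookup f c * of_nat (cmark I a b c))"

lemma fmark_superset:
  assumes "finite A" "Poly_Mapping.keys f \<subseteq> A"
  shows "fmark I a b f = (\<Sum>c\<in>A. Poly_Mapping.lookup f c * of_nat (cmark I a b c))"
  unfolding fmark_def using assms by (intro sum.mono_neutral_left) (auto simp: in_keys_iff)

lemma fmark_add: "fmark I a b (f + g) = fmark I a b f + fmark I a b g"
proof -
  let ?A = "Poly_Mapping.keys f \<union> Poly_Mapping.keys g"
  have "Poly_Mapping.keys (f + g) \<subseteq> ?A" by (rule Poly_Mapping.keys_add)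
  thus ?thesis
    by (simp add: fmark_superset[of ?A] lookup_add sum.distrib distrib_right)
qed

lemma fmark_scale: "fmark I a b (scale r f) = r * fmark I a b f"
proof -
  have "Poly_Mapping.keys (scale r f) \<subseteq> Poly_Mapping.keys f"
    by (auto simp: in_keys_iff lookup_scale)
  thus ?thesis
    by (subst fmark_superset[of "Poly_Mapping.keys f"])
       (auto simp: fmark_def lookup_scale sum_distrib_left mult_ac)
qed

lemma fmark_zero: "fmark I a b 0 = 0" by (simp add: fmark_def)

lemma fmark_diff: "fmark I a b (f - g) = fmark I a b f - fmark I a b g"
  using fmark_add[of I a b f "scale (- 1) g"] fmark_scale[of I a b "- 1" g] by simp

lemma fmark_sum: "fmark I a b (sum f A) = (\<Sum>i\<in>A. fmark I a b (f i))"
  by (induction A rule: infinite_finite_induct) (auto simp: fmark_add fmark_zero)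

lemma fmark_cls1: "fmark I a b (cls1 c) = of_nat (cmark I a b c)"
  by (simp add: fmark_def)

lemma fmark_single: "fmark I a b (Poly_Mapping.single c r) = r * of_nat (cmark I a b c)"
  using fmark_scale[of I a b r "cls1 c"] by (simp add: scale_cls1 fmark_cls1)

lemma fmark_cong:
  "(\<And>k. k \<in> I \<Longrightarrow> a k = a' k) \<Longrightarrow> (\<And>k. k \<in> I \<Longrightarrow> b k = b' k) \<Longrightarrow> fmark I a b f = fmark I a' b' f"
  unfolding fmark_def cmark_def by (simp add: mark_cong[of I a a' b b'])

section \<open>The Burnside module as a quotient of the free module on isomorphism classes\<close>

locale burnside_module = G: fin_group G + H: fin_group H for G H :: "'a monoid" +
  fixes p :: nat
begin

abbreviation "free \<equiv> burnside_free p G H"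
abbreviation "rels \<equiv> burnside_rel p G H"
abbreviation "coset \<equiv> burnside_coset p G H"
abbreviation "B \<equiv> burnside p G H"

lemma free_add: "f \<in> free \<Longrightarrow> g \<in> free \<Longrightarrow> f + g \<in> free"
  using Poly_Mapping.keys_add[of f g] by (auto simp: burnside_free_def lookup_add Zloc_add)

lemma free_scale: "f \<in> free \<Longrightarrow> r \<in> carrier (Zloc p) \<Longrightarrow> scale r f \<in> free"
  by (auto simp: burnside_free_def lookup_scale Zloc_mult in_keys_iff)

lemma free_zero: "0 \<in> free"
  by (simp add: burnside_free_def Zloc_0)

lemma free_uminus: "f \<in> free \<Longrightarrow> - f \<in> free"
  using free_scale[of f "- 1"] Zloc_m1[of p] by simp

lemma free_diff: "f \<in> free \<Longrightarrow> g \<in> free \<Longrightarrow> f - g \<in> free"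
  using free_add[of f "- g"] free_uminus[of g] by simp

lemma free_sum: "(\<And>i. i \<in> A \<Longrightarrow> f i \<in> free) \<Longrightarrow> sum f A \<in> free"
  by (induction A rule: infinite_finite_induct) (auto simp: free_zero free_add)

lemma free_cls1: "finite_left_free_biset G H X \<Longrightarrow> cls1 (iso_class G H X) \<in> free"
  using iso_class_in[of G H X] by (auto simp: burnside_free_def lookup_single when_def Zloc_1 Zloc_0)

lemma rels_free: "f \<in> rels \<Longrightarrow> f \<in> free"
proof (induction rule: burnside_rel.induct)
  case zero show ?case by (rule free_zero)
next
  case (step f r X Y)
  thus ?case by (intro free_add free_scale free_diff free_cls1 biset_sum_flfb)
qed

text \<open>The inductive set adds one scaled generator at a time; that it is closed under sums
  follows by adding the generators of one summand successively to the other.\<close>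

lemma rels_add:
  assumes "g \<in> rels" "f \<in> rels" shows "f + g \<in> rels"
  using assms(1)
proof (induction rule: burnside_rel.induct)
  case zero show ?case using assms(2) by simp
next
  case (step g r X Y)
  from burnside_rel.step[OF step.IH step.hyps(2-4)] show ?case by (simp only: add.assoc)
qed

lemma rels_scale:
  assumes "f \<in> rels" "s \<in> carrier (Zloc p)" shows "scale s f \<in> rels"
  using assms(1)
proof (induction rule: burnside_rel.induct)
  case zero show ?case using burnside_rel.zero by simp
next
  case (step g r X Y)
  from burnside_rel.step[OF step.IH Zloc_mult[OF assms(2) step.hyps(2)] step.hyps(3,4)] show ?case
    by simp
qed

lemma rels_uminus: "f \<in> rels \<Longrightarrow> - f \<in> rels"
  using rels_scale[of f "- 1"] Zloc_m1[of p] by simp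

lemma rels_diff: "f \<in> rels \<Longrightarrow> g \<in> rels \<Longrightarrow> f - g \<in> rels"
  using rels_add[of "- g" f] rels_uminus[of g] by simp

text \<open>The defining relations speak only of bisets with points in \<open>nat\<close>. Orbits,
  complements and transitive bisets live on other types, so the relation is transported to
  them.\<close>

lemma rels_sum: 
  assumes X: "finite_left_free_biset G H (X :: ('a, 'x) biset)"
    and Y: "finite_left_free_biset G H (Y :: ('a, 'y) biset)"
    and Z: "biset_iso G H (biset_sum X Y) Z"
  shows "cls1 (iso_class G H Z) - cls1 (iso_class G H X) - cls1 (iso_class G H Y) \<in> rels"
proof -
  obtain U :: "('a, nat) biset" where U: "finite_left_free_biset G H U" "biset_iso G H X U"
    using ex_nat_biset[OF X] .
  obtain V :: "('a, nat) biset" where V: "finite_left_free_biset G H V" "biset_iso G H Y V"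
    using ex_nat_biset[OF Y] .
  have eq: "iso_class G H X = iso_class G H U" "iso_class G H Y = iso_class G H V"
    "iso_class G H Z = iso_class G H (biset_sum U V)"
    using iso_class_eq[OF U(2) X] iso_class_eq[OF V(2) Y]
      iso_class_eq[OF Z biset_sum_flfb[OF X Y]]
      iso_class_eq[OF biset_sum_cong[OF U(2) V(2)] biset_sum_flfb[OF X Y]] by simp_all
  show ?thesis unfolding eq
    using burnside_rel.step[OF burnside_rel.zero Zloc_1 U(1) V(1)] by simp
qed

text \<open>Fixed points of a disjoint union are the disjoint union of the fixed points, so marks
  vanish on the generating relations.\<close>

lemma fmark_rels:
  assumes "f \<in> rels" "a \<in> I \<rightarrow> carrier G" "b \<in> I \<rightarrow> carrier H"
  shows "fmark I a b f = 0"
  using assms(1)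
proof (induction rule: burnside_rel.induct)
  case (step f r X Y)
  have "finite (points X)" "finite (points Y)"
    using step.hyps by (auto simp: finite_left_free_biset_def)
  thus ?case using step assms(2,3) biset_sum_flfb[of G H X Y]
    by (simp add: fmark_add fmark_diff fmark_scale fmark_cls1 cmark_iso_class mark_sum algebra_simps)
qed (simp add: fmark_zero)

lemma coset_eq_iff:
  assumes "f \<in> free" "g \<in> free"
  shows "coset f = coset g \<longleftrightarrow> f - g \<in> rels"
proof
  assume "coset f = coset g"
  moreover have "f \<in> coset f" using assms burnside_rel.zero by (simp add: burnside_coset_def)
  ultimately show "f - g \<in> rels" by (simp add: burnside_coset_def)
next
  assume fg: "f - g \<in> rels"
  have "h - f \<in> rels \<longleftrightarrow> h - g \<in> rels" for h
    using rels_add[OF fg, of "h - f"] rels_diff[OF _ fg, of "h - g"] by auto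
  thus "coset f = coset g" by (simp add: burnside_coset_def)
qed

lemma rep_coset:
  assumes "f \<in> free"
  shows "burnside_rep (coset f) \<in> free" "burnside_rep (coset f) - f \<in> rels"
proof -
  have "f \<in> coset f" using assms burnside_rel.zero by (simp add: burnside_coset_def)
  hence "burnside_rep (coset f) \<in> coset f" unfolding burnside_rep_def by (rule someI)
  thus "burnside_rep (coset f) \<in> free" "burnside_rep (coset f) - f \<in> rels"
    by (auto simp: burnside_coset_def)
qed

lemma coset_in: "f \<in> free \<Longrightarrow> coset f \<in> carrier B"
  by (simp add: burnside_def)

lemma carrier_rep:
  assumes "x \<in> carrier B"
  shows "burnside_rep x \<in> free" "coset (burnside_rep x) = x"
proof -
  obtain f where "f \<in> free" "x = coset f" using assms by (auto simp: burnside_def)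
  thus "burnside_rep x \<in> free" "coset (burnside_rep x) = x" using rep_coset coset_eq_iff by auto
qed

lemma coset_add:
  assumes "f \<in> free" "g \<in> free"
  shows "coset f \<oplus>\<^bsub>B\<^esub> coset g = coset (f + g)"
proof -
  have "(burnside_rep (coset f) + burnside_rep (coset g)) - (f + g) =
      (burnside_rep (coset f) - f) + (burnside_rep (coset g) - g)" by simp
  also have "\<dots> \<in> rels" using rep_coset assms by (intro rels_add)
  finally show ?thesis
    using assms rep_coset by (simp add: burnside_def coset_eq_iff free_add)
qed

lemma coset_smult:
  assumes "f \<in> free" "r \<in> carrier (Zloc p)"
  shows "r \<odot>\<^bsub>B\<^esub> coset f = coset (scale r f)"
proof -
  have "scale r (burnside_rep (coset f)) - scale r f = scale r (burnside_rep (coset f) - f)" by simp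
  also have "\<dots> \<in> rels" using rep_coset assms by (intro rels_scale)
  finally show ?thesis
    using assms rep_coset by (simp add: burnside_def coset_eq_iff free_scale)
qed

lemma add_closed: "x \<in> carrier B \<Longrightarrow> y \<in> carrier B \<Longrightarrow> x \<oplus>\<^bsub>B\<^esub> y \<in> carrier B"
  using coset_add[of "burnside_rep x" "burnside_rep y"] by (simp add: carrier_rep coset_in free_add)

lemma smult_closed: "r \<in> carrier (Zloc p) \<Longrightarrow> x \<in> carrier B \<Longrightarrow> r \<odot>\<^bsub>B\<^esub> x \<in> carrier B"
  using coset_smult[of "burnside_rep x" r] by (simp add: carrier_rep coset_in free_scale)

text \<open>The sum in \<open>F_generated\<close> is a \<open>finsum\<close>, whose laws require
  this structure.\<close>

lemma abelian_monoid: "abelian_monoid B"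
proof -
  have c: "\<exists>f\<in>free. x = coset f" if "x \<in> carrier B" for x using that by (auto simp: burnside_def)
  have z: "\<zero>\<^bsub>B\<^esub> = coset 0" by (simp add: burnside_def)
  show ?thesis
  proof (rule abelian_monoidI)
    fix x y z assume "x \<in> carrier B" "y \<in> carrier B" "z \<in> carrier B"
    then obtain f g h where "f \<in> free" "g \<in> free" "h \<in> free" "x = coset f" "y = coset g" "z = coset h"
      using c[of x] c[of y] c[of z] by auto
    thus "x \<oplus>\<^bsub>B\<^esub> y \<oplus>\<^bsub>B\<^esub> z = x \<oplus>\<^bsub>B\<^esub> (y \<oplus>\<^bsub>B\<^esub> z)" by (simp add: coset_add free_add add.assoc)
  next
    fix x assume "x \<in> carrier B"
    then obtain f where "f \<in> free" "x = coset f" using c[of x] by auto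
    thus "\<zero>\<^bsub>B\<^esub> \<oplus>\<^bsub>B\<^esub> x = x" by (simp add: z coset_add free_zero)
  next
    fix x y assume "x \<in> carrier B" "y \<in> carrier B"
    then obtain f g where "f \<in> free" "g \<in> free" "x = coset f" "y = coset g"
      using c[of x] c[of y] by auto
    thus "x \<oplus>\<^bsub>B\<^esub> y = y \<oplus>\<^bsub>B\<^esub> x" by (simp add: coset_add add.commute)
  qed (auto simp: add_closed z coset_in free_zero)
qed

end

subsection \<open>Marks of Burnside elements\<close>

definition bmark :: "'k set \<Rightarrow> ('k \<Rightarrow> 'a) \<Rightarrow> ('k \<Rightarrow> 'a) \<Rightarrow> 'a burnside \<Rightarrow> rat" where
  "bmark I a b x = fmark I a b (burnside_rep x)"

lemma bmark_cong:
  "(\<And>k. k \<in> I \<Longrightarrow> a k = a' k) \<Longrightarrow> (\<And>k. k \<in> I \<Longrightarrow> b k = b' k) \<Longrightarrow> bmark I a b f = bmark I a' b' f"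
  unfolding bmark_def by (rule fmark_cong)

context burnside_module
begin

context
  fixes I :: "'k set" and a b
  assumes a: "a \<in> I \<rightarrow> carrier G" and b: "b \<in> I \<rightarrow> carrier H"
begin

text \<open>Marks vanish on relations, so the representative picked by \<open>burnside_rep\<close>
  does not matter.\<close>

lemma bmark_coset: "f \<in> free \<Longrightarrow> bmark I a b (coset f) = fmark I a b f"
  using fmark_rels[OF rep_coset(2) a b, of f] by (simp add: bmark_def fmark_diff)

lemma bmark_add:
  "x \<in> carrier B \<Longrightarrow> y \<in> carrier B \<Longrightarrow> bmark I a b (x \<oplus>\<^bsub>B\<^esub> y) = bmark I a b x + bmark I a b y"
  using coset_add[of "burnside_rep x" "burnside_rep y"]
  by (simp add: carrier_rep bmark_coset free_add fmark_add flip: bmark_def)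

lemma bmark_smult:
  "x \<in> carrier B \<Longrightarrow> r \<in> carrier (Zloc p) \<Longrightarrow> bmark I a b (r \<odot>\<^bsub>B\<^esub> x) = r * bmark I a b x"
  using coset_smult[of "burnside_rep x" r]
  by (simp add: carrier_rep bmark_coset free_scale fmark_scale flip: bmark_def)

lemma bmark_zero: "bmark I a b \<zero>\<^bsub>B\<^esub> = 0"
  using bmark_coset[OF free_zero] by (simp add: burnside_def fmark_zero)

lemma bmark_finsum:
  assumes "finite A" "\<And>i. i \<in> A \<Longrightarrow> x i \<in> carrier B"
  shows "bmark I a b (\<Oplus>\<^bsub>B\<^esub>i\<in>A. x i) = (\<Sum>i\<in>A. bmark I a b (x i))"
proof -
  interpret abelian_monoid B by (rule abelian_monoid)
  show ?thesis using assms
    by (induction A rule: finite_induct) (simp_all add: bmark_zero Pi_iff bmark_add)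
qed

lemma bmark_cls1:
  "finite_left_free_biset G H X \<Longrightarrow> bmark I a b (coset (cls1 (iso_class G H X))) = of_nat (mark I a b X)"
  by (simp add: bmark_coset free_cls1 fmark_cls1 cmark_iso_class a b)

end

lemma std_pairI: "subgroup P G \<Longrightarrow> \<phi> \<in> hom (subgrp G P) H \<Longrightarrow> std_pair G H P \<phi>"
  by (simp add: std_pair_def std_pair_axioms_def G.fin_group_axioms H.fin_group_axioms)

lemma basis_free:
  "subgroup P G \<Longrightarrow> \<phi> \<in> hom (subgrp G P) H \<Longrightarrow> cls1 (iso_class G H (std_biset G H P \<phi>)) \<in> free"
  by (intro free_cls1 std_pair.std_flfb std_pairI)

lemma basis_in: "subgroup P G \<Longrightarrow> \<phi> \<in> hom (subgrp G P) H \<Longrightarrow> burnside_basis p G H P \<phi> \<in> carrier B"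
  unfolding burnside_basis_def by (intro coset_in basis_free)

lemma bmark_basis:
  assumes "subgroup P G" "\<phi> \<in> hom (subgrp G P) H" "a \<in> I \<rightarrow> carrier G" "b \<in> I \<rightarrow> carrier H"
  shows "of_nat (card P) * bmark I a b (burnside_basis p G H P \<phi>) =
    of_nat (card {(h, g). h \<in> carrier H \<and> g \<in> carrier G \<and> (\<forall>k\<in>I. g \<otimes>\<^bsub>G\<^esub> a k \<otimes>\<^bsub>G\<^esub> inv\<^bsub>G\<^esub> g \<in> P \<and>
       b k = h \<otimes>\<^bsub>H\<^esub> \<phi> (g \<otimes>\<^bsub>G\<^esub> a k \<otimes>\<^bsub>G\<^esub> inv\<^bsub>G\<^esub> g) \<otimes>\<^bsub>H\<^esub> inv\<^bsub>H\<^esub> h)})"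
proof -
  interpret std_pair G H P \<phi> by (intro std_pairI assms)
  show ?thesis
    unfolding burnside_basis_def bmark_cls1[OF assms(3,4) std_flfb] mark_std[OF assms(3,4), symmetric]
    by simp
qed

end

text \<open>The second claim is the bilinear extension of \<open>mark_comp\<close>: marks of a
  composite are obtained by matching the marks of the factors along all functions into the middle
  group.\<close>

lemma burnside_comp_closed:
  assumes "burnside_module G H" "burnside_module H K" "x \<in> carrier (burnside p H K)" "y \<in> carrier (burnside p G H)"
  shows "burnside_comp p G H K x y \<in> carrier (burnside p G K)"
    and "finite I \<Longrightarrow> a \<in> I \<rightarrow> carrier G \<Longrightarrow> b \<in> I \<rightarrow> carrier K \<Longrightarrow>
      of_nat (card (carrier H)) * bmark I a b (burnside_comp p G H K x y) =
      (\<Sum>\<theta>\<in>I \<rightarrow>\<^sub>E carrier H. bmark I \<theta> b x * bmark I a \<theta> y)"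
proof -
  interpret GH: burnside_module G H p by fact
  interpret HK: burnside_module H K p by fact
  interpret GK: burnside_module G K p by unfold_locales
  define f where "f = burnside_rep x"
  define g where "g = burnside_rep y"
  have f: "f \<in> burnside_free p H K" using HK.carrier_rep assms(3) by (simp add: f_def)
  have g: "g \<in> burnside_free p G H" using GH.carrier_rep assms(4) by (simp add: g_def)
  define h where "h = (\<Sum>c\<in>Poly_Mapping.keys f. \<Sum>d\<in>Poly_Mapping.keys g.
           Poly_Mapping.single (class_comp G H K c d)
             (Poly_Mapping.lookup f c * Poly_Mapping.lookup g d))"
  have comp: "burnside_comp p G H K x y = burnside_coset p G K h"
    by (simp add: burnside_comp_def h_def f_def g_def Let_def)
  have kc: "\<exists>X :: ('a, nat) biset. finite_left_free_biset H K X \<and> c = iso_class H K X"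
    if "c \<in> Poly_Mapping.keys f" for c
    using f that by (auto simp: burnside_free_def iso_classes_def)
  have kd: "\<exists>X :: ('a, nat) biset. finite_left_free_biset G H X \<and> c = iso_class G H X"
    if "c \<in> Poly_Mapping.keys g" for c
    using g that by (auto simp: burnside_free_def iso_classes_def)
  have cc: "class_comp G H K c d \<in> iso_classes G K"
    and cm: "finite I \<Longrightarrow> a \<in> I \<rightarrow> carrier G \<Longrightarrow> b \<in> I \<rightarrow> carrier K \<Longrightarrow>
      card (carrier H) * cmark I a b (class_comp G H K c d) =
      (\<Sum>\<theta>\<in>I \<rightarrow>\<^sub>E carrier H. cmark I \<theta> b c * cmark I a \<theta> d)"
    if c: "c \<in> Poly_Mapping.keys f" and d: "d \<in> Poly_Mapping.keys g" for c d and I :: "'b set" and a b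
  proof -
    obtain X :: "('a, nat) biset" where X: "finite_left_free_biset H K X" "c = iso_class H K X"
      using kc c by blast
    obtain Y :: "('a, nat) biset" where Y: "finite_left_free_biset G H Y" "d = iso_class G H Y"
      using kd d by blast
    interpret biset_pair G H K X Y
      by (simp add: biset_pair_def lf_bisetI GH.G.fin_group_axioms GH.H.fin_group_axioms
          HK.H.fin_group_axioms X Y)
    have eq: "class_comp G H K c d = iso_class G K (biset_comp H X Y)"
      unfolding X(2) Y(2) using X(1) Y(1)
      by (intro class_comp_eq GH.G.fin_group_axioms GH.H.fin_group_axioms HK.H.fin_group_axioms)
    show "class_comp G H K c d \<in> iso_classes G K"
      unfolding eq using biset_comp_flfb by (rule iso_class_in)
    assume I: "finite I" "a \<in> I \<rightarrow> carrier G" "b \<in> I \<rightarrow> carrier K"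
    have "card (carrier H) * cmark I a b (class_comp G H K c d) =
        (\<Sum>\<theta>\<in>I \<rightarrow>\<^sub>E carrier H. mark I \<theta> b X * mark I a \<theta> Y)"
      unfolding eq using I by (simp add: cmark_iso_class[OF biset_comp_flfb] mark_comp)
    also have "\<dots> = (\<Sum>\<theta>\<in>I \<rightarrow>\<^sub>E carrier H. cmark I \<theta> b c * cmark I a \<theta> d)"
      unfolding X(2) Y(2)
      using I X(1) Y(1) by (intro sum.cong refl) (auto simp: cmark_iso_class PiE_def)
    finally show "card (carrier H) * cmark I a b (class_comp G H K c d) = \<dots>" .
  qed
  have lk: "Poly_Mapping.lookup f c * Poly_Mapping.lookup g d \<in> carrier (Zloc p)" for c d
    using f g by (auto simp: burnside_free_def intro: Zloc_mult)
  have h: "h \<in> burnside_free p G K"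
    unfolding h_def
  proof (intro GK.free_sum)
    fix c d assume "c \<in> Poly_Mapping.keys f" "d \<in> Poly_Mapping.keys g"
    thus "Poly_Mapping.single (class_comp G H K c d)
        (Poly_Mapping.lookup f c * Poly_Mapping.lookup g d) \<in> burnside_free p G K"
      using cc lk by (auto simp: burnside_free_def lookup_single when_def Zloc_0)
  qed
  show "burnside_comp p G H K x y \<in> carrier (burnside p G K)"
    unfolding comp using h by (rule GK.coset_in)
  assume I: "finite I" "a \<in> I \<rightarrow> carrier G" "b \<in> I \<rightarrow> carrier K"
  have "of_nat (card (carrier H)) * bmark I a b (burnside_comp p G H K x y) =
      of_nat (card (carrier H)) * fmark I a b h"
    unfolding comp using h I by (simp add: GK.bmark_coset)
  also have "\<dots> = (\<Sum>c\<in>Poly_Mapping.keys f. \<Sum>d\<in>Poly_Mapping.keys g.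
      Poly_Mapping.lookup f c * Poly_Mapping.lookup g d *
      of_nat (card (carrier H) * cmark I a b (class_comp G H K c d)))"
    by (simp add: h_def fmark_sum fmark_single sum_distrib_left mult_ac)
  also have "\<dots> = (\<Sum>c\<in>Poly_Mapping.keys f. \<Sum>d\<in>Poly_Mapping.keys g. \<Sum>\<theta>\<in>I \<rightarrow>\<^sub>E carrier H.
      (Poly_Mapping.lookup f c * of_nat (cmark I \<theta> b c)) *
      (Poly_Mapping.lookup g d * of_nat (cmark I a \<theta> d)))"
    by (intro sum.cong refl) (simp only: cm[OF _ _ I] of_nat_sum of_nat_mult sum_distrib_left mult_ac)
  also have "\<dots> = (\<Sum>c\<in>Poly_Mapping.keys f. \<Sum>\<theta>\<in>I \<rightarrow>\<^sub>E carrier H. \<Sum>d\<in>Poly_Mapping.keys g.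
      (Poly_Mapping.lookup f c * of_nat (cmark I \<theta> b c)) *
      (Poly_Mapping.lookup g d * of_nat (cmark I a \<theta> d)))"
    by (intro sum.cong refl sum.swap)
  also have "\<dots> = (\<Sum>\<theta>\<in>I \<rightarrow>\<^sub>E carrier H. \<Sum>c\<in>Poly_Mapping.keys f. \<Sum>d\<in>Poly_Mapping.keys g.
      (Poly_Mapping.lookup f c * of_nat (cmark I \<theta> b c)) *
      (Poly_Mapping.lookup g d * of_nat (cmark I a \<theta> d)))"
    by (rule sum.swap)
  also have "\<dots> = (\<Sum>\<theta>\<in>I \<rightarrow>\<^sub>E carrier H. bmark I \<theta> b x * bmark I a \<theta> y)"
    by (simp add: bmark_def fmark_def sum_product flip: f_def g_def)
  finally show "of_nat (card (carrier H)) * bmark I a b (burnside_comp p G H K x y) = \<dots>" .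
qed

subsection \<open>Generation by transitive bisets\<close>

text \<open>Extensionality gives one function per homomorphism and makes the index set finite.
  Conjugate pairs are all kept, although they name the same basis element.\<close>

definition hom_pairs :: "'a monoid \<Rightarrow> 'a monoid \<Rightarrow> ('a set \<times> ('a \<Rightarrow> 'a)) set" where
  "hom_pairs G H = {(P, \<phi>). subgroup P G \<and> \<phi> \<in> hom (subgrp G P) H \<and> \<phi> \<in> extensional P}"

abbreviation std_cls :: "'a monoid \<Rightarrow> 'a monoid \<Rightarrow> 'a set \<times> ('a \<Rightarrow> 'a) \<Rightarrow> ('a biset_class \<Rightarrow>\<^sub>0 rat)" where
  "std_cls G H i \<equiv> cls1 (iso_class G H (std_biset G H (fst i) (snd i)))"

lemma finite_hom_pairs:
  assumes "finite (carrier G)" "finite (carrier H)"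
  shows "finite (hom_pairs G H)"
proof (rule finite_subset)
  show "hom_pairs G H \<subseteq> Sigma (Pow (carrier G)) (\<lambda>Q. Q \<rightarrow>\<^sub>E carrier H)"
    by (auto simp: hom_pairs_def hom_def PiE_def dest: subgroup.mem_carrier)
  show "finite (Sigma (Pow (carrier G)) (\<lambda>Q. Q \<rightarrow>\<^sub>E carrier H))"
    using assms by (intro finite_SigmaI finite_PiE) (auto intro: finite_subset)
qed

lemma (in lf_biset) restrict_flfb:
  assumes "A \<subseteq> points X" "\<And>x h. x \<in> A \<Longrightarrow> h \<in> carrier H \<Longrightarrow> lact X h x \<in> A"
    "\<And>x g. x \<in> A \<Longrightarrow> g \<in> carrier G \<Longrightarrow> ract X x g \<in> A"
  shows "finite_left_free_biset G H (X\<lparr>points := A\<rparr>)"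
proof -
  have X: "x \<in> points X" if "x \<in> A" for x using assms(1) that by blast
  have "is_biset G H (X\<lparr>points := A\<rparr>)"
    using X assms(2,3) by (auto simp: is_biset_def lact_one ract_one lact_mult ract_mult ract_lact)
  moreover have "\<forall>x\<in>A. \<forall>h\<in>carrier H. lact X h x = x \<longrightarrow> h = \<one>\<^bsub>H\<^esub>" using X free by blast
  ultimately show ?thesis
    using finite_subset[OF assms(1) fin_points] by (simp add: finite_left_free_biset_def)
qed

text \<open>In the orbit of \<open>x0\<close> under both groups, \<open>P\<close> consists of the
  \<open>g\<close> for which x0 g lies in the left orbit of \<open>x0\<close>. Freeness gives a
  unique \<open>h\<close> with h x0 = x0 g, and \<phi> is g -> h; its graph is the stabiliser, so
  \<open>transitive_iso_std\<close> identifies the orbit. The complement is stable because both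
  groups act invertibly.\<close>

lemma (in lf_biset) orbit_decomposition:
  assumes x0: "x0 \<in> points X"
  obtains A P \<phi> where "A \<subseteq> points X" "x0 \<in> A" "(P, \<phi>) \<in> hom_pairs G H"
    "finite_left_free_biset G H (X\<lparr>points := A\<rparr>)"
    "finite_left_free_biset G H (X\<lparr>points := points X - A\<rparr>)"
    "biset_iso G H (std_biset G H P \<phi>) (X\<lparr>points := A\<rparr>)"
proof -
  define A where "A = {lact X h (ract X x0 g) | h g. h \<in> carrier H \<and> g \<in> carrier G}"
  define P where "P = {g \<in> carrier G. \<exists>h\<in>carrier H. lact X h x0 = ract X x0 g}"
  define \<phi> where "\<phi> = (\<lambda>g\<in>P. THE h. h \<in> carrier H \<and> lact X h x0 = ract X x0 g)"
  have AX: "A \<subseteq> points X" using x0 by (auto simp: A_def lact_closed ract_closed)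
  have "lact X \<one>\<^bsub>H\<^esub> (ract X x0 \<one>\<^bsub>G\<^esub>) = x0" using x0 by (simp add: lact_one ract_one)
  hence xA: "x0 \<in> A" unfolding A_def using G.one_closed H.one_closed by force
  have Al: "lact X h x \<in> A" if x: "x \<in> A" and h: "h \<in> carrier H" for x h
  proof -
    obtain h' g where "x = lact X h' (ract X x0 g)" "h' \<in> carrier H" "g \<in> carrier G"
      using x by (auto simp: A_def)
    hence "lact X h x = lact X (h \<otimes>\<^bsub>H\<^esub> h') (ract X x0 g)" "h \<otimes>\<^bsub>H\<^esub> h' \<in> carrier H" "g \<in> carrier G"
      using x0 that by (simp_all add: lact_mult ract_closed)
    thus ?thesis unfolding A_def by blast
  qed
  have Ar: "ract X x g \<in> A" if x: "x \<in> A" and g: "g \<in> carrier G" for x g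
  proof -
    obtain h g' where "x = lact X h (ract X x0 g')" "h \<in> carrier H" "g' \<in> carrier G"
      using x by (auto simp: A_def)
    hence "ract X x g = lact X h (ract X x0 (g' \<otimes>\<^bsub>G\<^esub> g))" "h \<in> carrier H" "g' \<otimes>\<^bsub>G\<^esub> g \<in> carrier G"
      using x0 that by (simp_all add: ract_mult ract_closed ract_lact)
    thus ?thesis unfolding A_def by blast
  qed
  have flA: "finite_left_free_biset G H (X\<lparr>points := A\<rparr>)"
    by (rule restrict_flfb) (fact AX Al Ar)+
  have flB: "finite_left_free_biset G H (X\<lparr>points := points X - A\<rparr>)"
  proof (rule restrict_flfb)
    fix x h assume x: "x \<in> points X - A" and h: "h \<in> carrier H"
    have "lact X h x \<notin> A"
    proof
      assume "lact X h x \<in> A"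
      hence "lact X (inv\<^bsub>H\<^esub> h) (lact X h x) \<in> A" by (rule Al) (use h in simp)
      thus False using x h by (simp add: lact_inv)
    qed
    thus "lact X h x \<in> points X - A" using x h by (simp add: lact_closed)
  next
    fix x g assume x: "x \<in> points X - A" and g: "g \<in> carrier G"
    have "ract X x g \<notin> A"
    proof
      assume "ract X x g \<in> A"
      hence "ract X (ract X x g) (inv\<^bsub>G\<^esub> g) \<in> A" by (rule Ar) (use g in simp)
      thus False using x g by (simp add: ract_inv)
    qed
    thus "ract X x g \<in> points X - A" using x g by (simp add: ract_closed)
  qed auto
  have \<phi>: "\<phi> g \<in> carrier H" "lact X (\<phi> g) x0 = ract X x0 g" if "g \<in> P" for g
  proof -
    have "\<exists>!h. h \<in> carrier H \<and> lact X h x0 = ract X x0 g"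
      using that x0 lact_cancel unfolding P_def by (auto intro: lact_cancel[OF x0])
    from theI'[OF this] show "\<phi> g \<in> carrier H" "lact X (\<phi> g) x0 = ract X x0 g"
      using that by (simp_all add: \<phi>_def)
  qed
  have \<phi>eq: "\<phi> g = h" if "g \<in> P" "h \<in> carrier H" "lact X h x0 = ract X x0 g" for g h
    using lact_cancel[OF x0 \<phi>(1)[OF that(1)] that(2)] \<phi>(2)[OF that(1)] that(3) by simp
  have PG: "g \<in> carrier G" if "g \<in> P" for g using that by (simp add: P_def)
  have mult: "lact X (\<phi> g \<otimes>\<^bsub>H\<^esub> \<phi> g') x0 = ract X x0 (g \<otimes>\<^bsub>G\<^esub> g')" if "g \<in> P" "g' \<in> P" for g g'
    using that \<phi> x0 PG by (simp add: lact_mult ract_mult) (simp add: flip: ract_lact)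
  have P: "subgroup P G"
  proof (rule G.subgroupI)
    show "P \<subseteq> carrier G" by (auto simp: P_def)
    have "lact X \<one>\<^bsub>H\<^esub> x0 = ract X x0 \<one>\<^bsub>G\<^esub>" using x0 by (simp add: lact_one ract_one)
    thus "P \<noteq> {}" unfolding P_def using G.one_closed H.one_closed by blast
    fix g assume g: "g \<in> P"
    have "lact X (inv\<^bsub>H\<^esub> (\<phi> g)) x0 = lact X (inv\<^bsub>H\<^esub> (\<phi> g)) (ract X (ract X x0 g) (inv\<^bsub>G\<^esub> g))"
      using x0 g PG by (simp add: ract_inv)
    also have "\<dots> = lact X (inv\<^bsub>H\<^esub> (\<phi> g)) (ract X (lact X (\<phi> g) x0) (inv\<^bsub>G\<^esub> g))"
      by (simp only: \<phi>(2)[OF g])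
    also have "\<dots> = ract X x0 (inv\<^bsub>G\<^esub> g)"
      using x0 PG[OF g] \<phi>(1)[OF g] by (simp add: ract_closed lact_closed ract_lact lact_inv)
    finally have "lact X (inv\<^bsub>H\<^esub> (\<phi> g)) x0 = ract X x0 (inv\<^bsub>G\<^esub> g)" .
    moreover have "inv\<^bsub>H\<^esub> (\<phi> g) \<in> carrier H" "inv\<^bsub>G\<^esub> g \<in> carrier G"
      using PG[OF g] \<phi>(1)[OF g] by simp_all
    ultimately show "inv\<^bsub>G\<^esub> g \<in> P" unfolding P_def by blast
    fix g' assume g': "g' \<in> P"
    show "g \<otimes>\<^bsub>G\<^esub> g' \<in> P"
      using mult[OF g g'] PG[OF g] PG[OF g'] \<phi>(1)[OF g] \<phi>(1)[OF g'] unfolding P_def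
      by (intro CollectI conjI bexI[of _ "\<phi> g \<otimes>\<^bsub>H\<^esub> \<phi> g'"]) simp_all
  qed
  have hom: "\<phi> \<in> hom (subgrp G P) H"
  proof (rule homI)
    fix x y assume "x \<in> carrier (subgrp G P)" "y \<in> carrier (subgrp G P)"
    hence xy: "x \<in> P" "y \<in> P" by auto
    show "\<phi> (x \<otimes>\<^bsub>subgrp G P\<^esub> y) = \<phi> x \<otimes>\<^bsub>H\<^esub> \<phi> y"
      using xy mult[OF xy] subgroup.m_closed[OF P xy] \<phi>(1) by (simp add: \<phi>eq)
  qed (use \<phi> in auto)
  interpret A: lf_biset G H "X\<lparr>points := A\<rparr>" by unfold_locales (rule flA)
  have "biset_iso G H (std_biset G H P \<phi>) (X\<lparr>points := A\<rparr>)"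
  proof (rule A.transitive_iso_std[OF P hom, of x0])
    show "lact (X\<lparr>points := A\<rparr>) h x0 = ract (X\<lparr>points := A\<rparr>) x0 g \<longleftrightarrow> g \<in> P \<and> h = \<phi> g"
      if hg: "h \<in> carrier H" "g \<in> carrier G" for h g
    proof
      assume e: "lact (X\<lparr>points := A\<rparr>) h x0 = ract (X\<lparr>points := A\<rparr>) x0 g"
      hence "g \<in> P" using hg by (auto simp: P_def)
      thus "g \<in> P \<and> h = \<phi> g" using \<phi>eq[of g h] e hg by simp
    qed (use \<phi>(2) in auto)
  qed (use xA in \<open>auto simp: A_def\<close>)
  moreover have "(P, \<phi>) \<in> hom_pairs G H" using P hom by (simp add: hom_pairs_def \<phi>_def)
  ultimately show ?thesis using that AX xA flA flB by blast
qed

context burnside_module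
begin

text \<open>The empty biset is isomorphic to its double, so the relation for this sum reads [X] -
  [X] - [X] = 0.\<close>

lemma empty_rels:
  assumes "finite_left_free_biset G H X" "points X = {}"
  shows "cls1 (iso_class G H X) \<in> rels"
proof -
  have "biset_iso G H (biset_sum X X) X"
    using assms(2) by (auto simp: biset_iso_def biset_sum_def Plus_def bij_betw_def)
  from rels_uminus[OF rels_sum[OF assms(1,1) this]] show ?thesis by simp
qed

lemma std_cls_free: "i \<in> hom_pairs G H \<Longrightarrow> std_cls G H i \<in> free"
  by (auto simp: hom_pairs_def intro: basis_free)

text \<open>Splitting off one orbit at a time writes every class, modulo relations, as a sum of
  transitive ones. A property that respects linear combinations and does not see relations is
  therefore decided on the elements [P, \<phi>].\<close>

lemma free_induct [consumes 1, case_names base zero add scale rels]: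
  assumes f: "f \<in> free"
    and base: "\<And>i. i \<in> hom_pairs G H \<Longrightarrow> Q (std_cls G H i)"
    and zero: "Q 0"
    and add: "\<And>f g. f \<in> free \<Longrightarrow> g \<in> free \<Longrightarrow> Q f \<Longrightarrow> Q g \<Longrightarrow> Q (f + g)"
    and scale: "\<And>r f. r \<in> carrier (Zloc p) \<Longrightarrow> f \<in> free \<Longrightarrow> Q f \<Longrightarrow> Q (scale r f)"
    and rels: "\<And>f g. f \<in> free \<Longrightarrow> Q f \<Longrightarrow> g - f \<in> rels \<Longrightarrow> Q g"
  shows "Q f"
proof -
  have X: "Q (cls1 (iso_class G H X))" if "finite_left_free_biset G H X" for X :: "('a, nat) biset"
    using that
  proof (induction "card (points X)" arbitrary: X rule: less_induct)
    case less
    interpret lf_biset G H X by unfold_locales (rule less.prems)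
    show ?case
    proof (cases "points X = {}")
      case True
      show ?thesis using rels[OF free_zero zero] empty_rels[OF less.prems True] by simp
    next
      case False
      then obtain x0 where "x0 \<in> points X" by blast
      from orbit_decomposition[OF this] obtain A P \<phi> where A: "A \<subseteq> points X" "x0 \<in> A"
        "(P, \<phi>) \<in> hom_pairs G H" "finite_left_free_biset G H (X\<lparr>points := A\<rparr>)"
        "finite_left_free_biset G H (X\<lparr>points := points X - A\<rparr>)"
        "biset_iso G H (std_biset G H P \<phi>) (X\<lparr>points := A\<rparr>)" .
      let ?A = "X\<lparr>points := A\<rparr>" and ?B = "X\<lparr>points := points X - A\<rparr>"
      have "points X - A \<subset> points X" using A(1,2) by auto
      hence QB: "Q (cls1 (iso_class G H ?B))"
        using A(5) fin_points by (intro less.hyps) (auto intro: psubset_card_mono)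
      have "iso_class G H (std_biset G H P \<phi>) = iso_class G H ?A"
        by (rule iso_class_eq[OF A(6)], rule std_pair.std_flfb, rule std_pairI)
           (use A(3) in \<open>auto simp: hom_pairs_def\<close>)
      hence QA: "Q (cls1 (iso_class G H ?A))" using base[OF A(3)] by simp
      have "biset_iso G H (biset_sum ?A ?B) X" by (rule biset_sum_iso) (use A(1) in auto)
      hence "cls1 (iso_class G H X) - cls1 (iso_class G H ?A) - cls1 (iso_class G H ?B) \<in> rels"
        using A(4,5) by (intro rels_sum)
      hence "cls1 (iso_class G H X) - (cls1 (iso_class G H ?A) + cls1 (iso_class G H ?B)) \<in> rels"
        by (simp only: diff_diff_add)
      moreover have "Q (cls1 (iso_class G H ?A) + cls1 (iso_class G H ?B))"
        using add free_cls1 A(4,5) QA QB by blast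
      ultimately show ?thesis using rels free_add free_cls1 A(4,5) by blast
    qed
  qed
  have "(\<Sum>c\<in>C. scale (Poly_Mapping.lookup f c) (cls1 c)) \<in> free \<and>
      Q (\<Sum>c\<in>C. scale (Poly_Mapping.lookup f c) (cls1 c))" if "C \<subseteq> Poly_Mapping.keys f" for C
    using finite_subset[OF that finite_keys] that
  proof (induction C rule: finite_induct)
    case empty show ?case using zero free_zero by simp
  next
    case (insert c C)
    hence "c \<in> iso_classes G H" using f by (auto simp: burnside_free_def)
    then obtain X :: "('a, nat) biset" where X': "finite_left_free_biset G H X" "c = iso_class G H X"
      by (auto simp: iso_classes_def)
    have l: "Poly_Mapping.lookup f c \<in> carrier (Zloc p)" using f by (simp add: burnside_free_def)
    have "scale (Poly_Mapping.lookup f c) (cls1 c) \<in> free" "Q (scale (Poly_Mapping.lookup f c) (cls1 c))"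
      unfolding X'(2) using X(1)[OF X'(1)] free_cls1[OF X'(1)] l X'(2) scale free_scale by auto
    thus ?case using insert add free_add by simp
  qed
  from conjunct2[OF this[OF order_refl]] show ?thesis by (simp only: poly_mapping_expand[symmetric])
qed

lemma finite_pairs: "finite (hom_pairs G H)"
  by (rule finite_hom_pairs) (rule G.fin H.fin)+

text \<open>Only spanning over the local ring is claimed. The coefficients are far from unique,
  since \<open>hom_pairs\<close> contains all conjugates of a pair; the detection argument is free
  to move them between conjugates.\<close>

lemma free_span:
  assumes "f \<in> free"
  shows "\<exists>s. (\<forall>i. s i \<in> carrier (Zloc p)) \<and>
    f - (\<Sum>i\<in>hom_pairs G H. scale (s i) (std_cls G H i)) \<in> rels"
  using assms
proof (induction rule: free_induct)
  case (base i)
  have "(\<Sum>j\<in>hom_pairs G H. scale (if j = i then 1 else 0) (std_cls G H j)) =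
      (\<Sum>j\<in>hom_pairs G H. if j = i then std_cls G H j else 0)"
    by (rule sum.cong) auto
  also have "\<dots> = std_cls G H i" using base finite_pairs by simp
  finally show ?case using burnside_rel.zero Zloc_0 Zloc_1
    by (intro exI[of _ "\<lambda>j. if j = i then 1 else 0"]) simp
next
  case zero
  show ?case using burnside_rel.zero Zloc_0 by (intro exI[of _ "\<lambda>_. 0"]) simp
next
  case (add f g)
  then obtain s t where s: "\<forall>i. s i \<in> carrier (Zloc p)" "\<forall>i. t i \<in> carrier (Zloc p)"
    "f - (\<Sum>i\<in>hom_pairs G H. scale (s i) (std_cls G H i)) \<in> rels"
    "g - (\<Sum>i\<in>hom_pairs G H. scale (t i) (std_cls G H i)) \<in> rels" by blast
  from rels_add[OF s(4,3)] s(1,2) show ?case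
    by (intro exI[of _ "\<lambda>i. s i + t i"]) (simp add: scale_add_left sum.distrib Zloc_add algebra_simps)
next
  case (scale r f)
  then obtain s where s: "\<forall>i. s i \<in> carrier (Zloc p)"
    "f - (\<Sum>i\<in>hom_pairs G H. scale (s i) (std_cls G H i)) \<in> rels" by blast
  from rels_scale[OF s(2) scale(1)] s(1) scale(1) show ?case
    by (intro exI[of _ "\<lambda>i. r * s i"]) (simp add: scale_sum Zloc_mult)
next
  case (rels f g)
  then obtain s where s: "\<forall>i. s i \<in> carrier (Zloc p)"
    "f - (\<Sum>i\<in>hom_pairs G H. scale (s i) (std_cls G H i)) \<in> rels" by blast
  from rels_add[OF s(2) rels.hyps(2)] s(1) show ?case by (intro exI[of _ s]) simp
qed

end

text \<open>Right conjugation is a change of base point: the stabiliser of [1, g] in the biset of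
  (Q, \<psi>) is the graph of \<psi> composed with conjugation by \<open>g\<close>, on g^-1 Q
  g.\<close>

lemma std_cls_conj:
  assumes "std_pair G H Q \<psi>" "g \<in> carrier G" "subgroup P G" "\<phi> \<in> hom (subgrp G P) H"
    and P: "\<And>k. k \<in> carrier G \<Longrightarrow> k \<in> P \<longleftrightarrow> g \<otimes>\<^bsub>G\<^esub> k \<otimes>\<^bsub>G\<^esub> inv\<^bsub>G\<^esub> g \<in> Q"
    and \<phi>: "\<And>k. k \<in> P \<Longrightarrow> \<phi> k = \<psi> (g \<otimes>\<^bsub>G\<^esub> k \<otimes>\<^bsub>G\<^esub> inv\<^bsub>G\<^esub> g)"
  shows "iso_class G H (std_biset G H P \<phi>) = iso_class G H (std_biset G H Q \<psi>)"
proof -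
  interpret S: std_pair G H Q \<psi> by fact
  interpret X: lf_biset G H "std_biset G H Q \<psi>" by unfold_locales (rule S.std_flfb)
  interpret S': std_pair G H P \<phi>
    using assms(3,4) by (simp add: std_pair_def std_pair_axioms_def S.G.fin_group_axioms S.H.fin_group_axioms)
  have "biset_iso G H (std_biset G H P \<phi>) (std_biset G H Q \<psi>)"
  proof (rule X.transitive_iso_std[OF assms(3,4)])
    show "S.cls \<one>\<^bsub>H\<^esub> g \<in> points (std_biset G H Q \<psi>)" using assms(2) by (simp add: S.cls_in_points)
  next
    fix x assume "x \<in> points (std_biset G H Q \<psi>)"
    then obtain h g' where "h \<in> carrier H" "g' \<in> carrier G" "x = S.cls h g'"
      by (auto simp: S.points_std)
    thus "\<exists>h\<in>carrier H. \<exists>k\<in>carrier G. x = lact (std_biset G H Q \<psi>) h (ract (std_biset G H Q \<psi>) (S.cls \<one>\<^bsub>H\<^esub> g) k)"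
      using assms(2) by (intro bexI[of _ h] bexI[of _ "inv\<^bsub>G\<^esub> g \<otimes>\<^bsub>G\<^esub> g'"])
        (simp_all add: S.ract_std S.lact_std S.G.inv_mult_cancel)
  next
    fix h k assume hk: "h \<in> carrier H" "k \<in> carrier G"
    let ?q = "g \<otimes>\<^bsub>G\<^esub> k \<otimes>\<^bsub>G\<^esub> inv\<^bsub>G\<^esub> g"
    have "lact (std_biset G H Q \<psi>) h (S.cls \<one>\<^bsub>H\<^esub> g) = ract (std_biset G H Q \<psi>) (S.cls \<one>\<^bsub>H\<^esub> g) k \<longleftrightarrow>
        S.cls \<one>\<^bsub>H\<^esub> (g \<otimes>\<^bsub>G\<^esub> k) = S.cls h g"
      using assms(2) hk by (auto simp: S.ract_std S.lact_std)
    also have "\<dots> \<longleftrightarrow> (\<exists>q\<in>Q. h = \<psi> q \<and> g \<otimes>\<^bsub>G\<^esub> k = q \<otimes>\<^bsub>G\<^esub> g)"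
      using assms(2) hk S.hom_closed by (auto simp: S.cls_eq_iff)
    also have "\<dots> \<longleftrightarrow> (\<exists>q\<in>Q. h = \<psi> q \<and> ?q = q)"
    proof (rule bex_cong[OF refl])
      fix q assume "q \<in> Q"
      hence q: "q \<in> carrier G" by simp
      have "g \<otimes>\<^bsub>G\<^esub> k = q \<otimes>\<^bsub>G\<^esub> g \<longleftrightarrow> ?q = q"
      proof
        assume "g \<otimes>\<^bsub>G\<^esub> k = q \<otimes>\<^bsub>G\<^esub> g" thus "?q = q" using q assms(2) by (simp add: S.G.m_assoc)
      next
        assume "?q = q"
        hence "q \<otimes>\<^bsub>G\<^esub> g = ?q \<otimes>\<^bsub>G\<^esub> g" by simp
        thus "g \<otimes>\<^bsub>G\<^esub> k = q \<otimes>\<^bsub>G\<^esub> g" using q hk assms(2) by (simp add: S.G.m_assoc)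
      qed
      thus "h = \<psi> q \<and> g \<otimes>\<^bsub>G\<^esub> k = q \<otimes>\<^bsub>G\<^esub> g \<longleftrightarrow> h = \<psi> q \<and> ?q = q" by simp
    qed
    also have "\<dots> \<longleftrightarrow> k \<in> P \<and> h = \<phi> k" using P[OF hk(2)] \<phi>[of k] by auto
    finally show "lact (std_biset G H Q \<psi>) h (S.cls \<one>\<^bsub>H\<^esub> g) = ract (std_biset G H Q \<psi>) (S.cls \<one>\<^bsub>H\<^esub> g) k \<longleftrightarrow>
        k \<in> P \<and> h = \<phi> k" .
  qed
  thus ?thesis by (rule iso_class_eq) (rule S'.std_flfb)
qed

subsection \<open>Averaged marks detect elements\<close>

lemma scale_uminus: "scale (- r) f = - scale r f"
  by (rule poly_mapping_eqI) (simp add: lookup_scale)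

text \<open>The morphisms out of each subgroup in a fusion system on \<open>H\<close>, with codomain \<open>H\<close>.\<close>

locale morphism_class = H: fin_group H for H :: "'a monoid" +
  fixes M :: "'a set \<Rightarrow> ('a \<Rightarrow> 'a) set"
  assumes M_hom: "subgroup U H \<Longrightarrow> \<eta> \<in> M U \<Longrightarrow>
      \<eta> \<in> hom (subgrp H U) H \<and> inj_on \<eta> U \<and> \<eta> \<in> extensional U"
    and M_conj: "subgroup U H \<Longrightarrow> h \<in> carrier H \<Longrightarrow>
      (\<lambda>x\<in>U. h \<otimes>\<^bsub>H\<^esub> x \<otimes>\<^bsub>H\<^esub> inv\<^bsub>H\<^esub> h) \<in> M U"
    and M_comp: "subgroup U H \<Longrightarrow> \<eta> \<in> M U \<Longrightarrow> \<eta>' \<in> M (\<eta> ` U) \<Longrightarrow> compose U \<eta>' \<eta> \<in> M U"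
    and M_inv: "subgroup U H \<Longrightarrow> \<eta> \<in> M U \<Longrightarrow> (\<lambda>y\<in>\<eta> ` U. inv_into U \<eta> y) \<in> M (\<eta> ` U)"
    and M_restrict: "subgroup U H \<Longrightarrow> subgroup V H \<Longrightarrow> V \<subseteq> U \<Longrightarrow> \<eta> \<in> M U \<Longrightarrow> restrict \<eta> V \<in> M V"
begin

lemma M_closed: "subgroup U H \<Longrightarrow> \<eta> \<in> M U \<Longrightarrow> u \<in> U \<Longrightarrow> \<eta> u \<in> carrier H"
  using M_hom by (fastforce simp: hom_def)

lemma M_image_subgroup: "subgroup U H \<Longrightarrow> \<eta> \<in> M U \<Longrightarrow> subgroup (\<eta> ` U) H"
proof -
  assume U: "subgroup U H" "\<eta> \<in> M U"
  interpret U: subgroup U H by fact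
  interpret h: group_hom "subgrp H U" H \<eta>
    using M_hom[OF U] U.subgroup_is_group[OF H.group_axioms] H.group_axioms
    by (simp add: group_hom_def group_hom_axioms_def)
  show "subgroup (\<eta> ` U) H" using h.img_is_subgroup by simp
qed

lemma finite_M: "subgroup U H \<Longrightarrow> finite (M U)"
proof (rule finite_subset)
  assume U: "subgroup U H"
  have "\<eta> \<in> U \<rightarrow>\<^sub>E carrier H" if "\<eta> \<in> M U" for \<eta>
    using M_hom[OF U that] M_closed[OF U that] by (simp add: PiE_def Pi_iff)
  thus "M U \<subseteq> U \<rightarrow>\<^sub>E carrier H" by blast
  show "finite (U \<rightarrow>\<^sub>E carrier H)"
    using U H.fin by (intro finite_PiE) (auto intro: finite_subset dest: subgroup.subset)
qed

lemma M_conj_comp: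
  assumes U: "subgroup U H" "\<eta> \<in> M U" and h: "h \<in> carrier H"
  shows "\<exists>\<eta>'\<in>M U. \<forall>u\<in>U. \<eta>' u = h \<otimes>\<^bsub>H\<^esub> \<eta> u \<otimes>\<^bsub>H\<^esub> inv\<^bsub>H\<^esub> h"
  by (rule bexI[OF _ M_comp[OF U M_conj[OF M_image_subgroup[OF U] h]]]) (simp add: compose_def)

end

locale averaged_marks = burnside_module G H p + morphism_class H M
  for G H :: "'a monoid" and p M
begin

text \<open>A sum and not a mean, since only its vanishing is ever used.\<close>

definition avg :: "'a set \<Rightarrow> ('a \<Rightarrow> 'a) \<Rightarrow> ('a biset_class \<Rightarrow>\<^sub>0 rat) \<Rightarrow> rat" where
  "avg P \<phi> f = (\<Sum>\<eta>\<in>M (\<phi> ` P). fmark P (\<lambda>k. k) (\<lambda>k. \<eta> (\<phi> k)) f)"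

text \<open>The elements that make (P, \<phi>) subconjugate to (Q, \<psi>) when the target is taken
  up to \<open>M\<close>. For \<open>M\<close> the conjugations this decides whether a mark of
  [Q, \<psi>] is nonzero.\<close>

definition transporter :: "'a set \<Rightarrow> ('a \<Rightarrow> 'a) \<Rightarrow> 'a set \<Rightarrow> ('a \<Rightarrow> 'a) \<Rightarrow> 'a set" where
  "transporter P \<phi> Q \<psi> = {g \<in> carrier G. (\<forall>k\<in>P. g \<otimes>\<^bsub>G\<^esub> k \<otimes>\<^bsub>G\<^esub> inv\<^bsub>G\<^esub> g \<in> Q) \<and>
     (\<exists>\<eta>\<in>M (\<phi> ` P). \<forall>k\<in>P. \<eta> (\<phi> k) = \<psi> (g \<otimes>\<^bsub>G\<^esub> k \<otimes>\<^bsub>G\<^esub> inv\<^bsub>G\<^esub> g))}"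

lemma avg_add: "avg P \<phi> (f + g) = avg P \<phi> f + avg P \<phi> g"
  by (simp add: avg_def fmark_add sum.distrib)

lemma avg_scale: "avg P \<phi> (scale r f) = r * avg P \<phi> f"
  by (simp add: avg_def fmark_scale sum_distrib_left)

lemma avg_zero: "avg P \<phi> 0 = 0"
  by (simp add: avg_def fmark_zero)

lemma avg_diff: "avg P \<phi> (f - g) = avg P \<phi> f - avg P \<phi> g"
  by (simp add: avg_def fmark_diff sum_subtractf)

lemma avg_sum: "avg P \<phi> (sum f A) = (\<Sum>i\<in>A. avg P \<phi> (f i))"
  by (induction A rule: infinite_finite_induct) (auto simp: avg_add avg_zero)

lemma image_subgroup:
  assumes "(P, \<phi>) \<in> hom_pairs G H"
  shows "subgroup (\<phi> ` P) H" "\<And>k. k \<in> P \<Longrightarrow> \<phi> k \<in> carrier H" "\<And>k. k \<in> P \<Longrightarrow> k \<in> carrier G"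
proof -
  interpret std_pair G H P \<phi> using assms by (intro std_pairI) (auto simp: hom_pairs_def)
  show "subgroup (\<phi> ` P) H" using hom.img_is_subgroup by simp
  show "\<phi> k \<in> carrier H" "k \<in> carrier G" if "k \<in> P" for k using hom_closed that by auto
qed

lemma card_pair_pos:
  assumes "(Q, \<psi>) \<in> hom_pairs G H" shows "card Q > 0"
proof -
  have "subgroup Q G" using assms by (simp add: hom_pairs_def)
  from subgroup.subset[OF this] subgroup.one_closed[OF this] G.fin show ?thesis
    by (auto simp: card_gt_0_iff intro: finite_subset)
qed

lemma avg_rels:
  assumes "(P, \<phi>) \<in> hom_pairs G H" "f \<in> rels"
  shows "avg P \<phi> f = 0"
  unfolding avg_def
  using image_subgroup[OF assms(1)] assms(2) M_closed[OF image_subgroup(1)[OF assms(1)]]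
  by (intro sum.neutral ballI fmark_rels) auto

text \<open>By \<open>mark_std\<close> each mark counts pairs (h, g). For different \<eta> these
  sets are disjoint, because \<eta> is determined by its values on \<phi>(P); in their union
  \<open>h\<close> becomes free, because conjugation by \<open>h\<close> can be absorbed into
  \<eta>.\<close>

lemma avg_std:
  assumes P: "(P, \<phi>) \<in> hom_pairs G H" and Q: "(Q, \<psi>) \<in> hom_pairs G H"
  shows "of_nat (card Q) * avg P \<phi> (std_cls G H (Q, \<psi>)) =
    of_nat (card (carrier H) * card (transporter P \<phi> Q \<psi>))"
proof -
  note P' = image_subgroup[OF P]
  interpret S: std_pair G H Q \<psi> using Q by (intro std_pairI) (auto simp: hom_pairs_def)
  let ?c = "\<lambda>g k. g \<otimes>\<^bsub>G\<^esub> k \<otimes>\<^bsub>G\<^esub> inv\<^bsub>G\<^esub> g"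
  let ?A = "\<lambda>\<eta>. {(h, g). h \<in> carrier H \<and> g \<in> carrier G \<and> (\<forall>k\<in>P. ?c g k \<in> Q \<and>
       \<eta> (\<phi> k) = h \<otimes>\<^bsub>H\<^esub> \<psi> (?c g k) \<otimes>\<^bsub>H\<^esub> inv\<^bsub>H\<^esub> h)}"
  have "of_nat (card Q) * fmark P (\<lambda>k. k) (\<lambda>k. \<eta> (\<phi> k)) (std_cls G H (Q, \<psi>)) = of_nat (card (?A \<eta>))"
    if "\<eta> \<in> M (\<phi> ` P)" for \<eta>
  proof -
    have ab: "(\<lambda>k. k) \<in> P \<rightarrow> carrier G" "(\<lambda>k. \<eta> (\<phi> k)) \<in> P \<rightarrow> carrier H"
      using P' M_closed[OF P'(1) that] by auto
    show ?thesis
      unfolding fst_conv snd_conv fmark_cls1 cmark_iso_class[OF S.std_flfb ab] S.mark_std[OF ab, symmetric]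
      by simp
  qed
  hence "of_nat (card Q) * avg P \<phi> (std_cls G H (Q, \<psi>)) = of_nat (\<Sum>\<eta>\<in>M (\<phi> ` P). card (?A \<eta>))"
    by (simp add: avg_def sum_distrib_left)
  also have "(\<Sum>\<eta>\<in>M (\<phi> ` P). card (?A \<eta>)) = card (\<Union>\<eta>\<in>M (\<phi> ` P). ?A \<eta>)"
  proof (rule card_UN_disjoint[symmetric])
    show "finite (M (\<phi> ` P))" using finite_M[OF P'(1)] .
    have "finite (?A \<eta>)" for \<eta>
      by (rule finite_subset[of _ "carrier H \<times> carrier G"]) (use G.fin H.fin in auto)
    thus "\<forall>\<eta>\<in>M (\<phi> ` P). finite (?A \<eta>)" by blast
    show "\<forall>\<eta>\<in>M (\<phi> ` P). \<forall>\<eta>'\<in>M (\<phi> ` P). \<eta> \<noteq> \<eta>' \<longrightarrow> ?A \<eta> \<inter> ?A \<eta>' = {}"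
    proof (intro ballI impI)
      fix \<eta> \<eta>' assume e: "\<eta> \<in> M (\<phi> ` P)" "\<eta>' \<in> M (\<phi> ` P)" "\<eta> \<noteq> \<eta>'"
      have "\<eta> = \<eta>'" if "\<forall>k\<in>P. \<eta> (\<phi> k) = \<eta>' (\<phi> k)"
        using that M_hom[OF P'(1) e(1)] M_hom[OF P'(1) e(2)]
        by (intro extensionalityI[of \<eta> "\<phi> ` P"]) auto
      thus "?A \<eta> \<inter> ?A \<eta>' = {}" using e(3) by auto
    qed
  qed
  also have "(\<Union>\<eta>\<in>M (\<phi> ` P). ?A \<eta>) = carrier H \<times> transporter P \<phi> Q \<psi>"
  proof (intro equalityI subsetI)
    fix z assume "z \<in> (\<Union>\<eta>\<in>M (\<phi> ` P). ?A \<eta>)"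
    then obtain h g \<eta> where z: "z = (h, g)" "h \<in> carrier H" "g \<in> carrier G" "\<eta> \<in> M (\<phi> ` P)"
      "\<forall>k\<in>P. ?c g k \<in> Q \<and> \<eta> (\<phi> k) = h \<otimes>\<^bsub>H\<^esub> \<psi> (?c g k) \<otimes>\<^bsub>H\<^esub> inv\<^bsub>H\<^esub> h" by auto
    obtain \<eta>' where \<eta>': "\<eta>' \<in> M (\<phi> ` P)"
      "\<forall>u\<in>\<phi> ` P. \<eta>' u = inv\<^bsub>H\<^esub> h \<otimes>\<^bsub>H\<^esub> \<eta> u \<otimes>\<^bsub>H\<^esub> inv\<^bsub>H\<^esub> (inv\<^bsub>H\<^esub> h)"
      using M_conj_comp[OF P'(1) z(4), of "inv\<^bsub>H\<^esub> h"] z(2) by auto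
    have "\<eta>' (\<phi> k) = \<psi> (?c g k)" if "k \<in> P" for k
      using \<eta>'(2) z that S.hom_closed by (simp add: H.conj_inv_cancel)
    thus "z \<in> carrier H \<times> transporter P \<phi> Q \<psi>" using z \<eta>'(1) by (auto simp: transporter_def)
  next
    fix z assume "z \<in> carrier H \<times> transporter P \<phi> Q \<psi>"
    then obtain h g \<eta> where z: "z = (h, g)" "h \<in> carrier H" "g \<in> carrier G" "\<eta> \<in> M (\<phi> ` P)"
      "\<forall>k\<in>P. ?c g k \<in> Q" "\<forall>k\<in>P. \<eta> (\<phi> k) = \<psi> (?c g k)" by (auto simp: transporter_def)
    obtain \<eta>' where \<eta>': "\<eta>' \<in> M (\<phi> ` P)" "\<forall>u\<in>\<phi> ` P. \<eta>' u = h \<otimes>\<^bsub>H\<^esub> \<eta> u \<otimes>\<^bsub>H\<^esub> inv\<^bsub>H\<^esub> h"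
      using M_conj_comp[OF P'(1) z(4,2)] by auto
    hence "z \<in> ?A \<eta>'" using z by auto
    thus "z \<in> (\<Union>\<eta>\<in>M (\<phi> ` P). ?A \<eta>)" using \<eta>'(1) by blast
  qed
  finally show ?thesis by (simp add: card_cartesian_product)
qed

text \<open>The factor \<eta>0 can be moved to the other side of the defining equation. There it is
  restricted to the image of \<open>P\<close> and combined with \<eta>, which uses closure of
  \<open>M\<close> under inverses, restriction and composition.\<close>

lemma transporter_M_comp:
  assumes P: "(P, \<phi>) \<in> hom_pairs G H" and Q: "(Q, \<psi>) \<in> hom_pairs G H" and \<eta>0: "\<eta>0 \<in> M (\<psi> ` Q)"
  shows "transporter P \<phi> Q (compose Q \<eta>0 \<psi>) = transporter P \<phi> Q \<psi>"
proof -
  note P' = image_subgroup[OF P] and Q' = image_subgroup[OF Q]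
  let ?c = "\<lambda>g k. g \<otimes>\<^bsub>G\<^esub> k \<otimes>\<^bsub>G\<^esub> inv\<^bsub>G\<^esub> g"
  have aux: "\<exists>\<eta>'\<in>M (\<phi> ` P). \<forall>k\<in>P. \<eta>' (\<phi> k) = \<zeta> (\<eta> (\<phi> k))"
    if "\<eta> \<in> M (\<phi> ` P)" "subgroup V H" "\<zeta> \<in> M V" "\<And>k. k \<in> P \<Longrightarrow> \<eta> (\<phi> k) \<in> V" for \<eta> \<zeta> V
  proof -
    have "restrict \<zeta> (\<eta> ` \<phi> ` P) \<in> M (\<eta> ` \<phi> ` P)"
      by (rule M_restrict[OF that(2) M_image_subgroup[OF P'(1) that(1)] _ that(3)]) (use that(4) in auto)
    thus ?thesis by (intro bexI[OF _ M_comp[OF P'(1) that(1)]]) (auto simp: compose_def)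
  qed
  have hom: "\<eta>0 \<in> hom (subgrp H (\<psi> ` Q)) H" "inj_on \<eta>0 (\<psi> ` Q)" using M_hom[OF Q'(1) \<eta>0] by auto
  show ?thesis
  proof (intro equalityI subsetI)
    fix g assume "g \<in> transporter P \<phi> Q (compose Q \<eta>0 \<psi>)"
    then obtain \<eta> where g: "g \<in> carrier G" "\<And>k. k \<in> P \<Longrightarrow> ?c g k \<in> Q" "\<eta> \<in> M (\<phi> ` P)"
      "\<And>k. k \<in> P \<Longrightarrow> \<eta> (\<phi> k) = \<eta>0 (\<psi> (?c g k))" by (auto simp: transporter_def compose_def)
    let ?\<zeta> = "\<lambda>y\<in>\<eta>0 ` \<psi> ` Q. inv_into (\<psi> ` Q) \<eta>0 y"
    obtain \<eta>' where \<eta>': "\<eta>' \<in> M (\<phi> ` P)" "\<forall>k\<in>P. \<eta>' (\<phi> k) = ?\<zeta> (\<eta> (\<phi> k))"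
      using aux[OF g(3) M_image_subgroup[OF Q'(1) \<eta>0] M_inv[OF Q'(1) \<eta>0]] g(2,4) by auto
    have "\<eta>' (\<phi> k) = \<psi> (?c g k)" if "k \<in> P" for k
      using \<eta>'(2) that g(2,4) hom(2) by auto
    thus "g \<in> transporter P \<phi> Q \<psi>" using g \<eta>'(1) by (auto simp: transporter_def)
  next
    fix g assume "g \<in> transporter P \<phi> Q \<psi>"
    then obtain \<eta> where g: "g \<in> carrier G" "\<And>k. k \<in> P \<Longrightarrow> ?c g k \<in> Q" "\<eta> \<in> M (\<phi> ` P)"
      "\<And>k. k \<in> P \<Longrightarrow> \<eta> (\<phi> k) = \<psi> (?c g k)" by (auto simp: transporter_def)
    obtain \<eta>' where "\<eta>' \<in> M (\<phi> ` P)" "\<forall>k\<in>P. \<eta>' (\<phi> k) = \<eta>0 (\<eta> (\<phi> k))"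
      using aux[OF g(3) Q'(1) \<eta>0] g(2,4) by auto
    thus "g \<in> transporter P \<phi> Q (compose Q \<eta>0 \<psi>)"
      using g by (auto simp: transporter_def compose_def)
  qed
qed

lemma compose_pairs:
  assumes Q: "(Q, \<psi>) \<in> hom_pairs G H" and \<eta>: "\<eta> \<in> M (\<psi> ` Q)"
  shows "(Q, compose Q \<eta> \<psi>) \<in> hom_pairs G H"
proof -
  interpret S: std_pair G H Q \<psi> using Q by (intro std_pairI) (auto simp: hom_pairs_def)
  have "\<eta> \<in> hom (subgrp H (\<psi> ` Q)) H" using M_hom[OF image_subgroup(1)[OF Q] \<eta>] by blast
  hence "compose Q \<eta> \<psi> \<in> hom (subgrp G Q) H"
    by (auto simp: hom_def compose_def S.hom_mult)
  thus ?thesis using Q by (simp add: hom_pairs_def)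
qed

lemma avg_M_comp:
  assumes P: "(P, \<phi>) \<in> hom_pairs G H" and Q: "(Q, \<psi>) \<in> hom_pairs G H" and \<eta>: "\<eta> \<in> M (\<psi> ` Q)"
  shows "avg P \<phi> (std_cls G H (Q, compose Q \<eta> \<psi>)) = avg P \<phi> (std_cls G H (Q, \<psi>))"
proof -
  have "of_nat (card Q) \<noteq> (0 :: rat)" using card_pair_pos[OF Q] by simp
  moreover have "of_nat (card Q) * avg P \<phi> (std_cls G H (Q, compose Q \<eta> \<psi>)) =
      of_nat (card Q) * avg P \<phi> (std_cls G H (Q, \<psi>))"
    unfolding avg_std[OF P Q] avg_std[OF P compose_pairs[OF Q \<eta>]] transporter_M_comp[OF P Q \<eta>] ..
  ultimately show ?thesis by simp
qed

text \<open>Maximality of \<open>P\<close> in the support forces a partner \<open>(Q, \<psi>)\<close> with \<open>P\<close> and \<open>Q\<close> conjugate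
  and \<open>\<psi>\<close> differing from \<open>\<phi>\<close> by a morphism in \<open>M\<close>; the two coefficients can then be merged.\<close>

theorem averaged_marks_detect:
  assumes f: "f \<in> free" and avg: "\<And>P \<phi>. (P, \<phi>) \<in> hom_pairs G H \<Longrightarrow> avg P \<phi> f = 0"
    and rels: "rels \<subseteq> Z"
    and add: "\<And>f g. f \<in> Z \<Longrightarrow> g \<in> Z \<Longrightarrow> f + g \<in> Z"
    and scale: "\<And>r f. r \<in> carrier (Zloc p) \<Longrightarrow> f \<in> Z \<Longrightarrow> scale r f \<in> Z"
    and M: "\<And>Q \<psi> \<eta>. (Q, \<psi>) \<in> hom_pairs G H \<Longrightarrow> \<eta> \<in> M (\<psi> ` Q) \<Longrightarrow>
       std_cls G H (Q, compose Q \<eta> \<psi>) - std_cls G H (Q, \<psi>) \<in> Z"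
  shows "f \<in> Z"
proof -
  \<comment> \<open>The induction replaces \<open>f\<close> by a shorter combination and must know
    that its averaged marks still vanish, so this is made part of the submodule.\<close>
  define Z' where "Z' = {z \<in> Z. \<forall>(P, \<phi>)\<in>hom_pairs G H. avg P \<phi> z = 0}"
  have Z'_add: "f + g \<in> Z'" if "f \<in> Z'" "g \<in> Z'" for f g
    using that add by (auto simp: Z'_def avg_add split: prod.splits)
  have Z'_scale: "scale r f \<in> Z'" if "f \<in> Z'" "r \<in> carrier (Zloc p)" for r f
    using that scale by (auto simp: Z'_def avg_scale split: prod.splits)
  have Z'_rels: "f \<in> Z'" if "f \<in> rels" for f
    using that rels avg_rels by (auto simp: Z'_def)
  have Z'_M: "std_cls G H (Q, compose Q \<eta> \<psi>) - std_cls G H (Q, \<psi>) \<in> Z'"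
    if "(Q, \<psi>) \<in> hom_pairs G H" "\<eta> \<in> M (\<psi> ` Q)" for Q \<psi> \<eta>
    using M[OF that] avg_M_comp[OF _ that] by (auto simp: Z'_def avg_diff simp del: fst_conv snd_conv)
  let ?S = "\<lambda>s. \<Sum>i\<in>hom_pairs G H. scale (s i) (std_cls G H i)"
  have main: "f \<in> Z" if "\<forall>i. s i \<in> carrier (Zloc p)" "f - ?S s \<in> Z'" for s
    using that
  proof (induction "card {i \<in> hom_pairs G H. s i \<noteq> 0}" arbitrary: s rule: less_induct)
    case less
    let ?supp = "{i \<in> hom_pairs G H. s i \<noteq> 0}"
    have fin: "finite ?supp" using finite_pairs by simp
    show ?case
    proof (cases "?supp = {}")
      case True
      hence "?S s = 0" by (intro sum.neutral) auto
      thus ?thesis using less.prems(2) by (simp add: Z'_def)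
    next
      case False
      have "Max ((\<lambda>i. card (fst i)) ` ?supp) \<in> (\<lambda>i. card (fst i)) ` ?supp"
        using fin False by (intro Max_in) auto
      then obtain P \<phi> where P: "(P, \<phi>) \<in> ?supp" "card P = Max ((\<lambda>i. card (fst i)) ` ?supp)" by force
      have max: "card Q \<le> card P" if "(Q, \<psi>) \<in> ?supp" for Q \<psi>
        unfolding P(2) using fin that by (intro Max_ge) (auto intro!: image_eqI[of _ _ "(Q, \<psi>)"])
      have P': "(P, \<phi>) \<in> hom_pairs G H" "s (P, \<phi>) \<noteq> 0" using P(1) by auto
      note PP = image_subgroup[OF P'(1)]
      have fP: "finite P" using PP(3) G.fin by (meson finite_subset subsetI)
      \<comment> \<open>If no other pair of the support receives \<open>P\<close>, the averaged mark
        of \<open>f\<close> at (P, \<phi>) reduces to the single term of (P, \<phi>), which is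
        nonzero because the unit lies in its transporter.\<close>
      have "\<exists>Q \<psi>. (Q, \<psi>) \<in> ?supp \<and> (Q, \<psi>) \<noteq> (P, \<phi>) \<and> transporter P \<phi> Q \<psi> \<noteq> {}"
      proof (rule ccontr)
        assume no: "\<not> ?thesis"
        have "0 = avg P \<phi> (f - ?S s)" using less.prems(2) P'(1) by (auto simp: Z'_def)
        also have "\<dots> = - (\<Sum>i\<in>hom_pairs G H. s i * avg P \<phi> (std_cls G H i))"
          using avg[OF P'(1)] by (simp add: avg_diff avg_sum avg_scale)
        also have "(\<Sum>i\<in>hom_pairs G H. s i * avg P \<phi> (std_cls G H i)) =
            (\<Sum>i\<in>{(P, \<phi>)}. s i * avg P \<phi> (std_cls G H i))"
        proof (rule sum.mono_neutral_right[OF finite_pairs])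
          show "{(P, \<phi>)} \<subseteq> hom_pairs G H" using P'(1) by simp
          show "\<forall>i\<in>hom_pairs G H - {(P, \<phi>)}. s i * avg P \<phi> (std_cls G H i) = 0"
          proof
            fix i assume i: "i \<in> hom_pairs G H - {(P, \<phi>)}"
            obtain Q \<psi> where i': "i = (Q, \<psi>)" by (cases i)
            show "s i * avg P \<phi> (std_cls G H i) = 0"
            proof (cases "s i = 0")
              case False
              hence "transporter P \<phi> Q \<psi> = {}" using no i i' by auto
              moreover have Q: "(Q, \<psi>) \<in> hom_pairs G H" using i i' by simp
              ultimately have "of_nat (card Q) * avg P \<phi> (std_cls G H i) = 0"
                unfolding i' avg_std[OF P'(1) Q] by simp
              moreover have "card Q \<noteq> 0" using card_pair_pos[OF Q] by simp
              ultimately show ?thesis by simp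
            qed simp
          qed
        qed
        finally have "avg P \<phi> (std_cls G H (P, \<phi>)) = 0" using P'(2) by simp
        hence "of_nat (card (carrier H) * card (transporter P \<phi> P \<phi>)) = (0 :: rat)"
          unfolding avg_std[OF P'(1) P'(1), symmetric] by simp
        hence "transporter P \<phi> P \<phi> = {}"
          using H.fin H.one_closed G.fin by (auto simp: transporter_def)
        moreover have "\<one>\<^bsub>G\<^esub> \<in> transporter P \<phi> P \<phi>"
          using PP by (auto simp: transporter_def intro!: bexI[OF _ M_conj[OF PP(1) H.one_closed]])
        ultimately show False by simp
      qed
      then obtain Q \<psi> g where Q: "(Q, \<psi>) \<in> ?supp" "(Q, \<psi>) \<noteq> (P, \<phi>)" and g: "g \<in> transporter P \<phi> Q \<psi>"
        by blast
      from g obtain \<eta> where g: "g \<in> carrier G" "\<And>k. k \<in> P \<Longrightarrow> g \<otimes>\<^bsub>G\<^esub> k \<otimes>\<^bsub>G\<^esub> inv\<^bsub>G\<^esub> g \<in> Q"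
        and \<eta>: "\<eta> \<in> M (\<phi> ` P)" "\<And>k. k \<in> P \<Longrightarrow> \<eta> (\<phi> k) = \<psi> (g \<otimes>\<^bsub>G\<^esub> k \<otimes>\<^bsub>G\<^esub> inv\<^bsub>G\<^esub> g)"
        by (auto simp: transporter_def)
      have Q': "(Q, \<psi>) \<in> hom_pairs G H" using Q by simp
      note QQ = image_subgroup[OF Q']
      have inj: "inj_on (\<lambda>k. g \<otimes>\<^bsub>G\<^esub> k \<otimes>\<^bsub>G\<^esub> inv\<^bsub>G\<^esub> g) (carrier G)"
        using g(1) by (intro inj_onI) (rule G.conjugation_is_inj)
      have fQ: "finite Q" using QQ(3) G.fin by (meson finite_subset subsetI)
      \<comment> \<open>\<open>P\<close> has maximal order in the support, so the conjugate of
        \<open>P\<close> that lies in \<open>Q\<close> fills it.\<close>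
      have im: "(\<lambda>k. g \<otimes>\<^bsub>G\<^esub> k \<otimes>\<^bsub>G\<^esub> inv\<^bsub>G\<^esub> g) ` P = Q"
      proof (rule card_seteq[OF fQ])
        show "(\<lambda>k. g \<otimes>\<^bsub>G\<^esub> k \<otimes>\<^bsub>G\<^esub> inv\<^bsub>G\<^esub> g) ` P \<subseteq> Q" using g(2) by blast
        have "card ((\<lambda>k. g \<otimes>\<^bsub>G\<^esub> k \<otimes>\<^bsub>G\<^esub> inv\<^bsub>G\<^esub> g) ` P) = card P"
          using inj PP(3) by (intro card_image) (auto intro: inj_on_subset)
        thus "card Q \<le> card ((\<lambda>k. g \<otimes>\<^bsub>G\<^esub> k \<otimes>\<^bsub>G\<^esub> inv\<^bsub>G\<^esub> g) ` P)" using max[OF Q(1)] by simp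
      qed
      have "iso_class G H (std_biset G H P (compose P \<eta> \<phi>)) = iso_class G H (std_biset G H Q \<psi>)"
      proof (rule std_cls_conj[OF _ g(1)])
        show "std_pair G H Q \<psi>" using Q' by (intro std_pairI) (auto simp: hom_pairs_def)
        show "subgroup P G" "compose P \<eta> \<phi> \<in> hom (subgrp G P) H"
          using compose_pairs[OF P'(1) \<eta>(1)] by (auto simp: hom_pairs_def)
        fix k assume k: "k \<in> carrier G"
        have "k \<in> P" if "g \<otimes>\<^bsub>G\<^esub> k \<otimes>\<^bsub>G\<^esub> inv\<^bsub>G\<^esub> g \<in> Q"
        proof -
          obtain l where "l \<in> P" "g \<otimes>\<^bsub>G\<^esub> k \<otimes>\<^bsub>G\<^esub> inv\<^bsub>G\<^esub> g = g \<otimes>\<^bsub>G\<^esub> l \<otimes>\<^bsub>G\<^esub> inv\<^bsub>G\<^esub> g"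
            using \<open>_ \<in> Q\<close> unfolding im[symmetric] by blast
          thus ?thesis using inj_onD[OF inj, of k l] k PP(3) by auto
        qed
        thus "k \<in> P \<longleftrightarrow> g \<otimes>\<^bsub>G\<^esub> k \<otimes>\<^bsub>G\<^esub> inv\<^bsub>G\<^esub> g \<in> Q" using g(2) by blast
      qed (simp add: compose_def \<eta>(2))
      hence "std_cls G H (Q, \<psi>) - std_cls G H (P, \<phi>) \<in> Z'" using Z'_M[OF P'(1) \<eta>(1)] by simp
      hence d: "scale (s (Q, \<psi>)) (std_cls G H (Q, \<psi>) - std_cls G H (P, \<phi>)) \<in> Z'"
        using less.prems(1) by (intro Z'_scale) auto
      \<comment> \<open>The coefficient of (Q, \<psi>) is moved to (P, \<phi>). This needs only
        addition, so coefficients remain in the local ring, and the support loses at least one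
        pair.\<close>
      define s' where "s' = s((P, \<phi>) := s (P, \<phi>) + s (Q, \<psi>), (Q, \<psi>) := 0)"
      have "?S s' = ?S (\<lambda>i. s i + ((if i = (P, \<phi>) then s (Q, \<psi>) else 0) +
          (if i = (Q, \<psi>) then - s (Q, \<psi>) else 0)))"
        using Q(2) by (intro sum.cong) (auto simp: s'_def)
      also have "\<dots> = ?S s + ((\<Sum>i\<in>hom_pairs G H. if i = (P, \<phi>) then scale (s (Q, \<psi>)) (std_cls G H i) else 0)
          + (\<Sum>i\<in>hom_pairs G H. if i = (Q, \<psi>) then scale (- s (Q, \<psi>)) (std_cls G H i) else 0))"
        unfolding sum.distrib[symmetric]
        by (intro sum.cong refl) (simp add: scale_add_left)
      also have "\<dots> = ?S s + (scale (s (Q, \<psi>)) (std_cls G H (P, \<phi>)) +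
          scale (- s (Q, \<psi>)) (std_cls G H (Q, \<psi>)))"
        using P'(1) Q' finite_pairs by simp
      also have "scale (- s (Q, \<psi>)) (std_cls G H (Q, \<psi>)) = - scale (s (Q, \<psi>)) (std_cls G H (Q, \<psi>))"
        by (rule scale_uminus)
      finally have S': "f - ?S s' = (f - ?S s) + scale (s (Q, \<psi>)) (std_cls G H (Q, \<psi>) - std_cls G H (P, \<phi>))"
        by (simp add: algebra_simps)
      show ?thesis
      proof (rule less.hyps[of s'])
        have "{i \<in> hom_pairs G H. s' i \<noteq> 0} \<subset> ?supp" using P(1) Q(1,2) by (auto simp: s'_def split: if_splits)
        thus "card {i \<in> hom_pairs G H. s' i \<noteq> 0} < card ?supp" using fin by (rule psubset_card_mono[rotated])
        show "\<forall>i. s' i \<in> carrier (Zloc p)" using less.prems(1) Zloc_add Zloc_0 by (auto simp: s'_def)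
        show "f - ?S s' \<in> Z'" unfolding S' by (rule Z'_add[OF less.prems(2) d])
      qed
    qed
  qed
  obtain s where "\<forall>i. s i \<in> carrier (Zloc p)" "f - ?S s \<in> rels" using free_span[OF f] by blast
  thus ?thesis using main Z'_rels by blast
qed

end

subsection \<open>Marks are injective\<close>

text \<open>Left conjugation is a change of base point as well, now to [h, 1].\<close>

lemma std_cls_left_conj:
  assumes "std_pair G H Q \<psi>" "h \<in> carrier H" "\<phi> \<in> hom (subgrp G Q) H"
    and \<phi>: "\<And>k. k \<in> Q \<Longrightarrow> \<phi> k = h \<otimes>\<^bsub>H\<^esub> \<psi> k \<otimes>\<^bsub>H\<^esub> inv\<^bsub>H\<^esub> h"
  shows "iso_class G H (std_biset G H Q \<phi>) = iso_class G H (std_biset G H Q \<psi>)"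
proof -
  interpret S: std_pair G H Q \<psi> by fact
  interpret X: lf_biset G H "std_biset G H Q \<psi>" by unfold_locales (rule S.std_flfb)
  interpret S': std_pair G H Q \<phi>
    using assms(3) S.P.subgroup_axioms
    by (simp add: std_pair_def std_pair_axioms_def S.G.fin_group_axioms S.H.fin_group_axioms)
  have "biset_iso G H (std_biset G H Q \<phi>) (std_biset G H Q \<psi>)"
  proof (rule X.transitive_iso_std[OF S.P.subgroup_axioms assms(3)])
    show "S.cls h \<one>\<^bsub>G\<^esub> \<in> points (std_biset G H Q \<psi>)" using assms(2) by (simp add: S.cls_in_points)
  next
    fix x assume "x \<in> points (std_biset G H Q \<psi>)"
    then obtain h' g where "h' \<in> carrier H" "g \<in> carrier G" "x = S.cls h' g"
      by (auto simp: S.points_std)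
    thus "\<exists>k\<in>carrier H. \<exists>g\<in>carrier G. x = lact (std_biset G H Q \<psi>) k (ract (std_biset G H Q \<psi>) (S.cls h \<one>\<^bsub>G\<^esub>) g)"
      using assms(2) by (intro bexI[of _ "h' \<otimes>\<^bsub>H\<^esub> inv\<^bsub>H\<^esub> h"] bexI[of _ g])
        (simp_all add: S.ract_std S.lact_std S.H.m_assoc)
  next
    fix k g assume kg: "k \<in> carrier H" "g \<in> carrier G"
    have "lact (std_biset G H Q \<psi>) k (S.cls h \<one>\<^bsub>G\<^esub>) = ract (std_biset G H Q \<psi>) (S.cls h \<one>\<^bsub>G\<^esub>) g \<longleftrightarrow>
        S.cls h g = S.cls (k \<otimes>\<^bsub>H\<^esub> h) \<one>\<^bsub>G\<^esub>"
      using assms(2) kg by (auto simp: S.ract_std S.lact_std)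
    also have "\<dots> \<longleftrightarrow> g \<in> Q \<and> k \<otimes>\<^bsub>H\<^esub> h = h \<otimes>\<^bsub>H\<^esub> \<psi> g"
      using assms(2) kg by (auto simp: S.cls_eq_iff)
    also have "\<dots> \<longleftrightarrow> g \<in> Q \<and> k = \<phi> g"
    proof (rule conj_cong[OF refl])
      assume g: "g \<in> Q"
      hence c: "\<psi> g \<in> carrier H" by (rule S.hom_closed)
      show "k \<otimes>\<^bsub>H\<^esub> h = h \<otimes>\<^bsub>H\<^esub> \<psi> g \<longleftrightarrow> k = \<phi> g"
      proof
        assume "k \<otimes>\<^bsub>H\<^esub> h = h \<otimes>\<^bsub>H\<^esub> \<psi> g"
        hence "k \<otimes>\<^bsub>H\<^esub> h \<otimes>\<^bsub>H\<^esub> inv\<^bsub>H\<^esub> h = \<phi> g" using \<phi>[OF g] by simp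
        thus "k = \<phi> g" using kg assms(2) by (simp add: S.H.m_assoc)
      next
        assume "k = \<phi> g"
        thus "k \<otimes>\<^bsub>H\<^esub> h = h \<otimes>\<^bsub>H\<^esub> \<psi> g" using \<phi>[OF g] c assms(2) by (simp add: S.H.m_assoc)
      qed
    qed
    finally show "lact (std_biset G H Q \<psi>) k (S.cls h \<one>\<^bsub>G\<^esub>) = ract (std_biset G H Q \<psi>) (S.cls h \<one>\<^bsub>G\<^esub>) g \<longleftrightarrow>
        g \<in> Q \<and> k = \<phi> g" .
  qed
  thus ?thesis by (rule iso_class_eq) (rule S'.std_flfb)
qed

text \<open>The smallest class of morphisms allowed. Averaging over it yields ordinary injectivity
  of marks, so one detection theorem serves both purposes.\<close>

lemma (in fin_group) morphism_class_conj:
  "morphism_class G (\<lambda>U. {(\<lambda>x\<in>U. h \<otimes> x \<otimes> inv h) | h. h \<in> carrier G})" (is "morphism_class G ?M")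
proof
  fix U \<eta> assume U: "subgroup U G" and "\<eta> \<in> ?M U"
  then obtain h where h: "h \<in> carrier G" "\<eta> = (\<lambda>x\<in>U. h \<otimes> x \<otimes> inv h)" by auto
  interpret U: subgroup U G by fact
  have inj: "inj_on \<eta> U"
    using h conjugation_is_inj[OF h(1)] by (auto simp: inj_on_def)
  have "\<eta> \<in> hom (subgrp G U) G"
    using h by (intro homI) (simp_all add: conj_mult)
  thus "\<eta> \<in> hom (subgrp G U) G \<and> inj_on \<eta> U \<and> \<eta> \<in> extensional U" using inj h by auto
  have im: "\<eta> ` U = (\<lambda>x. h \<otimes> x \<otimes> inv h) ` U" using h by auto
  have "inv_into U \<eta> y = inv h \<otimes> y \<otimes> inv (inv h)" if y: "y \<in> \<eta> ` U" for y
  proof -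
    obtain x where x: "x \<in> U" "y = \<eta> x" using y by blast
    hence "inv_into U \<eta> y = x" using inj by simp
    thus ?thesis using x h by (simp add: conj_inv_cancel)
  qed
  hence "(\<lambda>y\<in>\<eta> ` U. inv_into U \<eta> y) = (\<lambda>y\<in>\<eta> ` U. inv h \<otimes> y \<otimes> inv (inv h))"
    by (rule restrict_ext)
  thus "(\<lambda>y\<in>\<eta> ` U. inv_into U \<eta> y) \<in> ?M (\<eta> ` U)" using h(1) inv_closed by blast
  fix \<eta>' assume "\<eta>' \<in> ?M (\<eta> ` U)"
  then obtain h' where h': "h' \<in> carrier G" "\<eta>' = (\<lambda>x\<in>\<eta> ` U. h' \<otimes> x \<otimes> inv h')" by auto
  have "compose U \<eta>' \<eta> = (\<lambda>x\<in>U. (h' \<otimes> h) \<otimes> x \<otimes> inv (h' \<otimes> h))"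
    using h h' by (auto simp: compose_def fun_eq_iff conj_conj restrict_def)
  thus "compose U \<eta>' \<eta> \<in> ?M U" using h h' by blast
next
  fix U V \<eta> assume UV: "subgroup U G" "subgroup V G" "V \<subseteq> U" "\<eta> \<in> ?M U"
  then obtain h where h: "h \<in> carrier G" "\<eta> = (\<lambda>x\<in>U. h \<otimes> x \<otimes> inv h)" by auto
  have "restrict \<eta> V = (\<lambda>x\<in>V. h \<otimes> x \<otimes> inv h)" using UV(3) h(2) by (auto simp: fun_eq_iff restrict_def)
  thus "restrict \<eta> V \<in> ?M V" using h by blast
qed auto

context burnside_module
begin

text \<open>With \<open>M\<close> the conjugations, the differences that
  \<open>averaged_marks_detect\<close> works modulo are already zero, since left conjugate pairs
  give isomorphic bisets. Hence the submodule can be taken to be \<open>rels\<close>.\<close>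

lemma marks_detect:
  assumes f: "f \<in> free" and z: "\<And>P \<phi>. (P, \<phi>) \<in> hom_pairs G H \<Longrightarrow> fmark P (\<lambda>k. k) \<phi> f = 0"
  shows "f \<in> rels"
proof -
  let ?M = "\<lambda>U. {(\<lambda>x\<in>U. h \<otimes>\<^bsub>H\<^esub> x \<otimes>\<^bsub>H\<^esub> inv\<^bsub>H\<^esub> h) | h. h \<in> carrier H}"
  interpret morphism_class H ?M by (rule H.morphism_class_conj)
  interpret averaged_marks G H p ?M by unfold_locales
  show ?thesis
  proof (rule averaged_marks_detect[OF f])
    fix P \<phi> assume P: "(P, \<phi>) \<in> hom_pairs G H"
    have "fmark P (\<lambda>k. k) (\<lambda>k. \<eta> (\<phi> k)) f = 0" if "\<eta> \<in> ?M (\<phi> ` P)" for \<eta>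
    proof -
      have "fmark P (\<lambda>k. k) (\<lambda>k. \<eta> (\<phi> k)) f = fmark P (\<lambda>k. k) (compose P \<eta> \<phi>) f"
        by (rule fmark_cong) (simp_all add: compose_def)
      thus ?thesis using z[OF compose_pairs[OF P that]] by simp
    qed
    thus "avg P \<phi> f = 0" unfolding avg_def by (rule sum.neutral[OF ballI])
  next
    fix Q \<psi> \<eta> assume Q: "(Q, \<psi>) \<in> hom_pairs G H" "\<eta> \<in> ?M (\<psi> ` Q)"
    then obtain h where h: "h \<in> carrier H" "\<eta> = (\<lambda>x\<in>\<psi> ` Q. h \<otimes>\<^bsub>H\<^esub> x \<otimes>\<^bsub>H\<^esub> inv\<^bsub>H\<^esub> h)" by auto
    have "iso_class G H (std_biset G H Q (compose Q \<eta> \<psi>)) = iso_class G H (std_biset G H Q \<psi>)"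
    proof (rule std_cls_left_conj[OF _ h(1)])
      show "std_pair G H Q \<psi>" using Q(1) by (intro std_pairI) (auto simp: hom_pairs_def)
      show "compose Q \<eta> \<psi> \<in> hom (subgrp G Q) H" using compose_pairs[OF Q] by (simp add: hom_pairs_def)
    qed (simp add: compose_def h(2))
    thus "std_cls G H (Q, compose Q \<eta> \<psi>) - std_cls G H (Q, \<psi>) \<in> rels"
      using burnside_rel.zero by simp
  qed (auto intro: rels_add rels_scale)
qed

lemma bmark_eqI:
  assumes "x \<in> carrier B" "y \<in> carrier B"
    and "\<And>P \<phi>. (P, \<phi>) \<in> hom_pairs G H \<Longrightarrow> bmark P (\<lambda>k. k) \<phi> x = bmark P (\<lambda>k. k) \<phi> y"
  shows "x = y"
proof -
  have "burnside_rep x - burnside_rep y \<in> rels"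
    by (rule marks_detect) (use assms in \<open>simp_all add: carrier_rep free_diff fmark_diff flip: bmark_def\<close>)
  thus ?thesis using coset_eq_iff carrier_rep assms(1,2) by metis
qed

lemma key_biset:
  assumes "x \<in> carrier B" "c \<in> Poly_Mapping.keys (burnside_rep x)"
  obtains X :: "('a, nat) biset" where "finite_left_free_biset G H X" "c = iso_class G H X"
proof -
  have "c \<in> iso_classes G H" using assms carrier_rep(1)[OF assms(1)] by (auto simp: burnside_free_def)
  thus ?thesis using that by (auto simp: iso_classes_def)
qed

lemma bmark_right_conj:
  assumes x: "x \<in> carrier B" and ab: "b \<in> I \<rightarrow> carrier H" "a \<in> I \<rightarrow> carrier G" and g: "g \<in> carrier G"
  shows "bmark I (\<lambda>k. g \<otimes>\<^bsub>G\<^esub> a k \<otimes>\<^bsub>G\<^esub> inv\<^bsub>G\<^esub> g) b x = bmark I a b x"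
proof -
  have "cmark I (\<lambda>k. g \<otimes>\<^bsub>G\<^esub> a k \<otimes>\<^bsub>G\<^esub> inv\<^bsub>G\<^esub> g) b c = cmark I a b c"
    if c: "c \<in> Poly_Mapping.keys (burnside_rep x)" for c
  proof -
    obtain X :: "('a, nat) biset" where X: "finite_left_free_biset G H X" "c = iso_class G H X"
      using key_biset[OF x c] .
    interpret lf_biset G H X by unfold_locales (rule X(1))
    have "(\<lambda>k. g \<otimes>\<^bsub>G\<^esub> a k \<otimes>\<^bsub>G\<^esub> inv\<^bsub>G\<^esub> g) \<in> I \<rightarrow> carrier G" using ab g by auto
    thus ?thesis unfolding X(2) using ab g
      by (simp add: cmark_iso_class[OF X(1)] mark_right_conj)
  qed
  thus ?thesis by (simp add: bmark_def fmark_def)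
qed

lemma bmark_left_conj:
  assumes x: "x \<in> carrier B" and ab: "b \<in> I \<rightarrow> carrier H" "a \<in> I \<rightarrow> carrier G" and h: "h \<in> carrier H"
  shows "bmark I a (\<lambda>k. h \<otimes>\<^bsub>H\<^esub> b k \<otimes>\<^bsub>H\<^esub> inv\<^bsub>H\<^esub> h) x = bmark I a b x"
proof -
  have "cmark I a (\<lambda>k. h \<otimes>\<^bsub>H\<^esub> b k \<otimes>\<^bsub>H\<^esub> inv\<^bsub>H\<^esub> h) c = cmark I a b c"
    if c: "c \<in> Poly_Mapping.keys (burnside_rep x)" for c
  proof -
    obtain X :: "('a, nat) biset" where X: "finite_left_free_biset G H X" "c = iso_class G H X"
      using key_biset[OF x c] .
    interpret lf_biset G H X by unfold_locales (rule X(1))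
    have "(\<lambda>k. h \<otimes>\<^bsub>H\<^esub> b k \<otimes>\<^bsub>H\<^esub> inv\<^bsub>H\<^esub> h) \<in> I \<rightarrow> carrier H" using ab h by auto
    thus ?thesis unfolding X(2) using ab h
      by (simp add: cmark_iso_class[OF X(1)] mark_left_conj)
  qed
  thus ?thesis by (simp add: bmark_def fmark_def)
qed

end

subsection \<open>Composition with transitive bisets\<close>

lemma card_pos_fin_group: "fin_group G \<Longrightarrow> card (carrier G) > 0"
  using fin_group.fin group.is_monoid monoid.one_closed
  by (fastforce simp: card_gt_0_iff fin_group_def)

text \<open>In the sum over \<theta>, the mark of [Q, \<psi>] counts the pairs (h, g) that produce
  \<theta> by conjugating \<psi>. Summing over the pairs instead, conjugation by \<open>h\<close>
  leaves the marks of \<open>x\<close> unchanged, so \<open>h\<close> contributes a factor |H| that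
  cancels.\<close>

lemma bmark_comp_basis_right:
  assumes GH: "burnside_module G H" and HK: "burnside_module H K" and x: "x \<in> carrier (burnside p H K)"
    and Q: "subgroup Q G" "\<psi> \<in> hom (subgrp G Q) H"
    and I: "finite I" "a \<in> I \<rightarrow> carrier G" "b \<in> I \<rightarrow> carrier K"
  shows "of_nat (card Q) * bmark I a b (burnside_comp p G H K x (burnside_basis p G H Q \<psi>)) =
    (\<Sum>g\<in>{g \<in> carrier G. \<forall>k\<in>I. g \<otimes>\<^bsub>G\<^esub> a k \<otimes>\<^bsub>G\<^esub> inv\<^bsub>G\<^esub> g \<in> Q}.
       bmark I (\<lambda>k. \<psi> (g \<otimes>\<^bsub>G\<^esub> a k \<otimes>\<^bsub>G\<^esub> inv\<^bsub>G\<^esub> g)) b x)"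
proof -
  interpret GH: burnside_module G H p by fact
  interpret HK: burnside_module H K p by fact
  interpret S: std_pair G H Q \<psi> by (rule GH.std_pairI[OF Q])
  let ?y = "burnside_basis p G H Q \<psi>"
  let ?c = "\<lambda>g k. g \<otimes>\<^bsub>G\<^esub> a k \<otimes>\<^bsub>G\<^esub> inv\<^bsub>G\<^esub> g"
  let ?N = "{g \<in> carrier G. \<forall>k\<in>I. ?c g k \<in> Q}"
  let ?A = "carrier H \<times> ?N"
  let ?\<theta> = "\<lambda>z. \<lambda>k\<in>I. fst z \<otimes>\<^bsub>H\<^esub> \<psi> (?c (snd z) k) \<otimes>\<^bsub>H\<^esub> inv\<^bsub>H\<^esub> (fst z)"
  have fin: "finite ?A" "finite (I \<rightarrow>\<^sub>E carrier H)"
    using GH.G.fin GH.H.fin I(1) by (auto intro: finite_PiE)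
  have im: "?\<theta> ` ?A \<subseteq> I \<rightarrow>\<^sub>E carrier H" using S.hom_closed by (auto simp: PiE_def)
  have y: "of_nat (card Q) * bmark I a \<theta> ?y = of_nat (card {z \<in> ?A. ?\<theta> z = \<theta>})"
    if "\<theta> \<in> I \<rightarrow>\<^sub>E carrier H" for \<theta>
  proof -
    have "\<theta> \<in> I \<rightarrow> carrier H" using that by (simp add: PiE_def)
    have "{(h, g). h \<in> carrier H \<and> g \<in> carrier G \<and> (\<forall>k\<in>I. ?c g k \<in> Q \<and>
       \<theta> k = h \<otimes>\<^bsub>H\<^esub> \<psi> (?c g k) \<otimes>\<^bsub>H\<^esub> inv\<^bsub>H\<^esub> h)} = {z \<in> ?A. ?\<theta> z = \<theta>}"
      using PiE_ext[OF _ that, of "?\<theta> _"] im by (fastforce simp: image_subset_iff)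
    thus ?thesis using GH.bmark_basis[OF Q I(2) \<open>\<theta> \<in> I \<rightarrow> carrier H\<close>] by simp
  qed
  have "of_nat (card (carrier H)) * (of_nat (card Q) * bmark I a b (burnside_comp p G H K x ?y)) =
      of_nat (card Q) * (\<Sum>\<theta>\<in>I \<rightarrow>\<^sub>E carrier H. bmark I \<theta> b x * bmark I a \<theta> ?y)"
    using burnside_comp_closed(2)[OF GH HK x GH.basis_in[OF Q] I] by simp
  also have "\<dots> = (\<Sum>\<theta>\<in>I \<rightarrow>\<^sub>E carrier H. bmark I \<theta> b x * of_nat (card {z \<in> ?A. ?\<theta> z = \<theta>}))"
    unfolding sum_distrib_left by (intro sum.cong refl) (simp add: y[symmetric])
  also have "\<dots> = (\<Sum>\<theta>\<in>I \<rightarrow>\<^sub>E carrier H. \<Sum>z\<in>{z \<in> ?A. ?\<theta> z = \<theta>}. bmark I (?\<theta> z) b x)"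
    by (intro sum.cong refl) simp
  also have "\<dots> = (\<Sum>z\<in>?A. bmark I (?\<theta> z) b x)"
    by (rule sum.group[OF fin im])
  also have "\<dots> = (\<Sum>z\<in>?A. bmark I (\<lambda>k. \<psi> (?c (snd z) k)) b x)"
  proof (rule sum.cong[OF refl])
    fix z assume z: "z \<in> ?A"
    have "bmark I (?\<theta> z) b x = bmark I (\<lambda>k. fst z \<otimes>\<^bsub>H\<^esub> \<psi> (?c (snd z) k) \<otimes>\<^bsub>H\<^esub> inv\<^bsub>H\<^esub> (fst z)) b x"
      by (rule bmark_cong) simp_all
    also have "\<dots> = bmark I (\<lambda>k. \<psi> (?c (snd z) k)) b x"
      using z S.hom_closed by (intro HK.bmark_right_conj[OF x I(3)]) auto
    finally show "bmark I (?\<theta> z) b x = bmark I (\<lambda>k. \<psi> (?c (snd z) k)) b x" .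
  qed
  also have "\<dots> = of_nat (card (carrier H)) * (\<Sum>g\<in>?N. bmark I (\<lambda>k. \<psi> (?c g k)) b x)"
    using sum.cartesian_product[of "\<lambda>_ g. bmark I (\<lambda>k. \<psi> (?c g k)) b x" ?N "carrier H"]
    by (simp add: case_prod_beta)
  finally show ?thesis using card_pos_fin_group[OF GH.H.fin_group_axioms] by simp
qed

text \<open>Composition with [G, \<psi>] restricts the right action along \<psi>. Conjugation by
  \<open>g\<close> becomes conjugation by \<psi>(g), so all |G| terms of the general formula are
  equal.\<close>

lemma bmark_comp_basis_right_full:
  assumes GH: "burnside_module G H" and HK: "burnside_module H K" and x: "x \<in> carrier (burnside p H K)"
    and \<psi>: "\<psi> \<in> hom G H"
    and I: "finite I" "a \<in> I \<rightarrow> carrier G" "b \<in> I \<rightarrow> carrier K"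
  shows "bmark I a b (burnside_comp p G H K x (burnside_basis p G H (carrier G) \<psi>)) =
    bmark I (\<lambda>k. \<psi> (a k)) b x"
proof -
  interpret GH: burnside_module G H p by fact
  interpret HK: burnside_module H K p by fact
  interpret h: group_hom G H \<psi>
    using \<psi> GH.G.group_axioms GH.H.group_axioms by (simp add: group_hom_def group_hom_axioms_def)
  have \<psi>': "\<psi> \<in> hom (subgrp G (carrier G)) H" using \<psi> by simp
  have "of_nat (card (carrier G)) * bmark I a b (burnside_comp p G H K x (burnside_basis p G H (carrier G) \<psi>)) =
      (\<Sum>g\<in>{g \<in> carrier G. \<forall>k\<in>I. g \<otimes>\<^bsub>G\<^esub> a k \<otimes>\<^bsub>G\<^esub> inv\<^bsub>G\<^esub> g \<in> carrier G}.
       bmark I (\<lambda>k. \<psi> (g \<otimes>\<^bsub>G\<^esub> a k \<otimes>\<^bsub>G\<^esub> inv\<^bsub>G\<^esub> g)) b x)"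
    by (rule bmark_comp_basis_right[OF GH HK x GH.G.subgroup_self \<psi>' I])
  also have "{g \<in> carrier G. \<forall>k\<in>I. g \<otimes>\<^bsub>G\<^esub> a k \<otimes>\<^bsub>G\<^esub> inv\<^bsub>G\<^esub> g \<in> carrier G} = carrier G"
    using I(2) by auto
  also have "(\<Sum>g\<in>carrier G. bmark I (\<lambda>k. \<psi> (g \<otimes>\<^bsub>G\<^esub> a k \<otimes>\<^bsub>G\<^esub> inv\<^bsub>G\<^esub> g)) b x) =
      (\<Sum>g\<in>carrier G. bmark I (\<lambda>k. \<psi> (a k)) b x)"
  proof (rule sum.cong[OF refl])
    fix g assume g: "g \<in> carrier G"
    have ak: "a k \<in> carrier G" if "k \<in> I" for k using that I(2) by auto
    have "bmark I (\<lambda>k. \<psi> (g \<otimes>\<^bsub>G\<^esub> a k \<otimes>\<^bsub>G\<^esub> inv\<^bsub>G\<^esub> g)) b x =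
        bmark I (\<lambda>k. \<psi> g \<otimes>\<^bsub>H\<^esub> \<psi> (a k) \<otimes>\<^bsub>H\<^esub> inv\<^bsub>H\<^esub> (\<psi> g)) b x"
      by (rule bmark_cong) (use g ak in simp_all)
    also have "\<dots> = bmark I (\<lambda>k. \<psi> (a k)) b x"
      using g ak by (intro HK.bmark_right_conj[OF x I(3)]) auto
    finally show "bmark I (\<lambda>k. \<psi> (g \<otimes>\<^bsub>G\<^esub> a k \<otimes>\<^bsub>G\<^esub> inv\<^bsub>G\<^esub> g)) b x = bmark I (\<lambda>k. \<psi> (a k)) b x" .
  qed
  finally show ?thesis using card_pos_fin_group[OF GH.G.fin_group_axioms] by simp
qed

lemma (in burnside_module) bmark_basis_full:
  assumes \<psi>: "\<psi> \<in> hom G H" and I: "a \<in> I \<rightarrow> carrier G" "b \<in> I \<rightarrow> carrier H"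
  shows "bmark I a b (burnside_basis p G H (carrier G) \<psi>) =
    of_nat (card {h \<in> carrier H. \<forall>k\<in>I. b k = h \<otimes>\<^bsub>H\<^esub> \<psi> (a k) \<otimes>\<^bsub>H\<^esub> inv\<^bsub>H\<^esub> h})"
proof -
  interpret h: group_hom G H \<psi>
    using \<psi> G.group_axioms H.group_axioms by (simp add: group_hom_def group_hom_axioms_def)
  have \<psi>': "\<psi> \<in> hom (subgrp G (carrier G)) H" using \<psi> by simp
  let ?c = "\<lambda>g k. g \<otimes>\<^bsub>G\<^esub> a k \<otimes>\<^bsub>G\<^esub> inv\<^bsub>G\<^esub> g"
  let ?A = "{(h, g). h \<in> carrier H \<and> g \<in> carrier G \<and> (\<forall>k\<in>I. ?c g k \<in> carrier G \<and>
       b k = h \<otimes>\<^bsub>H\<^esub> \<psi> (?c g k) \<otimes>\<^bsub>H\<^esub> inv\<^bsub>H\<^esub> h)}"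
  let ?N = "{h \<in> carrier H. \<forall>k\<in>I. b k = h \<otimes>\<^bsub>H\<^esub> \<psi> (a k) \<otimes>\<^bsub>H\<^esub> inv\<^bsub>H\<^esub> h}"
  have ak: "a k \<in> carrier G" if "k \<in> I" for k using that I by auto
  have e: "h \<otimes>\<^bsub>H\<^esub> \<psi> (?c g k) \<otimes>\<^bsub>H\<^esub> inv\<^bsub>H\<^esub> h = (h \<otimes>\<^bsub>H\<^esub> \<psi> g) \<otimes>\<^bsub>H\<^esub> \<psi> (a k) \<otimes>\<^bsub>H\<^esub> inv\<^bsub>H\<^esub> (h \<otimes>\<^bsub>H\<^esub> \<psi> g)"
    if "h \<in> carrier H" "g \<in> carrier G" "k \<in> I" for h g k
    using that ak by (simp add: H.m_assoc H.inv_mult_group)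
  have "bij_betw (\<lambda>(h, g). (h \<otimes>\<^bsub>H\<^esub> \<psi> g, g)) ?A (?N \<times> carrier G)"
  proof (rule bij_betw_byWitness[where f' = "\<lambda>(h, g). (h \<otimes>\<^bsub>H\<^esub> inv\<^bsub>H\<^esub> (\<psi> g), g)"], goal_cases)
    case 1 show ?case by (auto simp: H.m_assoc)
  next
    case 2 show ?case by (auto simp: H.m_assoc)
  next
    case 3 show ?case by (auto simp: e)
  next
    case 4
    have "h \<otimes>\<^bsub>H\<^esub> inv\<^bsub>H\<^esub> (\<psi> g) \<otimes>\<^bsub>H\<^esub> \<psi> g = h" if "h \<in> carrier H" "g \<in> carrier G" for h g
      using that by (simp add: H.m_assoc)
    thus ?case using ak by (auto simp: e simp del: h.hom_mult)
  qed
  hence "card ?A = card ?N * card (carrier G)"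
    by (simp add: bij_betw_same_card card_cartesian_product)
  moreover have "of_nat (card (carrier G)) * bmark I a b (burnside_basis p G H (carrier G) \<psi>) =
      of_nat (card ?A)"
    by (rule bmark_basis[OF G.subgroup_self \<psi>' I])
  ultimately show ?thesis using card_pos_fin_group[OF G.fin_group_axioms] by simp
qed

text \<open>Here \<chi> is an isomorphism from \<open>V\<close> onto \<open>K\<close> with inverse
  \<rho>, and composing with [V, \<chi>] on the left restricts the left action along \<rho>. The
  pairs (c, h) counted by the mark of [V, \<chi>] at \<theta> determine \<theta>, so the sum over
  \<theta> becomes a sum over pairs with equal terms.\<close>

lemma bmark_comp_basis_left:
  assumes GH: "burnside_module G H" and HK: "burnside_module H K" and x: "x \<in> carrier (burnside p G H)"
    and V: "subgroup V H" "\<chi> \<in> hom (subgrp H V) K"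
    and \<rho>: "\<rho> \<in> hom K H" "\<And>k. k \<in> carrier K \<Longrightarrow> \<rho> k \<in> V \<and> \<chi> (\<rho> k) = k"
      "\<And>v. v \<in> V \<Longrightarrow> \<rho> (\<chi> v) = v"
    and I: "finite I" "a \<in> I \<rightarrow> carrier G" "b \<in> I \<rightarrow> carrier K"
  shows "bmark I a b (burnside_comp p G H K (burnside_basis p H K V \<chi>) x) = bmark I a (\<lambda>k. \<rho> (b k)) x"
proof -
  interpret GH: burnside_module G H p by fact
  interpret HK: burnside_module H K p by fact
  interpret S: std_pair H K V \<chi> by (rule HK.std_pairI[OF V])
  interpret r: group_hom K H \<rho>
    using \<rho>(1) GH.H.group_axioms HK.H.group_axioms by (simp add: group_hom_def group_hom_axioms_def)
  let ?y = "burnside_basis p H K V \<chi>"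
  let ?A = "carrier K \<times> carrier H"
  let ?\<theta> = "\<lambda>z. \<lambda>k\<in>I. inv\<^bsub>H\<^esub> (snd z) \<otimes>\<^bsub>H\<^esub> \<rho> (inv\<^bsub>K\<^esub> (fst z) \<otimes>\<^bsub>K\<^esub> b k \<otimes>\<^bsub>K\<^esub> fst z) \<otimes>\<^bsub>H\<^esub> snd z"
  have bk: "b k \<in> carrier K" if "k \<in> I" for k using that I by auto
  have fin: "finite ?A" "finite (I \<rightarrow>\<^sub>E carrier H)"
    using GH.H.fin HK.H.fin I(1) by (auto intro: finite_PiE)
  have im: "?\<theta> ` ?A \<subseteq> I \<rightarrow>\<^sub>E carrier H" using bk by (auto simp: PiE_def)
  have y: "of_nat (card V) * bmark I \<theta> b ?y = of_nat (card {z \<in> ?A. ?\<theta> z = \<theta>})"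
    if \<theta>: "\<theta> \<in> I \<rightarrow>\<^sub>E carrier H" for \<theta>
  proof -
    have \<theta>': "\<theta> \<in> I \<rightarrow> carrier H" using \<theta> by (simp add: PiE_def)
    have iff: "(h \<otimes>\<^bsub>H\<^esub> t \<otimes>\<^bsub>H\<^esub> inv\<^bsub>H\<^esub> h \<in> V \<and> u = c \<otimes>\<^bsub>K\<^esub> \<chi> (h \<otimes>\<^bsub>H\<^esub> t \<otimes>\<^bsub>H\<^esub> inv\<^bsub>H\<^esub> h) \<otimes>\<^bsub>K\<^esub> inv\<^bsub>K\<^esub> c) \<longleftrightarrow>
        t = inv\<^bsub>H\<^esub> h \<otimes>\<^bsub>H\<^esub> \<rho> (inv\<^bsub>K\<^esub> c \<otimes>\<^bsub>K\<^esub> u \<otimes>\<^bsub>K\<^esub> c) \<otimes>\<^bsub>H\<^esub> h"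
      if "c \<in> carrier K" "h \<in> carrier H" "t \<in> carrier H" "u \<in> carrier K" for c h t u
    proof
      assume l: "h \<otimes>\<^bsub>H\<^esub> t \<otimes>\<^bsub>H\<^esub> inv\<^bsub>H\<^esub> h \<in> V \<and> u = c \<otimes>\<^bsub>K\<^esub> \<chi> (h \<otimes>\<^bsub>H\<^esub> t \<otimes>\<^bsub>H\<^esub> inv\<^bsub>H\<^esub> h) \<otimes>\<^bsub>K\<^esub> inv\<^bsub>K\<^esub> c"
      hence "\<chi> (h \<otimes>\<^bsub>H\<^esub> t \<otimes>\<^bsub>H\<^esub> inv\<^bsub>H\<^esub> h) \<in> carrier K" using S.hom_closed by blast
      hence "inv\<^bsub>K\<^esub> c \<otimes>\<^bsub>K\<^esub> u \<otimes>\<^bsub>K\<^esub> c = \<chi> (h \<otimes>\<^bsub>H\<^esub> t \<otimes>\<^bsub>H\<^esub> inv\<^bsub>H\<^esub> h)"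
        using l that by (simp add: HK.H.conj_inv_cancel)
      hence "\<rho> (inv\<^bsub>K\<^esub> c \<otimes>\<^bsub>K\<^esub> u \<otimes>\<^bsub>K\<^esub> c) = h \<otimes>\<^bsub>H\<^esub> t \<otimes>\<^bsub>H\<^esub> inv\<^bsub>H\<^esub> h" using l \<rho>(3) by simp
      thus "t = inv\<^bsub>H\<^esub> h \<otimes>\<^bsub>H\<^esub> \<rho> (inv\<^bsub>K\<^esub> c \<otimes>\<^bsub>K\<^esub> u \<otimes>\<^bsub>K\<^esub> c) \<otimes>\<^bsub>H\<^esub> h"
        using that by (simp add: GH.H.conj_inv_cancel)
    next
      assume t: "t = inv\<^bsub>H\<^esub> h \<otimes>\<^bsub>H\<^esub> \<rho> (inv\<^bsub>K\<^esub> c \<otimes>\<^bsub>K\<^esub> u \<otimes>\<^bsub>K\<^esub> c) \<otimes>\<^bsub>H\<^esub> h"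
      have "h \<otimes>\<^bsub>H\<^esub> t \<otimes>\<^bsub>H\<^esub> inv\<^bsub>H\<^esub> h = \<rho> (inv\<^bsub>K\<^esub> c \<otimes>\<^bsub>K\<^esub> u \<otimes>\<^bsub>K\<^esub> c)"
        unfolding t using that by (intro GH.H.conj_inv_cancel) (auto intro!: r.hom_closed)
      thus "h \<otimes>\<^bsub>H\<^esub> t \<otimes>\<^bsub>H\<^esub> inv\<^bsub>H\<^esub> h \<in> V \<and> u = c \<otimes>\<^bsub>K\<^esub> \<chi> (h \<otimes>\<^bsub>H\<^esub> t \<otimes>\<^bsub>H\<^esub> inv\<^bsub>H\<^esub> h) \<otimes>\<^bsub>K\<^esub> inv\<^bsub>K\<^esub> c"
        using \<rho>(2)[of "inv\<^bsub>K\<^esub> c \<otimes>\<^bsub>K\<^esub> u \<otimes>\<^bsub>K\<^esub> c"] that by (simp del: r.hom_mult add: HK.H.conj_inv_cancel)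
    qed
    have "{(c, h). c \<in> carrier K \<and> h \<in> carrier H \<and> (\<forall>k\<in>I. h \<otimes>\<^bsub>H\<^esub> \<theta> k \<otimes>\<^bsub>H\<^esub> inv\<^bsub>H\<^esub> h \<in> V \<and>
       b k = c \<otimes>\<^bsub>K\<^esub> \<chi> (h \<otimes>\<^bsub>H\<^esub> \<theta> k \<otimes>\<^bsub>H\<^esub> inv\<^bsub>H\<^esub> h) \<otimes>\<^bsub>K\<^esub> inv\<^bsub>K\<^esub> c)} = {z \<in> ?A. ?\<theta> z = \<theta>}" (is "?L = ?R")
    proof -
      have "z \<in> ?L \<longleftrightarrow> z \<in> ?R" for z
      proof (cases "z \<in> ?A")
        case True
        then obtain c h where z: "z = (c, h)" "c \<in> carrier K" "h \<in> carrier H" by auto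
        have tk: "\<theta> k \<in> carrier H" if "k \<in> I" for k using \<theta>' that by auto
        have "z \<in> ?L \<longleftrightarrow> (\<forall>k\<in>I. \<theta> k = inv\<^bsub>H\<^esub> h \<otimes>\<^bsub>H\<^esub> \<rho> (inv\<^bsub>K\<^esub> c \<otimes>\<^bsub>K\<^esub> b k \<otimes>\<^bsub>K\<^esub> c) \<otimes>\<^bsub>H\<^esub> h)"
          using z iff[OF z(2,3) tk bk] by simp
        also have "\<dots> \<longleftrightarrow> ?\<theta> z = \<theta>"
          using \<theta> by (auto simp: z(1) fun_eq_iff PiE_def extensional_def)
        finally show ?thesis using True by simp
      qed auto
      thus ?thesis by blast
    qed
    thus ?thesis using HK.bmark_basis[OF V \<theta>' I(3)] by simp
  qed
  have "of_nat (card (carrier H)) * (of_nat (card V) * bmark I a b (burnside_comp p G H K ?y x)) =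
      of_nat (card V) * (\<Sum>\<theta>\<in>I \<rightarrow>\<^sub>E carrier H. bmark I \<theta> b ?y * bmark I a \<theta> x)"
    using burnside_comp_closed(2)[OF GH HK HK.basis_in[OF V] x I] by simp
  also have "\<dots> = (\<Sum>\<theta>\<in>I \<rightarrow>\<^sub>E carrier H. of_nat (card {z \<in> ?A. ?\<theta> z = \<theta>}) * bmark I a \<theta> x)"
    unfolding sum_distrib_left by (intro sum.cong refl) (simp add: y[symmetric])
  also have "\<dots> = (\<Sum>\<theta>\<in>I \<rightarrow>\<^sub>E carrier H. \<Sum>z\<in>{z \<in> ?A. ?\<theta> z = \<theta>}. bmark I a (?\<theta> z) x)"
    by (intro sum.cong refl) simp
  also have "\<dots> = (\<Sum>z\<in>?A. bmark I a (?\<theta> z) x)"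
    by (rule sum.group[OF fin im])
  also have "\<dots> = (\<Sum>z\<in>?A. bmark I a (\<lambda>k. \<rho> (b k)) x)"
  proof (rule sum.cong[OF refl])
    fix z assume "z \<in> ?A"
    then obtain c h where z: "z = (c, h)" "c \<in> carrier K" "h \<in> carrier H" by auto
    \<comment> \<open>The conjugations by \<open>c\<close> and by \<open>h\<close> combine into a
      single one in \<open>H\<close>, to which marks are insensitive.\<close>
    define g where "g = inv\<^bsub>H\<^esub> h \<otimes>\<^bsub>H\<^esub> inv\<^bsub>H\<^esub> (\<rho> c)"
    have g: "g \<in> carrier H" using z by (simp add: g_def)
    have "bmark I a (?\<theta> z) x = bmark I a (\<lambda>k. g \<otimes>\<^bsub>H\<^esub> \<rho> (b k) \<otimes>\<^bsub>H\<^esub> inv\<^bsub>H\<^esub> g) x"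
      by (rule bmark_cong) (use z bk in \<open>simp_all add: g_def GH.H.inv_mult_group GH.H.m_assoc\<close>)
    also have "\<dots> = bmark I a (\<lambda>k. \<rho> (b k)) x"
      using g bk I by (intro GH.bmark_left_conj[OF x]) auto
    finally show "bmark I a (?\<theta> z) x = bmark I a (\<lambda>k. \<rho> (b k)) x" .
  qed
  also have "\<dots> = of_nat (card (carrier H)) * (of_nat (card (carrier K)) * bmark I a (\<lambda>k. \<rho> (b k)) x)"
    by (simp add: card_cartesian_product)
  also have "card (carrier K) = card V"
    by (rule bij_betw_same_card[of \<rho>], rule bij_betw_byWitness[where f' = \<chi>])
       (use \<rho>(2,3) S.hom_closed in auto)
  finally show ?thesis
    using card_pos_fin_group[OF GH.H.fin_group_axioms] card_pos_fin_group[OF HK.H.fin_group_axioms]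
      \<open>card (carrier K) = card V\<close> by simp
qed

text \<open>Factoring \<eta>\<psi> through the image \<open>U\<close> of \<psi> isolates
  [U, \<eta>], the element that stability under a fusion system speaks of. Comparing marks spares an
  explicit isomorphism of bisets.\<close>

lemma basis_compose:
  assumes "burnside_module G H" and Q: "(Q, \<psi>) \<in> hom_pairs G H"
    and \<eta>: "\<eta> \<in> hom (subgrp H (\<psi> ` Q)) H"
  defines "U \<equiv> \<psi> ` Q"
  shows "burnside_basis p G H Q (compose Q \<eta> \<psi>) =
    burnside_comp p G (subgrp H U) H (burnside_basis p (subgrp H U) H U \<eta>)
      (burnside_basis p G (subgrp H U) Q \<psi>)"
    "burnside_basis p (subgrp H U) H U \<eta> \<in> carrier (burnside p (subgrp H U) H)"
    "burnside_basis p G (subgrp H U) Q \<psi> \<in> carrier (burnside p G (subgrp H U))"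
proof -
  interpret GH: burnside_module G H p by fact
  interpret S: std_pair G H Q \<psi> using Q by (intro GH.std_pairI) (auto simp: hom_pairs_def)
  have U: "subgroup U H" unfolding U_def using S.hom.img_is_subgroup by simp
  interpret U: subgroup U H by fact
  have gU: "fin_group (subgrp H U)"
    using U.subgroup_is_group[OF GH.H.group_axioms] finite_subset[OF U.subset GH.H.fin]
    by (simp add: fin_group_def fin_group_axioms_def)
  interpret UH: burnside_module "subgrp H U" H p
    by (simp add: burnside_module_def gU GH.H.fin_group_axioms)
  interpret GU: burnside_module G "subgrp H U" p
    by (simp add: burnside_module_def gU GH.G.fin_group_axioms)
  have \<eta>': "\<eta> \<in> hom (subgrp H U) H" using \<eta> by (simp add: U_def)
  have \<psi>': "\<psi> \<in> hom (subgrp G Q) (subgrp H U)" using S.hom_mult by (auto simp: hom_def U_def)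
  have comp: "compose Q \<eta> \<psi> \<in> hom (subgrp G Q) H"
    using \<eta>' S.hom_mult by (auto simp: hom_def compose_def U_def)
  show x: "burnside_basis p (subgrp H U) H U \<eta> \<in> carrier (burnside p (subgrp H U) H)"
    using UH.basis_in[OF UH.G.subgroup_self] \<eta>' by simp
  show y: "burnside_basis p G (subgrp H U) Q \<psi> \<in> carrier (burnside p G (subgrp H U))"
    by (rule GU.basis_in[OF S.P.subgroup_axioms \<psi>'])
  show "burnside_basis p G H Q (compose Q \<eta> \<psi>) =
    burnside_comp p G (subgrp H U) H (burnside_basis p (subgrp H U) H U \<eta>)
      (burnside_basis p G (subgrp H U) Q \<psi>)" (is "?l = ?r")
  proof (rule GH.bmark_eqI)
    show "?l \<in> carrier GH.B" by (rule GH.basis_in[OF S.P.subgroup_axioms comp])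
    show "?r \<in> carrier GH.B"
      by (rule burnside_comp_closed(1)[OF GU.burnside_module_axioms UH.burnside_module_axioms x y])
    fix P \<phi> assume "(P, \<phi>) \<in> hom_pairs G H"
    then interpret P: std_pair G H P \<phi> by (intro GH.std_pairI) (auto simp: hom_pairs_def)
    let ?c = "\<lambda>g k. g \<otimes>\<^bsub>G\<^esub> k \<otimes>\<^bsub>G\<^esub> inv\<^bsub>G\<^esub> g"
    let ?N = "{g \<in> carrier G. \<forall>k\<in>P. ?c g k \<in> Q}"
    let ?R = "\<lambda>g. {h \<in> carrier H. \<forall>k\<in>P. \<phi> k = h \<otimes>\<^bsub>H\<^esub> \<eta> (\<psi> (?c g k)) \<otimes>\<^bsub>H\<^esub> inv\<^bsub>H\<^esub> h}"
    have P: "finite P" "(\<lambda>k. k) \<in> P \<rightarrow> carrier G" "\<phi> \<in> P \<rightarrow> carrier H"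
      using finite_subset[OF P.P.subset GH.G.fin] P.hom_closed by auto
    have "of_nat (card Q) * bmark P (\<lambda>k. k) \<phi> ?r =
        (\<Sum>g\<in>?N. bmark P (\<lambda>k. \<psi> (?c g k)) \<phi> (burnside_basis p (subgrp H U) H U \<eta>))"
      by (rule bmark_comp_basis_right[OF GU.burnside_module_axioms UH.burnside_module_axioms x
            S.P.subgroup_axioms \<psi>' P])
    also have "\<dots> = (\<Sum>g\<in>?N. of_nat (card (?R g)))"
    proof (rule sum.cong[OF refl])
      fix g assume "g \<in> ?N"
      hence "(\<lambda>k. \<psi> (?c g k)) \<in> P \<rightarrow> carrier (subgrp H U)" by (auto simp: U_def)
      from UH.bmark_basis_full[OF \<eta>' this P(3)]
      show "bmark P (\<lambda>k. \<psi> (?c g k)) \<phi> (burnside_basis p (subgrp H U) H U \<eta>) = of_nat (card (?R g))"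
        by simp
    qed
    also have "\<dots> = of_nat (card (Sigma ?N ?R))"
      using GH.G.fin GH.H.fin by simp
    also have "card (Sigma ?N ?R) = card ((\<lambda>(g, h). (h, g)) ` Sigma ?N ?R)"
      by (rule card_image[symmetric]) (auto simp: inj_on_def)
    also have "(\<lambda>(g, h). (h, g)) ` Sigma ?N ?R = {(h, g). h \<in> carrier H \<and> g \<in> carrier G \<and>
       (\<forall>k\<in>P. ?c g k \<in> Q \<and> \<phi> k = h \<otimes>\<^bsub>H\<^esub> compose Q \<eta> \<psi> (?c g k) \<otimes>\<^bsub>H\<^esub> inv\<^bsub>H\<^esub> h)}"
      by (auto simp: compose_def image_iff)
    also have "of_nat (card \<dots>) = of_nat (card Q) * bmark P (\<lambda>k. k) \<phi> ?l"
      by (rule GH.bmark_basis[OF S.P.subgroup_axioms comp P(2,3), symmetric])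
    finally have "of_nat (card Q) * bmark P (\<lambda>k. k) \<phi> ?r = of_nat (card Q) * bmark P (\<lambda>k. k) \<phi> ?l" .
    moreover have "Q \<noteq> {}" using S.P.one_closed by blast
    hence "card Q \<noteq> 0" using finite_subset[OF S.P.subset GH.G.fin] by simp
    ultimately show "bmark P (\<lambda>k. k) \<phi> ?l = bmark P (\<lambda>k. k) \<phi> ?r" by simp
  qed
qed

section \<open>Characteristic idempotents\<close>

locale fusion = fixes p :: nat and S :: "'a monoid" (structure) and F :: "'a fusion"
  assumes p: "prime p" and fusion: "fusion_system p S F"
begin

sublocale fin_group S
  using fusion by (auto simp: fusion_system_def finite_p_group_def fin_group_def fin_group_axioms_def)

lemma p_group: "finite_p_group p S"
  using fusion by (simp add: fusion_system_def)

lemma order_power: "\<exists>n. order S = p ^ n"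
  using p_group by (simp add: finite_p_group_def)

lemma F_subgroup: "\<phi> \<in> F P Q \<Longrightarrow> subgroup P S" "\<phi> \<in> F P Q \<Longrightarrow> subgroup Q S"
  using fusion by (auto simp: fusion_system_def)

lemma F_bounds:
  assumes "subgroup P S" "subgroup Q S"
  shows "conj_homs S P Q \<subseteq> F P Q" "F P Q \<subseteq> inj_homs S P Q"
  using fusion assms unfolding fusion_system_def by blast+

lemma F_inj_homs: "\<phi> \<in> F P Q \<Longrightarrow> \<phi> \<in> inj_homs S P Q"
  using F_subgroup[of \<phi> P Q] F_bounds(2) by blast

lemma F_hom: "\<phi> \<in> F P Q \<Longrightarrow> \<phi> \<in> hom (subgrp S P) (subgrp S Q)"
  and F_inj: "\<phi> \<in> F P Q \<Longrightarrow> inj_on \<phi> P"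
  and F_ext: "\<phi> \<in> F P Q \<Longrightarrow> \<phi> \<in> extensional P"
  using F_inj_homs by (auto simp: inj_homs_def)

lemma F_closed: "\<phi> \<in> F P Q \<Longrightarrow> x \<in> P \<Longrightarrow> \<phi> x \<in> Q"
  using F_hom[of \<phi> P Q] by (auto simp: hom_def)

lemma F_mult: "\<phi> \<in> F P Q \<Longrightarrow> x \<in> P \<Longrightarrow> y \<in> P \<Longrightarrow> \<phi> (x \<otimes> y) = \<phi> x \<otimes> \<phi> y"
  using F_hom[of \<phi> P Q] by (auto simp: hom_def)

lemma F_comp: "\<phi> \<in> F P Q \<Longrightarrow> \<psi> \<in> F Q R \<Longrightarrow> compose P \<psi> \<phi> \<in> F P R"
  using fusion by (auto simp: fusion_system_def)

lemma F_image: "\<phi> \<in> F P Q \<Longrightarrow> \<phi> \<in> F P (\<phi> ` P)"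
  and F_inv: "\<phi> \<in> F P Q \<Longrightarrow> (\<lambda>y\<in>\<phi> ` P. inv_into P \<phi> y) \<in> F (\<phi> ` P) P"
  using fusion by (auto simp: fusion_system_def)

lemma F_image_subgroup: "\<phi> \<in> F P Q \<Longrightarrow> subgroup (\<phi> ` P) S"
  using F_image F_subgroup by blast

lemma F_conj: "subgroup P S \<Longrightarrow> subgroup Q S \<Longrightarrow> g \<in> carrier S \<Longrightarrow>
    (\<And>x. x \<in> P \<Longrightarrow> g \<otimes> x \<otimes> inv g \<in> Q) \<Longrightarrow> (\<lambda>x\<in>P. g \<otimes> x \<otimes> inv g) \<in> F P Q"
  using F_bounds(1)[of P Q] by (auto simp: conj_homs_def)

lemma F_incl: "subgroup P S \<Longrightarrow> subgroup Q S \<Longrightarrow> P \<subseteq> Q \<Longrightarrow> (\<lambda>x\<in>P. x) \<in> F P Q"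
proof -
  assume a: "subgroup P S" "subgroup Q S" "P \<subseteq> Q"
  have "\<one> \<otimes> x \<otimes> inv \<one> = x" if "x \<in> P" for x
    using subgroup.mem_carrier[OF a(1) that] by simp
  hence "(\<lambda>x\<in>P. x) = (\<lambda>x\<in>P. \<one> \<otimes> x \<otimes> inv \<one>)" "\<And>x. x \<in> P \<Longrightarrow> \<one> \<otimes> x \<otimes> inv \<one> \<in> Q"
    using a(3) by (auto intro!: restrict_ext)
  thus ?thesis using F_conj[OF a(1,2) one_closed] by simp
qed

lemma F_codom:
  assumes "\<phi> \<in> F P Q" "\<phi> ` P \<subseteq> R" "subgroup R S"
  shows "\<phi> \<in> F P R"
proof -
  have "compose P (\<lambda>x\<in>\<phi> ` P. x) \<phi> = \<phi>"
    using F_ext[OF assms(1)] by (auto simp: compose_def fun_eq_iff extensional_def)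
  thus ?thesis
    using F_comp[OF F_image[OF assms(1)] F_incl[OF F_image_subgroup[OF assms(1)] assms(3,2)]] by simp
qed

lemma F_carrier: "\<phi> \<in> F P Q \<Longrightarrow> \<phi> \<in> F P (carrier S)"
  by (rule F_codom) (auto dest: F_closed F_subgroup subgroup.mem_carrier intro: subgroup_self)

lemma F_restrict:
  assumes "\<phi> \<in> F P Q" "V \<subseteq> P" "subgroup V S"
  shows "restrict \<phi> V \<in> F V Q"
proof -
  have "compose V \<phi> (\<lambda>x\<in>V. x) = restrict \<phi> V" by (auto simp: compose_def fun_eq_iff)
  thus ?thesis using F_comp[OF F_incl[OF assms(3) F_subgroup(1)[OF assms(1)] assms(2)] assms(1)] by simp
qed

lemma F_PiE: "F P (carrier S) \<subseteq> P \<rightarrow>\<^sub>E carrier S"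
  using F_closed F_ext by (auto simp: PiE_def)

lemma subgroup_finite: "subgroup P S \<Longrightarrow> finite P"
  using subgroup.subset[of P S] fin finite_subset by blast

lemma finite_F: "finite (F P (carrier S))"
proof (cases "subgroup P S")
  case True
  have "finite (P \<rightarrow>\<^sub>E carrier S)" using subgroup_finite[OF True] fin by (intro finite_PiE) auto
  thus ?thesis using F_PiE finite_subset by blast
next
  case False
  hence "F P (carrier S) = {}" using F_subgroup(1) by blast
  thus ?thesis by simp
qed

lemma F_incl_S: "subgroup P S \<Longrightarrow> (\<lambda>x\<in>P. x) \<in> F P (carrier S)"
  by (rule F_incl) (auto intro: subgroup_self dest: subgroup.subset)

lemma F_hom_S: "\<phi> \<in> F P (carrier S) \<Longrightarrow> \<phi> \<in> hom (subgrp S P) S"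
  using F_hom[of \<phi> P "carrier S"] by simp

lemma F_hom_pairs: "\<phi> \<in> F P (carrier S) \<Longrightarrow> (P, \<phi>) \<in> hom_pairs S S"
  by (simp add: hom_pairs_def F_subgroup(1) F_hom_S F_ext)

lemma subgroup_fin_group: "subgroup P S \<Longrightarrow> fin_group (subgrp S P)"
  using subgroup.subgroup_is_group[OF _ is_group] subgroup_finite
  by (simp add: fin_group_def fin_group_axioms_def)

lemma card_subgroup: "subgroup P S \<Longrightarrow> \<exists>n. card P = p ^ n"
proof -
  assume "subgroup P S"
  from lagrange[OF this] order_power obtain n where n: "card (rcosets P) * card P = p ^ n" by auto
  have "card P dvd p ^ n" unfolding n[symmetric] by simp
  thus ?thesis using divides_primepow_nat[OF p] by blast
qed

lemma p_subgroup: "subgroup P S \<Longrightarrow> finite_p_group p (subgrp S P)"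
  using card_subgroup[of P] subgroup_fin_group[of P]
  by (simp add: finite_p_group_def fin_group_def fin_group_axioms_def order_def)

sublocale morphism_class S "\<lambda>U. F U (carrier S)"
proof
  fix U V \<eta> \<eta>' and h
  show "\<eta> \<in> hom (subgrp S U) S \<and> inj_on \<eta> U \<and> \<eta> \<in> extensional U" if "\<eta> \<in> F U (carrier S)"
    using that F_hom_S F_inj F_ext by blast
  show "(\<lambda>x\<in>U. h \<otimes> x \<otimes> inv h) \<in> F U (carrier S)" if "subgroup U S" "h \<in> carrier S"
    using that by (intro F_conj) (auto intro: subgroup_self dest: subgroup.mem_carrier)
  show "compose U \<eta>' \<eta> \<in> F U (carrier S)" if "\<eta> \<in> F U (carrier S)" "\<eta>' \<in> F (\<eta> ` U) (carrier S)"
    using F_comp[OF F_image[OF that(1)] that(2)] .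
  show "(\<lambda>y\<in>\<eta> ` U. inv_into U \<eta> y) \<in> F (\<eta> ` U) (carrier S)" if "\<eta> \<in> F U (carrier S)"
    using F_carrier[OF F_inv[OF that]] .
  show "restrict \<eta> V \<in> F V (carrier S)" if "subgroup V S" "V \<subseteq> U" "\<eta> \<in> F U (carrier S)"
    using F_restrict[OF that(3,2,1)] .
qed

end

subsection \<open>The augmentation\<close>

text \<open>A \<open>p\<close>-subgroup \<open>P\<close> of \<open>G\<close> acts on the set of left \<open>H\<close>-orbits; the fixed orbits are counted by the
  sum of the marks at \<open>P\<close>.\<close>

lemma (in lf_biset) sum_marks_cong:
  assumes p: "prime (p :: nat)" and P: "subgroup P G" "card P = p ^ n"
  shows "\<exists>n1 n2. (\<Sum>\<theta>\<in>P \<rightarrow>\<^sub>E carrier H. mark P (\<lambda>k. k) \<theta> X) = card (carrier H) * n1 \<and>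
    card (points X) = card (carrier H) * n2 \<and> [n2 = n1] (mod p)"
proof -
  interpret P: subgroup P G by fact
  define r where "r = {(z, lact X k z) | z k. z \<in> points X \<and> k \<in> carrier H}"
  have act1: "lact X k z \<in> points X" if "k \<in> carrier H" "z \<in> points X" for k z
    using that by (simp add: lact_closed)
  have act2: "lact X (k \<otimes>\<^bsub>H\<^esub> l) z = lact X k (lact X l z)"
    if "k \<in> carrier H" "l \<in> carrier H" "z \<in> points X" for k l z
    using that by (simp add: lact_mult)
  have act3: "k = \<one>\<^bsub>H\<^esub>" if "k \<in> carrier H" "z \<in> points X" "lact X k z = z" for k z
    using free that by blast
  have fa: "equiv (points X) r \<and> (\<forall>z\<in>points X. r `` {z} = (\<lambda>k. lact X k z) ` carrier H) \<and>
      (\<forall>z\<in>points X. card (r `` {z}) = card (carrier H))"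
    using free_action_equiv[where act = "lact X" and E = "points X" and L = H and r = r,
      OF H.group_axioms _ _ _ _ r_def] act1 lact_one act2 act3 by blast
  hence e: "equiv (points X) r"
    and cls: "\<And>z. z \<in> points X \<Longrightarrow> r `` {z} = (\<lambda>k. lact X k z) ` carrier H"
    and card: "\<And>z. z \<in> points X \<Longrightarrow> card (r `` {z}) = card (carrier H)" by blast+
  define act where "act = (\<lambda>g C. (\<lambda>x. ract X x (inv\<^bsub>G\<^esub> g)) ` C)"
  have act: "act g (r `` {z}) = r `` {ract X z (inv\<^bsub>G\<^esub> g)}" if "z \<in> points X" "g \<in> carrier G" for g z
    using that by (simp add: act_def cls ract_closed image_image ract_lact)
  have q: "C \<in> points X // r \<longleftrightarrow> (\<exists>z\<in>points X. C = r `` {z})" for C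
    by (auto simp: quotient_def)
  have iff: "act g (r `` {z}) = r `` {z} \<longleftrightarrow> (\<exists>h\<in>carrier H. lact X h z = ract X z (inv\<^bsub>G\<^esub> g))"
    if "z \<in> points X" "g \<in> carrier G" for g z
  proof -
    have "act g (r `` {z}) = r `` {z} \<longleftrightarrow> (z, ract X z (inv\<^bsub>G\<^esub> g)) \<in> r"
      using that eq_equiv_class_iff[OF e, of z "ract X z (inv\<^bsub>G\<^esub> g)"]
      by (auto simp: act ract_closed)
    also have "\<dots> \<longleftrightarrow> (\<exists>h\<in>carrier H. lact X h z = ract X z (inv\<^bsub>G\<^esub> g))"
      using that by (auto simp: r_def eq_commute[of "ract X z (inv\<^bsub>G\<^esub> g)"])
    finally show ?thesis .
  qed
  let ?n2 = "card (points X // r)"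
  let ?n1 = "card {C \<in> points X // r. \<forall>g\<in>P. act g C = C}"
  have "[?n2 = card {C \<in> points X // r. \<forall>g\<in>carrier (subgrp G P). act g C = C}] (mod p)"
  proof (rule fixed_points_cong[OF _ p])
    show "group (subgrp G P)" by (rule P.subgroup_is_group) (rule G.group_axioms)
    show "order (subgrp G P) = p ^ n" using P by (simp add: order_def)
    show "finite (points X // r)" using fin_points by (simp add: quotient_def)
  next
    fix g C assume "g \<in> carrier (subgrp G P)" "C \<in> points X // r"
    thus "act g C \<in> points X // r" using ract_closed by (auto simp: q act intro!: bexI)
  next
    fix C assume "C \<in> points X // r"
    thus "act \<one>\<^bsub>subgrp G P\<^esub> C = C" by (auto simp: q act ract_one)
  next
    fix g h C assume "g \<in> carrier (subgrp G P)" "h \<in> carrier (subgrp G P)" "C \<in> points X // r"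
    thus "act (g \<otimes>\<^bsub>subgrp G P\<^esub> h) C = act g (act h C)"
      by (auto simp: q act ract_closed ract_mult G.inv_mult_group)
  qed
  hence cong: "[?n2 = ?n1] (mod p)" by simp
  have 2: "card (points X) = card (carrier H) * ?n2"
    using quotient_count[OF e fin_points card, of "\<lambda>_. True" "\<lambda>_. True"] by simp
  have 1: "card {x \<in> points X. \<forall>g\<in>P. \<exists>h\<in>carrier H. lact X h x = ract X x (inv\<^bsub>G\<^esub> g)} = card (carrier H) * ?n1"
  proof (rule quotient_count[OF e fin_points card])
    fix x assume "x \<in> points X"
    thus "(\<forall>g\<in>P. \<exists>h\<in>carrier H. lact X h x = ract X x (inv\<^bsub>G\<^esub> g)) \<longleftrightarrow> (\<forall>g\<in>P. act g (r `` {x}) = r `` {x})"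
      by (intro ball_cong refl iff[symmetric]) auto
  qed
  let ?A = "\<lambda>\<theta>. {x \<in> points X. \<forall>k\<in>P. lact X (\<theta> k) x = ract X x k}"
  have "{x \<in> points X. \<forall>g\<in>P. \<exists>h\<in>carrier H. lact X h x = ract X x (inv\<^bsub>G\<^esub> g)} =
      {x \<in> points X. \<forall>g\<in>P. \<exists>h\<in>carrier H. lact X h x = ract X x g}"
  proof -
    have inv: "(\<forall>g\<in>P. R (inv\<^bsub>G\<^esub> g)) \<longleftrightarrow> (\<forall>g\<in>P. R g)" for R
    proof (intro iffI ballI)
      fix g assume "\<forall>g\<in>P. R (inv\<^bsub>G\<^esub> g)" and g: "g \<in> P"
      hence "R (inv\<^bsub>G\<^esub> (inv\<^bsub>G\<^esub> g))" by blast
      thus "R g" using g by simp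
    qed auto
    show ?thesis
      by (intro Collect_cong conj_cong refl
          inv[where R = "\<lambda>g. \<exists>h\<in>carrier H. lact X h x = ract X x g" for x])
  qed
  \<comment> \<open>Freeness of the left action makes \<open>h\<close> unique for each
    \<open>g\<close>, so these points split into blocks according to \<theta>, each counted by one
    mark.\<close>
  also have "\<dots> = (\<Union>\<theta>\<in>P \<rightarrow>\<^sub>E carrier H. ?A \<theta>)"
  proof (intro equalityI subsetI)
    fix x assume x: "x \<in> {x \<in> points X. \<forall>g\<in>P. \<exists>h\<in>carrier H. lact X h x = ract X x g}"
    hence "\<forall>g\<in>P. \<exists>h. h \<in> carrier H \<and> lact X h x = ract X x g" by blast
    from bchoice[OF this] obtain \<theta> where
      \<theta>: "\<And>g. g \<in> P \<Longrightarrow> \<theta> g \<in> carrier H \<and> lact X (\<theta> g) x = ract X x g" by blast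
    have "restrict \<theta> P \<in> P \<rightarrow>\<^sub>E carrier H" "x \<in> ?A (restrict \<theta> P)" using x \<theta> by auto
    thus "x \<in> (\<Union>\<theta>\<in>P \<rightarrow>\<^sub>E carrier H. ?A \<theta>)" by blast
  qed (auto simp: PiE_def)
  also have "card \<dots> = (\<Sum>\<theta>\<in>P \<rightarrow>\<^sub>E carrier H. card (?A \<theta>))"
  proof (rule card_UN_disjoint)
    have "finite P" using finite_subset[OF P.subset G.fin] .
    thus "finite (P \<rightarrow>\<^sub>E carrier H)" using H.fin by (intro finite_PiE) auto
    show "\<forall>\<theta>\<in>P \<rightarrow>\<^sub>E carrier H. finite (?A \<theta>)" using fin_points by simp
    show "\<forall>\<theta>\<in>P \<rightarrow>\<^sub>E carrier H. \<forall>\<theta>'\<in>P \<rightarrow>\<^sub>E carrier H. \<theta> \<noteq> \<theta>' \<longrightarrow> ?A \<theta> \<inter> ?A \<theta>' = {}"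
    proof (intro ballI impI)
      fix \<theta> \<theta>' assume t: "\<theta> \<in> P \<rightarrow>\<^sub>E carrier H" "\<theta>' \<in> P \<rightarrow>\<^sub>E carrier H" "\<theta> \<noteq> \<theta>'"
      have "\<theta> = \<theta>'" if x: "x \<in> ?A \<theta>" "x \<in> ?A \<theta>'" for x
      proof (rule PiE_ext[OF t(1,2)])
        fix k assume k: "k \<in> P"
        show "\<theta> k = \<theta>' k"
          by (rule lact_cancel[of x]) (use x k t in \<open>auto simp: PiE_mem\<close>)
      qed
      thus "?A \<theta> \<inter> ?A \<theta>' = {}" using t(3) by blast
    qed
  qed
  finally have "(\<Sum>\<theta>\<in>P \<rightarrow>\<^sub>E carrier H. mark P (\<lambda>k. k) \<theta> X) = card (carrier H) * ?n1"
    using 1 by (simp add: mark_def)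
  thus ?thesis using 2 cong by blast
qed

text \<open>The empty index set imposes no condition on points, so this is the linear extension of
  the cardinality of a biset.\<close>

abbreviation bcard :: "'a burnside \<Rightarrow> rat" where
  "bcard x \<equiv> bmark {} (\<lambda>k :: 'a. k) (\<lambda>k. k) x"

context burnside_module
begin

lemma lookup_rep: "x \<in> carrier B \<Longrightarrow> Poly_Mapping.lookup (burnside_rep x) c \<in> carrier (Zloc p)"
  using carrier_rep(1)[of x] by (simp add: burnside_free_def)

text \<open>The left action is free, so the cardinality of a biset is a multiple of |H|. The
  quotient is the number of left orbits, an integer for each biset.\<close>

lemma bcard_Zloc:
  assumes p: "prime p" and x: "x \<in> carrier B"
  shows "bcard x / of_nat (card (carrier H)) \<in> carrier (Zloc p)"
proof -
  have "\<exists>n. cmark {} (\<lambda>k :: 'a. k) (\<lambda>k. k) c = card (carrier H) * n"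
    if c: "c \<in> Poly_Mapping.keys (burnside_rep x)" for c
  proof -
    obtain X :: "('a, nat) biset" where X: "finite_left_free_biset G H X" "c = iso_class G H X"
      using key_biset[OF x c] .
    interpret lf_biset G H X by unfold_locales (rule X(1))
    have "subgroup {\<one>\<^bsub>G\<^esub>} G" "card {\<one>\<^bsub>G\<^esub>} = p ^ 0" using G.triv_subgroup by simp_all
    from sum_marks_cong[OF p this] show ?thesis
      unfolding X(2) by (simp add: cmark_iso_class[OF X(1)] mark_def) blast
  qed
  then obtain n where n: "\<And>c. c \<in> Poly_Mapping.keys (burnside_rep x) \<Longrightarrow>
    cmark {} (\<lambda>k :: 'a. k) (\<lambda>k. k) c = card (carrier H) * n c" by metis
  have "bcard x / of_nat (card (carrier H)) =
     (\<Sum>c\<in>Poly_Mapping.keys (burnside_rep x). Poly_Mapping.lookup (burnside_rep x) c * of_nat (n c))"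
    unfolding bmark_def fmark_def sum_divide_distrib
    by (intro sum.cong refl) (use n card_pos_fin_group[OF H.fin_group_axioms] in simp)
  also have "\<dots> \<in> carrier (Zloc p)"
    using x by (intro Zloc_sum Zloc_mult lookup_rep Zloc_of_nat)
  finally show ?thesis .
qed

text \<open>Linear extension of the orbit count: the number of left orbits agrees modulo
  \<open>p\<close> with the number of those fixed by \<open>P\<close>, and coefficients in the local
  ring preserve divisibility by \<open>p\<close>.\<close>

lemma bcard_cong:
  assumes p: "prime p" and x: "x \<in> carrier B" and P: "subgroup P G" "card P = p ^ n"
  shows "\<exists>z\<in>carrier (Zloc p). bcard x / of_nat (card (carrier H)) =
    (\<Sum>\<theta>\<in>P \<rightarrow>\<^sub>E carrier H. bmark P (\<lambda>k. k) \<theta> x) / of_nat (card (carrier H)) + of_nat p * z"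
proof -
  let ?K = "Poly_Mapping.keys (burnside_rep x)" and ?l = "Poly_Mapping.lookup (burnside_rep x)"
  let ?h = "card (carrier H)"
  have "\<exists>m :: int. of_nat (cmark {} (\<lambda>k :: 'a. k) (\<lambda>k. k) c) =
      (of_nat (\<Sum>\<theta>\<in>P \<rightarrow>\<^sub>E carrier H. cmark P (\<lambda>k. k) \<theta> c) + of_nat ?h * (of_nat p * of_int m) :: rat)"
    if c: "c \<in> ?K" for c
  proof -
    obtain X :: "('a, nat) biset" where X: "finite_left_free_biset G H X" "c = iso_class G H X"
      using key_biset[OF x c] .
    interpret lf_biset G H X by unfold_locales (rule X(1))
    have "(\<lambda>k. k) \<in> P \<rightarrow> carrier G" using P(1) by (auto dest: subgroup.mem_carrier)
    hence s: "(\<Sum>\<theta>\<in>P \<rightarrow>\<^sub>E carrier H. cmark P (\<lambda>k. k) \<theta> c) = (\<Sum>\<theta>\<in>P \<rightarrow>\<^sub>E carrier H. mark P (\<lambda>k. k) \<theta> X)"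
      unfolding X(2) by (intro sum.cong refl cmark_iso_class[OF X(1)]) (auto simp: PiE_def)
    have c0: "cmark {} (\<lambda>k :: 'a. k) (\<lambda>k. k) c = card (points X)"
      unfolding X(2) by (simp add: cmark_iso_class[OF X(1)] mark_def)
    obtain n1 n2 where n: "(\<Sum>\<theta>\<in>P \<rightarrow>\<^sub>E carrier H. mark P (\<lambda>k. k) \<theta> X) = ?h * n1"
      "card (points X) = ?h * n2" "[n2 = n1] (mod p)" using sum_marks_cong[OF p P] by blast
    have "int p dvd int n2 - int n1" using n(3) by (simp add: cong_iff_dvd_diff flip: cong_int_iff)
    then obtain m where "int n2 - int n1 = int p * m" by (elim dvdE)
    hence "int n2 = int n1 + int p * m" by simp
    hence "(of_int (int n2) :: rat) = of_int (int n1 + int p * m)" by simp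
    hence "(of_nat n2 :: rat) = of_nat n1 + of_nat p * of_int m" by simp
    hence "(of_nat (?h * n2) :: rat) = of_nat (?h * n1) + of_nat ?h * (of_nat p * of_int m)"
      by (simp add: distrib_left)
    thus ?thesis unfolding s c0 n(1,2) by blast
  qed
  then obtain m where m: "\<And>c. c \<in> ?K \<Longrightarrow> of_nat (cmark {} (\<lambda>k :: 'a. k) (\<lambda>k. k) c) =
      (of_nat (\<Sum>\<theta>\<in>P \<rightarrow>\<^sub>E carrier H. cmark P (\<lambda>k. k) \<theta> c) + of_nat ?h * (of_nat p * of_int (m c)) :: rat)"
    by metis
  have "bcard x = (\<Sum>c\<in>?K. ?l c * of_nat (\<Sum>\<theta>\<in>P \<rightarrow>\<^sub>E carrier H. cmark P (\<lambda>k. k) \<theta> c)) +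
      of_nat ?h * (of_nat p * (\<Sum>c\<in>?K. ?l c * of_int (m c)))"
    unfolding bmark_def fmark_def sum_distrib_left sum.distrib[symmetric]
    by (intro sum.cong refl) (simp only: m distrib_left mult_ac)
  also have "(\<Sum>c\<in>?K. ?l c * of_nat (\<Sum>\<theta>\<in>P \<rightarrow>\<^sub>E carrier H. cmark P (\<lambda>k. k) \<theta> c)) =
      (\<Sum>\<theta>\<in>P \<rightarrow>\<^sub>E carrier H. bmark P (\<lambda>k. k) \<theta> x)"
    unfolding bmark_def fmark_def of_nat_sum sum_distrib_left by (rule sum.swap)
  finally have "bcard x / of_nat ?h = (\<Sum>\<theta>\<in>P \<rightarrow>\<^sub>E carrier H. bmark P (\<lambda>k. k) \<theta> x) / of_nat ?h +
      of_nat p * (\<Sum>c\<in>?K. ?l c * of_int (m c))"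
    using card_pos_fin_group[OF H.fin_group_axioms] by (simp add: add_divide_distrib)
  moreover have "(\<Sum>c\<in>?K. ?l c * of_int (m c)) \<in> carrier (Zloc p)"
    using x by (intro Zloc_sum Zloc_mult lookup_rep Zloc_of_int)
  ultimately show ?thesis by blast
qed

end

text \<open>The augmentation is the number of left orbits: [P, \<phi>] has |S|^2 / |P| points and
  therefore |S/P| left orbits. The definite description is met because a linear map is determined by
  its values on the transitive bisets.\<close>

lemma augmentation_eq:
  assumes p: "prime p" and S: "fin_group S" and x: "x \<in> carrier (burnside p S S)"
  shows "augmentation p S x = bcard x / of_nat (card (carrier S))"
proof -
  interpret S: fin_group S by fact
  interpret burnside_module S S p by unfold_locales
  let ?e = "\<lambda>x\<in>carrier B. bcard x / of_nat (card (carrier S))"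
  let ?P = "\<lambda>e. e \<in> extensional (carrier B) \<and> linear_map (Zloc p) B (Zloc p) e \<and>
     (\<forall>P. subgroup P S \<longrightarrow> (\<forall>\<phi>\<in>hom (subgrp S P) S.
        e (burnside_basis p S S P \<phi>) = of_nat (card (rcosets\<^bsub>S\<^esub> P))))"
  have ids: "(\<lambda>k :: 'a. k) \<in> {} \<rightarrow> carrier S" by simp
  have pos: "card (carrier S) > 0" by (rule card_pos_fin_group) (rule S)
  have Zl: "a \<oplus>\<^bsub>Zloc p\<^esub> b = a + b" "a \<odot>\<^bsub>Zloc p\<^esub> b = a * b" for a b by (simp_all add: Zloc_def)
  have ex: "?P ?e"
  proof (intro conjI allI impI ballI)
    show "linear_map (Zloc p) B (Zloc p) ?e"
      unfolding linear_map_def Zl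
      using bcard_Zloc[OF p]
      by (auto simp: add_closed smult_closed bmark_add[OF ids ids] bmark_smult[OF ids ids] add_divide_distrib)
    fix P \<phi> assume P: "subgroup P S" "\<phi> \<in> hom (subgrp S P) S"
    have cP: "card P > 0" using S.fin subgroup.subset[OF P(1)] subgroup.one_closed[OF P(1)]
      by (auto simp: card_gt_0_iff intro: finite_subset)
    have "of_nat (card P) * bcard (burnside_basis p S S P \<phi>) = of_nat (card (carrier S \<times> carrier S))"
      using bmark_basis[OF P ids ids] by simp
    also have "\<dots> = of_nat (card (rcosets\<^bsub>S\<^esub> P) * card P) * of_nat (card (carrier S))"
      using S.lagrange[OF P(1)] by (simp add: card_cartesian_product order_def)
    finally have "bcard (burnside_basis p S S P \<phi>) = of_nat (card (rcosets\<^bsub>S\<^esub> P)) * of_nat (card (carrier S))"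
      using cP by simp
    thus "?e (burnside_basis p S S P \<phi>) = of_nat (card (rcosets\<^bsub>S\<^esub> P))"
      using basis_in[OF P] pos by simp
  qed auto
  \<comment> \<open>\<open>free_induct\<close> transfers equality from basis elements to the whole
    module; a change by a relation does not change the coset.\<close>
  have uniq: "e = ?e" if e: "?P e" for e
  proof -
    have lin: "e (x \<oplus>\<^bsub>B\<^esub> y) = e x + e y" if "x \<in> carrier B" "y \<in> carrier B" for x y
      using e that unfolding linear_map_def Zl by blast
    have hom: "e (r \<odot>\<^bsub>B\<^esub> x) = r * e x" if "x \<in> carrier B" "r \<in> carrier (Zloc p)" for r x
      using e that unfolding linear_map_def Zl by blast
    have lin': "?e (x \<oplus>\<^bsub>B\<^esub> y) = ?e x + ?e y" if "x \<in> carrier B" "y \<in> carrier B" for x y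
      using ex that unfolding linear_map_def Zl by blast
    have hom': "?e (r \<odot>\<^bsub>B\<^esub> x) = r * ?e x" if "x \<in> carrier B" "r \<in> carrier (Zloc p)" for r x
      using ex that unfolding linear_map_def Zl by blast
    have "e (coset f) = ?e (coset f)" if "f \<in> free" for f
      using that
    proof (induction rule: free_induct)
      case (base i)
      hence "coset (std_cls S S i) = burnside_basis p S S (fst i) (snd i)" "subgroup (fst i) S"
        "snd i \<in> hom (subgrp S (fst i)) S" by (auto simp: burnside_basis_def hom_pairs_def)
      thus ?case using e ex by metis
    next
      case zero
      have "coset 0 = 0 \<odot>\<^bsub>B\<^esub> coset 0" using coset_smult[OF free_zero Zloc_0] by simp
      thus ?case using hom[OF coset_in[OF free_zero] Zloc_0] hom'[OF coset_in[OF free_zero] Zloc_0] by simp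
    next
      case (add f g)
      thus ?case using lin[of "coset f" "coset g"] lin'[of "coset f" "coset g"]
        by (simp add: coset_add coset_in)
    next
      case (scale r f)
      thus ?case using hom[of "coset f" r] hom'[of "coset f" r] by (simp add: coset_smult coset_in)
    next
      case (rels f g)
      have "g = f + (g - f)" by simp
      hence "g \<in> free" using rels.hyps free_add rels_free by metis
      hence "coset g = coset f" using rels.hyps coset_eq_iff by blast
      thus ?case using rels.IH by simp
    qed
    hence "e x = ?e x" if "x \<in> carrier B" for x using that carrier_rep by metis
    thus "e = ?e" using e by (intro extensionalityI[of e "carrier B"]) auto
  qed
  have "augmentation p S = ?e"
    unfolding augmentation_def by (rule the_equality) (fact ex, rule uniq)
  thus ?thesis using x by simp
qed

subsection \<open>Marks of the characteristic idempotent\<close>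

locale char_idem = fusion +
  fixes \<omega> :: "'a burnside"
  assumes char_idem: "characteristic_idempotent p S F \<omega>"
begin

sublocale B: burnside_module S S p by unfold_locales

lemma omega_in: "\<omega> \<in> carrier (burnside p S S)"
  using char_idem by (simp add: characteristic_idempotent_def)

text \<open>A nonzero mark of a combination of elements [Q, \<psi>] comes from one of them. Then
  \<theta> is \<psi> preceded and followed by conjugations in \<open>S\<close>, all of which lie in
  \<open>F\<close>.\<close>

lemma bmark_omega_support:
  assumes P: "subgroup P S" and \<theta>: "\<theta> \<in> P \<rightarrow>\<^sub>E carrier S" and nz: "bmark P (\<lambda>k. k) \<theta> \<omega> \<noteq> 0"
  shows "\<theta> \<in> F P (carrier S)"
proof -
  have ids: "(\<lambda>k. k) \<in> P \<rightarrow> carrier S" "\<theta> \<in> P \<rightarrow> carrier S"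
    using subgroup.mem_carrier[OF P] \<theta> by (auto simp: PiE_def)
  let ?A = "{(P, \<phi>). \<phi> \<in> F P (carrier S)}"
  obtain c where c: "range c \<subseteq> carrier (Zloc p)" and
    \<omega>: "\<omega> = (\<Oplus>\<^bsub>burnside p S S\<^esub>b\<in>?A. c b \<odot>\<^bsub>burnside p S S\<^esub> burnside_basis p S S (fst b) (snd b))"
    using char_idem by (auto simp: characteristic_idempotent_def F_generated_def)
  have fA: "finite ?A"
    by (rule finite_subset[OF _ B.finite_pairs]) (use F_hom_pairs in auto)
  have in_A: "burnside_basis p S S (fst b) (snd b) \<in> carrier B.B" if "b \<in> ?A" for b
    using that F_subgroup(1) F_hom_S by (auto intro: B.basis_in)
  have c': "c b \<in> carrier (Zloc p)" for b using c by auto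
  have "bmark P (\<lambda>k. k) \<theta> \<omega> =
      (\<Sum>b\<in>?A. bmark P (\<lambda>k. k) \<theta> (c b \<odot>\<^bsub>B.B\<^esub> burnside_basis p S S (fst b) (snd b)))"
    unfolding \<omega> using in_A c' by (intro B.bmark_finsum[OF ids fA] B.smult_closed)
  then obtain b where b: "b \<in> ?A" "bmark P (\<lambda>k. k) \<theta> (c b \<odot>\<^bsub>B.B\<^esub> burnside_basis p S S (fst b) (snd b)) \<noteq> 0"
    using nz by (metis (mono_tags, lifting) sum.neutral)
  then obtain Q \<psi> where Q: "b = (Q, \<psi>)" "\<psi> \<in> F Q (carrier S)" by auto
  let ?N = "{(h, g). h \<in> carrier S \<and> g \<in> carrier S \<and> (\<forall>k\<in>P. g \<otimes> k \<otimes> inv g \<in> Q \<and>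
       \<theta> k = h \<otimes> \<psi> (g \<otimes> k \<otimes> inv g) \<otimes> inv h)}"
  have "bmark P (\<lambda>k. k) \<theta> (burnside_basis p S S Q \<psi>) \<noteq> 0"
    using b(2) in_A[OF b(1)] c' by (auto simp: Q(1) B.bmark_smult[OF ids])
  moreover have "of_nat (card Q) * bmark P (\<lambda>k. k) \<theta> (burnside_basis p S S Q \<psi>) = of_nat (card ?N)"
    by (rule B.bmark_basis[OF F_subgroup(1)[OF Q(2)] F_hom_S[OF Q(2)] ids])
  moreover have "Q \<noteq> {}" using subgroup.one_closed[OF F_subgroup(1)[OF Q(2)]] by blast
  hence "card Q \<noteq> 0" using subgroup_finite[OF F_subgroup(1)[OF Q(2)]] by simp
  ultimately have "card ?N \<noteq> 0" by (metis mult_eq_0_iff of_nat_eq_0_iff)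
  hence "?N \<noteq> {}" by (metis card.empty)
  then obtain h g where hg: "h \<in> carrier S" "g \<in> carrier S"
    "\<And>k. k \<in> P \<Longrightarrow> g \<otimes> k \<otimes> inv g \<in> Q" "\<And>k. k \<in> P \<Longrightarrow> \<theta> k = h \<otimes> \<psi> (g \<otimes> k \<otimes> inv g) \<otimes> inv h" by auto
  have "compose P \<psi> (\<lambda>k\<in>P. g \<otimes> k \<otimes> inv g) \<in> F P (carrier S)"
    using F_comp[OF F_conj[OF P F_subgroup(1)[OF Q(2)] hg(2,3)] Q(2)] by blast
  from F_comp[OF this F_conj[OF subgroup_self subgroup_self hg(1)]]
  have "compose P (\<lambda>x\<in>carrier S. h \<otimes> x \<otimes> inv h) (compose P \<psi> (\<lambda>k\<in>P. g \<otimes> k \<otimes> inv g)) \<in> F P (carrier S)"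
    using hg(1) by simp
  also have "compose P (\<lambda>x\<in>carrier S. h \<otimes> x \<otimes> inv h) (compose P \<psi> (\<lambda>k\<in>P. g \<otimes> k \<otimes> inv g)) = \<theta>"
    using \<theta> hg F_closed[OF Q(2)] by (auto simp: compose_def fun_eq_iff PiE_def extensional_def)
  finally show ?thesis .
qed

text \<open>Composing with [P, \<phi>] restricts the right action along \<phi>, so right stability,
  read on marks at \<open>P\<close>, is this equation.\<close>

lemma bmark_omega_right:
  assumes \<phi>: "\<phi> \<in> F P (carrier S)" and b: "b \<in> P \<rightarrow> carrier S"
  shows "bmark P \<phi> b \<omega> = bmark P (\<lambda>k. k) b \<omega>"
proof -
  have P: "subgroup P S" using F_subgroup(1)[OF \<phi>] .
  interpret P: fin_group "subgrp S P" by (rule subgroup_fin_group[OF P])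
  have m: "burnside_module (subgrp S P) S" "burnside_module S S"
    using P.fin_group_axioms fin_group_axioms by (simp_all add: burnside_module_def)
  have f: "finite P" "(\<lambda>k. k) \<in> P \<rightarrow> carrier (subgrp S P)" using subgroup_finite[OF P] by auto
  have id: "(\<lambda>x. x) \<in> hom (subgrp S P) S" using subgroup.mem_carrier[OF P] by (auto simp: hom_def)
  have st: "burnside_comp p (subgrp S P) S S \<omega> (burnside_basis p (subgrp S P) S P \<phi>) =
      burnside_comp p (subgrp S P) S S \<omega> (burnside_basis p (subgrp S P) S P (\<lambda>x. x))"
    using char_idem \<phi> by (auto simp: characteristic_idempotent_def right_stable_def)
  have "bmark P (\<lambda>k. k) b (burnside_comp p (subgrp S P) S S \<omega> (burnside_basis p (subgrp S P) S P \<phi>)) =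
      bmark P (\<lambda>k. \<phi> k) b \<omega>"
    using bmark_comp_basis_right_full[OF m omega_in F_hom_S[OF \<phi>] f b] by simp
  moreover have "bmark P (\<lambda>k. k) b (burnside_comp p (subgrp S P) S S \<omega> (burnside_basis p (subgrp S P) S P (\<lambda>x. x))) =
      bmark P (\<lambda>k. k) b \<omega>"
    using bmark_comp_basis_right_full[OF m omega_in id f b] by simp
  ultimately show ?thesis using st by simp
qed

text \<open>Left stability is stated with [\<phi>(P), \<phi>^-1], and composing with that element
  restricts the left action along \<phi>, the inverse of its isomorphism.\<close>

lemma bmark_omega_left:
  assumes \<phi>: "\<phi> \<in> F P (carrier S)" and I: "finite I" "a \<in> I \<rightarrow> carrier S" "b \<in> I \<rightarrow> P"
  shows "bmark I a (\<lambda>k. \<phi> (b k)) \<omega> = bmark I a b \<omega>"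
proof -
  have P: "subgroup P S" using F_subgroup(1)[OF \<phi>] .
  interpret P: fin_group "subgrp S P" by (rule subgroup_fin_group[OF P])
  have m: "burnside_module S S" "burnside_module S (subgrp S P)"
    using P.fin_group_axioms fin_group_axioms by (simp_all add: burnside_module_def)
  have b: "b \<in> I \<rightarrow> carrier (subgrp S P)" using I by simp
  have id: "(\<lambda>x. x) \<in> hom (subgrp S P) (subgrp S P)" "(\<lambda>x. x) \<in> hom (subgrp S P) S"
    using subgroup.mem_carrier[OF P] by (auto simp: hom_def)
  have inv: "inv_into P \<phi> \<in> hom (subgrp S (\<phi> ` P)) (subgrp S P)"
    using F_hom[OF F_inv[OF \<phi>]] subgroup.m_closed[OF F_image_subgroup[OF \<phi>]]
    by (auto simp: hom_def inv_into_into)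
  have st: "burnside_comp p S S (subgrp S P) (burnside_basis p S (subgrp S P) (\<phi> ` P) (inv_into P \<phi>)) \<omega> =
      burnside_comp p S S (subgrp S P) (burnside_basis p S (subgrp S P) P (\<lambda>x. x)) \<omega>"
    using char_idem \<phi> by (auto simp: characteristic_idempotent_def left_stable_def)
  have "bmark I a b (burnside_comp p S S (subgrp S P)
      (burnside_basis p S (subgrp S P) (\<phi> ` P) (inv_into P \<phi>)) \<omega>) = bmark I a (\<lambda>k. \<phi> (b k)) \<omega>"
    by (rule bmark_comp_basis_left[OF m omega_in F_image_subgroup[OF \<phi>] inv F_hom_S[OF \<phi>] _ _ I(1,2) b])
       (use F_inj[OF \<phi>] in auto)
  moreover have "bmark I a b (burnside_comp p S S (subgrp S P)
      (burnside_basis p S (subgrp S P) P (\<lambda>x. x)) \<omega>) = bmark I a b \<omega>"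
    by (rule bmark_comp_basis_left[OF m omega_in P id _ _ I(1,2) b]) auto
  ultimately show ?thesis using st by simp
qed

lemma bmark_omega_const:
  assumes \<theta>: "\<theta> \<in> F P (carrier S)"
  shows "bmark P (\<lambda>k. k) \<theta> \<omega> = bmark P (\<lambda>k. k) (\<lambda>k. k) \<omega>"
  using bmark_omega_left[OF \<theta>, of P "\<lambda>k. k" "\<lambda>k. k"] subgroup_finite[OF F_subgroup(1)[OF \<theta>]]
    subgroup.mem_carrier[OF F_subgroup(1)[OF \<theta>]] by auto

text \<open>Marks at functions outside \<open>F\<close> vanish and marks inside \<open>F\<close> are
  equal, so the sum that occurs in a composition formula collapses to a sum over
  \<open>F\<close>.\<close>

lemma sum_bmark_omega:
  assumes P: "subgroup P S"
  shows "(\<Sum>\<theta>\<in>P \<rightarrow>\<^sub>E carrier S. f \<theta> * bmark P (\<lambda>k. k) \<theta> \<omega>) =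
    (\<Sum>\<theta>\<in>F P (carrier S). f \<theta>) * bmark P (\<lambda>k. k) (\<lambda>k. k) \<omega>"
proof -
  have "finite (P \<rightarrow>\<^sub>E carrier S)" using subgroup_finite[OF P] fin by (intro finite_PiE) auto
  hence "(\<Sum>\<theta>\<in>P \<rightarrow>\<^sub>E carrier S. f \<theta> * bmark P (\<lambda>k. k) \<theta> \<omega>) =
      (\<Sum>\<theta>\<in>F P (carrier S). f \<theta> * bmark P (\<lambda>k. k) \<theta> \<omega>)"
    using bmark_omega_support[OF P] F_PiE by (intro sum.mono_neutral_right) auto
  thus ?thesis by (simp add: bmark_omega_const sum_distrib_right)
qed

text \<open>Idempotency gives \<open>w = |F(P,S)| w\<^sup>2 / |S|\<close> for the common mark \<open>w\<close> at \<open>P\<close>, and \<open>w \<noteq> 0\<close>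
  because the augmentation is prime to \<open>p\<close>.\<close>

theorem bmark_omega:
  assumes P: "subgroup P S"
  shows "bmark P (\<lambda>k. k) (\<lambda>k. k) \<omega> = of_nat (card (carrier S)) / of_nat (card (F P (carrier S)))"
proof -
  let ?w = "bmark P (\<lambda>k. k) (\<lambda>k. k) \<omega>"
  have f: "finite P" "(\<lambda>k. k) \<in> P \<rightarrow> carrier S"
    using subgroup_finite[OF P] subgroup.mem_carrier[OF P] by auto
  have "of_nat (card (carrier S)) * ?w = of_nat (card (carrier S)) * bmark P (\<lambda>k. k) (\<lambda>k. k) (burnside_comp p S S S \<omega> \<omega>)"
    using char_idem by (simp add: characteristic_idempotent_def)
  also have "\<dots> = (\<Sum>\<theta>\<in>P \<rightarrow>\<^sub>E carrier S. bmark P \<theta> (\<lambda>k. k) \<omega> * bmark P (\<lambda>k. k) \<theta> \<omega>)"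
    by (rule burnside_comp_closed(2)[OF B.burnside_module_axioms B.burnside_module_axioms omega_in omega_in f(1,2,2)])
  also have "\<dots> = (\<Sum>\<theta>\<in>F P (carrier S). bmark P \<theta> (\<lambda>k. k) \<omega>) * ?w"
    by (rule sum_bmark_omega[OF P])
  \<comment> \<open>Right stability makes each summand equal to the mark at the inclusion.\<close>
  also have "(\<Sum>\<theta>\<in>F P (carrier S). bmark P \<theta> (\<lambda>k. k) \<omega>) = of_nat (card (F P (carrier S))) * ?w"
    using bmark_omega_right[OF _ f(2)] by simp
  finally have eq: "of_nat (card (carrier S)) * ?w = of_nat (card (F P (carrier S))) * ?w * ?w" .
  have "?w \<noteq> 0"
  proof
    assume w: "?w = 0"
    obtain n where "card P = p ^ n" using card_subgroup[OF P] by blast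
    then obtain z where z: "z \<in> carrier (Zloc p)" "bcard \<omega> / of_nat (card (carrier S)) =
        (\<Sum>\<theta>\<in>P \<rightarrow>\<^sub>E carrier S. bmark P (\<lambda>k. k) \<theta> \<omega>) / of_nat (card (carrier S)) + of_nat p * z"
      using B.bcard_cong[OF p omega_in P] by blast
    \<comment> \<open>If the common mark is zero, no left orbit is fixed by \<open>P\<close> in the
      virtual count, and the augmentation is a multiple of \<open>p\<close>.\<close>
    have "(\<Sum>\<theta>\<in>P \<rightarrow>\<^sub>E carrier S. bmark P (\<lambda>k. k) \<theta> \<omega>) = 0"
      using sum_bmark_omega[OF P, of "\<lambda>_. 1"] w by simp
    hence "augmentation p S \<omega> = of_nat p * z"
      using z(2) augmentation_eq[OF p fin_group_axioms omega_in] by simp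
    moreover have "prime_to p (augmentation p S \<omega>)"
      using char_idem by (simp add: characteristic_idempotent_def)
    ultimately show False using not_prime_to_multiple[OF p z(1)] by simp
  qed
  hence "of_nat (card (carrier S)) = of_nat (card (F P (carrier S))) * ?w" using eq by simp
  moreover have "card (F P (carrier S)) > 0"
    using F_incl_S[OF P] finite_F by (auto simp: card_gt_0_iff)
  ultimately show ?thesis by (simp add: field_simps)
qed

end

section \<open>The Frattini property of weakly normal subsystems\<close>

context fusion
begin

lemma F_self_image: "\<phi> \<in> F P P \<Longrightarrow> \<phi> ` P = P"
  using F_closed F_inj F_subgroup(1) subgroup_finite
  by (intro card_subset_eq) (auto simp: card_image)

lemma aut_group_group: "subgroup P S \<Longrightarrow> group (aut_group F P)"
proof (rule groupI)
  assume P: "subgroup P S"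
  note [simp] = aut_group_def
  show "\<one>\<^bsub>aut_group F P\<^esub> \<in> carrier (aut_group F P)" using F_incl[OF P P] by simp
  fix x assume x: "x \<in> carrier (aut_group F P)"
  hence x': "x \<in> F P P" by simp
  show "\<one>\<^bsub>aut_group F P\<^esub> \<otimes>\<^bsub>aut_group F P\<^esub> x = x"
    using F_closed[OF x'] F_ext[OF x'] by (auto simp: compose_def fun_eq_iff extensional_def)
  show "\<exists>y\<in>carrier (aut_group F P). y \<otimes>\<^bsub>aut_group F P\<^esub> x = \<one>\<^bsub>aut_group F P\<^esub>"
  proof
    show "(\<lambda>y\<in>x ` P. inv_into P x y) \<in> carrier (aut_group F P)"
      using F_inv[OF x'] F_self_image[OF x'] by simp
    show "(\<lambda>y\<in>x ` P. inv_into P x y) \<otimes>\<^bsub>aut_group F P\<^esub> x = \<one>\<^bsub>aut_group F P\<^esub>"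
      using F_inj[OF x'] by (auto simp: compose_def fun_eq_iff)
  qed
  fix y assume y: "y \<in> carrier (aut_group F P)"
  show "x \<otimes>\<^bsub>aut_group F P\<^esub> y \<in> carrier (aut_group F P)" using F_comp[of y P P x P] x y by simp
  fix z assume z: "z \<in> carrier (aut_group F P)"
  show "x \<otimes>\<^bsub>aut_group F P\<^esub> y \<otimes>\<^bsub>aut_group F P\<^esub> z = x \<otimes>\<^bsub>aut_group F P\<^esub> (y \<otimes>\<^bsub>aut_group F P\<^esub> z)"
    using F_closed[of z P P] z by (auto simp: compose_def fun_eq_iff)
qed

lemma aut_group_finite: "finite (carrier (aut_group F P))"
  using finite_F[of P] F_carrier by (auto simp: aut_group_def intro: finite_subset)

text \<open>Conjugation is injective and \<open>P\<close> is finite, so carrying \<open>P\<close>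
  into itself is the same as carrying it onto itself.\<close>

lemma normalizer_iff:
  assumes P: "subgroup P S"
  shows "g \<in> normalizer S P \<longleftrightarrow> g \<in> carrier S \<and> (\<forall>x\<in>P. g \<otimes> x \<otimes> inv g \<in> P)"
proof -
  have PS: "P \<subseteq> carrier S" by (rule subgroup.subset[OF P])
  have "g <# P #> inv g = (\<lambda>x. g \<otimes> x \<otimes> inv g) ` P" by (auto simp: l_coset_def r_coset_def)
  moreover have "(\<lambda>x. g \<otimes> x \<otimes> inv g) ` P = P \<longleftrightarrow> (\<forall>x\<in>P. g \<otimes> x \<otimes> inv g \<in> P)" if g: "g \<in> carrier S"
  proof
    assume im: "\<forall>x\<in>P. g \<otimes> x \<otimes> inv g \<in> P"
    have "inj_on (\<lambda>x. g \<otimes> x \<otimes> inv g) P"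
    proof (rule inj_onI)
      fix x y assume "x \<in> P" "y \<in> P" "g \<otimes> x \<otimes> inv g = g \<otimes> y \<otimes> inv g"
      thus "x = y" using conjugation_is_inj[OF g, of x y] PS by blast
    qed
    thus "(\<lambda>x. g \<otimes> x \<otimes> inv g) ` P = P"
      using im subgroup_finite[OF P] by (intro card_subset_eq) (auto simp: card_image)
  qed auto
  ultimately show ?thesis using PS by (auto simp: normalizer_def stabilizer_def)
qed

lemma normalizer_subgroup: "subgroup P S \<Longrightarrow> subgroup (normalizer S P) S"
  using normalizer_imp_subgroup subgroup.subset by blast

lemma subgroup_le_normalizer: "subgroup P S \<Longrightarrow> P \<subseteq> normalizer S P"
  using subgroup.m_closed subgroup.m_inv_closed subgroup.mem_carrier by (fastforce simp: normalizer_iff)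

text \<open>Conjugation by elements of \<open>N\<close>, transported along \<psi>, gives a
  \<open>p\<close>-group of automorphisms of \<open>P1\<close> inside Aut_L(P1). Some \<beta>
  conjugates it into the Sylow subgroup \<open>C\<close>, which consists of conjugations by elements
  of \<open>S\<close>; then \<open>N\<close> lies in the extender of \<beta>\<psi> and saturation
  extends \<beta>\<psi> to \<open>N\<close>. The system \<open>L\<close> is a parameter so that the
  correction \<beta> can be kept inside a subsystem.\<close>

lemma extension_after_automorphism:
  assumes sat: "saturated p S F"
    and \<psi>: "\<psi> \<in> F P2 (carrier S)" and P1: "P1 = \<psi> ` P2" and fc: "fully_centralized S F P1"
    and N: "subgroup N S" "N \<subseteq> normalizer S P2" "P2 \<subseteq> N"
    and L: "group (aut_group L P1)" "finite (L P1 P1)" "L P1 P1 \<subseteq> F P1 P1"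
    and C: "sylow_subgroup p C (aut_group L P1)" "C \<subseteq> conj_homs S P1 P1"
    and conj: "\<And>g. g \<in> N \<Longrightarrow> (\<lambda>y\<in>P1. \<psi> (g \<otimes> inv_into P2 \<psi> y \<otimes> inv g)) \<in> L P1 P1"
  obtains \<beta> \<psi>' where "\<beta> \<in> L P1 P1" "\<psi>' \<in> F N (carrier S)" "\<And>x. x \<in> P2 \<Longrightarrow> \<psi>' x = \<beta> (\<psi> x)"
proof -
  have P2: "subgroup P2 S" by (rule F_subgroup(1)[OF \<psi>])
  have P1': "subgroup P1 S" unfolding P1 by (rule F_image_subgroup[OF \<psi>])
  interpret A: group "aut_group L P1" by (rule L(1))
  let ?\<theta> = "\<lambda>g. \<lambda>y\<in>P1. \<psi> (g \<otimes> inv_into P2 \<psi> y \<otimes> inv g)"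
  have iv: "inv_into P2 \<psi> (\<psi> x) = x" if "x \<in> P2" for x using F_inj[OF \<psi>] that by simp
  have NS: "g \<in> carrier S" if "g \<in> N" for g using subgroup.mem_carrier[OF N(1) that] .
  have NP: "g \<otimes> x \<otimes> inv g \<in> P2" if "g \<in> N" "x \<in> P2" for g x
    using that N(2) normalizer_iff[OF P2] by blast
  have hom: "?\<theta> \<in> hom (subgrp S N) (aut_group L P1)"
  proof (rule homI)
    fix g h assume "g \<in> carrier (subgrp S N)" "h \<in> carrier (subgrp S N)"
    hence gh: "g \<in> N" "h \<in> N" by auto
    show "?\<theta> (g \<otimes>\<^bsub>subgrp S N\<^esub> h) = ?\<theta> g \<otimes>\<^bsub>aut_group L P1\<^esub> ?\<theta> h"
    proof
      fix y
      show "?\<theta> (g \<otimes>\<^bsub>subgrp S N\<^esub> h) y = (?\<theta> g \<otimes>\<^bsub>aut_group L P1\<^esub> ?\<theta> h) y"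
      proof (cases "y \<in> P1")
        case True
        then obtain x where x: "x \<in> P2" "y = \<psi> x" by (auto simp: P1)
        have "\<psi> (h \<otimes> x \<otimes> inv h) \<in> P1" using NP[OF gh(2) x(1)] by (simp add: P1)
        thus ?thesis
          using True x gh NP NS subgroup.mem_carrier[OF P2 x(1)]
          by (simp add: aut_group_def compose_def iv conj_conj)
      qed (simp add: aut_group_def compose_def)
    qed
  qed (use conj in \<open>auto simp: aut_group_def\<close>)
  obtain n where n: "card N = p ^ n" using card_subgroup[OF N(1)] by blast
  have gN: "group (subgrp S N)" "order (subgrp S N) = p ^ n"
    using subgroup.subgroup_is_group[OF N(1) is_group] n by (auto simp: order_def)
  have fA: "finite (carrier (aut_group L P1))" using L(2) by (simp add: aut_group_def)
  obtain \<beta> where \<beta>: "\<beta> \<in> carrier (aut_group L P1)" and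
    \<beta>C: "\<And>g. g \<in> carrier (subgrp S N) \<Longrightarrow> \<beta> \<otimes>\<^bsub>aut_group L P1\<^esub> ?\<theta> g \<otimes>\<^bsub>aut_group L P1\<^esub> inv\<^bsub>aut_group L P1\<^esub> \<beta> \<in> C"
    using sylow_conj[OF L(1) p fA gN hom C(1)] by blast
  define \<beta>i where "\<beta>i = inv\<^bsub>aut_group L P1\<^esub> \<beta>"
  have \<beta>': "\<beta> \<in> L P1 P1" "\<beta> \<in> F P1 P1" using \<beta> L(3) by (auto simp: aut_group_def)
  have "\<beta>i \<otimes>\<^bsub>aut_group L P1\<^esub> \<beta> = \<one>\<^bsub>aut_group L P1\<^esub>" using \<beta> by (simp add: \<beta>i_def)
  hence "compose P1 \<beta>i \<beta> = (\<lambda>x\<in>P1. x)" by (simp add: aut_group_def)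
  hence \<beta>i: "\<beta>i (\<beta> y) = y" if "y \<in> P1" for y using that by (metis compose_eq restrict_apply')
  let ?\<chi> = "compose P2 \<beta> \<psi>"
  have \<chi>: "?\<chi> \<in> F P2 (carrier S)"
    using F_carrier[OF F_comp[OF F_image[OF \<psi>], of \<beta> P1]] \<beta>'(2) by (simp add: P1)
  have \<chi>P: "?\<chi> ` P2 = P1"
  proof -
    have "?\<chi> ` P2 = \<beta> ` P1" by (auto simp: compose_def P1)
    thus ?thesis using F_self_image[OF \<beta>'(2)] by simp
  qed
  \<comment> \<open>Transporting conjugation by \<open>g\<close> along \<beta>\<psi> gives the
    transport along \<psi> conjugated by \<beta>, which has been placed in \<open>C\<close>.\<close>
  have "N \<subseteq> extender S P2 ?\<chi>"
  proof
    fix g assume g: "g \<in> N"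
    have "(\<lambda>y\<in>?\<chi> ` P2. ?\<chi> (g \<otimes> inv_into P2 ?\<chi> y \<otimes> inv g)) =
        \<beta> \<otimes>\<^bsub>aut_group L P1\<^esub> ?\<theta> g \<otimes>\<^bsub>aut_group L P1\<^esub> \<beta>i"
    proof
      fix y
      show "(\<lambda>y\<in>?\<chi> ` P2. ?\<chi> (g \<otimes> inv_into P2 ?\<chi> y \<otimes> inv g)) y =
        (\<beta> \<otimes>\<^bsub>aut_group L P1\<^esub> ?\<theta> g \<otimes>\<^bsub>aut_group L P1\<^esub> \<beta>i) y"
      proof (cases "y \<in> P1")
        case True
        then obtain x where x: "x \<in> P2" "y = \<beta> (\<psi> x)"
          unfolding \<chi>P[symmetric] by (auto simp: compose_def)
        have "\<psi> x \<in> P1" using x by (simp add: P1)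
        moreover have "inv_into P2 ?\<chi> y = x"
          using inv_into_f_f[OF F_inj[OF \<chi>] x(1)] x by (simp add: compose_def)
        ultimately show ?thesis
          using True x NP[OF g x(1)] unfolding \<chi>P by (simp add: aut_group_def compose_def \<beta>i iv)
      next
        case False
        thus ?thesis unfolding \<chi>P by (simp add: aut_group_def compose_def)
      qed
    qed
    also have "\<dots> \<in> conj_homs S P1 P1" using \<beta>C[of g] g C(2) by (auto simp: \<beta>i_def)
    finally show "g \<in> extender S P2 ?\<chi>" using g N(2) by (auto simp: extender_def \<chi>P)
  qed
  moreover have "fully_centralized S F (?\<chi> ` P2)" using fc by (simp add: \<chi>P)
  then obtain \<psi>' where \<psi>': "\<psi>' \<in> F (extender S P2 ?\<chi>) (carrier S)" "restrict \<psi>' P2 = ?\<chi>"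
    using sat \<chi> unfolding saturated_def by blast
  ultimately have "restrict \<psi>' N \<in> F N (carrier S)" using F_restrict N(1) by blast
  moreover have "restrict \<psi>' N x = \<beta> (\<psi> x)" if "x \<in> P2" for x
    using that N(3) \<psi>'(2) by (metis compose_eq restrict_apply' subsetD)
  ultimately show ?thesis using that \<beta>'(1) by blast
qed

end

section \<open>Factorisations through a weakly normal subsystem\<close>

lemma subgroup_subgrp_iff:
  assumes "group S" "subgroup T S"
  shows "subgroup P (subgrp S T) \<longleftrightarrow> subgroup P S \<and> P \<subseteq> T"
  using group.incl_subgroup[OF assms] group.subgroup_incl[OF assms(1) _ assms(2)]
    subgroup.subset[of P "subgrp S T"] by auto

locale weakly_normal_subsystem = fusion +
  fixes T :: "'a set" and K :: "'a fusion"
  assumes sat: "saturated p S F" and wn: "weakly_normal p S F T K"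
begin

lemma satK: "saturated p (subgrp S T) K" and strongly_closed: "strongly_closed S F T"
  and KF: "K P Q \<subseteq> F P Q" and T: "subgroup T S"
  using wn by (auto simp: weakly_normal_def fusion_subsystem_def)

sublocale K: fusion p "subgrp S T" K
  by unfold_locales (use p satK in \<open>auto simp: saturated_def\<close>)

lemma subgrp_simps: "x \<otimes>\<^bsub>subgrp S T\<^esub> y = x \<otimes> y" "carrier (subgrp S T) = T"
    "x \<in> T \<Longrightarrow> inv\<^bsub>subgrp S T\<^esub> x = inv x"
  using m_inv_consistent[OF T] by auto

lemma subgroup_T_iff: "subgroup P (subgrp S T) \<longleftrightarrow> subgroup P S \<and> P \<subseteq> T"
  by (rule subgroup_subgrp_iff[OF is_group T])

lemma F_into_T: "\<phi> \<in> F P Q \<Longrightarrow> P \<subseteq> T \<Longrightarrow> x \<in> P \<Longrightarrow> \<phi> x \<in> T"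
  using strongly_closed F_carrier unfolding strongly_closed_def by blast

lemma K_conj:
  assumes "\<phi> \<in> F P (carrier S)" "\<psi> \<in> K Q R" "Q \<subseteq> P" "R \<subseteq> P"
  shows "(\<lambda>y\<in>\<phi> ` Q. \<phi> (\<psi> (inv_into Q \<phi> y))) \<in> K (\<phi> ` Q) (\<phi> ` R)"
  using wn assms unfolding weakly_normal_def by blast

lemma F_T_image: "\<alpha> \<in> F T (carrier S) \<Longrightarrow> \<alpha> ` T = T"
  using F_into_T F_inj subgroup_finite[OF T] by (intro card_subset_eq) (auto simp: card_image)

lemma F_T_T: "\<alpha> \<in> F T (carrier S) \<Longrightarrow> \<alpha> \<in> F T T"
  using F_codom[OF _ _ T] F_T_image by auto

lemma F_T_inv: "\<alpha> \<in> F T (carrier S) \<Longrightarrow> (\<lambda>y\<in>T. inv_into T \<alpha> y) \<in> F T (carrier S)"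
  using F_inv[of \<alpha> T "carrier S"] F_T_image[of \<alpha>] F_carrier by auto

lemma K_T: "\<kappa> \<in> K P Q \<Longrightarrow> \<kappa> \<in> K P T"
  using K.F_carrier by simp

text \<open>Weak normality with a morphism defined on all of \<open>T\<close>: the domain condition
  is then automatic, and the \<open>F\<close>-automorphisms of \<open>T\<close> act on
  \<open>K\<close> by conjugation.\<close>

lemma K_conj_aut:
  assumes \<alpha>: "\<alpha> \<in> F T (carrier S)" and \<kappa>: "\<kappa> \<in> K Q R"
  shows "\<exists>\<kappa>'\<in>K (\<alpha> ` Q) (\<alpha> ` R). \<forall>x\<in>Q. \<kappa>' (\<alpha> x) = \<alpha> (\<kappa> x)"
proof (rule bexI)
  have Q: "Q \<subseteq> T" "R \<subseteq> T" using K.F_subgroup[OF \<kappa>] by (simp_all add: subgroup_T_iff)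
  show "(\<lambda>y\<in>\<alpha> ` Q. \<alpha> (\<kappa> (inv_into Q \<alpha> y))) \<in> K (\<alpha> ` Q) (\<alpha> ` R)" by (rule K_conj[OF \<alpha> \<kappa> Q])
  show "\<forall>x\<in>Q. (\<lambda>y\<in>\<alpha> ` Q. \<alpha> (\<kappa> (inv_into Q \<alpha> y))) (\<alpha> x) = \<alpha> (\<kappa> x)"
    using inj_on_subset[OF F_inj[OF \<alpha>] Q(1)] by simp
qed

text \<open>The factorisation \<phi> = \<alpha>\<kappa> as a property of single morphisms: the
  induction assembles a morphism from pieces for which the property is already known.\<close>

definition frattini :: "'a set \<Rightarrow> ('a \<Rightarrow> 'a) \<Rightarrow> bool" where
  "frattini P \<phi> \<longleftrightarrow> \<phi> \<in> F P (carrier S) \<and>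
     (\<exists>\<alpha>\<in>F T (carrier S). \<exists>\<kappa>\<in>K P T. \<forall>x\<in>P. \<phi> x = \<alpha> (\<kappa> x))"

text \<open>\<alpha>2 \<kappa>2 \<alpha>1 \<kappa>1 = (\<alpha>2 \<alpha>1) (\<alpha>1^-1 \<kappa>2
  \<alpha>1) \<kappa>1, and the conjugate in the middle lies in \<open>K\<close>.\<close>

lemma frattini_comp:
  assumes "frattini P \<phi>" "frattini (\<phi> ` P) \<psi>"
  shows "frattini P (compose P \<psi> \<phi>)"
proof -
  obtain \<alpha>1 \<kappa>1 where 1: "\<phi> \<in> F P (carrier S)" "\<alpha>1 \<in> F T (carrier S)" "\<kappa>1 \<in> K P T"
    "\<And>x. x \<in> P \<Longrightarrow> \<phi> x = \<alpha>1 (\<kappa>1 x)" using assms(1) unfolding frattini_def by blast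
  obtain \<alpha>2 \<kappa>2 where 2: "\<psi> \<in> F (\<phi> ` P) (carrier S)" "\<alpha>2 \<in> F T (carrier S)" "\<kappa>2 \<in> K (\<phi> ` P) T"
    "\<And>x. x \<in> P \<Longrightarrow> \<psi> (\<phi> x) = \<alpha>2 (\<kappa>2 (\<phi> x))" using assms(2) unfolding frattini_def by blast
  let ?\<beta> = "\<lambda>y\<in>T. inv_into T \<alpha>1 y"
  have \<beta>: "?\<beta> \<in> F T (carrier S)" by (rule F_T_inv[OF 1(2)])
  have k1: "\<kappa>1 x \<in> T" if "x \<in> P" for x using K.F_closed[OF 1(3) that] .
  have \<beta>1: "?\<beta> (\<phi> x) = \<kappa>1 x" if "x \<in> P" for x
    using that 1(4) k1 F_inj[OF 1(2)] F_into_T[OF 1(2) order_refl] by simp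
  have im: "?\<beta> ` \<phi> ` P = \<kappa>1 ` P" unfolding image_image by (rule image_cong[OF refl \<beta>1])
  obtain \<kappa>' where \<kappa>': "\<kappa>' \<in> K (?\<beta> ` \<phi> ` P) (?\<beta> ` T)" "\<forall>x\<in>\<phi> ` P. \<kappa>' (?\<beta> x) = ?\<beta> (\<kappa>2 x)"
    using K_conj_aut[OF \<beta> 2(3)] by blast
  have "compose P \<kappa>' \<kappa>1 \<in> K P T"
    using K.F_comp[OF K.F_image[OF 1(3)], of \<kappa>' T] K_T[OF \<kappa>'(1)] unfolding im by blast
  moreover have "compose T \<alpha>2 \<alpha>1 \<in> F T (carrier S)" by (rule F_comp[OF F_T_T[OF 1(2)] 2(2)])
  moreover have "compose P \<psi> \<phi> x = compose T \<alpha>2 \<alpha>1 (compose P \<kappa>' \<kappa>1 x)" if x: "x \<in> P" for x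
  proof -
    have k2: "\<kappa>2 (\<phi> x) \<in> T" using K.F_closed[OF 2(3)] x by simp
    have "\<kappa>' (\<kappa>1 x) = ?\<beta> (\<kappa>2 (\<phi> x))" using \<kappa>'(2) x \<beta>1[OF x] by auto
    moreover have "\<alpha>1 (?\<beta> (\<kappa>2 (\<phi> x))) = \<kappa>2 (\<phi> x)" "?\<beta> (\<kappa>2 (\<phi> x)) \<in> T"
      using k2 F_T_image[OF 1(2)] by (simp_all add: f_inv_into_f inv_into_into)
    ultimately show ?thesis using x 2(4) by (simp add: compose_def)
  qed
  moreover have "compose P \<psi> \<phi> \<in> F P (carrier S)" by (rule F_comp[OF F_image[OF 1(1)] 2(1)])
  ultimately show ?thesis unfolding frattini_def by blast
qed

text \<open>(\<alpha> \<kappa>)^-1 = \<alpha>^-1 (\<alpha> \<kappa>^-1 \<alpha>^-1), with the second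
  factor in \<open>K\<close>.\<close>

lemma frattini_inv:
  assumes "frattini P \<phi>"
  shows "frattini (\<phi> ` P) (\<lambda>y\<in>\<phi> ` P. inv_into P \<phi> y)"
proof -
  obtain \<alpha> \<kappa> where 1: "\<phi> \<in> F P (carrier S)" "\<alpha> \<in> F T (carrier S)" "\<kappa> \<in> K P T"
    "\<And>x. x \<in> P \<Longrightarrow> \<phi> x = \<alpha> (\<kappa> x)" using assms(1) unfolding frattini_def by blast
  let ?\<kappa>i = "\<lambda>y\<in>\<kappa> ` P. inv_into P \<kappa> y"
  obtain \<kappa>' where \<kappa>': "\<kappa>' \<in> K (\<alpha> ` \<kappa> ` P) (\<alpha> ` P)" "\<forall>x\<in>\<kappa> ` P. \<kappa>' (\<alpha> x) = \<alpha> (?\<kappa>i x)"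
    using K_conj_aut[OF 1(2) K.F_inv[OF 1(3)]] by blast
  have im: "\<alpha> ` \<kappa> ` P = \<phi> ` P" using 1(4) by (auto simp: image_image)
  have PT: "P \<subseteq> T" using K.F_subgroup(1)[OF 1(3)] by (simp add: subgroup_T_iff)
  have e: "inv_into P \<phi> y = (\<lambda>y\<in>T. inv_into T \<alpha> y) (\<kappa>' y)" if y: "y \<in> \<phi> ` P" for y
  proof -
    obtain x where x: "x \<in> P" "y = \<phi> x" using y by blast
    have "\<kappa>' y = \<alpha> x" using \<kappa>'(2) x 1(4) F_inj[OF 1(1)] K.F_inj[OF 1(3)] by simp
    moreover have "x \<in> T" "\<alpha> x \<in> T" using x PT F_into_T[OF 1(2) order_refl] by auto
    ultimately show ?thesis using x F_inj[OF 1(1)] F_inj[OF 1(2)] by simp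
  qed
  have "\<forall>y\<in>\<phi> ` P. (\<lambda>y\<in>\<phi> ` P. inv_into P \<phi> y) y = (\<lambda>y\<in>T. inv_into T \<alpha> y) (\<kappa>' y)"
  proof
    fix y assume y: "y \<in> \<phi> ` P"
    show "(\<lambda>y\<in>\<phi> ` P. inv_into P \<phi> y) y = (\<lambda>y\<in>T. inv_into T \<alpha> y) (\<kappa>' y)"
      unfolding restrict_apply'[OF y] by (rule e[OF y])
  qed
  moreover have "\<kappa>' \<in> K (\<phi> ` P) T" using K_T[OF \<kappa>'(1)] unfolding im .
  ultimately show ?thesis
    unfolding frattini_def using F_carrier[OF F_inv[OF 1(1)]] F_T_inv[OF 1(2)] by blast
qed

lemma frattini_restrict:
  assumes "frattini P \<phi>" "V \<subseteq> P" "subgroup V S"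
  shows "frattini V (restrict \<phi> V)"
proof -
  obtain \<alpha> \<kappa> where 1: "\<phi> \<in> F P (carrier S)" "\<alpha> \<in> F T (carrier S)" "\<kappa> \<in> K P T"
    "\<And>x. x \<in> P \<Longrightarrow> \<phi> x = \<alpha> (\<kappa> x)" using assms(1) unfolding frattini_def by blast
  have "P \<subseteq> T" using K.F_subgroup(1)[OF 1(3)] by (simp add: subgroup_T_iff)
  hence "subgroup V (subgrp S T)" using assms(2,3) by (simp add: subgroup_T_iff)
  hence "restrict \<kappa> V \<in> K V T" by (rule K.F_restrict[OF 1(3) assms(2)])
  moreover have "\<forall>x\<in>V. restrict \<phi> V x = \<alpha> (restrict \<kappa> V x)" using 1(4) assms(2) by auto
  ultimately show ?thesis
    unfolding frattini_def using F_restrict[OF 1(1) assms(2,3)] 1(2) by blast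
qed

lemma frattini_K: "\<kappa> \<in> K P T \<Longrightarrow> frattini P \<kappa>"
proof -
  assume \<kappa>: "\<kappa> \<in> K P T"
  have "\<kappa> \<in> F P (carrier S)" using KF \<kappa> F_carrier by blast
  moreover have "\<forall>x\<in>P. \<kappa> x = (\<lambda>y\<in>T. y) (\<kappa> x)" using K.F_closed[OF \<kappa>] by simp
  ultimately show ?thesis unfolding frattini_def using \<kappa> F_incl_S[OF T] by blast
qed

abbreviation "NT P \<equiv> normalizer S P \<inter> T"

lemma NT_facts:
  assumes P: "subgroup P S" "P \<subseteq> T"
  shows "subgroup (NT P) S" "NT P \<subseteq> normalizer S P" "P \<subseteq> NT P" "normalizer (subgrp S T) P = NT P"
proof -
  show "subgroup (NT P) S" using subgroups_Inter_pair normalizer_subgroup[OF P(1)] T by blast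
  show "P \<subseteq> NT P" using subgroup_le_normalizer[OF P(1)] P(2) by simp
  have "subgroup P (subgrp S T)" using P by (simp add: subgroup_T_iff)
  thus "normalizer (subgrp S T) P = NT P"
    using K.normalizer_iff[of P] normalizer_iff[OF P(1)] subgroup.mem_carrier[OF T]
    by (auto simp: m_inv_consistent[OF T])
qed auto

end

lemma ex_max_nat:
  fixes f :: "'b \<Rightarrow> nat"
  assumes "finite A" "A \<noteq> {}"
  shows "\<exists>x\<in>A. \<forall>y\<in>A. f y \<le> f x"
proof -
  have "Max (f ` A) \<in> f ` A" using assms by (intro Max_in) auto
  then obtain x where "x \<in> A" "f x = Max (f ` A)" by auto
  thus ?thesis using assms(1) by (intro bexI[of _ x]) auto
qed

section \<open>Transport along isomorphisms and fully normalized subgroups\<close>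

context fusion
begin

lemma F_eqI: "\<phi> \<in> F P Q \<Longrightarrow> \<psi> \<in> F P R \<Longrightarrow> (\<And>x. x \<in> P \<Longrightarrow> \<phi> x = \<psi> x) \<Longrightarrow> \<phi> = \<psi>"
  using F_ext by (intro extensionalityI[of \<phi> P]) auto

lemma F_comp_image: "\<phi> \<in> F P Q \<Longrightarrow> \<psi> \<in> F (\<phi> ` P) R \<Longrightarrow> compose P \<psi> \<phi> \<in> F P R"
  using F_comp[OF F_image] .

lemma F_card_image: "\<phi> \<in> F P Q \<Longrightarrow> card (\<phi> ` P) = card P"
  by (rule card_image[OF F_inj])

lemma F_factor:
  assumes "\<phi> \<in> F P Q" "\<rho> \<in> F P R"
  shows "\<exists>\<theta>\<in>F (\<phi> ` P) R. \<forall>x\<in>P. \<theta> (\<phi> x) = \<rho> x"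
  using F_comp[OF F_inv[OF assms(1)] assms(2)] F_inj[OF assms(1)]
  by (intro bexI[of _ "compose (\<phi> ` P) \<rho> (\<lambda>y\<in>\<phi> ` P. inv_into P \<phi> y)"]) (auto simp: compose_def)

lemma inj_compose_F:
  assumes "\<phi> \<in> F P Q"
  shows "inj_on (\<lambda>\<theta>. compose P \<theta> \<phi>) (F (\<phi> ` P) R)"
proof (rule inj_onI)
  fix \<theta> \<theta>' assume t: "\<theta> \<in> F (\<phi> ` P) R" "\<theta>' \<in> F (\<phi> ` P) R" "compose P \<theta> \<phi> = compose P \<theta>' \<phi>"
  show "\<theta> = \<theta>'"
  proof (rule F_eqI[OF t(1,2)])
    fix y assume "y \<in> \<phi> ` P"
    then obtain x where "x \<in> P" "y = \<phi> x" by blast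
    thus "\<theta> y = \<theta>' y" using fun_cong[OF t(3), of x] by (simp add: compose_def)
  qed
qed

lemma card_F_image:
  assumes "\<phi> \<in> F P Q"
  shows "card (F (\<phi> ` P) R) = card (F P R)"
proof -
  have "(\<lambda>\<theta>. compose P \<theta> \<phi>) ` F (\<phi> ` P) R = F P R"
  proof (intro equalityI subsetI)
    fix \<rho> assume \<rho>: "\<rho> \<in> F P R"
    then obtain \<theta> where \<theta>: "\<theta> \<in> F (\<phi> ` P) R" "\<forall>x\<in>P. \<theta> (\<phi> x) = \<rho> x"
      using F_factor[OF assms] by blast
    have "\<rho> = compose P \<theta> \<phi>"
      by (rule F_eqI[OF \<rho> F_comp_image[OF assms \<theta>(1)]]) (use \<theta>(2) in \<open>simp add: compose_def\<close>)
    thus "\<rho> \<in> (\<lambda>\<theta>. compose P \<theta> \<phi>) ` F (\<phi> ` P) R" using \<theta>(1) by blast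
  qed (use F_comp_image[OF assms] in blast)
  thus ?thesis using card_image[OF inj_compose_F[OF assms]] by metis
qed

lemma F_conj_transport:
  assumes \<psi>: "\<psi> \<in> F P Q" and g: "g \<in> normalizer S P"
  shows "(\<lambda>y\<in>\<psi> ` P. \<psi> (g \<otimes> inv_into P \<psi> y \<otimes> inv g)) \<in> F (\<psi> ` P) (\<psi> ` P)"
proof -
  have P: "subgroup P S" by (rule F_subgroup(1)[OF \<psi>])
  have g': "g \<in> carrier S" "\<And>x. x \<in> P \<Longrightarrow> g \<otimes> x \<otimes> inv g \<in> P" using g normalizer_iff[OF P] by auto
  have c: "(\<lambda>x\<in>P. g \<otimes> x \<otimes> inv g) \<in> F P P" using F_conj[OF P P g'] .
  have "compose (\<psi> ` P) \<psi> (compose (\<psi> ` P) (\<lambda>x\<in>P. g \<otimes> x \<otimes> inv g) (\<lambda>y\<in>\<psi> ` P. inv_into P \<psi> y)) \<in> F (\<psi> ` P) (\<psi> ` P)"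
    by (rule F_comp[OF F_comp[OF F_inv[OF \<psi>] c] F_image[OF \<psi>]])
  also have "compose (\<psi> ` P) \<psi> (compose (\<psi> ` P) (\<lambda>x\<in>P. g \<otimes> x \<otimes> inv g) (\<lambda>y\<in>\<psi> ` P. inv_into P \<psi> y)) =
      (\<lambda>y\<in>\<psi> ` P. \<psi> (g \<otimes> inv_into P \<psi> y \<otimes> inv g))"
    by (auto simp: compose_def fun_eq_iff inv_into_into)
  finally show ?thesis .
qed

text \<open>A maximum of the normalizer order over the finitely many images of \<open>P\<close> is
  still a maximum seen from the image that attains it, since morphisms compose.\<close>

lemma ex_fully_normalized:
  assumes P: "subgroup P S"
  obtains \<chi> where "\<chi> \<in> F P (carrier S)" "fully_normalized S F (\<chi> ` P)"
proof -
  have "F P (carrier S) \<noteq> {}" using F_incl_S[OF P] by blast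
  then obtain \<chi> where \<chi>: "\<chi> \<in> F P (carrier S)"
    "\<forall>\<psi>\<in>F P (carrier S). card (normalizer S (\<psi> ` P)) \<le> card (normalizer S (\<chi> ` P))"
    using ex_max_nat[OF finite_F[of P], of "\<lambda>\<psi>. card (normalizer S (\<psi> ` P))"] by auto
  have "card (normalizer S (\<psi> ` \<chi> ` P)) \<le> card (normalizer S (\<chi> ` P))"
    if \<psi>: "\<psi> \<in> F (\<chi> ` P) (carrier S)" for \<psi>
  proof -
    have "compose P \<psi> \<chi> ` P = \<psi> ` \<chi> ` P" by (auto simp: compose_def)
    thus ?thesis using \<chi>(2) F_comp_image[OF \<chi>(1) \<psi>] by metis
  qed
  thus ?thesis using that \<chi>(1) unfolding fully_normalized_def by blast
qed

end

context weakly_normal_subsystem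
begin

lemma T_group: "group (subgrp S T)" and T_order: "\<exists>n. order (subgrp S T) = p ^ n"
  using subgroup_fin_group[OF T] card_subgroup[OF T] by (auto simp: fin_group_def order_def)

text \<open>Normalizers grow in the \<open>p\<close>-group \<open>T\<close>; this drives the
  induction on the order of \<open>P\<close>.\<close>

lemma card_NT_greater:
  assumes P: "subgroup P S" "P \<subseteq> T" "P \<noteq> T"
  shows "card P < card (NT P)"
proof -
  obtain n where n: "order (subgrp S T) = p ^ n" using T_order by blast
  have P': "subgroup P (subgrp S T)" "P \<noteq> carrier (subgrp S T)" using P by (auto simp: subgroup_T_iff)
  obtain g where g: "g \<in> T" "g \<notin> P" "\<And>x. x \<in> P \<Longrightarrow> g \<otimes> x \<otimes> inv\<^bsub>subgrp S T\<^esub> g \<in> P"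
    using normalizer_grows[OF T_group p n P'] by auto
  hence "g \<in> NT P" using subgroup.mem_carrier[OF T] by (simp add: normalizer_iff[OF P(1)] subgrp_simps(3))
  hence "P \<subset> NT P" using NT_facts(3)[OF P(1,2)] g(2) by blast
  thus ?thesis using subgroup_finite[OF NT_facts(1)[OF P(1,2)]] by (rule psubset_card_mono[rotated])
qed

text \<open>Downward induction on |P|. Fix a fully normalized conjugate \<open>P1\<close> of
  \<open>P\<close>. Morphisms into \<open>P1\<close> extend to the larger group N_T of their source
  after a correction by an automorphism of \<open>P1\<close>, and the extension is covered by the
  induction hypothesis. What remains is to undo the correction, that is, to treat automorphisms of
  \<open>P1\<close>; there the correction can be taken in \<open>K\<close>, where the property is
  known.\<close>

theorem frattini_all:
  assumes "subgroup P S" "P \<subseteq> T" "\<phi> \<in> F P (carrier S)"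
  shows "frattini P \<phi>"
  using assms
proof (induction "card T - card P" arbitrary: P \<phi> rule: less_induct)
  case less
  note P = less.prems(1,2) and \<phi> = less.prems(3)
  have fT: "finite T" by (rule subgroup_finite[OF T])
  show ?case
  proof (cases "P = T")
    case True
    have "(\<lambda>x\<in>T. x) \<in> K T T" using K.F_incl[of T T] K.subgroup_self by simp
    thus ?thesis unfolding frattini_def using \<phi> True by (intro conjI bexI[of _ \<phi>] bexI[of _ "\<lambda>x\<in>T. x"]) auto
  next
    case False
    have cP: "card P < card T" using False P(2) fT by (intro psubset_card_mono) auto
    have IH: "frattini Q \<psi>" if "subgroup Q S" "Q \<subseteq> T" "\<psi> \<in> F Q (carrier S)" "card P < card Q" for Q \<psi>
      using less.hyps[OF _ that(1-3)] that(4) cP by linarith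
    obtain \<chi> where \<chi>: "\<chi> \<in> F P (carrier S)" "fully_normalized S F (\<chi> ` P)"
      using ex_fully_normalized[OF P(1)] .
    define P1 where "P1 = \<chi> ` P"
    have P1: "subgroup P1 S" "P1 \<subseteq> T" "card P1 = card P"
      using F_image_subgroup[OF \<chi>(1)] F_into_T[OF \<chi>(1) P(2)] F_card_image[OF \<chi>(1)] by (auto simp: P1_def)
    have P1T: "P1 \<noteq> T" using P1(3) cP by auto
    have fc: "fully_centralized S F P1" and syl: "sylow_subgroup p (conj_homs S P1 P1) (aut_group F P1)"
      using sat \<chi>(2) P1(1) unfolding saturated_def P1_def by blast+
    \<comment> \<open>The image of the extension normalises \<open>P1\<close> and stays in
      \<open>T\<close> by strong closure. This gives the inequality of orders as a by-product; it is
      needed to compare normalizers inside \<open>T\<close>.\<close>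
    have C1: "\<exists>\<beta>\<in>F P1 P1. frattini P2 (compose P2 \<beta> \<psi>) \<and> card (NT P2) \<le> card (NT P1)"
      if \<psi>: "\<psi> \<in> F P2 (carrier S)" and im: "P1 = \<psi> ` P2" and P2T: "P2 \<subseteq> T" for P2 \<psi>
    proof -
      have P2: "subgroup P2 S" by (rule F_subgroup(1)[OF \<psi>])
      have c2: "card P2 = card P" using F_card_image[OF \<psi>] P1(3) im by simp
      have P2T': "P2 \<noteq> T" using c2 cP by auto
      note N = NT_facts[OF P2 P2T]
      have finF: "finite (F P1 P1)" using aut_group_finite[of P1] by (simp add: aut_group_def)
      obtain \<beta> \<psi>' where \<beta>: "\<beta> \<in> F P1 P1" and \<psi>': "\<psi>' \<in> F (NT P2) (carrier S)"
        "\<And>x. x \<in> P2 \<Longrightarrow> \<psi>' x = \<beta> (\<psi> x)"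
      proof (rule extension_after_automorphism[OF sat \<psi> im fc N(1,2,3) aut_group_group[OF P1(1)] finF
            order_refl syl order_refl])
        fix g assume "g \<in> NT P2"
        thus "(\<lambda>y\<in>P1. \<psi> (g \<otimes> inv_into P2 \<psi> y \<otimes> inv g)) \<in> F P1 P1"
          unfolding im using F_conj_transport[OF \<psi>] by blast
      qed (rule that)
      have "frattini (NT P2) \<psi>'"
        using IH[OF N(1) _ \<psi>'(1)] card_NT_greater[OF P2 P2T P2T'] c2 by simp
      hence "frattini P2 (restrict \<psi>' P2)" by (rule frattini_restrict[OF _ N(3) P2])
      also have "restrict \<psi>' P2 = compose P2 \<beta> \<psi>" using \<psi>'(2) by (auto simp: compose_def fun_eq_iff)
      finally have fr: "frattini P2 (compose P2 \<beta> \<psi>)" .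
      have im': "\<psi>' ` P2 = P1"
      proof -
        have "\<psi>' ` P2 = \<beta> ` \<psi> ` P2" using \<psi>'(2) by (auto simp: image_image)
        thus ?thesis using F_self_image[OF \<beta>] im by simp
      qed
      have "\<psi>' ` NT P2 \<subseteq> NT P1"
      proof
        fix y assume "y \<in> \<psi>' ` NT P2"
        then obtain g where g: "g \<in> NT P2" "y = \<psi>' g" by blast
        have yS: "y \<in> carrier S" "y \<in> T"
          using F_closed[OF \<psi>'(1) g(1)] F_into_T[OF \<psi>'(1) _ g(1)] g(2) by auto
        have "y \<otimes> z \<otimes> inv y \<in> P1" if z: "z \<in> P1" for z
        proof -
          obtain x where x: "x \<in> P2" "z = \<psi>' x" using z im' by blast
          have xN: "x \<in> NT P2" using x(1) N(3) by blast
          have gx: "g \<otimes> x \<otimes> inv g \<in> P2" using g(1) x(1) normalizer_iff[OF P2] by blast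
          have gxN: "g \<otimes> x \<otimes> inv g \<in> NT P2" using gx N(3) by blast
          have gS: "g \<in> carrier S" "x \<in> carrier S" using subgroup.mem_carrier[OF N(1)] g(1) xN by auto
          have "\<psi>' (g \<otimes> x \<otimes> inv g) \<otimes> y = \<psi>' (g \<otimes> x \<otimes> inv g \<otimes> g)"
            using F_mult[OF \<psi>'(1) gxN g(1)] g(2) by simp
          also have "g \<otimes> x \<otimes> inv g \<otimes> g = g \<otimes> x" using gS by (simp add: m_assoc)
          also have "\<psi>' (g \<otimes> x) = y \<otimes> z" using F_mult[OF \<psi>'(1) g(1) xN] g(2) x(2) by simp
          finally have "y \<otimes> z \<otimes> inv y = \<psi>' (g \<otimes> x \<otimes> inv g) \<otimes> y \<otimes> inv y" by simp
          also have "\<dots> = \<psi>' (g \<otimes> x \<otimes> inv g)"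
            using yS(1) F_closed[OF \<psi>'(1) gxN] by (simp add: m_assoc)
          finally show ?thesis using gx im' by blast
        qed
        thus "y \<in> NT P1" using yS by (simp add: normalizer_iff[OF P1(1)])
      qed
      hence "card (\<psi>' ` NT P2) \<le> card (NT P1)"
        using subgroup_finite[OF NT_facts(1)[OF P1(1,2)]] by (rule card_mono[rotated])
      thus ?thesis using \<beta> fr F_card_image[OF \<psi>'(1)] by auto
    qed
    have P1K: "subgroup P1 (subgrp S T)" using P1 by (simp add: subgroup_T_iff)
    \<comment> \<open>The inequality applied to the inverse of a \<open>K\<close>-isomorphism out of
      \<open>P1\<close>. Saturation of \<open>K\<close> then provides a Sylow subgroup of Aut_K(P1)
      that consists of conjugations by elements of \<open>T\<close>.\<close>
    have "fully_normalized (subgrp S T) K P1"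
      unfolding fully_normalized_def
    proof
      fix \<kappa> assume \<kappa>: "\<kappa> \<in> K P1 (carrier (subgrp S T))"
      have kF: "\<kappa> \<in> F P1 T" using \<kappa> KF by auto
      let ?\<psi> = "\<lambda>y\<in>\<kappa> ` P1. inv_into P1 \<kappa> y"
      have kT: "\<kappa> ` P1 \<subseteq> T" using F_closed[OF kF] by blast
      have im: "P1 = ?\<psi> ` \<kappa> ` P1" using F_inj[OF kF] by (auto simp: image_image)
      have "card (NT (\<kappa> ` P1)) \<le> card (NT P1)" using C1[OF F_carrier[OF F_inv[OF kF]] im kT] by blast
      thus "card (normalizer (subgrp S T) (\<kappa> ` P1)) \<le> card (normalizer (subgrp S T) P1)"
        using NT_facts(4)[OF F_image_subgroup[OF kF] kT] NT_facts(4)[OF P1(1,2)] by simp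
    qed
    hence sylK: "sylow_subgroup p (conj_homs (subgrp S T) P1 P1) (aut_group K P1)"
      using satK P1K unfolding saturated_def by blast
    have conjK: "conj_homs (subgrp S T) P1 P1 \<subseteq> conj_homs S P1 P1"
      unfolding conj_homs_def using subgroup.mem_carrier[OF T] by (fastforce simp: subgrp_simps(3))
    have finK: "finite (K P1 P1)" using K.aut_group_finite[of P1] by (simp add: aut_group_def)
    \<comment> \<open>Conjugations by elements of N_T(P1) are in \<open>K\<close>, and by weak
      normality so are their transports along \<psi>. The extension argument therefore runs with
      Aut_K(P1) in place of Aut_F(P1), and \<beta> lies in \<open>K\<close>.\<close>
    have C2: "frattini P1 \<psi>" if \<psi>: "\<psi> \<in> F P1 P1" for \<psi>
    proof -
      note N = NT_facts[OF P1(1,2)]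
      have im: "P1 = \<psi> ` P1" using F_self_image[OF \<psi>] by simp
      obtain \<beta> \<psi>' where \<beta>: "\<beta> \<in> K P1 P1" and \<psi>': "\<psi>' \<in> F (NT P1) (carrier S)"
        "\<And>x. x \<in> P1 \<Longrightarrow> \<psi>' x = \<beta> (\<psi> x)"
      proof (rule extension_after_automorphism[OF sat F_carrier[OF \<psi>] im fc N(1,2,3)
            K.aut_group_group[OF P1K] finK KF sylK conjK])
        fix g assume g: "g \<in> NT P1"
        have gT: "g \<in> T" "\<And>x. x \<in> P1 \<Longrightarrow> g \<otimes> x \<otimes> inv g \<in> P1" using g normalizer_iff[OF P1(1)] by auto
        have "(\<lambda>x\<in>P1. g \<otimes> x \<otimes> inv g) \<in> K P1 P1"
          using K.F_conj[OF P1K P1K, of g] gT by (simp add: subgrp_simps(3))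
        hence "(\<lambda>y\<in>\<psi> ` P1. \<psi> ((\<lambda>x\<in>P1. g \<otimes> x \<otimes> inv g) (inv_into P1 \<psi> y))) \<in> K (\<psi> ` P1) (\<psi> ` P1)"
          by (rule K_conj[OF F_carrier[OF \<psi>] _ order_refl order_refl])
        also have "(\<lambda>y\<in>\<psi> ` P1. \<psi> ((\<lambda>x\<in>P1. g \<otimes> x \<otimes> inv g) (inv_into P1 \<psi> y))) =
            (\<lambda>y\<in>P1. \<psi> (g \<otimes> inv_into P1 \<psi> y \<otimes> inv g))"
          unfolding im[symmetric] using inv_into_into[of _ \<psi> P1] im by (intro restrict_ext) auto
        finally show "(\<lambda>y\<in>P1. \<psi> (g \<otimes> inv_into P1 \<psi> y \<otimes> inv g)) \<in> K P1 P1" unfolding im[symmetric] .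
      qed (rule that)
      have "frattini (NT P1) \<psi>'"
        using IH[OF N(1) _ \<psi>'(1)] card_NT_greater[OF P1(1,2) P1T] P1(3) by simp
      hence "frattini P1 (restrict \<psi>' P1)" by (rule frattini_restrict[OF _ N(3) P1(1)])
      also have "restrict \<psi>' P1 = compose P1 \<beta> \<psi>" using \<psi>'(2) by (auto simp: compose_def fun_eq_iff)
      finally have fr: "frattini P1 (compose P1 \<beta> \<psi>)" .
      have \<beta>im: "\<beta> ` P1 = P1" by (rule K.F_self_image[OF \<beta>])
      have cim: "compose P1 \<beta> \<psi> ` P1 = P1"
      proof -
        have "compose P1 \<beta> \<psi> ` P1 = \<beta> ` \<psi> ` P1" by (auto simp: compose_def)
        thus ?thesis using \<beta>im im by simp
      qed
      have "frattini P1 (\<lambda>y\<in>P1. inv_into P1 \<beta> y)"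
        using frattini_inv[OF frattini_K[OF K_T[OF \<beta>]]] by (simp add: \<beta>im)
      hence "frattini P1 (compose P1 (\<lambda>y\<in>P1. inv_into P1 \<beta> y) (compose P1 \<beta> \<psi>))"
        by (intro frattini_comp[OF fr]) (simp add: cim)
      also have "compose P1 (\<lambda>y\<in>P1. inv_into P1 \<beta> y) (compose P1 \<beta> \<psi>) = \<psi>"
        using F_closed[OF \<psi>] K.F_closed[OF \<beta>] K.F_inj[OF \<beta>] F_ext[OF \<psi>]
        by (auto simp: compose_def fun_eq_iff extensional_def)
      finally show ?thesis .
    qed
    \<comment> \<open>The correcting automorphism of \<open>P1\<close> from the first claim is
      inverted with the second.\<close>
    have C3: "frattini P2 \<psi>" if \<psi>: "\<psi> \<in> F P2 (carrier S)" and im: "P1 = \<psi> ` P2" and P2T: "P2 \<subseteq> T" for P2 \<psi>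
    proof -
      obtain \<beta> where \<beta>: "\<beta> \<in> F P1 P1" "frattini P2 (compose P2 \<beta> \<psi>)" using C1[OF \<psi> im P2T] by blast
      have bi: "(\<lambda>y\<in>P1. inv_into P1 \<beta> y) \<in> F P1 P1" using F_inv[OF \<beta>(1)] F_self_image[OF \<beta>(1)] by simp
      have cim: "compose P2 \<beta> \<psi> ` P2 = P1"
      proof -
        have "compose P2 \<beta> \<psi> ` P2 = \<beta> ` \<psi> ` P2" by (auto simp: compose_def)
        thus ?thesis using F_self_image[OF \<beta>(1)] im by simp
      qed
      have "frattini P2 (compose P2 (\<lambda>y\<in>P1. inv_into P1 \<beta> y) (compose P2 \<beta> \<psi>))"
        using C2[OF bi] by (intro frattini_comp[OF \<beta>(2)]) (simp add: cim)
      also have "compose P2 (\<lambda>y\<in>P1. inv_into P1 \<beta> y) (compose P2 \<beta> \<psi>) = \<psi>"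
        using F_closed[OF \<beta>(1)] F_inj[OF \<beta>(1)] F_ext[OF \<psi>] im
        by (auto simp: compose_def fun_eq_iff extensional_def)
      finally show ?thesis .
    qed
    have phT: "\<phi> ` P \<subseteq> T" using F_into_T[OF \<phi> P(2)] by blast
    \<comment> \<open>\<phi> is \<chi> followed by the inverse of \<psi>, where both \<chi> and
      \<psi> end in \<open>P1\<close>.\<close>
    obtain \<psi> where \<psi>: "\<psi> \<in> F (\<phi> ` P) (carrier S)" "\<forall>x\<in>P. \<psi> (\<phi> x) = \<chi> x"
      using F_factor[OF \<phi> \<chi>(1)] by blast
    have im: "\<psi> ` \<phi> ` P = P1" using \<psi>(2) by (auto simp: P1_def image_image)
    have f1: "frattini P \<chi>" by (rule C3[OF \<chi>(1) P1_def P(2)])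
    have "frattini P1 (\<lambda>y\<in>P1. inv_into (\<phi> ` P) \<psi> y)"
      using frattini_inv[OF C3[OF \<psi>(1) im[symmetric] phT]] by (simp add: im)
    hence "frattini P (compose P (\<lambda>y\<in>P1. inv_into (\<phi> ` P) \<psi> y) \<chi>)"
      by (intro frattini_comp[OF f1]) (simp add: P1_def)
    also have "compose P (\<lambda>y\<in>P1. inv_into (\<phi> ` P) \<psi> y) \<chi> = \<phi>"
    proof -
      have "inv_into (\<phi> ` P) \<psi> (\<chi> x) = \<phi> x" if "x \<in> P" for x
        using \<psi>(2) that inv_into_f_f[OF F_inj[OF \<psi>(1)], of "\<phi> x"] by simp
      thus ?thesis using F_ext[OF \<phi>] by (auto simp: compose_def fun_eq_iff extensional_def P1_def)
    qed
    finally show ?thesis .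
  qed
qed

end

section \<open>Composition products with a weakly normal factor\<close>

locale composition_setup = weakly_normal_subsystem +
  fixes H :: "'a fusion"
  assumes H_sub: "fusion_subsystem p S F (carrier S) H"
    and product: "composition_product S F (carrier S) H T K"
begin

sublocale H: fusion p S H
  by unfold_locales (use p H_sub in \<open>auto simp: fusion_subsystem_def\<close>)

lemma HF: "H P Q \<subseteq> F P Q"
  using H_sub by (simp add: fusion_subsystem_def)

text \<open>Plays the part of the intersection in the product formula: two factorisations of the
  same morphism differ by an element of it.\<close>

definition L :: "'a fusion" where "L P Q = K P Q \<inter> H P Q"

sublocale L: fusion p "subgrp S T" L
proof
  show "fusion_system p (subgrp S T) L"
    unfolding fusion_system_def
  proof (intro conjI allI impI)
    show "finite_p_group p (subgrp S T)" by (rule K.p_group)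
    fix P Q
    show "subgroup P (subgrp S T)" "subgroup Q (subgrp S T)" if "\<phi> \<in> L P Q" for \<phi>
      using that K.F_subgroup by (auto simp: L_def)
    assume PQ: "subgroup P (subgrp S T)" "subgroup Q (subgrp S T)"
    show "conj_homs (subgrp S T) P Q \<subseteq> L P Q"
    proof
      fix c assume c: "c \<in> conj_homs (subgrp S T) P Q"
      then obtain g where g: "g \<in> T" "c = (\<lambda>x\<in>P. g \<otimes> x \<otimes> inv g)" "\<forall>x\<in>P. g \<otimes> x \<otimes> inv g \<in> Q"
        by (auto simp: conj_homs_def subgrp_simps(3))
      have "c \<in> H P Q"
        unfolding g(2) using PQ g subgroup.mem_carrier[OF T] by (intro H.F_conj) (auto simp: subgroup_T_iff)
      thus "c \<in> L P Q" using c K.F_bounds(1)[OF PQ] by (auto simp: L_def)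
    qed
    show "L P Q \<subseteq> inj_homs (subgrp S T) P Q" using K.F_bounds(2)[OF PQ] by (auto simp: L_def)
  next
    fix P Q R \<phi> \<psi> assume "\<phi> \<in> L P Q" "\<psi> \<in> L Q R"
    thus "compose P \<psi> \<phi> \<in> L P R" using K.F_comp H.F_comp by (auto simp: L_def)
  next
    fix P Q \<phi> assume "\<phi> \<in> L P Q"
    thus "\<phi> \<in> L P (\<phi> ` P)" "(\<lambda>y\<in>\<phi> ` P. inv_into P \<phi> y) \<in> L (\<phi> ` P) P"
      using K.F_image K.F_inv H.F_image H.F_inv by (auto simp: L_def)
  qed
qed (rule p)

lemma L_iff: "\<rho> \<in> L P T \<longleftrightarrow> \<rho> \<in> K P T \<and> \<rho> \<in> H P (carrier S)"
proof
  assume "\<rho> \<in> K P T \<and> \<rho> \<in> H P (carrier S)"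
  thus "\<rho> \<in> L P T"
    using H.F_codom[of \<rho> P "carrier S" T] K.F_closed[of \<rho> P T] T by (auto simp: L_def)
qed (use H.F_carrier in \<open>auto simp: L_def\<close>)

text \<open>The product decomposition of an automorphism of \<open>T\<close> puts the \<open>H\<close>-factor on all of \<open>T\<close>, where it
  normalises \<open>K\<close>.\<close>

lemma decompose:
  assumes "subgroup P S" "P \<subseteq> T" "\<phi> \<in> F P (carrier S)"
  obtains \<eta> \<kappa> where "\<eta> \<in> H T (carrier S)" "\<kappa> \<in> K P T" "\<And>x. x \<in> P \<Longrightarrow> \<phi> x = \<eta> (\<kappa> x)"
proof -
  obtain \<alpha> \<kappa> where 1: "\<alpha> \<in> F T (carrier S)" "\<kappa> \<in> K P T" "\<forall>x\<in>P. \<phi> x = \<alpha> (\<kappa> x)"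
    using frattini_all[OF assms] unfolding frattini_def by blast
  have pr: "\<exists>U. \<exists>\<kappa>\<in>K Q U. \<exists>\<eta>\<in>H U R. \<psi> = compose Q \<eta> \<kappa>"
    if "Q \<subseteq> T" "R \<subseteq> carrier S" "\<psi> \<in> F Q R" for Q R \<psi>
    using product that by (simp add: composition_product_def)
  obtain U \<kappa>' \<eta> where 2: "\<kappa>' \<in> K T U" "\<eta> \<in> H U (carrier S)" "\<alpha> = compose T \<eta> \<kappa>'"
    using pr[OF order_refl order_refl 1(1)] by blast
  \<comment> \<open>The intermediate subgroup is squeezed: it lies in \<open>T\<close> because
    \<open>K\<close> lives there, and it contains the image of an injective map from
    \<open>T\<close> to itself.\<close>
  have "U \<subseteq> T" using K.F_subgroup(2)[OF 2(1)] by (simp add: subgroup_T_iff)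
  moreover have "\<kappa>' ` T = T" using K.F_self_image K.F_carrier[OF 2(1)] by simp
  moreover have "\<kappa>' ` T \<subseteq> U" using K.F_closed[OF 2(1)] by (rule image_subsetI)
  ultimately have U: "U = T" by simp
  show ?thesis
  proof (rule that)
    show "\<eta> \<in> H T (carrier S)" using 2(2) U by simp
    show "compose P \<kappa>' \<kappa> \<in> K P T" using K.F_comp[OF 1(2)] 2(1) U by blast
    show "\<phi> x = \<eta> (compose P \<kappa>' \<kappa> x)" if "x \<in> P" for x
      using 1(3) 2(3) that K.F_closed[OF 1(2) that] by (simp add: compose_def)
  qed
qed

section \<open>Counting morphisms in \<open>F\<close>, \<open>H\<close>, \<open>K\<close> and in the
  intersection of \<open>H\<close> with \<open>K\<close>\<close>

lemma H_into_F: "\<eta> \<in> H P (carrier S) \<Longrightarrow> \<eta> \<in> F P (carrier S)"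
  using HF by blast

text \<open>Conjugation by \<alpha> embeds the morphisms out of \<open>Q\<close> into those out of
  \<alpha>(Q). When \<alpha> lies in \<open>H\<close> it also preserves \<open>H\<close>, hence the
  intersection. The reverse inequalities come from \<alpha>^-1.\<close>

lemma conj_K_inj:
  assumes \<alpha>: "\<alpha> \<in> F T (carrier S)" and Q: "subgroup Q S" "Q \<subseteq> T"
  shows "card (K Q T) \<le> card (K (\<alpha> ` Q) T)"
    and "\<alpha> \<in> H T (carrier S) \<Longrightarrow> card (L Q T) \<le> card (L (\<alpha> ` Q) T)"
proof -
  let ?c = "\<lambda>\<kappa>. \<lambda>y\<in>\<alpha> ` Q. \<alpha> (\<kappa> (inv_into Q \<alpha> y))"
  have injQ: "inj_on \<alpha> Q" using inj_on_subset[OF F_inj[OF \<alpha>] Q(2)] .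
  have c: "?c \<kappa> \<in> K (\<alpha> ` Q) T" if \<kappa>: "\<kappa> \<in> K Q T" for \<kappa>
    using K_conj[OF \<alpha> \<kappa> Q(2) order_refl] by (simp add: F_T_image[OF \<alpha>])
  have inj: "inj_on ?c (K Q T)"
  proof (rule inj_onI)
    fix \<kappa> \<kappa>' assume k: "\<kappa> \<in> K Q T" "\<kappa>' \<in> K Q T" "?c \<kappa> = ?c \<kappa>'"
    show "\<kappa> = \<kappa>'"
    proof (rule K.F_eqI[OF k(1,2)])
      fix x assume x: "x \<in> Q"
      have "\<alpha> (\<kappa> x) = \<alpha> (\<kappa>' x)" using fun_cong[OF k(3), of "\<alpha> x"] x injQ by simp
      thus "\<kappa> x = \<kappa>' x"
        using F_inj[OF \<alpha>] K.F_closed[OF k(1) x] K.F_closed[OF k(2) x] by (auto dest: inj_onD)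
    qed
  qed
  have fK: "finite (K P T)" for P using K.finite_F[of P] by simp
  show "card (K Q T) \<le> card (K (\<alpha> ` Q) T)"
    by (rule card_inj_on_le[OF inj _ fK]) (use c in blast)
  assume \<alpha>H: "\<alpha> \<in> H T (carrier S)"
  have cL: "?c \<kappa> \<in> L (\<alpha> ` Q) T" if \<kappa>: "\<kappa> \<in> L Q T" for \<kappa>
  proof -
    have \<kappa>': "\<kappa> \<in> K Q T" "\<kappa> \<in> H Q T" using \<kappa> by (auto simp: L_def)
    have r: "restrict \<alpha> Q \<in> H Q (carrier S)" by (rule H.F_restrict[OF \<alpha>H Q(2,1)])
    have im: "restrict \<alpha> Q ` Q = \<alpha> ` Q" by simp
    obtain \<theta> where \<theta>: "\<theta> \<in> H (\<alpha> ` Q) (carrier S)" "\<forall>x\<in>Q. \<theta> (restrict \<alpha> Q x) = compose Q \<alpha> \<kappa> x"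
      using H.F_factor[OF r H.F_comp[OF \<kappa>'(2) \<alpha>H]] unfolding im by blast
    have "?c \<kappa> = \<theta>"
    proof (rule F_eqI)
      show "?c \<kappa> \<in> F (\<alpha> ` Q) T" using c[OF \<kappa>'(1)] KF by blast
      show "\<theta> \<in> F (\<alpha> ` Q) (carrier S)" by (rule H_into_F[OF \<theta>(1)])
      fix y assume "y \<in> \<alpha> ` Q"
      thus "?c \<kappa> y = \<theta> y" using \<theta>(2) injQ by (auto simp: compose_def)
    qed
    thus ?thesis using c[OF \<kappa>'(1)] \<theta>(1) by (simp add: L_iff)
  qed
  have "finite (L (\<alpha> ` Q) T)" using fK[of "\<alpha> ` Q"] by (simp add: L_def)
  thus "card (L Q T) \<le> card (L (\<alpha> ` Q) T)"
    by (rule card_inj_on_le[rotated 2]) (use cL in \<open>auto intro: inj_on_subset[OF inj] simp: L_def\<close>)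
qed

lemma card_K_conj:
  assumes \<alpha>: "\<alpha> \<in> F T (carrier S)" and Q: "subgroup Q S" "Q \<subseteq> T"
  shows "card (K (\<alpha> ` Q) T) = card (K Q T)"
    and "\<alpha> \<in> H T (carrier S) \<Longrightarrow> card (L (\<alpha> ` Q) T) = card (L Q T)"
proof -
  let ?\<beta> = "\<lambda>y\<in>T. inv_into T \<alpha> y"
  have \<beta>: "?\<beta> \<in> F T (carrier S)" by (rule F_T_inv[OF \<alpha>])
  have r: "restrict \<alpha> Q \<in> F Q (carrier S)" by (rule F_restrict[OF \<alpha> Q(2,1)])
  have aQ: "subgroup (\<alpha> ` Q) S" "\<alpha> ` Q \<subseteq> T"
    using F_image_subgroup[OF r] F_into_T[OF r Q(2)] by auto
  have im: "?\<beta> ` \<alpha> ` Q = Q"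
  proof -
    have "?\<beta> (\<alpha> x) = x" if "x \<in> Q" for x
      using that Q(2) aQ(2) F_inj[OF \<alpha>] by (auto simp: subset_iff)
    hence "(\<lambda>x. ?\<beta> (\<alpha> x)) ` Q = (\<lambda>x. x) ` Q" by (rule image_cong[OF refl])
    thus ?thesis by (simp only: image_image image_ident)
  qed
  show "card (K (\<alpha> ` Q) T) = card (K Q T)"
    using conj_K_inj(1)[OF \<alpha> Q] conj_K_inj(1)[OF \<beta> aQ] unfolding im by simp
  assume \<alpha>H: "\<alpha> \<in> H T (carrier S)"
  have "?\<beta> \<in> H T (carrier S)"
    using H.F_carrier[OF H.F_inv[OF \<alpha>H]] by (simp add: F_T_image[OF \<alpha>])
  thus "card (L (\<alpha> ` Q) T) = card (L Q T)"
    using conj_K_inj(2)[OF \<alpha> Q \<alpha>H] conj_K_inj(2)[OF \<beta> aQ] unfolding im by simp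
qed

lemma K_image:
  assumes "\<kappa> \<in> K P T"
  shows "subgroup (\<kappa> ` P) S" "\<kappa> ` P \<subseteq> T" "subgroup P S" "P \<subseteq> T"
  using K.F_subgroup[OF assms] K.F_image_subgroup[OF assms] by (auto simp: subgroup_T_iff)

text \<open>Write \<phi> = \<eta>\<kappa>. Precomposition with \<kappa> is a bijection on
  \<open>K\<close>-morphisms, and conjugation by \<eta>, defined on all of \<open>T\<close>, is
  another; so the count is constant along all of \<open>F\<close>.\<close>

lemma card_K_F:
  assumes R: "subgroup R S" "R \<subseteq> T" and \<phi>: "\<phi> \<in> F R (carrier S)"
  shows "card (K (\<phi> ` R) T) = card (K R T)"
proof -
  obtain \<eta> \<kappa> where d: "\<eta> \<in> H T (carrier S)" "\<kappa> \<in> K R T" "\<And>x. x \<in> R \<Longrightarrow> \<phi> x = \<eta> (\<kappa> x)"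
    using decompose[OF R \<phi>] by blast
  have "\<phi> ` R = \<eta> ` \<kappa> ` R" using d(3) by (auto simp: image_image)
  thus ?thesis
    using card_K_conj(1)[OF H_into_F[OF d(1)] K_image(1,2)[OF d(2)]] K.card_F_image[OF d(2)] by simp
qed

text \<open>In the factorisation \<eta> = \<eta>0 \<kappa>, the factor \<kappa> = \<eta>0^-1 \<eta>
  is in \<open>H\<close> as well, hence in \<open>L\<close>, and each of the two factors preserves
  the count.\<close>

lemma card_L_H:
  assumes R: "subgroup R S" "R \<subseteq> T" and \<eta>: "\<eta> \<in> H R (carrier S)"
  shows "card (L (\<eta> ` R) T) = card (L R T)"
proof -
  obtain \<eta>0 \<kappa> where d: "\<eta>0 \<in> H T (carrier S)" "\<kappa> \<in> K R T" "\<And>x. x \<in> R \<Longrightarrow> \<eta> x = \<eta>0 (\<kappa> x)"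
    using decompose[OF R H_into_F[OF \<eta>]] by blast
  have \<eta>0F: "\<eta>0 \<in> F T (carrier S)" by (rule H_into_F[OF d(1)])
  have im: "\<eta> ` R = \<eta>0 ` \<kappa> ` R" using d(3) by (auto simp: image_image)
  have k: "\<kappa> x \<in> T" if "x \<in> R" for x using K.F_closed[OF d(2) that] .
  let ?i = "\<lambda>y\<in>T. inv_into T \<eta>0 y"
  have i: "?i \<in> H T (carrier S)"
    using H.F_carrier[OF H.F_inv[OF d(1)]] by (simp add: F_T_image[OF \<eta>0F])
  have "\<eta> \<in> H R T" using H.F_codom[OF \<eta> _ T] F_into_T[OF H_into_F[OF \<eta>] R(2)] by blast
  hence "compose R ?i \<eta> \<in> H R (carrier S)" using i by (rule H.F_comp)
  moreover have "compose R ?i \<eta> = \<kappa>"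
    using d(3) k F_inj[OF \<eta>0F] F_into_T[OF \<eta>0F order_refl] K.F_ext[OF d(2)]
    by (auto simp: compose_def fun_eq_iff extensional_def)
  ultimately have \<kappa>L: "\<kappa> \<in> L R T" using d(2) by (simp add: L_iff)
  show ?thesis
    unfolding im using card_K_conj(2)[OF \<eta>0F K_image(1,2)[OF d(2)] d(1)] L.card_F_image[OF \<kappa>L] by simp
qed

text \<open>Two ways to count the pairs \<open>(\<eta>, \<phi>)\<close> for which \<open>\<phi>\<close> factors as a \<open>K\<close>-morphism after \<open>\<eta>\<close>.\<close>

lemma card_F_L:
  assumes R: "subgroup R S" "R \<subseteq> T"
  shows "card (F R (carrier S)) * card (L R T) = card (H R (carrier S)) * card (K R T)"
proof -
  let ?rel = "\<lambda>\<phi> \<eta>. \<exists>\<kappa>\<in>K (\<eta> ` R) T. \<forall>x\<in>R. \<phi> x = \<kappa> (\<eta> x)"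
  \<comment> \<open>For fixed \<eta> the morphism \<phi> is determined by a
    \<open>K\<close>-morphism out of \<eta>(R), and there are as many of these as out of
    \<open>R\<close>.\<close>
  have 1: "card {\<phi> \<in> F R (carrier S). ?rel \<phi> \<eta>} = card (K R T)" if \<eta>: "\<eta> \<in> H R (carrier S)" for \<eta>
  proof -
    have \<eta>F: "\<eta> \<in> F R (carrier S)" by (rule H_into_F[OF \<eta>])
    have "{\<phi> \<in> F R (carrier S). ?rel \<phi> \<eta>} = (\<lambda>\<kappa>. compose R \<kappa> \<eta>) ` K (\<eta> ` R) T"
    proof (intro equalityI subsetI)
      fix \<phi> assume "\<phi> \<in> {\<phi> \<in> F R (carrier S). ?rel \<phi> \<eta>}"
      then obtain \<kappa> where \<kappa>: "\<phi> \<in> F R (carrier S)" "\<kappa> \<in> K (\<eta> ` R) T" "\<forall>x\<in>R. \<phi> x = \<kappa> (\<eta> x)" by blast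
      have "\<phi> = compose R \<kappa> \<eta>"
        using \<kappa>(3) F_ext[OF \<kappa>(1)] by (auto simp: compose_def fun_eq_iff extensional_def)
      thus "\<phi> \<in> (\<lambda>\<kappa>. compose R \<kappa> \<eta>) ` K (\<eta> ` R) T" using \<kappa>(2) by blast
    next
      fix \<phi> assume "\<phi> \<in> (\<lambda>\<kappa>. compose R \<kappa> \<eta>) ` K (\<eta> ` R) T"
      then obtain \<kappa> where \<kappa>: "\<kappa> \<in> K (\<eta> ` R) T" "\<phi> = compose R \<kappa> \<eta>" by blast
      have "\<phi> \<in> F R (carrier S)" unfolding \<kappa>(2) using F_comp_image[OF \<eta>F F_carrier] \<kappa>(1) KF by blast
      thus "\<phi> \<in> {\<phi> \<in> F R (carrier S). ?rel \<phi> \<eta>}" using \<kappa> by (auto simp: compose_def)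
    qed
    moreover have "inj_on (\<lambda>\<kappa>. compose R \<kappa> \<eta>) (K (\<eta> ` R) T)"
      using inj_on_subset[OF inj_compose_F[OF \<eta>F] KF] .
    ultimately show ?thesis using card_K_F[OF R \<eta>F] by (simp add: card_image)
  qed
  have 2: "card {\<eta> \<in> H R (carrier S). ?rel \<phi> \<eta>} = card (L R T)" if \<phi>: "\<phi> \<in> F R (carrier S)" for \<phi>
  proof -
    obtain \<eta>1 \<kappa>1 where d: "\<eta>1 \<in> H T (carrier S)" "\<kappa>1 \<in> K R T" "\<And>x. x \<in> R \<Longrightarrow> \<phi> x = \<eta>1 (\<kappa>1 x)"
      using decompose[OF R \<phi>] by blast
    define \<eta>0 where "\<eta>0 = restrict \<eta>1 R"
    have \<eta>0: "\<eta>0 \<in> H R (carrier S)" unfolding \<eta>0_def by (rule H.F_restrict[OF d(1) R(2,1)])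
    \<comment> \<open>The decomposition has the \<open>K\<close>-factor first. Conjugating \<kappa>1
      by \<eta>1 reverses the order and gives one \<eta> related to \<phi>.\<close>
    obtain \<kappa>0 where \<kappa>0: "\<kappa>0 \<in> K (\<eta>1 ` R) (\<eta>1 ` T)" "\<forall>x\<in>R. \<kappa>0 (\<eta>1 x) = \<eta>1 (\<kappa>1 x)"
      using K_conj_aut[OF H_into_F[OF d(1)] d(2)] by blast
    have \<kappa>0': "\<kappa>0 \<in> K (\<eta>0 ` R) T" using K_T[OF \<kappa>0(1)] by (simp add: \<eta>0_def)
    have \<phi>0: "\<phi> x = \<kappa>0 (\<eta>0 x)" if "x \<in> R" for x using \<kappa>0(2) d(3) that by (simp add: \<eta>0_def)
    \<comment> \<open>Any other \<eta> related to \<phi> is \<rho>\<eta>0 with \<rho> in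
      \<open>H\<close>; comparing the two factorisations of \<phi> shows that \<rho> is in
      \<open>K\<close> too.\<close>
    have "{\<eta> \<in> H R (carrier S). ?rel \<phi> \<eta>} = (\<lambda>\<rho>. compose R \<rho> \<eta>0) ` L (\<eta>0 ` R) T"
    proof (intro equalityI subsetI)
      fix \<eta> assume "\<eta> \<in> {\<eta> \<in> H R (carrier S). ?rel \<phi> \<eta>}"
      then obtain \<kappa> where \<eta>: "\<eta> \<in> H R (carrier S)" and \<kappa>: "\<kappa> \<in> K (\<eta> ` R) T" "\<forall>x\<in>R. \<phi> x = \<kappa> (\<eta> x)"
        by blast
      obtain \<rho> where \<rho>: "\<rho> \<in> H (\<eta>0 ` R) (carrier S)" "\<forall>x\<in>R. \<rho> (\<eta>0 x) = \<eta> x"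
        using H.F_factor[OF \<eta>0 \<eta>] by blast
      have im: "\<kappa>0 ` \<eta>0 ` R = \<kappa> ` \<eta> ` R"
        using \<phi>0 \<kappa>(2) by (force simp: image_image)
      let ?\<kappa>i = "\<lambda>y\<in>\<kappa> ` \<eta> ` R. inv_into (\<eta> ` R) \<kappa> y"
      have "?\<kappa>i \<in> K (\<kappa>0 ` \<eta>0 ` R) T" unfolding im using K_T[OF K.F_inv[OF \<kappa>(1)]] .
      hence c: "compose (\<eta>0 ` R) ?\<kappa>i \<kappa>0 \<in> K (\<eta>0 ` R) T" by (rule K.F_comp_image[OF \<kappa>0'])
      have "\<rho> = compose (\<eta>0 ` R) ?\<kappa>i \<kappa>0"
      proof (rule F_eqI)
        show "\<rho> \<in> F (\<eta>0 ` R) (carrier S)" by (rule H_into_F[OF \<rho>(1)])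
        show "compose (\<eta>0 ` R) ?\<kappa>i \<kappa>0 \<in> F (\<eta>0 ` R) T" using c KF by blast
        fix y assume "y \<in> \<eta>0 ` R"
        then obtain x where x: "x \<in> R" "y = \<eta>0 x" by blast
        have "\<kappa>0 y = \<kappa> (\<eta> x)" using x \<phi>0 \<kappa>(2) by simp
        thus "\<rho> y = compose (\<eta>0 ` R) ?\<kappa>i \<kappa>0 y"
          using x \<rho>(2) K.F_inj[OF \<kappa>(1)] by (simp add: compose_def)
      qed
      hence "\<rho> \<in> L (\<eta>0 ` R) T" using c \<rho>(1) by (simp add: L_iff)
      moreover have "\<eta> = compose R \<rho> \<eta>0"
        using \<rho>(2) H.F_ext[OF \<eta>] by (auto simp: compose_def fun_eq_iff extensional_def)
      ultimately show "\<eta> \<in> (\<lambda>\<rho>. compose R \<rho> \<eta>0) ` L (\<eta>0 ` R) T" by blast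
    next
      fix \<eta> assume "\<eta> \<in> (\<lambda>\<rho>. compose R \<rho> \<eta>0) ` L (\<eta>0 ` R) T"
      then obtain \<rho> where \<rho>: "\<rho> \<in> L (\<eta>0 ` R) T" "\<eta> = compose R \<rho> \<eta>0" by blast
      have \<rho>': "\<rho> \<in> K (\<eta>0 ` R) T" "\<rho> \<in> H (\<eta>0 ` R) (carrier S)" using \<rho>(1) by (auto simp: L_iff)
      have im: "\<eta> ` R = \<rho> ` \<eta>0 ` R" using \<rho>(2) by (auto simp: compose_def)
      obtain \<kappa> where \<kappa>: "\<kappa> \<in> K (\<eta> ` R) T" "\<forall>y\<in>\<eta>0 ` R. \<kappa> (\<rho> y) = \<kappa>0 y"
        using K.F_factor[OF \<rho>'(1) \<kappa>0'] unfolding im by blast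
      have "\<forall>x\<in>R. \<phi> x = \<kappa> (\<eta> x)" using \<kappa>(2) \<phi>0 by (simp add: \<rho>(2) compose_def)
      moreover have "\<eta> \<in> H R (carrier S)" unfolding \<rho>(2) by (rule H.F_comp_image[OF \<eta>0 \<rho>'(2)])
      ultimately show "\<eta> \<in> {\<eta> \<in> H R (carrier S). ?rel \<phi> \<eta>}" using \<kappa>(1) by blast
    qed
    moreover have "inj_on (\<lambda>\<rho>. compose R \<rho> \<eta>0) (L (\<eta>0 ` R) T)"
      by (rule inj_on_subset[OF H.inj_compose_F[OF \<eta>0, of T]]) (auto simp: L_def)
    ultimately show ?thesis using card_L_H[OF R \<eta>0] by (simp add: card_image)
  qed
  have "(\<Sum>\<phi>\<in>F R (carrier S). card {\<eta> \<in> H R (carrier S). ?rel \<phi> \<eta>}) =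
      (\<Sum>\<eta>\<in>H R (carrier S). card (K R T))"
    by (rule sum_multicount_gen[OF finite_F H.finite_F]) (use 1 in blast)
  thus ?thesis using 2 by simp
qed

text \<open>Write \<phi> = \<eta>0 \<kappa> and let R = \<kappa>(P). The \<theta> counted on the
  left are the \<rho>\<kappa> with \<rho> in both \<open>H\<close> and \<open>K\<close> on
  \<open>R\<close>, so their number is |L(R, T)|. The product formula at \<open>R\<close> then
  transports to \<open>P\<close> and \<phi>(P) along \<kappa> and \<eta>0.\<close>

lemma card_factorizations:
  assumes P: "subgroup P S" "P \<subseteq> T" and \<phi>: "\<phi> \<in> F P (carrier S)"
  shows "card {\<theta> \<in> K P T. \<exists>\<eta>\<in>H (\<phi> ` P) (carrier S). \<forall>x\<in>P. \<eta> (\<phi> x) = \<theta> x} * card (F P (carrier S)) =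
    card (H (\<phi> ` P) (carrier S)) * card (K P T)"
proof -
  obtain \<eta>1 \<kappa> where d: "\<eta>1 \<in> H T (carrier S)" "\<kappa> \<in> K P T" "\<And>x. x \<in> P \<Longrightarrow> \<phi> x = \<eta>1 (\<kappa> x)"
    using decompose[OF P \<phi>] by blast
  define R where "R = \<kappa> ` P"
  have R: "subgroup R S" "R \<subseteq> T" unfolding R_def by (rule K_image[OF d(2)])+
  define \<eta>0 where "\<eta>0 = restrict \<eta>1 R"
  have \<eta>0: "\<eta>0 \<in> H R (carrier S)" unfolding \<eta>0_def by (rule H.F_restrict[OF d(1) R(2,1)])
  have \<phi>0: "\<phi> x = \<eta>0 (\<kappa> x)" if "x \<in> P" for x using d(3) that by (simp add: \<eta>0_def R_def)
  have im: "\<phi> ` P = \<eta>0 ` R" using \<phi>0 by (force simp: R_def image_image)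
  have \<kappa>F: "\<kappa> \<in> F P T" using d(2) KF by blast
  have "{\<theta> \<in> K P T. \<exists>\<eta>\<in>H (\<phi> ` P) (carrier S). \<forall>x\<in>P. \<eta> (\<phi> x) = \<theta> x} = (\<lambda>\<rho>. compose P \<rho> \<kappa>) ` L R T"
  proof (intro equalityI subsetI)
    fix \<theta> assume "\<theta> \<in> {\<theta> \<in> K P T. \<exists>\<eta>\<in>H (\<phi> ` P) (carrier S). \<forall>x\<in>P. \<eta> (\<phi> x) = \<theta> x}"
    then obtain \<eta> where \<theta>: "\<theta> \<in> K P T" and \<eta>: "\<eta> \<in> H (\<eta>0 ` R) (carrier S)" "\<forall>x\<in>P. \<eta> (\<phi> x) = \<theta> x"
      unfolding im by blast
    obtain \<rho> where \<rho>: "\<rho> \<in> K R T" "\<forall>x\<in>P. \<rho> (\<kappa> x) = \<theta> x"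
      using K.F_factor[OF d(2) \<theta>] unfolding R_def by blast
    have c: "compose R \<eta> \<eta>0 \<in> H R (carrier S)" by (rule H.F_comp_image[OF \<eta>0 \<eta>(1)])
    have "\<rho> = compose R \<eta> \<eta>0"
    proof (rule F_eqI)
      show "\<rho> \<in> F R T" using \<rho>(1) KF by blast
      show "compose R \<eta> \<eta>0 \<in> F R (carrier S)" by (rule H_into_F[OF c])
      fix y assume y: "y \<in> R"
      then obtain x where x: "x \<in> P" "y = \<kappa> x" by (auto simp: R_def)
      thus "\<rho> y = compose R \<eta> \<eta>0 y" using y \<rho>(2) \<eta>(2) \<phi>0 by (simp add: compose_def)
    qed
    hence "\<rho> \<in> L R T" using \<rho>(1) c by (simp add: L_iff)
    moreover have "\<theta> = compose P \<rho> \<kappa>"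
      using \<rho>(2) K.F_ext[OF \<theta>] by (auto simp: compose_def fun_eq_iff extensional_def)
    ultimately show "\<theta> \<in> (\<lambda>\<rho>. compose P \<rho> \<kappa>) ` L R T" by blast
  next
    fix \<theta> assume "\<theta> \<in> (\<lambda>\<rho>. compose P \<rho> \<kappa>) ` L R T"
    then obtain \<rho> where \<rho>: "\<rho> \<in> L R T" "\<theta> = compose P \<rho> \<kappa>" by blast
    have \<rho>': "\<rho> \<in> K R T" "\<rho> \<in> H R (carrier S)" using \<rho>(1) by (auto simp: L_iff)
    obtain \<eta> where \<eta>: "\<eta> \<in> H (\<phi> ` P) (carrier S)" "\<forall>y\<in>R. \<eta> (\<eta>0 y) = \<rho> y"
      using H.F_factor[OF \<eta>0 \<rho>'(2)] unfolding im by blast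
    have "\<forall>x\<in>P. \<eta> (\<phi> x) = \<theta> x" using \<eta>(2) \<phi>0 by (simp add: \<rho>(2) compose_def R_def)
    moreover have "\<theta> \<in> K P T"
      unfolding \<rho>(2) using K.F_comp_image[OF d(2)] \<rho>'(1) unfolding R_def by blast
    ultimately show "\<theta> \<in> {\<theta> \<in> K P T. \<exists>\<eta>\<in>H (\<phi> ` P) (carrier S). \<forall>x\<in>P. \<eta> (\<phi> x) = \<theta> x}"
      using \<eta>(1) by blast
  qed
  moreover have "inj_on (\<lambda>\<rho>. compose P \<rho> \<kappa>) (L R T)"
    unfolding R_def by (rule inj_on_subset[OF K.inj_compose_F[OF d(2), of T]]) (auto simp: L_def)
  ultimately have "card {\<theta> \<in> K P T. \<exists>\<eta>\<in>H (\<phi> ` P) (carrier S). \<forall>x\<in>P. \<eta> (\<phi> x) = \<theta> x} = card (L R T)"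
    by (simp add: card_image)
  moreover have "card (F R (carrier S)) = card (F P (carrier S))" unfolding R_def by (rule card_F_image[OF \<kappa>F])
  moreover have "card (K R T) = card (K P T)" unfolding R_def by (rule K.card_F_image[OF d(2)])
  moreover have "card (H (\<phi> ` P) (carrier S)) = card (H R (carrier S))" unfolding im by (rule H.card_F_image[OF \<eta>0])
  ultimately show ?thesis using card_F_L[OF R] by (simp add: mult.commute)
qed

end

section \<open>Comparison of the two compositions\<close>

locale composition_idempotents = composition_setup +
  fixes \<omega>F \<omega>K :: "'a burnside"
  assumes omegaF: "characteristic_idempotent p S F \<omega>F"
    and omegaK: "characteristic_idempotent p (subgrp S T) K \<omega>K"
begin

sublocale OF: char_idem p S F \<omega>F
  by unfold_locales (rule omegaF)

sublocale OK: char_idem p "subgrp S T" K \<omega>K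
  by unfold_locales (rule omegaK)

abbreviation "S\<^sub>T \<equiv> subgrp S T"

definition "incl = burnside_basis p S\<^sub>T S T (\<lambda>x. x)"
definition "A\<^sub>0 = burnside_comp p S\<^sub>T S S \<omega>F incl"
definition "A\<^sub>1 = burnside_comp p S\<^sub>T S\<^sub>T S A\<^sub>0 \<omega>K"
definition "A\<^sub>2 = burnside_comp p S\<^sub>T S\<^sub>T S incl \<omega>K"

sublocale TS: burnside_module S\<^sub>T S p
  by unfold_locales

lemma modules: "burnside_module S\<^sub>T S" "burnside_module S S" "burnside_module S\<^sub>T S\<^sub>T"
  by (simp_all add: burnside_module_def fin_group_axioms K.fin_group_axioms)

lemma incl_hom: "(\<lambda>x. x) \<in> hom S\<^sub>T S"
  using subgroup.mem_carrier[OF T] by (auto simp: hom_def)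

lemma incl_in: "incl \<in> carrier (burnside p S\<^sub>T S)"
  unfolding incl_def using TS.basis_in[OF K.subgroup_self] incl_hom by simp

lemma A0_in: "A\<^sub>0 \<in> carrier (burnside p S\<^sub>T S)"
  unfolding A\<^sub>0_def by (rule burnside_comp_closed(1)[OF modules(1,2) OF.omega_in incl_in])

lemma A1_in: "A\<^sub>1 \<in> carrier (burnside p S\<^sub>T S)" and A2_in: "A\<^sub>2 \<in> carrier (burnside p S\<^sub>T S)"
  unfolding A\<^sub>1_def A\<^sub>2_def
  by (rule burnside_comp_closed(1)[OF modules(3,1) A0_in OK.omega_in]
      burnside_comp_closed(1)[OF modules(3,1) incl_in OK.omega_in])+

lemma card_T_pos: "card T > 0"
  using card_pos_fin_group[OF K.fin_group_axioms] by simp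

section \<open>Marks of the two compositions\<close>

context
  fixes P b
  assumes P: "subgroup P S" "P \<subseteq> T" and b: "b \<in> P \<rightarrow> carrier S"
begin

lemma PT: "subgroup P S\<^sub>T"
  using P by (simp add: subgroup_T_iff)

lemma P_typing: "finite P" "(\<lambda>k. k) \<in> P \<rightarrow> carrier S\<^sub>T" "(\<lambda>k. k) \<in> P \<rightarrow> T"
  using subgroup_finite[OF P(1)] P(2) by auto

lemma card_K_pos: "card (K P T) > 0"
  using K.F_incl_S[OF PT] K.finite_F[of P] by (auto simp: card_gt_0_iff)

lemma bmark_comp_omegaK:
  assumes x: "x \<in> carrier (burnside p S\<^sub>T S)"
  shows "of_nat (card (K P T)) * bmark P (\<lambda>k. k) b (burnside_comp p S\<^sub>T S\<^sub>T S x \<omega>K) =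
    (\<Sum>\<theta>\<in>K P T. bmark P \<theta> b x)"
proof -
  have "of_nat (card T) * bmark P (\<lambda>k. k) b (burnside_comp p S\<^sub>T S\<^sub>T S x \<omega>K) =
      (\<Sum>\<theta>\<in>P \<rightarrow>\<^sub>E T. bmark P \<theta> b x * bmark P (\<lambda>k. k) \<theta> \<omega>K)"
    using burnside_comp_closed(2)[OF modules(3,1) x OK.omega_in P_typing(1,2) b] by simp
  also have "\<dots> = (\<Sum>\<theta>\<in>K P T. bmark P \<theta> b x) * (of_nat (card T) / of_nat (card (K P T)))"
    using OK.sum_bmark_omega[OF PT, of "\<lambda>\<theta>. bmark P \<theta> b x"] OK.bmark_omega[OF PT] by simp
  finally show ?thesis using card_T_pos card_K_pos by (simp add: field_simps)
qed

text \<open>Every \<theta> in K(P, T) is a morphism of \<open>F\<close>, so right stability of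
  \<open>\<omega>F\<close> makes all terms of the average over \<open>K\<close> equal.\<close>

lemma bmark_A1: "bmark P (\<lambda>k. k) b A\<^sub>1 = bmark P (\<lambda>k. k) b \<omega>F"
proof -
  have "bmark P \<theta> b A\<^sub>0 = bmark P (\<lambda>k. k) b \<omega>F" if \<theta>: "\<theta> \<in> K P T" for \<theta>
  proof -
    have t: "\<theta> \<in> P \<rightarrow> carrier S\<^sub>T" using K.F_closed[OF \<theta>] by simp
    have "bmark P \<theta> b A\<^sub>0 = bmark P \<theta> b \<omega>F"
      unfolding A\<^sub>0_def incl_def
      using bmark_comp_basis_right_full[OF modules(1,2) OF.omega_in incl_hom P_typing(1) t b] by simp
    also have "\<dots> = bmark P (\<lambda>k. k) b \<omega>F"
      using OF.bmark_omega_right[OF _ b] F_carrier KF \<theta> by blast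
    finally show ?thesis .
  qed
  hence "of_nat (card (K P T)) * bmark P (\<lambda>k. k) b A\<^sub>1 = of_nat (card (K P T)) * bmark P (\<lambda>k. k) b \<omega>F"
    unfolding A\<^sub>1_def bmark_comp_omegaK[OF A0_in] by simp
  thus ?thesis using card_K_pos by simp
qed

lemma bmark_A2: "of_nat (card (K P T)) * bmark P (\<lambda>k. k) b A\<^sub>2 =
    (\<Sum>\<theta>\<in>K P T. of_nat (card {s \<in> carrier S. \<forall>k\<in>P. b k = s \<otimes> \<theta> k \<otimes> inv s}))"
  unfolding A\<^sub>2_def bmark_comp_omegaK[OF incl_in]
proof (rule sum.cong[OF refl])
  fix \<theta> assume "\<theta> \<in> K P T"
  hence t: "\<theta> \<in> P \<rightarrow> carrier S\<^sub>T" using K.F_closed by simp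
  show "bmark P \<theta> b incl = of_nat (card {s \<in> carrier S. \<forall>k\<in>P. b k = s \<otimes> \<theta> k \<otimes> inv s})"
    unfolding incl_def using TS.bmark_basis_full[OF incl_hom t b] by simp
qed

lemma bmark_A1_nonzero: "bmark P (\<lambda>k. k) b A\<^sub>1 \<noteq> 0 \<Longrightarrow> restrict b P \<in> F P (carrier S)"
proof -
  assume nz: "bmark P (\<lambda>k. k) b A\<^sub>1 \<noteq> 0"
  have r: "restrict b P \<in> P \<rightarrow>\<^sub>E carrier S" using b by auto
  have "bmark P (\<lambda>k. k) (restrict b P) \<omega>F = bmark P (\<lambda>k. k) b \<omega>F" by (rule bmark_cong) simp_all
  thus ?thesis using OF.bmark_omega_support[OF P(1) r] nz bmark_A1 by simp
qed

text \<open>A nonzero mark exhibits \<open>b\<close> as a \<open>K\<close>-morphism followed by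
  conjugation in \<open>S\<close>, both of which belong to \<open>F\<close>.\<close>

lemma bmark_A2_nonzero: "bmark P (\<lambda>k. k) b A\<^sub>2 \<noteq> 0 \<Longrightarrow> restrict b P \<in> F P (carrier S)"
proof -
  assume "bmark P (\<lambda>k. k) b A\<^sub>2 \<noteq> 0"
  hence "(\<Sum>\<theta>\<in>K P T. of_nat (card {s \<in> carrier S. \<forall>k\<in>P. b k = s \<otimes> \<theta> k \<otimes> inv s})) \<noteq> (0 :: rat)"
    unfolding bmark_A2[symmetric] using card_K_pos by simp
  then obtain \<theta> where \<theta>: "\<theta> \<in> K P T"
    "of_nat (card {s \<in> carrier S. \<forall>k\<in>P. b k = s \<otimes> \<theta> k \<otimes> inv s}) \<noteq> (0 :: rat)"
    by (rule sum.not_neutral_contains_not_neutral)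
  have "{s \<in> carrier S. \<forall>k\<in>P. b k = s \<otimes> \<theta> k \<otimes> inv s} \<noteq> {}"
  proof
    assume e: "{s \<in> carrier S. \<forall>k\<in>P. b k = s \<otimes> \<theta> k \<otimes> inv s} = {}"
    show False using \<theta>(2) unfolding e by simp
  qed
  then obtain s where s: "s \<in> carrier S" "\<forall>k\<in>P. b k = s \<otimes> \<theta> k \<otimes> inv s" by blast
  have "\<theta> \<in> F P (carrier S)" using \<theta>(1) KF F_carrier by blast
  from M_conj_comp[OF P(1) this s(1)] obtain \<eta> where
    \<eta>: "\<eta> \<in> F P (carrier S)" "\<forall>u\<in>P. \<eta> u = s \<otimes> \<theta> u \<otimes> inv s" by blast
  have "restrict b P = \<eta>" using s(2) \<eta>(2) F_ext[OF \<eta>(1)] by (auto simp: fun_eq_iff extensional_def)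
  thus ?thesis using \<eta>(1) by simp
qed

end

sublocale AV: averaged_marks S\<^sub>T S p "\<lambda>U. H U (carrier S)"
  by unfold_locales

text \<open>Let U = \<phi>(P). For \<phi> in \<open>F\<close> the first sum is |H(U, S)| |S| / |F(P,
  S)|. The second is |S| / |K(P, T)| times the number of \<theta> in K(P, T) of the form
  \<eta>\<phi> with \<eta> in \<open>H\<close>; equality is \<open>card_factorizations\<close>. For
  \<phi> outside \<open>F\<close> all marks that occur vanish.\<close>

lemma averaged_marks_agree:
  assumes pair: "(P, \<phi>) \<in> hom_pairs S\<^sub>T S"
  shows "AV.avg P \<phi> (burnside_rep A\<^sub>1 - burnside_rep A\<^sub>2) = 0"
proof -
  have P: "subgroup P S" "P \<subseteq> T" and ext: "\<phi> \<in> extensional P"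
    using pair by (auto simp: hom_pairs_def subgroup_T_iff)
  note im = AV.image_subgroup[OF pair]
  define U where "U = \<phi> ` P"
  have U: "subgroup U S" using im(1) by (simp add: U_def)
  have b: "(\<lambda>k. \<eta> (\<phi> k)) \<in> P \<rightarrow> carrier S" if "\<eta> \<in> H U (carrier S)" for \<eta>
    using H.F_closed[OF that] by (auto simp: U_def)
  have avg: "AV.avg P \<phi> (burnside_rep A\<^sub>1 - burnside_rep A\<^sub>2) =
      (\<Sum>\<eta>\<in>H U (carrier S). bmark P (\<lambda>k. k) (\<lambda>k. \<eta> (\<phi> k)) A\<^sub>1) -
      (\<Sum>\<eta>\<in>H U (carrier S). bmark P (\<lambda>k. k) (\<lambda>k. \<eta> (\<phi> k)) A\<^sub>2)"
    by (simp add: AV.avg_def fmark_diff bmark_def U_def sum_subtractf)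
  show ?thesis
  proof (cases "\<phi> \<in> F P (carrier S)")
    case False
    \<comment> \<open>Since \<eta> is invertible in \<open>F\<close>, a composite \<eta>\<phi> in
      \<open>F\<close> would put \<phi> itself in \<open>F\<close>.\<close>
    have no: "restrict (\<lambda>k. \<eta> (\<phi> k)) P \<notin> F P (carrier S)" if \<eta>: "\<eta> \<in> H U (carrier S)" for \<eta>
    proof
      assume c: "restrict (\<lambda>k. \<eta> (\<phi> k)) P \<in> F P (carrier S)"
      have "restrict (\<lambda>k. \<eta> (\<phi> k)) P ` P = \<eta> ` U" by (auto simp: U_def)
      hence "compose P (\<lambda>y\<in>\<eta> ` U. inv_into U \<eta> y) (restrict (\<lambda>k. \<eta> (\<phi> k)) P) \<in> F P U"
        using F_comp_image[OF c] F_inv[OF H_into_F[OF \<eta>]] by simp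
      also have "compose P (\<lambda>y\<in>\<eta> ` U. inv_into U \<eta> y) (restrict (\<lambda>k. \<eta> (\<phi> k)) P) = \<phi>"
        using H.F_inj[OF \<eta>] ext by (auto simp: compose_def fun_eq_iff extensional_def U_def)
      finally show False using False F_carrier by blast
    qed
    have z: "bmark P (\<lambda>k. k) (\<lambda>k. \<eta> (\<phi> k)) A\<^sub>1 = 0" "bmark P (\<lambda>k. k) (\<lambda>k. \<eta> (\<phi> k)) A\<^sub>2 = 0"
      if "\<eta> \<in> H U (carrier S)" for \<eta>
      using no[OF that] bmark_A1_nonzero[OF P b[OF that]] bmark_A2_nonzero[OF P b[OF that]] by blast+
    show ?thesis unfolding avg by (simp add: z)
  next
    case True
    have "bmark P (\<lambda>k. k) (\<lambda>k. \<eta> (\<phi> k)) A\<^sub>1 = of_nat (card (carrier S)) / of_nat (card (F P (carrier S)))"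
      if \<eta>: "\<eta> \<in> H U (carrier S)" for \<eta>
    proof -
      have c: "compose P \<eta> \<phi> \<in> F P (carrier S)"
        using F_comp_image[OF True] H_into_F[OF \<eta>] by (simp add: U_def)
      have "bmark P (\<lambda>k. k) (\<lambda>k. \<eta> (\<phi> k)) A\<^sub>1 = bmark P (\<lambda>k. k) (compose P \<eta> \<phi>) \<omega>F"
        unfolding bmark_A1[OF P b[OF \<eta>]] by (rule bmark_cong) (simp_all add: compose_def)
      thus ?thesis using OF.bmark_omega_const[OF c] OF.bmark_omega[OF P(1)] by simp
    qed
    hence 1: "(\<Sum>\<eta>\<in>H U (carrier S). bmark P (\<lambda>k. k) (\<lambda>k. \<eta> (\<phi> k)) A\<^sub>1) =
        of_nat (card (H U (carrier S))) * (of_nat (card (carrier S)) / of_nat (card (F P (carrier S))))"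
      by simp
    let ?E = "{\<theta> \<in> K P T. \<exists>\<eta>\<in>H U (carrier S). \<forall>x\<in>P. \<eta> (\<phi> x) = \<theta> x}"
    let ?R = "\<lambda>\<theta> \<eta> s. \<forall>k\<in>P. \<eta> (\<phi> k) = s \<otimes> \<theta> k \<otimes> inv s"
    \<comment> \<open>For fixed \<theta> and \<open>s\<close> the equation determines \<eta> on
      \<open>U\<close>. A solution exists for one \<open>s\<close> exactly when it exists for s = 1,
      because \<open>H\<close> contains the conjugations.\<close>
    have cnt: "card {\<eta> \<in> H U (carrier S). ?R \<theta> \<eta> s} = (if \<theta> \<in> ?E then 1 else 0)"
      if \<theta>: "\<theta> \<in> K P T" and s: "s \<in> carrier S" for \<theta> s
    proof (cases "\<theta> \<in> ?E")
      case True
      then obtain \<eta>0 where \<eta>0: "\<eta>0 \<in> H U (carrier S)" "\<forall>x\<in>P. \<eta>0 (\<phi> x) = \<theta> x" by blast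
      obtain \<eta>1 where \<eta>1: "\<eta>1 \<in> H U (carrier S)" "\<forall>u\<in>U. \<eta>1 u = s \<otimes> \<eta>0 u \<otimes> inv s"
        using H.M_conj_comp[OF U \<eta>0(1) s] by blast
      have "{\<eta> \<in> H U (carrier S). ?R \<theta> \<eta> s} = {\<eta>1}"
      proof (intro equalityI subsetI)
        fix \<eta> assume "\<eta> \<in> {\<eta> \<in> H U (carrier S). ?R \<theta> \<eta> s}"
        hence \<eta>: "\<eta> \<in> H U (carrier S)" "?R \<theta> \<eta> s" by blast+
        have "\<eta> = \<eta>1"
          by (rule H.F_eqI[OF \<eta>(1) \<eta>1(1)]) (use \<eta>(2) \<eta>0(2) \<eta>1(2) in \<open>auto simp: U_def\<close>)
        thus "\<eta> \<in> {\<eta>1}" by simp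
      qed (use \<eta>1 \<eta>0(2) in \<open>auto simp: U_def\<close>)
      thus ?thesis using True by simp
    next
      case False
      have e: "{\<eta> \<in> H U (carrier S). ?R \<theta> \<eta> s} = {}"
      proof (rule equals0I)
        fix \<eta> assume "\<eta> \<in> {\<eta> \<in> H U (carrier S). ?R \<theta> \<eta> s}"
        hence \<eta>: "\<eta> \<in> H U (carrier S)" "?R \<theta> \<eta> s" by blast+
        obtain \<eta>1 where \<eta>1: "\<eta>1 \<in> H U (carrier S)" "\<forall>u\<in>U. \<eta>1 u = inv s \<otimes> \<eta> u \<otimes> inv (inv s)"
          using H.M_conj_comp[OF U \<eta>(1) inv_closed[OF s]] by blast
        have "\<eta>1 (\<phi> x) = \<theta> x" if x: "x \<in> P" for x
        proof -
          have "\<theta> x \<in> carrier S" using subgroup.mem_carrier[OF T K.F_closed[OF \<theta> x]] .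
          moreover have "\<eta>1 (\<phi> x) = inv s \<otimes> (s \<otimes> \<theta> x \<otimes> inv s) \<otimes> inv (inv s)"
            using \<eta>1(2) \<eta>(2) x by (simp add: U_def)
          ultimately show ?thesis using s by (simp add: conj_inv_cancel)
        qed
        thus False using False \<theta> \<eta>1(1) by blast
      qed
      show ?thesis by (simp only: if_not_P[OF False] e card.empty)
    qed
    have fK: "finite (K P T)" using K.finite_F[of P] by simp
    have "of_nat (card (K P T)) * (\<Sum>\<eta>\<in>H U (carrier S). bmark P (\<lambda>k. k) (\<lambda>k. \<eta> (\<phi> k)) A\<^sub>2) =
        (\<Sum>\<eta>\<in>H U (carrier S). \<Sum>\<theta>\<in>K P T. of_nat (card {s \<in> carrier S. ?R \<theta> \<eta> s}))"
      unfolding sum_distrib_left by (intro sum.cong refl bmark_A2[OF P b])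
    also have "\<dots> = (\<Sum>\<theta>\<in>K P T. of_nat (\<Sum>\<eta>\<in>H U (carrier S). card {s \<in> carrier S. ?R \<theta> \<eta> s}))"
      unfolding of_nat_sum by (rule sum.swap)
    also have "\<dots> = (\<Sum>\<theta>\<in>K P T. of_nat (if \<theta> \<in> ?E then card (carrier S) else 0))"
    proof (rule sum.cong[OF refl])
      fix \<theta> assume \<theta>: "\<theta> \<in> K P T"
      \<comment> \<open>Double counting of the pairs (\<eta>, s): summing over \<open>s\<close>
        first leaves at most one \<eta> for each.\<close>
      have "(\<Sum>\<eta>\<in>H U (carrier S). card {s \<in> carrier S. ?R \<theta> \<eta> s}) =
          (\<Sum>s\<in>carrier S. if \<theta> \<in> ?E then 1 else 0)"
        by (rule sum_multicount_gen[OF H.finite_F fin]) (use cnt[OF \<theta>] in blast)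
      also have "\<dots> = (if \<theta> \<in> ?E then card (carrier S) else 0)"
        by (cases "\<theta> \<in> ?E")
           (simp_all only: if_P if_not_P if_True if_False sum_constant mult_1_right mult_0_right of_nat_id)
      finally show "of_nat (\<Sum>\<eta>\<in>H U (carrier S). card {s \<in> carrier S. ?R \<theta> \<eta> s}) =
          (of_nat (if \<theta> \<in> ?E then card (carrier S) else 0) :: rat)"
        by (rule arg_cong)
    qed
    also have "\<dots> = of_nat (card ?E) * of_nat (card (carrier S))"
    proof -
      have "(\<Sum>\<theta>\<in>K P T. if \<theta> \<in> ?E then card (carrier S) else 0) = (\<Sum>\<theta>\<in>?E. card (carrier S))"
        by (rule sum.mono_neutral_cong_right[OF fK]) auto
      hence "(\<Sum>\<theta>\<in>K P T. if \<theta> \<in> ?E then card (carrier S) else 0) = card ?E * card (carrier S)" by simp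
      thus ?thesis by (simp only: of_nat_sum[symmetric] of_nat_mult[symmetric])
    qed
    finally have 2: "of_nat (card (K P T)) * (\<Sum>\<eta>\<in>H U (carrier S). bmark P (\<lambda>k. k) (\<lambda>k. \<eta> (\<phi> k)) A\<^sub>2) =
        of_nat (card ?E) * of_nat (card (carrier S))" .
    have "card ?E * card (F P (carrier S)) = card (H U (carrier S)) * card (K P T)"
      using card_factorizations[OF P True] by (simp add: U_def)
    hence "of_nat (card ?E) * of_nat (card (F P (carrier S))) =
        (of_nat (card (H U (carrier S))) * of_nat (card (K P T)) :: rat)"
      by (simp only: of_nat_mult[symmetric])
    moreover have F0: "of_nat (card (F P (carrier S))) \<noteq> (0 :: rat)" using F_incl_S[OF P(1)] finite_F by auto
    moreover have K0: "of_nat (card (K P T)) \<noteq> (0 :: rat)" using card_K_pos[OF P b] H.F_incl_S[OF U] by simp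
    ultimately have "of_nat (card ?E) = of_nat (card (H U (carrier S))) * of_nat (card (K P T)) / (of_nat (card (F P (carrier S))) :: rat)"
      by (simp add: eq_divide_eq)
    hence "of_nat (card (K P T)) * (\<Sum>\<eta>\<in>H U (carrier S). bmark P (\<lambda>k. k) (\<lambda>k. \<eta> (\<phi> k)) A\<^sub>2) =
        of_nat (card (K P T)) * (\<Sum>\<eta>\<in>H U (carrier S). bmark P (\<lambda>k. k) (\<lambda>k. \<eta> (\<phi> k)) A\<^sub>1)"
      unfolding 2 1 by (simp add: mult_ac)
    thus ?thesis unfolding avg using K0 by simp
  qed
qed

end

section \<open>Passage to Mackey functors\<close>

locale mackey = composition_idempotents +
  fixes Mob :: "('a, 'm) mackey_ob" and Mmor :: "('a, 'm) mackey_mor"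
  assumes mackey: "mackey_functor p Mob Mmor"
begin

lemma M_comp:
  assumes "finite_p_group p G" "finite_p_group p G'" "finite_p_group p G''"
    "Y \<in> carrier (burnside p G' G'')" "X \<in> carrier (burnside p G G')" "x \<in> carrier (Mob G'')"
  shows "Mmor G G'' (burnside_comp p G G' G'' Y X) x = Mmor G G' X (Mmor G' G'' Y x)"
  using mackey assms unfolding mackey_functor_def by simp

lemma M_closed:
  assumes "finite_p_group p G" "finite_p_group p G'" "X \<in> carrier (burnside p G G')" "x \<in> carrier (Mob G')"
  shows "Mmor G G' X x \<in> carrier (Mob G)"
  using mackey assms unfolding mackey_functor_def linear_map_def by blast

lemma M_add:
  assumes "finite_p_group p G" "finite_p_group p G'" "X \<in> carrier (burnside p G G')"
    "Y \<in> carrier (burnside p G G')" "x \<in> carrier (Mob G')"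
  shows "Mmor G G' (X \<oplus>\<^bsub>burnside p G G'\<^esub> Y) x = Mmor G G' X x \<oplus>\<^bsub>Mob G\<^esub> Mmor G G' Y x"
  using mackey assms unfolding mackey_functor_def by simp

lemma M_smult:
  assumes "finite_p_group p G" "finite_p_group p G'" "X \<in> carrier (burnside p G G')"
    "r \<in> carrier (Zloc p)" "x \<in> carrier (Mob G')"
  shows "Mmor G G' (r \<odot>\<^bsub>burnside p G G'\<^esub> X) x = r \<odot>\<^bsub>Mob G\<^esub> Mmor G G' X x"
  using mackey assms unfolding mackey_functor_def by simp

lemma M_id: "finite_p_group p G \<Longrightarrow> x \<in> carrier (Mob G) \<Longrightarrow>
    Mmor G G (burnside_basis p G G (carrier G) (\<lambda>x. x)) x = x"
  using mackey unfolding mackey_functor_def by blast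

text \<open>[Q, \<eta>\<psi>] is [U, \<eta>] composed with [Q, \<psi>] for U = \<psi>(Q). By
  contravariance \<open>M\<close> of the first factor meets \<open>x\<close> directly, where
  \<open>H\<close>-stability replaces \<eta> by the inclusion.\<close>

lemma M_stable_basis:
  assumes x: "x \<in> stable_elements p Mob Mmor S H"
    and Q: "(Q, \<psi>) \<in> hom_pairs S\<^sub>T S" and \<eta>: "\<eta> \<in> H (\<psi> ` Q) (carrier S)"
  shows "Mmor S\<^sub>T S (burnside_basis p S\<^sub>T S Q (compose Q \<eta> \<psi>)) x = Mmor S\<^sub>T S (burnside_basis p S\<^sub>T S Q \<psi>) x"
proof -
  let ?U = "\<psi> ` Q"
  have xS: "x \<in> carrier (Mob S)" using x by (simp add: stable_elements_def)
  have U: "subgroup ?U S" by (rule AV.image_subgroup[OF Q])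
  have id: "(\<lambda>x. x) \<in> hom (subgrp S ?U) S" using subgroup.mem_carrier[OF U] by (auto simp: hom_def)
  have M: "Mmor S\<^sub>T S (burnside_basis p S\<^sub>T S Q (compose Q \<zeta> \<psi>)) x =
      Mmor S\<^sub>T (subgrp S ?U) (burnside_basis p S\<^sub>T (subgrp S ?U) Q \<psi>)
        (Mmor (subgrp S ?U) S (burnside_basis p (subgrp S ?U) S ?U \<zeta>) x)"
    if "\<zeta> \<in> hom (subgrp S ?U) S" for \<zeta>
    unfolding basis_compose(1)[OF modules(1) Q that]
    by (rule M_comp[OF K.p_group p_subgroup[OF U] p_group basis_compose(2,3)[OF modules(1) Q that] xS])
  have "compose Q (\<lambda>x. x) \<psi> = \<psi>"
    using Q by (auto simp: hom_pairs_def compose_def fun_eq_iff extensional_def)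
  moreover have "Mmor (subgrp S ?U) S (burnside_basis p (subgrp S ?U) S ?U \<eta>) x =
      Mmor (subgrp S ?U) S (burnside_basis p (subgrp S ?U) S ?U (\<lambda>x. x)) x"
    using x \<eta> unfolding stable_elements_def by blast
  ultimately show ?thesis using M[OF H.F_hom_S[OF \<eta>]] M[OF id] by simp
qed

text \<open>\<open>Z\<close> is the kernel, lifted to the free module, of evaluating
  \<open>M\<close> at the fixed element \<open>x\<close>. Linearity of \<open>M\<close> makes it a
  submodule over the local ring containing the relations, and \<open>H\<close>-stability puts the
  required differences in it; detection then places the difference of the two elements
  there.\<close>

theorem stable_transfer:
  assumes x: "x \<in> stable_elements p Mob Mmor S H"
  shows "Mmor S\<^sub>T S A\<^sub>1 x = Mmor S\<^sub>T S A\<^sub>2 x"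
proof -
  have xS: "x \<in> carrier (Mob S)" using x by (simp add: stable_elements_def)
  interpret M: module "Zloc p" "Mob S\<^sub>T"
    using mackey K.p_group unfolding mackey_functor_def by blast
  define Z where "Z = {f \<in> TS.free. Mmor S\<^sub>T S (TS.coset f) x = \<zero>\<^bsub>Mob S\<^sub>T\<^esub>}"
  note pS = K.p_group p_group
  have cl: "Mmor S\<^sub>T S (TS.coset f) x \<in> carrier (Mob S\<^sub>T)" if "f \<in> TS.free" for f
    by (rule M_closed[OF pS TS.coset_in[OF that] xS])
  have add: "Mmor S\<^sub>T S (TS.coset (f + g)) x =
      Mmor S\<^sub>T S (TS.coset f) x \<oplus>\<^bsub>Mob S\<^sub>T\<^esub> Mmor S\<^sub>T S (TS.coset g) x"
    if "f \<in> TS.free" "g \<in> TS.free" for f g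
    using M_add[OF pS TS.coset_in[OF that(1)] TS.coset_in[OF that(2)] xS] by (simp add: TS.coset_add that)
  have smult: "Mmor S\<^sub>T S (TS.coset (scale r f)) x = r \<odot>\<^bsub>Mob S\<^sub>T\<^esub> Mmor S\<^sub>T S (TS.coset f) x"
    if "f \<in> TS.free" "r \<in> carrier (Zloc p)" for r f
    using M_smult[OF pS TS.coset_in[OF that(1)] that(2) xS] by (simp add: TS.coset_smult that)
  have Z0: "\<zero>\<^bsub>Zloc p\<^esub> = 0" by (simp add: Zloc_def)
  \<comment> \<open>Additivity and homogeneity are what the definition of a Mackey functor provides;
    the value at zero is obtained by scaling with 0.\<close>
  have zero: "Mmor S\<^sub>T S (TS.coset 0) x = \<zero>\<^bsub>Mob S\<^sub>T\<^esub>"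
    using smult[OF TS.free_zero Zloc_0] M.smult_l_null[OF cl[OF TS.free_zero]] by (simp add: Z0)
  have diff: "f - g \<in> Z \<longleftrightarrow> Mmor S\<^sub>T S (TS.coset f) x = Mmor S\<^sub>T S (TS.coset g) x"
    if fg: "f \<in> TS.free" "g \<in> TS.free" for f g
  proof -
    have fr: "f - g \<in> TS.free" using fg by (rule TS.free_diff)
    have "Mmor S\<^sub>T S (TS.coset f) x = Mmor S\<^sub>T S (TS.coset (f - g)) x \<oplus>\<^bsub>Mob S\<^sub>T\<^esub> Mmor S\<^sub>T S (TS.coset g) x"
      using add[OF fr fg(2)] by simp
    thus ?thesis using fr cl[OF fr] cl[OF fg(2)] by (simp add: Z_def)
  qed
  have "burnside_rep A\<^sub>1 - burnside_rep A\<^sub>2 \<in> Z"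
  proof (rule AV.averaged_marks_detect)
    show "burnside_rep A\<^sub>1 - burnside_rep A\<^sub>2 \<in> TS.free"
      using TS.carrier_rep(1)[OF A1_in] TS.carrier_rep(1)[OF A2_in] by (rule TS.free_diff)
    show "AV.avg P \<phi> (burnside_rep A\<^sub>1 - burnside_rep A\<^sub>2) = 0" if "(P, \<phi>) \<in> hom_pairs S\<^sub>T S" for P \<phi>
      by (rule averaged_marks_agree[OF that])
    show "TS.rels \<subseteq> Z"
    proof
      fix f assume f: "f \<in> TS.rels"
      hence "TS.coset f = TS.coset 0" using TS.coset_eq_iff[OF TS.rels_free TS.free_zero] by simp
      thus "f \<in> Z" using zero TS.rels_free[OF f] by (simp add: Z_def)
    qed
    show "f + g \<in> Z" if "f \<in> Z" "g \<in> Z" for f g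
      using that add TS.free_add by (simp add: Z_def)
    show "scale r f \<in> Z" if "r \<in> carrier (Zloc p)" "f \<in> Z" for r f
      using that smult TS.free_scale by (simp add: Z_def)
    fix Q \<psi> \<eta> assume Q: "(Q, \<psi>) \<in> hom_pairs S\<^sub>T S" and \<eta>: "\<eta> \<in> H (\<psi> ` Q) (carrier S)"
    have c: "(Q, compose Q \<eta> \<psi>) \<in> hom_pairs S\<^sub>T S" by (rule AV.compose_pairs[OF Q \<eta>])
    show "std_cls S\<^sub>T S (Q, compose Q \<eta> \<psi>) - std_cls S\<^sub>T S (Q, \<psi>) \<in> Z"
      using M_stable_basis[OF x Q \<eta>] diff[OF TS.std_cls_free[OF c] TS.std_cls_free[OF Q]]
      by (simp add: burnside_basis_def)
  qed
  thus ?thesis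
    using diff[OF TS.carrier_rep(1)[OF A1_in] TS.carrier_rep(1)[OF A2_in]]
    by (simp add: TS.carrier_rep(2) A1_in A2_in)
qed

text \<open>Contravariance turns the composites \<open>A\<^sub>1\<close> and
  \<open>A\<^sub>2\<close> into the two maps, read from right to left. The transfer from
  \<open>S\<close> to itself that is built into \<open>tr_subsys\<close> is \<open>M\<close> of the
  identity.\<close>

theorem transfers_agree:
  assumes x: "x \<in> stable_elements p Mob Mmor S H"
  shows "res_subsys p Mmor S T \<omega>K (tr_subsys p Mmor S \<omega>F (carrier S) x) =
    tr_fus Mmor S\<^sub>T \<omega>K (res_sub p Mmor S T x)"
proof -
  have xS: "x \<in> carrier (Mob S)" using x by (simp add: stable_elements_def)
  note pS = K.p_group p_group
  have "Mmor S\<^sub>T S A\<^sub>1 x = Mmor S\<^sub>T S\<^sub>T \<omega>K (Mmor S\<^sub>T S incl (Mmor S S \<omega>F x))"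
    unfolding A\<^sub>1_def A\<^sub>0_def
    by (simp only: M_comp[OF K.p_group pS A0_in[unfolded A\<^sub>0_def] OK.omega_in xS]
        M_comp[OF pS p_group OF.omega_in incl_in xS])
  moreover have "Mmor S\<^sub>T S A\<^sub>2 x = Mmor S\<^sub>T S\<^sub>T \<omega>K (Mmor S\<^sub>T S incl x)"
    unfolding A\<^sub>2_def by (rule M_comp[OF K.p_group pS incl_in OK.omega_in xS])
  moreover have "tr_sub p Mmor S (carrier S) x = x"
    using M_id[OF p_group xS] by (simp add: tr_sub_def)
  ultimately show ?thesis
    using stable_transfer[OF x] by (simp add: res_subsys_def tr_subsys_def tr_fus_def res_sub_def incl_def)
qed

end

theorem corollary1p5:
  fixes p :: nat and S :: "'a monoid" and T :: "'a set"
    and F H K :: "'a fusion"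
    and \<omega>F \<omega>K :: "'a burnside"
    and Mob :: "('a, 'm) mackey_ob" and Mmor :: "('a, 'm) mackey_mor"
  assumes "prime p"
    and "saturated p S F"
    and "fusion_subsystem p S F (carrier S) H" and "saturated p S H"
    and "fusion_subsystem p S F T K" and "saturated p (subgrp S T) K"
    and "weakly_normal p S F T K"
    and "composition_product S F (carrier S) H T K"
    and "characteristic_idempotent p S F \<omega>F"
    and "characteristic_idempotent p (subgrp S T) K \<omega>K"
    and "mackey_functor p Mob Mmor"
  shows "\<forall>x\<in>stable_elements p Mob Mmor S H.
    res_subsys p Mmor S T \<omega>K (tr_subsys p Mmor S \<omega>F (carrier S) x) =
    tr_fus Mmor (subgrp S T) \<omega>K (res_sub p Mmor S T x)"
proof -
  interpret mackey p S F T K H \<omega>F \<omega>K Mob Mmor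
    by unfold_locales (use assms in \<open>simp_all add: saturated_def\<close>)
  show ?thesis using transfers_agree by blast
qed

end
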